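(* Let $P_d\in\mathcal{O}$ be a monic irreducible polynomial of degree $d$ and let $k\geqslant 0$ and $m$ be integers. Let $\mathcal{D}:S^1_{k,m}(\Gamma_0(P_d))\to S^1_{k,m}(\Gamma_0(P_d))$ be the map $$\mathcal{D}:=Id-P_d^{\,k-2m}(Tr')^2.$$ Then there is a direct sum decomposition $$S^1_{k,m}(\Gamma_0(P_d))=S^{1,old}_{k,m}(\Gamma_0(P_d))\oplus S^{1,new}_{k,m}(\Gamma_0(P_d))$$ if and only if $\mathcal{D}$ is bijective.
   Context: Let $q$ be a power of a prime $p$, $K=\mathbb{F}_q(t)$, $\mathcal{O}=\mathbb{F}_q[t]$, $K_\infty=\mathbb{F}_q((1/t))$ the completion of $K$ at the place $1/t$, and $\mathbb{C}_\infty$ the completion of an algebraic closure of $K_\infty$. Let $\Omega=\mathbb{P}^1(\mathbb{C}_\infty)-\mathbb{P}^1(K_\infty)$ be the Drinfeld upper half-plane with its rigid analytic structure; $GL_2(K_\infty)$ acts on it by Möbius transformations. For $\gamma=\begin{pmatrix}a&b\\c&d\end{pmatrix}\in GL_2(K_\infty)$, integers $k,m$, and $\varphi:\Omega\to\mathbb{C}_\infty$, put $$(\varphi|_{k,m}\gamma)(z)=\varphi(\gamma z)(\det\gamma)^m(cz+d)^{-k}.$$ Let $\Gamma_0(P_d)=\{\begin{pmatrix}a&b\\c&d\end{pmatrix}\in GL_2(\mathcal{O}): c\equiv 0 \pmod{P_d}\}$. For $\Gamma\in\{GL_2(\mathcal{O}),\Gamma_0(P_d)\}$, the $\mathbb{C}_\infty$-vector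 space $S^1_{k,m}(\Gamma)$ of cusp forms of weight $k\geqslant 0$ and type $m$ (which matters only modulo $q-1$) for $\Gamma$ consists of the rigid analytic functions $\varphi:\Omega\to\mathbb{C}_\infty$ with $\varphi|_{k,m}\gamma=\varphi$ for all $\gamma\in\Gamma$ that are holomorphic at all cusps of $\Gamma$ and vanish at all cusps (in the usual sense for Drinfeld modular forms; the cusps are the $\Gamma$-equivalence classes in $\mathbb{P}^1(K)$). It is finite dimensional over $\mathbb{C}_\infty$. An integer representative $m$ of the type is fixed in the formulas below. Degeneracy maps $\delta_1,\delta_{P_d}:S^1_{k,m}(GL_2(\mathcal{O}))\to S^1_{k,m}(\Gamma_0(P_d))$: $\delta_1\varphi=\varphi$ and $\delta_{P_d}\varphi=\varphi|_{k,m}\begin{pmatrix}P_d&0\\0&1\end{pmatrix}$, i.e. $(\delta_{P_d}\varphi)(z)=P_d^m\varphi(P_dz)$. The space of oldforms of level $P_d$ is $$S^{1,old}_{k,m}(\Gamma_0(P_d))=\{\delta_1\varphi_1+\delta_{P_d}\varphi_2:\varphi_1,\varphi_2\in S^1_{k,m}(GL_2(\mathcal{O}))\}.$$ On $S^1_{k,m}(\Gamma_0(P_d))$ define: the Fricke involution $\varphi^{Fr}=\varphi|_{k,m}\begin{pmatrix}0&-1\\P_d&0\end{pmatrix}$ (which preserves $S^1_{k,m}(\Gamma_0(P_d))$); the trace $Tr:S^1_{k,m}(\Gamma_0(P_d))\to S^1_{k,m}(GL_2(\mathcal{O}))$, $Tr(\varphi)=\sum_{\gamma\in R}\varphi|_{k,m}\gamma$,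 where $R=\{Id\}\cup\{\begin{pmatrix}0&-1\\1&Q\end{pmatrix}:Q\in\mathcal{O},\ \deg Q<d\}$ is a system of coset representatives of $\Gamma_0(P_d)\backslash GL_2(\mathcal{O})$ (here $Q=0$ is included); the twisted trace $Tr':S^1_{k,m}(\Gamma_0(P_d))\to S^1_{k,m}(GL_2(\mathcal{O}))$, $Tr'(\varphi)=Tr(\varphi^{Fr})$. Via the inclusion $S^1_{k,m}(GL_2(\mathcal{O}))\subseteq S^1_{k,m}(\Gamma_0(P_d))$ (the map $\delta_1$), $Tr'$ is regarded as an endomorphism of $S^1_{k,m}(\Gamma_0(P_d))$, so that $(Tr')^2$ makes sense. The space of newforms of level $P_d$ is $S^{1,new}_{k,m}(\Gamma_0(P_d))=Ker(Tr)\cap Ker(Tr')$. *)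

theory Defs
  imports
    "HOL-Analysis.Analysis"
    "HOL-Computational_Algebra.Formal_Laurent_Series"
    "HOL-Algebra.Algebraic_Closure_Type"
begin

text \<open>
  The finite field is a type \<open>'a :: {finite, field}\<close>, \<open>q = CARD('a)\<close>, and
  \<open>\<O> = 'a poly\<close>. The field \<open>K\<^sub>\<infinity> = \<bbbF>\<^sub>q((1/t))\<close> is \<open>'a fls\<close>, where the variable of the
  Laurent series is \<open>1/t\<close>; thus \<open>t\<close> is \<^const>\<open>fls_X_inv\<close>.
\<close>

section \<open>The fields\<close>

definition fls_abs :: "'a::{finite,field} fls \<Rightarrow> real" where
  "fls_abs x = (if x = 0 then 0 else real CARD('a) powi (- fls_subdegree x))"

definition of_O :: "'a::{finite,field} poly \<Rightarrow> 'a fls" where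
  "of_O p = poly (map_poly fls_const p) fls_X_inv"

definition field_K :: "'a::{finite,field} fls set" where
  "field_K = {of_O a / of_O b | a b. b \<noteq> 0}"

text \<open>
  Fields that are complete with respect to a multiplicative ultrametric absolute value. The class
  \<^class>\<open>real_normed_field\<close> is not available in positive characteristic; the absolute value of \<open>x\<close>
  is \<open>dist x 0\<close>.
\<close>

class complete_ultrametric_field = field + complete_space +
  assumes dist_eq_dist_diff: "dist x y = dist (x - y) 0"
    and dist_mult_0: "dist (x * y) 0 = dist x 0 * dist y 0"
    and dist_add_0_le_max: "dist (x + y) 0 \<le> max (dist x 0) (dist y 0)"

definition vabs :: "'c::complete_ultrametric_field \<Rightarrow> real" where
  "vabs x = dist x 0"

text \<open>
  The map \<open>\<iota>\<close> exhibits the type \<open>'c\<close> as \<open>\<complex>\<^sub>\<infinity>\<close>: it is the restriction to \<open>K\<^sub>\<infinity>\<close> of an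
  embedding of an algebraic closure of \<open>K\<^sub>\<infinity>\<close> with dense image in the complete field \<open>'c\<close>, whose
  absolute value extends that of \<open>K\<^sub>\<infinity>\<close>. Since the latter extends uniquely to the
  algebraic closure, this determines \<open>'c\<close> up to isometric isomorphism over \<open>K\<^sub>\<infinity>\<close>.
\<close>

definition is_C_infinity ::
    "('a::{finite,field} fls \<Rightarrow> 'c::complete_ultrametric_field) \<Rightarrow> bool" where
  "is_C_infinity \<iota> \<longleftrightarrow>
     (\<exists>j :: 'a fls alg_closure \<Rightarrow> 'c.
        j 1 = 1 \<and> (\<forall>x y. j (x + y) = j x + j y) \<and> (\<forall>x y. j (x * y) = j x * j y) \<and>
        closure (range j) = UNIV \<and>
        (\<forall>x. \<iota> x = j (to_ac x)) \<and>
        (\<forall>x. vabs (\<iota> x) = fls_abs x))"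


section \<open>The Drinfeld upper half-plane\<close>

text \<open>As \<open>\<infinity> \<in> \<bbbP>\<^sup>1(K\<^sub>\<infinity>)\<close>, the set \<open>\<bbbP>\<^sup>1(\<complex>\<^sub>\<infinity>) - \<bbbP>\<^sup>1(K\<^sub>\<infinity>)\<close> is \<open>\<complex>\<^sub>\<infinity> - K\<^sub>\<infinity>\<close>.\<close>

definition Omega :: "('a::{finite,field} fls \<Rightarrow> 'c::complete_ultrametric_field) \<Rightarrow> 'c set" where
  "Omega \<iota> = - range \<iota>"

text \<open>The imaginary part \<open>|z|\<^sub>i\<close>, the distance of \<open>z\<close> to \<open>K\<^sub>\<infinity>\<close>.\<close>

definition im_abs :: "('a::{finite,field} fls \<Rightarrow> 'c::complete_ultrametric_field) \<Rightarrow> 'c \<Rightarrow> real" where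
  "im_abs \<iota> z = infdist z (range \<iota>)"

text \<open>
  \<open>Omega\<close> is the increasing union of these affinoids, which form an admissible covering. Each is
  a closed disc minus finitely many open discs, as \<open>K\<^sub>\<infinity>\<close> is locally compact.
\<close>

definition Omega_aff ::
    "('a::{finite,field} fls \<Rightarrow> 'c::complete_ultrametric_field) \<Rightarrow> nat \<Rightarrow> 'c set" where
  "Omega_aff \<iota> n = {z. vabs z \<le> real CARD('a) ^ n \<and> im_abs \<iota> z \<ge> 1 / real CARD('a) ^ n}"

text \<open>
  The rigid analytic functions on an affinoid subset of the projective line are the uniform limits
  of rational functions without poles on it.
\<close>

definition rigid_analytic ::
    "('a::{finite,field} fls \<Rightarrow> 'c::complete_ultrametric_field) \<Rightarrow> ('c \<Rightarrow> 'c) \<Rightarrow> bool" where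
  "rigid_analytic \<iota> \<phi> \<longleftrightarrow>
     (\<forall>n. \<exists>f g :: nat \<Rightarrow> 'c poly.
        (\<forall>i. \<forall>z\<in>Omega_aff \<iota> n. poly (g i) z \<noteq> 0) \<and>
        uniform_limit (Omega_aff \<iota> n) (\<lambda>i z. poly (f i) z / poly (g i) z) \<phi> sequentially)"


section \<open>Groups of matrices and the slash operators\<close>

definition mat2 :: "'r::zero \<Rightarrow> 'r \<Rightarrow> 'r \<Rightarrow> 'r \<Rightarrow> 'r ^ 2 ^ 2" where
  "mat2 a b c d = vector [vector [a, b], vector [c, d]]"

text \<open>All groups are regarded as subsets of \<open>GL\<^sub>2(K\<^sub>\<infinity>)\<close>.\<close>

definition GL2_K :: "('a::{finite,field} fls ^ 2 ^ 2) set" where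
  "GL2_K = {\<gamma>. invertible \<gamma> \<and> (\<forall>i l. \<gamma> $ i $ l \<in> field_K)}"

definition GL2_O :: "('a::{finite,field} fls ^ 2 ^ 2) set" where
  "GL2_O = map_matrix of_O ` {A :: 'a poly ^ 2 ^ 2. invertible A}"

definition Gamma0 :: "'a::{finite,field} poly \<Rightarrow> ('a fls ^ 2 ^ 2) set" where
  "Gamma0 P = map_matrix of_O ` {A :: 'a poly ^ 2 ^ 2. invertible A \<and> P dvd A $ 2 $ 1}"

definition moebius ::
    "('a::{finite,field} fls \<Rightarrow> 'c::complete_ultrametric_field) \<Rightarrow> 'a fls ^ 2 ^ 2 \<Rightarrow> 'c \<Rightarrow> 'c" where
  "moebius \<iota> \<gamma> z =
     (\<iota> (\<gamma> $ 1 $ 1) * z + \<iota> (\<gamma> $ 1 $ 2)) / (\<iota> (\<gamma> $ 2 $ 1) * z + \<iota> (\<gamma> $ 2 $ 2))"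

text \<open>
  A function on \<open>Omega\<close> is represented by a function on \<open>'c\<close> that vanishes outside of \<open>Omega\<close>.
\<close>

definition slash ::
    "('a::{finite,field} fls \<Rightarrow> 'c::complete_ultrametric_field) \<Rightarrow> int \<Rightarrow> int \<Rightarrow>
     'a fls ^ 2 ^ 2 \<Rightarrow> ('c \<Rightarrow> 'c) \<Rightarrow> 'c \<Rightarrow> 'c" where
  "slash \<iota> k m \<gamma> \<phi> z =
     (if z \<in> Omega \<iota>
      then \<phi> (moebius \<iota> \<gamma> z) * \<iota> (det \<gamma>) powi m * (\<iota> (\<gamma> $ 2 $ 1) * z + \<iota> (\<gamma> $ 2 $ 2)) powi (- k)
      else 0)"


section \<open>Cusp forms\<close>

text \<open>
  The lattice of all \<open>b\<close> such that \<open>z \<mapsto> z + b\<close> belongs to \<open>\<gamma>\<^sup>-\<^sup>1\<Gamma>\<gamma>\<close>, the group under which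
  \<open>\<phi>|\<gamma>\<close> is invariant if \<open>\<phi>\<close> is invariant under \<open>\<Gamma>\<close>.
\<close>

definition cusp_lattice ::
    "('a::{finite,field} fls ^ 2 ^ 2) set \<Rightarrow> 'a fls ^ 2 ^ 2 \<Rightarrow> 'a fls set" where
  "cusp_lattice \<Gamma> \<gamma> = {b. \<gamma> ** mat2 1 b 0 1 ** matrix_inv \<gamma> \<in> \<Gamma>}"

text \<open>The exponential function \<open>z \<Prod> (1 - z/\<mu>)\<close> of a lattice, with \<open>\<mu>\<close> ranging over \<open>\<Lambda> - {0}\<close>.\<close>

definition lattice_exp ::
    "('a::{finite,field} fls \<Rightarrow> 'c::complete_ultrametric_field) \<Rightarrow> 'a fls set \<Rightarrow> 'c \<Rightarrow> 'c" where
  "lattice_exp \<iota> \<Lambda> z =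
     lim (\<lambda>N. z * (\<Prod>\<mu> \<in> {\<mu> \<in> \<Lambda>. \<mu> \<noteq> 0 \<and> fls_abs \<mu> \<le> real N}. 1 - z / \<iota> \<mu>))"

text \<open>
  Expansion at infinity in the parameter \<open>u = 1 / lattice_exp \<iota> \<Lambda>\<close>. The customary
  factor \<open>1/\<pi>\<close> in \<open>u\<close>, with \<open>\<pi>\<close> the Carlitz period, only rescales the coefficients.
\<close>

definition has_u_expansion ::
    "('a::{finite,field} fls \<Rightarrow> 'c::complete_ultrametric_field) \<Rightarrow> 'a fls set \<Rightarrow>
     ('c \<Rightarrow> 'c) \<Rightarrow> (nat \<Rightarrow> 'c) \<Rightarrow> bool" where
  "has_u_expansion \<iota> \<Lambda> f a \<longleftrightarrow>
     (\<exists>C>0. \<forall>z. im_abs \<iota> z \<ge> C \<longrightarrow> (\<lambda>n. a n * (1 / lattice_exp \<iota> \<Lambda> z) ^ n) sums f z)"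

text \<open>
  The cusps of \<open>\<Gamma>\<close> are represented by \<open>\<gamma> \<infinity>\<close> with \<open>\<gamma> \<in> GL2_K\<close>. In an expansion without negative
  exponents the condition \<open>a 0 = 0\<close> says that the form vanishes at the cusp.
\<close>

definition cusp_forms ::
    "('a::{finite,field} fls \<Rightarrow> 'c::complete_ultrametric_field) \<Rightarrow> int \<Rightarrow> int \<Rightarrow>
     ('a fls ^ 2 ^ 2) set \<Rightarrow> ('c \<Rightarrow> 'c) set" where
  "cusp_forms \<iota> k m \<Gamma> =
     {\<phi>. (\<forall>z. z \<notin> Omega \<iota> \<longrightarrow> \<phi> z = 0) \<and>
         rigid_analytic \<iota> \<phi> \<and>
         (\<forall>\<gamma>\<in>\<Gamma>. slash \<iota> k m \<gamma> \<phi> = \<phi>) \<and>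
         (\<forall>\<gamma>\<in>GL2_K. \<exists>a. has_u_expansion \<iota> (cusp_lattice \<Gamma> \<gamma>) (slash \<iota> k m \<gamma> \<phi>) a \<and> a 0 = 0)}"


section \<open>Oldforms and newforms\<close>

definition delta_one :: "('c \<Rightarrow> 'c) \<Rightarrow> 'c \<Rightarrow> 'c" where
  "delta_one \<phi> = \<phi>"

definition delta_P ::
    "('a::{finite,field} fls \<Rightarrow> 'c::complete_ultrametric_field) \<Rightarrow> int \<Rightarrow> int \<Rightarrow>
     'a poly \<Rightarrow> ('c \<Rightarrow> 'c) \<Rightarrow> 'c \<Rightarrow> 'c" where
  "delta_P \<iota> k m P = slash \<iota> k m (mat2 (of_O P) 0 0 1)"

definition oldforms ::
    "('a::{finite,field} fls \<Rightarrow> 'c::complete_ultrametric_field) \<Rightarrow> int \<Rightarrow> int \<Rightarrow>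
     'a poly \<Rightarrow> ('c \<Rightarrow> 'c) set" where
  "oldforms \<iota> k m P =
     {(\<lambda>z. delta_one \<phi>\<^sub>1 z + delta_P \<iota> k m P \<phi>\<^sub>2 z) | \<phi>\<^sub>1 \<phi>\<^sub>2.
        \<phi>\<^sub>1 \<in> cusp_forms \<iota> k m GL2_O \<and> \<phi>\<^sub>2 \<in> cusp_forms \<iota> k m GL2_O}"

definition fricke ::
    "('a::{finite,field} fls \<Rightarrow> 'c::complete_ultrametric_field) \<Rightarrow> int \<Rightarrow> int \<Rightarrow>
     'a poly \<Rightarrow> ('c \<Rightarrow> 'c) \<Rightarrow> 'c \<Rightarrow> 'c" where
  "fricke \<iota> k m P = slash \<iota> k m (mat2 0 (- 1) (of_O P) 0)"

text \<open>
  As \<open>Polynomial.degree 0 = 0\<close>, the matrix with \<open>Q = 0\<close> is included for nonconstant \<open>P\<close>.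
\<close>

definition coset_reps :: "'a::{finite,field} poly \<Rightarrow> ('a fls ^ 2 ^ 2) set" where
  "coset_reps P =
     {mat 1} \<union> {mat2 0 (- 1) 1 (of_O Q) | Q. Polynomial.degree Q < Polynomial.degree P}"

definition trace_map ::
    "('a::{finite,field} fls \<Rightarrow> 'c::complete_ultrametric_field) \<Rightarrow> int \<Rightarrow> int \<Rightarrow>
     'a poly \<Rightarrow> ('c \<Rightarrow> 'c) \<Rightarrow> 'c \<Rightarrow> 'c" where
  "trace_map \<iota> k m P \<phi> = (\<lambda>z. \<Sum>\<gamma>\<in>coset_reps P. slash \<iota> k m \<gamma> \<phi> z)"

definition twisted_trace ::
    "('a::{finite,field} fls \<Rightarrow> 'c::complete_ultrametric_field) \<Rightarrow> int \<Rightarrow> int \<Rightarrow>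
     'a poly \<Rightarrow> ('c \<Rightarrow> 'c) \<Rightarrow> 'c \<Rightarrow> 'c" where
  "twisted_trace \<iota> k m P \<phi> = trace_map \<iota> k m P (fricke \<iota> k m P \<phi>)"

definition newforms ::
    "('a::{finite,field} fls \<Rightarrow> 'c::complete_ultrametric_field) \<Rightarrow> int \<Rightarrow> int \<Rightarrow>
     'a poly \<Rightarrow> ('c \<Rightarrow> 'c) set" where
  "newforms \<iota> k m P =
     {\<phi> \<in> cusp_forms \<iota> k m (Gamma0 P).
        trace_map \<iota> k m P \<phi> = (\<lambda>z. 0) \<and> twisted_trace \<iota> k m P \<phi> = (\<lambda>z. 0)}"

definition D_map ::
    "('a::{finite,field} fls \<Rightarrow> 'c::complete_ultrametric_field) \<Rightarrow> int \<Rightarrow> int \<Rightarrow>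
     'a poly \<Rightarrow> ('c \<Rightarrow> 'c) \<Rightarrow> 'c \<Rightarrow> 'c" where
  "D_map \<iota> k m P \<phi> =
     (\<lambda>z. \<phi> z - \<iota> (of_O P) powi (k - 2 * m) *
            twisted_trace \<iota> k m P (twisted_trace \<iota> k m P \<phi>) z)"

text \<open>Internal direct sum of vector spaces of functions.\<close>

definition is_direct_sum :: "('c \<Rightarrow> 'c::ab_group_add) set \<Rightarrow> ('c \<Rightarrow> 'c) set \<Rightarrow> ('c \<Rightarrow> 'c) set \<Rightarrow> bool" where
  "is_direct_sum V A B \<longleftrightarrow>
     V = {(\<lambda>z. f z + g z) | f g. f \<in> A \<and> g \<in> B} \<and> A \<inter> B = {\<lambda>z. 0}"

end

theory Submission
  imports Defs "HOL-Computational_Algebra.Polynomial_FPS"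
begin

text \<open>
  Write \<open>S\<close> for the cusp forms of level \<open>P\<close> and \<open>S\<^sub>1\<close> for
  those of level one, and \<open>b = P\<^sup>2\<^sup>m\<^sup>-\<^sup>k\<close>. The proof rests on four
  formal properties: \<open>Tr\<close> is the identity on \<open>S\<^sub>1\<close>, since it sums
  \<open>1 + q\<^sup>d\<close> copies of the form (\<open>trace_level_one\<close>); the Fricke operator
  satisfies \<open>Fr\<^sup>2 = b\<close> on \<open>S\<close> (\<open>fricke_fricke\<close>); it agrees
  with \<open>\<delta>\<^sub>P\<close> on \<open>S\<^sub>1\<close> (\<open>delta_P_level_one\<close>);
  and \<open>Fr\<close> maps \<open>S\<close> to itself and \<open>Tr\<close> maps \<open>S\<close> to
  \<open>S\<^sub>1\<close>. Hence the oldforms are the sums \<open>x + Fr y\<close> with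
  \<open>x\<close> and \<open>y\<close> in \<open>S\<^sub>1\<close>, and \<open>Tr (x + Fr y) = x + Tr'
  y\<close> and \<open>Tr' (x + Fr y) = Tr' x + b y\<close> (\<open>traces_oldform\<close>). An oldform
  with prescribed traces is found by eliminating \<open>x\<close>: the equation that remains for
  \<open>y\<close> is \<open>\<D> y = \<psi>\<close> with \<open>\<psi>\<close> in
  \<open>S\<^sub>1\<close>. So if \<open>\<D>\<close> is bijective, every form differs from exactly one
  oldform by a newform. Here bijectivity on \<open>S\<close> entails bijectivity on
  \<open>S\<^sub>1\<close>, because \<open>\<D>\<close> is the identity modulo \<open>S\<^sub>1\<close>.

  Conversely, let the sum be direct. A form \<open>y\<close> with \<open>\<D> y = 0\<close> has level
  one and \<open>- Tr' y + Fr y\<close> is both old and new, hence zero. Two facts about level one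
  finish the proof. The first is that \<open>x + Fr y = 0\<close> implies \<open>y = 0\<close>
  (\<open>fricke_level_one_imp_zero\<close>), so \<open>\<D>\<close> is injective: otherwise
  \<open>|y(z)|\<close> and \<open>|y(P\<^sup>2z)|\<close> would have a constant ratio, against the
  decay of \<open>y\<close> at the cusp. The second is that \<open>S\<^sub>1\<close> has finite
  dimension, by which \<open>\<D>\<close> is surjective on \<open>S\<^sub>1\<close>
  (\<open>level_one_surjective\<close>) and then on \<open>S\<close>.

  Finite dimension is derived without the geometry of modular curves. A form of level one whose first
  coefficients vanish is zero (\<open>level_one_vanishing\<close>). Such a form is invariant under
  translation by polynomials, so its product with a power of the exponential function \<open>E\<close>
  of the polynomials of bounded degree satisfies a maximum principle on discs with holes
  (\<open>three_circles\<close>). To see this, one takes the norm \<open>\<Prod>\<^sub>a h(z +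
  a)\<close> of a rational approximation \<open>h\<close>; being a rational function of
  \<open>E(z)\<close>, it is governed by its zeros and poles on a single annulus
  (\<open>annulus_maximum\<close>). The outer boundary contributes nothing in the limit, by the
  vanishing at the cusp, and the inversion \<open>z \<mapsto> -1/z\<close> turns the bound from the
  inner boundary into a bound by a fraction of itself.

  That \<open>Fr\<close> and \<open>Tr\<close> preserve the conditions at the cusps is not formal, as
  each cusp has its own lattice and its own parameter. Passing to a sublattice is a substitution of
  power series (\<open>has_u_expansion_sublattice\<close>). Passing back is possible for functions that
  are periodic under the larger lattice (\<open>has_u_expansion_superlattice\<close>), by repeated
  division with remainder. Both depend on the additivity of exponential functions and the resulting
  polynomial relation between those of two lattices (\<open>lattice_exp_sublattice\<close>). The
  analysis uses that \<open>\<complex>\<^sub>\<infinity>\<close> is algebraically closed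
  (\<open>C_infinity_root\<close>), for instance to split numerators and denominators of rational
  functions.
\<close>

no_notation fps_nth (infixl "$" 75)

section \<open>Ultrametric fields\<close>

lemma dist_conv_vabs: "dist x y = vabs (x - y :: 'c::complete_ultrametric_field)"
  by (simp add: vabs_def dist_eq_dist_diff[of x y])

lemma vabs_nonneg [simp]: "0 \<le> vabs (x :: 'c::complete_ultrametric_field)"
  by (simp add: vabs_def)

lemma vabs_eq_0_iff [simp]: "vabs x = 0 \<longleftrightarrow> x = (0 :: 'c::complete_ultrametric_field)"
  by (simp add: vabs_def)

lemma vabs_0 [simp]: "vabs (0 :: 'c::complete_ultrametric_field) = 0"
  by simp

lemma vabs_pos_iff [simp]: "0 < vabs x \<longleftrightarrow> x \<noteq> (0 :: 'c::complete_ultrametric_field)"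
  by (simp add: vabs_def)

lemma vabs_mult: "vabs (x * y) = vabs x * vabs (y :: 'c::complete_ultrametric_field)"
  by (simp add: vabs_def dist_mult_0)

lemma vabs_1 [simp]: "vabs (1 :: 'c::complete_ultrametric_field) = 1"
proof -
  have "vabs (1::'c) * vabs (1::'c) = vabs (1::'c) * 1"
    using vabs_mult[of "1::'c" 1] by simp
  thus ?thesis
    by (simp only: mult_cancel_left vabs_eq_0_iff) simp
qed

lemma vabs_minus [simp]: "vabs (- x) = vabs (x :: 'c::complete_ultrametric_field)"
  using dist_eq_dist_diff[of "0::'c" x] dist_commute[of 0 x]
  by (simp add: vabs_def)

lemma vabs_minus_commute: "vabs (x - y) = vabs (y - x :: 'c::complete_ultrametric_field)"
  using vabs_minus[of "x - y"] by simp

lemma vabs_add_le: "vabs (x + y) \<le> max (vabs x) (vabs (y :: 'c::complete_ultrametric_field))"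
  by (simp add: vabs_def dist_add_0_le_max)

lemma vabs_diff_le: "vabs (x - y) \<le> max (vabs x) (vabs (y :: 'c::complete_ultrametric_field))"
  using vabs_add_le[of x "- y"] by simp

lemma vabs_add_leI:
  "vabs x \<le> B \<Longrightarrow> vabs y \<le> B \<Longrightarrow> vabs (x + y :: 'c::complete_ultrametric_field) \<le> B"
  using vabs_add_le[of x y] by simp

lemma vabs_diff_leI:
  "vabs x \<le> B \<Longrightarrow> vabs y \<le> B \<Longrightarrow> vabs (x - y :: 'c::complete_ultrametric_field) \<le> B"
  using vabs_diff_le[of x y] by simp

lemma vabs_add_eq:
  assumes "vabs x < vabs (y :: 'c::complete_ultrametric_field)"
  shows "vabs (x + y) = vabs y"
proof (rule antisym)
  show "vabs (x + y) \<le> vabs y"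
    using vabs_add_le[of x y] assms by simp
  have "vabs y \<le> max (vabs (x + y)) (vabs x)"
    using vabs_diff_le[of "x + y" x] by simp
  thus "vabs y \<le> vabs (x + y)"
    using assms by (auto simp: max_def split: if_splits)
qed

lemma vabs_add_eq2:
  "vabs y < vabs x \<Longrightarrow> vabs (x + y :: 'c::complete_ultrametric_field) = vabs x"
  using vabs_add_eq[of y x] by (simp add: add.commute)

lemma vabs_diff_eq:
  "vabs x < vabs y \<Longrightarrow> vabs (x - y :: 'c::complete_ultrametric_field) = vabs y"
  using vabs_add_eq[of x "- y"] by simp

lemma vabs_diff_eq2:
  "vabs y < vabs x \<Longrightarrow> vabs (x - y :: 'c::complete_ultrametric_field) = vabs x"
  using vabs_add_eq2[of "- y" x] by simp

lemma vabs_power: "vabs (x ^ n) = vabs (x :: 'c::complete_ultrametric_field) ^ n"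
  by (induction n) (auto simp: vabs_mult)

lemma vabs_inverse: "vabs (inverse x) = inverse (vabs (x :: 'c::complete_ultrametric_field))"
proof (cases "x = 0")
  case False
  hence "vabs x * vabs (inverse x) = 1"
    by (metis right_inverse vabs_1 vabs_mult)
  thus ?thesis by (metis inverse_unique)
qed simp

lemma vabs_divide: "vabs (x / y) = vabs x / vabs (y :: 'c::complete_ultrametric_field)"
  by (simp add: divide_inverse vabs_mult vabs_inverse)

lemma vabs_prod: "vabs (\<Prod>x\<in>A. f x) = (\<Prod>x\<in>A. vabs (f x :: 'c::complete_ultrametric_field))"
  by (induction A rule: infinite_finite_induct) (auto simp: vabs_mult)

lemma vabs_prod_list:
  "vabs (prod_list xs) = prod_list (map vabs (xs :: 'c::complete_ultrametric_field list))"
  by (induction xs) (auto simp: vabs_mult)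

lemma vabs_sum_le:
  assumes "\<And>x. x \<in> A \<Longrightarrow> vabs (f x :: 'c::complete_ultrametric_field) \<le> B" "0 \<le> B"
  shows "vabs (\<Sum>x\<in>A. f x) \<le> B"
  using assms
proof (induction A rule: infinite_finite_induct)
  case (insert x A)
  thus ?case by (auto intro!: vabs_add_leI)
qed auto

lemma tendsto_iff_vabs:
  "(f \<longlongrightarrow> l) F \<longleftrightarrow> ((\<lambda>x. vabs (f x - l :: 'c::complete_ultrametric_field)) \<longlongrightarrow> 0) F"
  by (subst tendsto_dist_iff) (simp add: dist_conv_vabs)

lemma tendsto_vabs: "(f \<longlongrightarrow> l) F \<Longrightarrow> ((\<lambda>x. vabs (f x)) \<longlongrightarrow> vabs l) F"
  unfolding vabs_def by (intro tendsto_intros)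

lemma tendsto_0_iff_vabs:
  "(f \<longlongrightarrow> (0 :: 'c::complete_ultrametric_field)) F \<longleftrightarrow> ((\<lambda>x. vabs (f x)) \<longlongrightarrow> 0) F"
  using tendsto_iff_vabs[of f 0 F] by simp

lemma tendsto_vabs_squeeze:
  assumes "(g \<longlongrightarrow> 0) F" "\<And>x. vabs (f x - (l :: 'c::complete_ultrametric_field)) \<le> g x"
  shows "(f \<longlongrightarrow> l) F"
  unfolding tendsto_iff_vabs
  by (rule tendsto_sandwich[OF _ _ tendsto_const assms(1)])
     (auto intro!: always_eventually assms(2))

instance complete_ultrametric_field \<subseteq> topological_ab_group_add
proof
  fix a b :: 'a
  have l: "((\<lambda>x. vabs (fst x - a)) \<longlongrightarrow> 0) (nhds a \<times>\<^sub>F nhds b)"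
    "((\<lambda>x. vabs (snd x - b)) \<longlongrightarrow> 0) (nhds a \<times>\<^sub>F nhds b)"
    using tendsto_fst[OF filterlim_ident, of "(a,b)"] tendsto_snd[OF filterlim_ident, of "(a,b)"]
    unfolding nhds_prod[symmetric] tendsto_iff_vabs by simp_all
  have "((\<lambda>x. vabs (fst x - a) + vabs (snd x - b)) \<longlongrightarrow> 0 + 0) (nhds a \<times>\<^sub>F nhds b)"
    by (intro tendsto_add l)
  hence lim: "((\<lambda>x. vabs (fst x - a) + vabs (snd x - b)) \<longlongrightarrow> 0) (nhds a \<times>\<^sub>F nhds b)"
    by simp
  show "((\<lambda>x. fst x + snd x) \<longlongrightarrow> a + b) (nhds a \<times>\<^sub>F nhds b)"
  proof (rule tendsto_vabs_squeeze[OF lim])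
    fix x
    show "vabs (fst x + snd x - (a + b)) \<le> vabs (fst x - a) + vabs (snd x - b)"
      using order.trans[OF vabs_add_le[of "fst x - a" "snd x - b"],
        of "vabs (fst x - a) + vabs (snd x - b)"] by (simp add: algebra_simps)
  qed
next
  fix a :: 'a
  show "(uminus \<longlongrightarrow> - a) (nhds a)"
    using filterlim_ident[of "nhds a"]
    by (subst tendsto_iff_vabs, subst (asm) tendsto_iff_vabs)
       (simp add: vabs_minus_commute)
qed

instance complete_ultrametric_field \<subseteq> topological_comm_monoid_mult
proof
  fix a b :: 'a
  have l: "((\<lambda>x. vabs (fst x - a)) \<longlongrightarrow> 0) (nhds a \<times>\<^sub>F nhds b)"
    "((\<lambda>x. vabs (snd x - b)) \<longlongrightarrow> 0) (nhds a \<times>\<^sub>F nhds b)"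
    using tendsto_fst[OF filterlim_ident, of "(a,b)"] tendsto_snd[OF filterlim_ident, of "(a,b)"]
    unfolding nhds_prod[symmetric] tendsto_iff_vabs by simp_all
  have "((\<lambda>x. vabs (fst x - a) * vabs (snd x - b) + vabs b * vabs (fst x - a)
      + vabs a * vabs (snd x - b)) \<longlongrightarrow> 0 * 0 + vabs b * 0 + vabs a * 0) (nhds a \<times>\<^sub>F nhds b)"
    by (intro tendsto_intros l)
  hence lim: "((\<lambda>x. vabs (fst x - a) * vabs (snd x - b) + vabs b * vabs (fst x - a)
      + vabs a * vabs (snd x - b)) \<longlongrightarrow> 0) (nhds a \<times>\<^sub>F nhds b)"
    by simp
  show "((\<lambda>x. fst x * snd x) \<longlongrightarrow> a * b) (nhds a \<times>\<^sub>F nhds b)"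
  proof (rule tendsto_vabs_squeeze[OF lim])
      fix x
      have "fst x * snd x - a * b = (fst x - a) * (snd x - b) + b * (fst x - a) + a * (snd x - b)"
        by (simp add: algebra_simps)
      also have "vabs \<dots> \<le> max (max (vabs ((fst x - a) * (snd x - b))) (vabs (b * (fst x - a))))
          (vabs (a * (snd x - b)))"
        by (intro order.trans[OF vabs_add_le] max.mono) auto
      also have "\<dots> \<le> vabs (fst x - a) * vabs (snd x - b) + vabs b * vabs (fst x - a)
          + vabs a * vabs (snd x - b)"
        by (auto simp: vabs_mult)
      finally show "vabs (fst x * snd x - a * b)
        \<le> vabs (fst x - a) * vabs (snd x - b) + vabs b * vabs (fst x - a)
          + vabs a * vabs (snd x - b)" .
  qed
qed

lemma vabs_le_of_tendsto:
  assumes "(f \<longlongrightarrow> (l :: 'c::complete_ultrametric_field)) F" "F \<noteq> bot"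
    "eventually (\<lambda>x. vabs (f x) \<le> B) F"
  shows "vabs l \<le> B"
  using tendsto_upperbound[OF tendsto_vabs[OF assms(1)] assms(3,2)] .

lemma tendsto_inverse_vabs:
  assumes "(f \<longlongrightarrow> (l :: 'c::complete_ultrametric_field)) F" "l \<noteq> 0"
  shows "((\<lambda>x. inverse (f x)) \<longlongrightarrow> inverse l) F"
proof -
  have ev: "eventually (\<lambda>x. vabs (f x - l) < vabs l) F"
    using assms by (simp add: tendsto_iff dist_conv_vabs)
  have eq: "eventually (\<lambda>x. vabs (f x - l) / vabs l ^ 2 = vabs (inverse (f x) - inverse l)) F"
    using ev
  proof eventually_elim
    case (elim x)
    have a: "vabs (f x) = vabs l"
      using vabs_add_eq[OF elim] by simp
    hence "f x \<noteq> 0" using assms(2) by (metis vabs_eq_0_iff)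
    hence "inverse (f x) - inverse l = (l - f x) / (f x * l)"
      using assms(2) by (simp add: field_simps)
    thus ?case
      by (simp add: vabs_divide vabs_mult a power2_eq_square vabs_minus_commute)
  qed
  have "((\<lambda>x. vabs (f x - l) / vabs l ^ 2) \<longlongrightarrow> 0 / vabs l ^ 2) F"
    using assms by (intro tendsto_divide) (auto simp flip: tendsto_iff_vabs)
  thus ?thesis
    by (subst tendsto_iff_vabs) (use tendsto_cong[OF eq] in simp)
qed

text \<open>
  A difference \<open>f (M + k) - f M\<close> is a sum of successive differences and hence no larger
  than the largest of them.
\<close>

lemma ultrametric_Cauchy:
  fixes f :: "nat \<Rightarrow> 'c::complete_ultrametric_field"
  assumes "(\<lambda>n. f (Suc n) - f n) \<longlonglongrightarrow> 0"
  shows "Cauchy f"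
proof (rule metric_CauchyI)
  fix e :: real assume e: "e > 0"
  then obtain M where M: "\<And>n. n \<ge> M \<Longrightarrow> vabs (f (Suc n) - f n) < e"
    using assms unfolding LIMSEQ_def by (auto simp: vabs_def)
  have *: "vabs (f (M + k) - f M) < e" for k
  proof (induction k)
    case (Suc k)
    have "vabs (f (M + Suc k) - f M) \<le> max (vabs (f (Suc (M + k)) - f (M + k))) (vabs (f (M + k) - f M))"
      using vabs_add_le[of "f (Suc (M + k)) - f (M + k)" "f (M + k) - f M"] by simp
    thus ?case using Suc M[of "M + k"] by simp
  qed (use e in auto)
  show "\<exists>M. \<forall>m\<ge>M. \<forall>n\<ge>M. dist (f m) (f n) < e"
  proof (intro exI allI impI)
    fix m n assume "m \<ge> M" "n \<ge> M"
    hence "vabs (f m - f M) < e" "vabs (f n - f M) < e"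
      using *[of "m - M"] *[of "n - M"] by auto
    thus "dist (f m) (f n) < e"
      using vabs_diff_le[of "f m - f M" "f n - f M"] by (simp add: dist_conv_vabs)
  qed
qed

lemma ultrametric_summable:
  fixes f :: "nat \<Rightarrow> 'c::complete_ultrametric_field"
  assumes "f \<longlonglongrightarrow> 0"
  shows "summable f"
proof -
  have "Cauchy (\<lambda>n. \<Sum>i<n. f i)"
    using assms by (intro ultrametric_Cauchy) simp
  thus ?thesis
    by (simp add: Cauchy_convergent_iff summable_iff_convergent)
qed

lemma vabs_sums_le:
  fixes f :: "nat \<Rightarrow> 'c::complete_ultrametric_field"
  assumes "f sums s" "\<And>n. vabs (f n) \<le> B"
  shows "vabs s \<le> B"
proof -
  have B: "0 \<le> B" using assms(2)[of 0] vabs_nonneg[of "f 0"] by linarith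
  show ?thesis
    by (rule vabs_le_of_tendsto[OF assms(1)[unfolded sums_def]])
       (auto intro!: always_eventually vabs_sum_le assms B)
qed

lemma ultrametric_sums_mult_left:
  fixes f :: "nat \<Rightarrow> 'c::complete_ultrametric_field"
  assumes "f sums s"
  shows "(\<lambda>n. c * f n) sums (c * s)"
  using assms unfolding sums_def
  by (auto simp flip: sum_distrib_left intro: tendsto_mult)

lemma ultrametric_sums_tendsto_0:
  fixes f :: "nat \<Rightarrow> 'c::complete_ultrametric_field"
  assumes "f sums s"
  shows "f \<longlonglongrightarrow> 0"
proof -
  have "(\<lambda>n. (\<Sum>i<Suc n. f i) - (\<Sum>i<n. f i)) \<longlonglongrightarrow> s - s"
    using assms unfolding sums_def
    by (intro tendsto_diff LIMSEQ_Suc)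
  thus ?thesis by simp
qed

lemma ultrametric_sums_bounded:
  fixes f :: "nat \<Rightarrow> 'c::complete_ultrametric_field"
  assumes "f sums s"
  shows "\<exists>B>0. \<forall>n. vabs (f n) \<le> B"
proof -
  have "(\<lambda>n. vabs (f n)) \<longlonglongrightarrow> 0"
    using ultrametric_sums_tendsto_0[OF assms] by (simp add: tendsto_0_iff_vabs)
  hence "Bseq (\<lambda>n. vabs (f n))"
    by (intro convergent_imp_Bseq) (auto simp: convergent_def)
  thus ?thesis by (auto simp: Bseq_def)
qed

section \<open>The ring of polynomials inside the field of Laurent series\<close>

lemma of_O_pCons: "of_O (pCons a p) = fls_const a + fls_X_inv * of_O p"
  by (simp add: of_O_def map_poly_pCons)

lemma of_O_nth:
  "fls_nth (of_O p) n = (if n \<le> 0 then Polynomial.coeff p (nat (- n)) else 0)"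
proof (induction p arbitrary: n)
  case 0
  show ?case by (simp add: of_O_def)
next
  case (pCons a p)
  show ?case
  proof (cases "n < 0")
    case True
    hence "nat (- n) = Suc (nat (- (n + 1)))" by simp
    thus ?thesis using True
      by (simp add: of_O_pCons fls_X_inv_times_conv_shift pCons.IH)
  qed (auto simp: of_O_pCons fls_X_inv_times_conv_shift pCons.IH)
qed

lemma of_O_0 [simp]: "of_O 0 = 0"
  by (simp add: of_O_def)

lemma of_O_1 [simp]: "of_O 1 = 1"
  by (simp add: of_O_def)

lemma of_O_add: "of_O (x + y) = of_O x + of_O y"
  by (rule fls_eqI) (simp add: of_O_nth)

lemma of_O_minus: "of_O (- x) = - of_O x"
  by (rule fls_eqI) (simp add: of_O_nth)

lemma of_O_diff: "of_O (x - y) = of_O x - of_O y"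
  by (rule fls_eqI) (simp add: of_O_nth)

lemma of_O_smult: "of_O (Polynomial.smult c p) = fls_const c * of_O p"
  by (rule fls_eqI) (simp add: of_O_nth)

lemma of_O_mult: "of_O (x * y) = of_O x * of_O y"
  by (induction x) (simp_all add: of_O_pCons of_O_add of_O_smult algebra_simps)

lemma of_O_eq_iff [simp]: "of_O x = of_O y \<longleftrightarrow> x = y"
proof
  assume "of_O x = of_O y"
  hence "fls_nth (of_O x) (- int n) = fls_nth (of_O y) (- int n)" for n by simp
  thus "x = y" by (intro poly_eqI) (simp add: of_O_nth)
qed simp

lemma of_O_eq_0_iff [simp]: "of_O x = 0 \<longleftrightarrow> x = 0"
  using of_O_eq_iff[of x 0] by simp

lemma fls_subdegree_of_O: "fls_subdegree (of_O p) = - int (Polynomial.degree p)"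
proof (cases "p = 0")
  case False
  thus ?thesis
    by (intro fls_subdegree_eqI) (auto simp: of_O_nth intro: coeff_eq_0)
qed simp

lemma fls_abs_of_O:
  "fls_abs (of_O (p :: 'a::{finite,field} poly)) =
     (if p = 0 then 0 else real CARD('a) ^ Polynomial.degree p)"
  by (simp add: fls_abs_def fls_subdegree_of_O)

lemma CARD_field_ge_2: "CARD('a::{finite,field}) \<ge> 2"
proof -
  have "card {0, 1 :: 'a} \<le> CARD('a)"
    by (intro card_mono) auto
  thus ?thesis by simp
qed

lemma real_CARD_field_gt_1 [simp]: "real CARD('a::{finite,field}) > 1"
  using CARD_field_ge_2[where 'a='a] by linarith

lemma fls_abs_pos_iff [simp]: "fls_abs x > 0 \<longleftrightarrow> x \<noteq> 0"
  by (simp add: fls_abs_def)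

lemma fls_abs_le_powi_iff:
  "fls_abs (x :: 'a::{finite,field} fls) \<le> real CARD('a) powi n \<longleftrightarrow> (\<forall>k < - n. fls_nth x k = 0)"
proof (cases "x = 0")
  case False
  have "fls_abs x \<le> real CARD('a) powi n \<longleftrightarrow> - fls_subdegree x \<le> n"
  proof
    assume "fls_abs x \<le> real CARD('a) powi n"
    thus "- fls_subdegree x \<le> n"
      using False power_int_strict_increasing[of n "- fls_subdegree x" "real CARD('a)"]
      unfolding fls_abs_def by (metis not_le real_CARD_field_gt_1)
  next
    assume "- fls_subdegree x \<le> n"
    thus "fls_abs x \<le> real CARD('a) powi n"
      using False unfolding fls_abs_def
      by (auto intro!: power_int_increasing simp: less_imp_le)
  qed
  also have "\<dots> \<longleftrightarrow> (\<forall>k < - n. fls_nth x k = 0)"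
    using False by (auto intro!: fls_subdegree_geI simp: fls_eq0_below_subdegree minus_le_iff)
  finally show ?thesis .
qed (auto simp: fls_abs_def)

text \<open>The polynomial collects the terms of the series with nonnegative powers of \<open>t\<close>.\<close>

lemma polynomial_part:
  "\<exists>p. fls_abs (x - of_O p) \<le> 1 / real CARD('a)" for x :: "'a::{finite,field} fls"
proof -
  define N where "N = Suc (nat (- fls_subdegree x))"
  define p where "p = Poly (map (\<lambda>i. fls_nth x (- int i)) [0..<N])"
  have "fls_nth (x - of_O p) k = 0" if "k < 1" for k
  proof (cases "nat (- k) < N")
    case True
    thus ?thesis using that
      by (simp add: of_O_nth p_def nth_default_nth)
  next
    case False
    hence "k < fls_subdegree x" unfolding N_def using that by linarith
    thus ?thesis using False
      by (simp add: of_O_nth p_def nth_default_def)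
  qed
  hence "fls_abs (x - of_O p) \<le> real CARD('a) powi (- 1)"
    by (subst fls_abs_le_powi_iff) auto
  thus ?thesis by (auto simp: power_int_minus field_simps)
qed

lemma finite_degree_less: "finite {p :: 'a::{finite,zero} poly. Polynomial.degree p < n}"
proof -
  have "{p :: 'a poly. Polynomial.degree p < n} \<subseteq> Poly ` {xs. set xs \<subseteq> UNIV \<and> length xs \<le> n}"
  proof
    fix p :: "'a poly" assume "p \<in> {p. Polynomial.degree p < n}"
    moreover have "length (Polynomial.coeffs p) \<le> Suc (Polynomial.degree p)"
      by (cases "p = 0") (auto simp: length_coeffs_degree)
    ultimately show "p \<in> Poly ` {xs. set xs \<subseteq> UNIV \<and> length xs \<le> n}"
      by (intro image_eqI[of _ _ "Polynomial.coeffs p"]) auto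
  qed
  thus ?thesis
    by (rule finite_subset) (intro finite_imageI finite_lists_length_le finite)
qed


section \<open>The field \<open>\<complex>\<^sub>\<infinity>\<close>\<close>

locale drinfeld_setting =
  fixes \<iota> :: "'a::{finite,field} fls \<Rightarrow> 'c::complete_ultrametric_field" and q :: real
  assumes C_infinity: "is_C_infinity \<iota>"
  defines q_def: "q \<equiv> real CARD('a)"
begin

lemma q_gt_1: "q > 1" and q_pos: "q > 0"
  using real_CARD_field_gt_1[where 'a='a] unfolding q_def by linarith+

lemmas fls_abs_le_powi_iff' = fls_abs_le_powi_iff[where 'a='a, folded q_def]
  and fls_abs_of_O' = fls_abs_of_O[where 'a='a, folded q_def]
  and polynomial_part' = polynomial_part[where 'a='a, folded q_def]
  and fls_abs_q = fls_abs_def[where 'a='a, folded q_def]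

lemma iota_add: "\<iota> (x + y) = \<iota> x + \<iota> y"
proof -
  obtain j :: "'a fls alg_closure \<Rightarrow> 'c" where "\<forall>x y. j (x + y) = j x + j y" "\<forall>x. \<iota> x = j (to_ac x)"
    using C_infinity unfolding is_C_infinity_def by blast
  thus ?thesis by simp
qed

lemma iota_mult: "\<iota> (x * y) = \<iota> x * \<iota> y"
proof -
  obtain j :: "'a fls alg_closure \<Rightarrow> 'c" where "\<forall>x y. j (x * y) = j x * j y" "\<forall>x. \<iota> x = j (to_ac x)"
    using C_infinity unfolding is_C_infinity_def by blast
  thus ?thesis by simp
qed

lemma iota_1 [simp]: "\<iota> 1 = 1"
proof -
  obtain j :: "'a fls alg_closure \<Rightarrow> 'c" where "j 1 = 1" "\<forall>x. \<iota> x = j (to_ac x)"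
    using C_infinity unfolding is_C_infinity_def by blast
  thus ?thesis by simp
qed

lemma vabs_iota: "vabs (\<iota> x) = fls_abs x"
  using C_infinity unfolding is_C_infinity_def by blast

lemma iota_0 [simp]: "\<iota> 0 = 0"
proof -
  have "\<iota> 0 + \<iota> 0 = \<iota> 0 + 0" using iota_add[of 0 0] by (simp only: add_0_right)
  thus ?thesis by (simp only: add_left_cancel)
qed

lemma iota_minus: "\<iota> (- x) = - \<iota> x"
  using iota_add[of x "- x"] by (simp add: add_eq_0_iff)

lemma iota_diff: "\<iota> (x - y) = \<iota> x - \<iota> y"
  using iota_add[of x "- y"] by (simp add: iota_minus)

lemma iota_eq_0_iff [simp]: "\<iota> x = 0 \<longleftrightarrow> x = 0"
  using vabs_pos_iff[of "\<iota> x"] by (simp add: vabs_iota)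

lemma iota_eq_iff [simp]: "\<iota> x = \<iota> y \<longleftrightarrow> x = y"
  using iota_eq_0_iff[of "x - y"] by (simp add: iota_diff)

lemma iota_inverse: "\<iota> (inverse x) = inverse (\<iota> x)"
proof (cases "x = 0")
  case False
  hence "\<iota> x * \<iota> (inverse x) = 1" by (simp flip: iota_mult)
  thus ?thesis by (metis inverse_unique)
qed simp

lemma iota_divide: "\<iota> (x / y) = \<iota> x / \<iota> y"
  by (simp add: divide_inverse iota_mult iota_inverse)

lemma fls_abs_mult: "fls_abs (x * y :: 'a fls) = fls_abs x * fls_abs y"
  unfolding vabs_iota[symmetric] iota_mult by (rule vabs_mult)

lemma fls_abs_diff_leI: "fls_abs x \<le> B \<Longrightarrow> fls_abs y \<le> B \<Longrightarrow> fls_abs (x - y :: 'a fls) \<le> B"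
  unfolding vabs_iota[symmetric] iota_diff by (rule vabs_diff_leI)

text \<open>
  The completion of an algebraically closed field is algebraically closed. A monic polynomial over
  \<open>\<complex>\<^sub>\<infinity>\<close> is approximated by polynomials that split over the dense
  subfield. Their roots may be chosen to form a Cauchy sequence: a root \<open>x\<close> of one of them
  is almost a root of the next one, so the product of the distances from \<open>x\<close> to the roots
  of the latter is small.
\<close>

lemma split_approximation:
  fixes p :: "'c poly" and e :: real
  assumes p: "Polynomial.lead_coeff p = 1" and e: "e > 0"
  shows "\<exists>rs. length rs = Polynomial.degree p \<and>
    (\<forall>i. vabs (Polynomial.coeff (\<Prod>r\<leftarrow>rs. [:-r, 1:]) i - Polynomial.coeff p i) < e)"
proof -
  define n where "n = Polynomial.degree p"
  obtain j :: "'a fls alg_closure \<Rightarrow> 'c" where j1: "j 1 = 1"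
    and jadd: "\<And>x y. j (x + y) = j x + j y" and jmult: "\<And>x y. j (x * y) = j x * j y"
    and dense: "closure (range j) = UNIV"
    using C_infinity unfolding is_C_infinity_def by auto
  have "j 0 + j 0 = j 0 + 0" using jadd[of 0 0] by (simp only: add_0_right)
  hence j0: "j 0 = 0" by (simp only: add_left_cancel)
  have jminus: "j (- x) = - j x" for x
    using jadd[of x "- x"] j0 by (simp add: add_eq_0_iff)
  have jdiff: "j (x - y) = j x - j y" for x y
    using jadd[of x "- y"] jminus by simp
  have "\<exists>y. vabs (j y - c) < e" for c
  proof -
    have "c \<in> closure (range j)" using dense by simp
    thus ?thesis using e unfolding closure_approachable by (auto simp: dist_conv_vabs)
  qed
  then obtain g where g: "\<And>c. vabs (j (g c) - c) < e" by metis
  define h :: "'a fls alg_closure poly" where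
    "h = Polynomial.monom 1 n + (\<Sum>i<n. Polynomial.monom (g (Polynomial.coeff p i)) i)"
  have h_coeff: "Polynomial.coeff h i =
      (if i < n then g (Polynomial.coeff p i) else if i = n then 1 else 0)" for i
    unfolding h_def by (auto simp: coeff_sum sum.delta)
  have hdeg: "Polynomial.degree h = n"
    by (rule antisym) (auto intro!: degree_le le_degree simp: h_coeff)
  have "h \<noteq> 0" using h_coeff[of n] by auto
  obtain A where A: "size A = n" "h = (\<Prod>x\<in>#A. [:-x, 1:])"
    using alg_closed_imp_factorization[of h] hdeg h_coeff[of n]
      \<open>h \<noteq> 0\<close> by (auto simp: hdeg)
  obtain xs where xs: "mset xs = A" using ex_mset by blast
  have h_xs: "h = (\<Prod>x\<leftarrow>xs. [:-x, 1:])"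
    by (simp add: A(2) flip: xs prod_mset_prod_list)
  have coeff_j: "Polynomial.coeff (\<Prod>r\<leftarrow>map j ys. [:-r, 1:]) i =
      j (Polynomial.coeff (\<Prod>x\<leftarrow>ys. [:-x, 1:]) i)" for ys i
    by (induction ys arbitrary: i)
       (auto simp: coeff_pCons j0 j1 jadd jmult jminus jdiff split: nat.splits)
  have "vabs (Polynomial.coeff (\<Prod>r\<leftarrow>map j xs. [:-r, 1:]) i - Polynomial.coeff p i) < e" for i
  proof -
    have "vabs (j (Polynomial.coeff h i) - Polynomial.coeff p i) < e"
      using g[of "Polynomial.coeff p i"] e p coeff_eq_0[of p i]
      by (auto simp: h_coeff n_def j1 j0)
    thus ?thesis by (simp only: coeff_j h_xs)
  qed
  moreover have "length (map j xs) = Polynomial.degree p"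
    using A(1) xs by (auto simp: n_def)
  ultimately show ?thesis by blast
qed

end

lemma poly_prod_linear: "poly (\<Prod>r\<leftarrow>rs. [:-r, 1:]) x = (\<Prod>r\<leftarrow>rs. x - (r :: 'b::comm_ring_1))"
  by (induction rs) (auto simp: algebra_simps)

lemma tendsto_poly_ultrametric:
  assumes "(f \<longlongrightarrow> (l :: 'c::complete_ultrametric_field)) F"
  shows "((\<lambda>x. poly p (f x)) \<longlongrightarrow> poly p l) F"
  by (induction p) (auto intro!: tendsto_add tendsto_mult assms)

lemma vabs_poly_le:
  fixes p :: "'c::complete_ultrametric_field poly"
  assumes "\<And>i. i \<le> n \<Longrightarrow> vabs (Polynomial.coeff p i) \<le> e" "Polynomial.degree p \<le> n"
    "vabs x \<le> B" "1 \<le> B" "0 \<le> e"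
  shows "vabs (poly p x) \<le> e * B ^ n"
proof -
  have "poly p x = (\<Sum>i\<le>n. Polynomial.coeff p i * x ^ i)"
    unfolding poly_altdef using assms(2)
    by (intro sum.mono_neutral_left) (auto simp: coeff_eq_0)
  also have "vabs \<dots> \<le> e * B ^ n"
  proof (rule vabs_sum_le)
    fix i assume i: "i \<in> {..n}"
    have "vabs x ^ i \<le> B ^ i" using assms by (intro power_mono) auto
    also have "\<dots> \<le> B ^ n" using i assms by (intro power_increasing) auto
    finally show "vabs (Polynomial.coeff p i * x ^ i) \<le> e * B ^ n"
      using assms(1)[of i] i unfolding vabs_mult vabs_power
      by (intro mult_mono) (use assms(5) in auto)
  qed (use assms in auto)
  finally show ?thesis .
qed

lemma prod_list_ge_power:
  fixes e :: real
  assumes "\<And>x. x \<in> set xs \<Longrightarrow> e \<le> f x" "0 \<le> e"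
  shows "e ^ length xs \<le> prod_list (map f xs)"
  using assms
proof (induction xs)
  case (Cons a xs)
  have "e ^ length xs \<le> prod_list (map f xs)" using Cons by auto
  moreover have "e \<le> f a" using Cons.prems by auto
  ultimately show ?case using Cons.prems(2) by (auto intro!: mult_mono)
qed auto

lemma prod_list_gt_power:
  fixes e :: real
  assumes "\<And>x. x \<in> set xs \<Longrightarrow> e < f x" "0 \<le> e" "xs \<noteq> []"
  shows "e ^ length xs < prod_list (map f xs)"
  using assms(3,1)
proof (induction xs rule: list_nonempty_induct)
  case (cons a xs)
  have "e ^ length xs < prod_list (map f xs)" using cons by auto
  moreover have "e < f a" using cons by auto
  ultimately show ?case using assms(2) by (auto intro!: mult_strict_mono')
qed auto

text \<open>
  If a product of differences is small then one of its factors is. This is how a root of one polynomial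
  leads to a nearby root of another whose coefficients are close.
\<close>

lemma close_root:
  fixes x :: "'c::complete_ultrametric_field"
  assumes "rs \<noteq> []" "vabs (\<Prod>r\<leftarrow>rs. x - r) \<le> d ^ length rs" "0 \<le> d"
  shows "\<exists>r\<in>set rs. vabs (x - r) \<le> d"
proof (rule ccontr)
  assume "\<not> ?thesis"
  hence "d ^ length rs < prod_list (map (\<lambda>r. vabs (x - r)) rs)"
    using assms by (intro prod_list_gt_power) auto
  thus False using assms(2) by (simp add: vabs_prod_list o_def)
qed

lemma vabs_root_le:
  fixes p :: "'c::complete_ultrametric_field poly"
  assumes lc: "Polynomial.lead_coeff p = 1" and x: "poly p x = 0" and B: "1 \<le> B"
    and coeff: "\<And>i. vabs (Polynomial.coeff p i) \<le> B"
  shows "vabs x \<le> B"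
proof (rule ccontr)
  assume "\<not> vabs x \<le> B"
  hence gt: "B < vabs x" by simp
  define n where "n = Polynomial.degree p"
  have "n > 0"
  proof (rule ccontr)
    assume "\<not> n > 0"
    hence "Polynomial.degree p = 0" by (simp add: n_def)
    then obtain c where "p = [:c:]" by (rule degree_eq_zeroE)
    thus False using x lc by (cases "c = 0") auto
  qed
  have "(\<Sum>i<n. Polynomial.coeff p i * x ^ i) + x ^ n = (\<Sum>i<Suc n. Polynomial.coeff p i * x ^ i)"
    using lc by (simp add: n_def)
  also have "\<dots> = poly p x"
    unfolding poly_altdef n_def lessThan_Suc_atMost ..
  finally have "x ^ n = - (\<Sum>i<n. Polynomial.coeff p i * x ^ i)"
    using x by (simp add: add_eq_0_iff)
  hence "vabs (x ^ n) = vabs (\<Sum>i<n. Polynomial.coeff p i * x ^ i)"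
    by simp
  also have "\<dots> \<le> B * vabs x ^ (n - 1)"
  proof (rule vabs_sum_le)
    fix i assume "i \<in> {..<n}"
    hence "vabs x ^ i \<le> vabs x ^ (n - 1)"
      using gt B by (intro power_increasing) auto
    thus "vabs (Polynomial.coeff p i * x ^ i) \<le> B * vabs x ^ (n - 1)"
      unfolding vabs_mult vabs_power using coeff[of i] B by (intro mult_mono) auto
  qed (use B in simp)
  also have "\<dots> < vabs x * vabs x ^ (n - 1)"
    using gt B by (intro mult_strict_right_mono zero_less_power) linarith+
  also have "\<dots> = vabs (x ^ n)"
    using power_minus_mult[OF \<open>n > 0\<close>, of "vabs x"] by (simp add: vabs_power mult.commute)
  finally show False by simp
qed

context drinfeld_setting
begin

lemma C_infinity_root_monic:
  fixes p :: "'c poly"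
  assumes lc: "Polynomial.lead_coeff p = 1" and n0: "Polynomial.degree p > 0"
  shows "\<exists>x. poly p x = 0"
proof -
  define n where "n = Polynomial.degree p"
  define B where "B = Max (insert 1 ((\<lambda>i. vabs (Polynomial.coeff p i)) ` {..n}))"
  have B1: "1 \<le> B" unfolding B_def by (intro Max_ge) auto
  have Bc: "vabs (Polynomial.coeff p i) \<le> B" for i
  proof (cases "i \<le> n")
    case True
    thus ?thesis unfolding B_def by (intro Max_ge) auto
  next
    case False
    thus ?thesis using B1 by (simp add: n_def coeff_eq_0)
  qed
  \<comment> \<open>an \<open>n\<close>-th power, since an error \<open>d\<^sup>n\<close> of the values only gives a root within distance \<open>d\<close>\<close>
  define e :: "nat \<Rightarrow> real" where "e k = (1 / 2 ^ k) ^ n" for k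
  have e0: "e k > 0" for k by (simp add: e_def)
  have e1: "e k \<le> 1" for k unfolding e_def by (intro power_le_one) auto
  have "\<exists>rs. length rs = n \<and>
    (\<forall>i. vabs (Polynomial.coeff (\<Prod>r\<leftarrow>rs. [:-r, 1:]) i - Polynomial.coeff p i) < e k)" for k
    using split_approximation[OF lc e0[of k]] by (simp add: n_def)
  then obtain R where R: "\<And>k. length (R k) = n"
    "\<And>k i. vabs (Polynomial.coeff (\<Prod>r\<leftarrow>R k. [:-r, 1:]) i - Polynomial.coeff p i) < e k"
    by metis
  define G where "G k = (\<Prod>r\<leftarrow>R k. [:-r, 1:])" for k
  have degG: "Polynomial.degree (\<Prod>r\<leftarrow>rs. [:-r, 1::'c:]) = length rs \<and>
      Polynomial.lead_coeff (\<Prod>r\<leftarrow>rs. [:-r, 1::'c:]) = 1" for rs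
  proof (induction rs)
    case (Cons a rs)
    hence "(\<Prod>r\<leftarrow>rs. [:-r, 1::'c:]) \<noteq> 0" by auto
    hence "Polynomial.degree ([:-a, 1:] * (\<Prod>r\<leftarrow>rs. [:-r, 1::'c:])) = Suc (length rs)"
      using Cons by (subst degree_mult_eq) auto
    moreover have "Polynomial.lead_coeff ([:-a, 1:] * (\<Prod>r\<leftarrow>rs. [:-r, 1::'c:])) = 1"
      using Cons lead_coeff_mult[of "[:-a, 1:]" "\<Prod>r\<leftarrow>rs. [:-r, 1::'c:]"]
      by (metis lead_coeff_pCons(1) lead_coeff_pCons(2) mult_1 one_neq_zero pCons_eq_0_iff)
    ultimately show ?case by (simp del: mult_pCons_left)
  qed simp
  have G_deg: "Polynomial.degree (G k) = n" "Polynomial.lead_coeff (G k) = 1" for k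
    using degG[of "R k"] R(1) by (auto simp: G_def)
  have root_bound: "vabs x \<le> B" if "x \<in> set (R k)" for x k
  proof (rule vabs_root_le[OF G_deg(2) _ B1])
    show "poly (G k) x = 0"
      using that unfolding G_def poly_prod_linear by (auto simp: prod_list_zero_iff)
    fix i
    show "vabs (Polynomial.coeff (G k) i) \<le> B"
      using R(2)[of k i] Bc[of i] e1[of k] B1
        vabs_add_le[of "Polynomial.coeff (G k) i - Polynomial.coeff p i" "Polynomial.coeff p i"]
      by (auto simp: G_def)
  qed
  have close: "vabs (poly (G k) x - poly p x) \<le> e k * B ^ n" if "vabs x \<le> B" for x k
  proof -
    have "vabs (poly (G k - p) x) \<le> e k * B ^ n"
    proof (rule vabs_poly_le)
      show "Polynomial.degree (G k - p) \<le> n"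
        by (intro degree_diff_le) (simp_all add: G_deg n_def)
    qed (use that R(2)[of k] e0[of k] B1 in \<open>auto simp: G_def less_imp_le\<close>)
    thus ?thesis by simp
  qed
  have step: "\<exists>y. y \<in> set (R (Suc k)) \<and> vabs (x - y) \<le> B / 2 ^ k" if "x \<in> set (R k)" for x k
  proof -
    have xB: "vabs x \<le> B" using root_bound[OF that] .
    have x0: "poly (G k) x = 0"
      using that unfolding G_def poly_prod_linear by (auto simp: prod_list_zero_iff)
    have "e (Suc k) \<le> e k"
      unfolding e_def by (intro power_mono) (auto simp: field_simps)
    hence "e (Suc k) * B ^ n \<le> e k * B ^ n"
      using B1 by (intro mult_right_mono) auto
    hence "vabs (poly (G (Suc k)) x - poly p x) \<le> e k * B ^ n"
      using close[OF xB, of "Suc k"] by linarith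
    moreover have "vabs (poly (G k) x - poly p x) \<le> e k * B ^ n"
      using close[OF xB] .
    ultimately have "vabs (poly (G (Suc k)) x) \<le> e k * B ^ n"
      using vabs_diff_le[of "poly (G (Suc k)) x - poly p x" "poly (G k) x - poly p x"] x0 by simp
    also have "\<dots> = (B / 2 ^ k) ^ length (R (Suc k))"
      by (simp add: e_def R(1) power_divide)
    finally have "\<exists>r\<in>set (R (Suc k)). vabs (x - r) \<le> B / 2 ^ k"
      using R(1)[of "Suc k"] n0 B1 unfolding G_def poly_prod_linear
      by (intro close_root) (auto simp: n_def)
    thus ?thesis by blast
  qed
  have "R 0 \<noteq> []" using R(1)[of 0] n0 by (auto simp: n_def)
  hence "\<exists>x. x \<in> set (R 0)" by (auto simp: neq_Nil_conv)
  then obtain x where x': "\<forall>k. x k \<in> set (R k) \<and> vabs (x k - x (Suc k)) \<le> B / 2 ^ k"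
    using dependent_nat_choice[of "\<lambda>k x. x \<in> set (R k)" "\<lambda>k x y. vabs (x - y) \<le> B / 2 ^ k"] step
    by blast
  have x: "x k \<in> set (R k)" "vabs (x k - x (Suc k)) \<le> B / 2 ^ k" for k
    using x' by auto
  have "Cauchy x"
  proof (rule ultrametric_Cauchy, rule tendsto_vabs_squeeze)
    show "(\<lambda>k. B * (1 / 2) ^ k) \<longlonglongrightarrow> 0"
      by (intro tendsto_mult_right_zero LIMSEQ_realpow_zero) auto
    show "vabs (x (Suc k) - x k - 0) \<le> B * (1 / 2) ^ k" for k
      using x(2)[of k] by (simp add: vabs_minus_commute power_divide)
  qed
  then obtain l where l: "x \<longlonglongrightarrow> l" by (auto simp: Cauchy_convergent_iff convergent_def)
  have "(\<lambda>k. poly p (x k)) \<longlonglongrightarrow> poly p l"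
    by (rule tendsto_poly_ultrametric[OF l])
  moreover have "(\<lambda>k. poly p (x k)) \<longlonglongrightarrow> 0"
  proof (rule tendsto_vabs_squeeze)
    have "(\<lambda>k. (1 / 2 ^ n) ^ k :: real) \<longlonglongrightarrow> 0"
      using n0 by (intro LIMSEQ_realpow_zero) (auto simp: n_def)
    hence "(\<lambda>k. e k) \<longlonglongrightarrow> 0"
      by (simp add: e_def power_divide flip: power_mult) (simp add: mult.commute)
    thus "(\<lambda>k. e k * B ^ n) \<longlonglongrightarrow> 0" by (intro tendsto_mult_left_zero)
    fix k
    have "poly (G k) (x k) = 0"
      using x(1) unfolding G_def poly_prod_linear by (auto simp: prod_list_zero_iff)
    thus "vabs (poly p (x k) - 0) \<le> e k * B ^ n"
      using close[OF root_bound[OF x(1)], of k k] by simp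
  qed
  ultimately show ?thesis using LIMSEQ_unique by blast
qed

lemma C_infinity_root:
  fixes p :: "'c poly"
  assumes "Polynomial.degree p > 0"
  shows "\<exists>x. poly p x = 0"
proof -
  have "p \<noteq> 0" using assms by auto
  thus ?thesis
    using C_infinity_root_monic[of "Polynomial.smult (inverse (Polynomial.lead_coeff p)) p"] assms by auto
qed

lemma C_infinity_splits:
  fixes p :: "'c poly"
  shows "\<exists>rs. p = Polynomial.smult (Polynomial.lead_coeff p) (\<Prod>r\<leftarrow>rs. [:-r, 1:])"
proof (induction "Polynomial.degree p" arbitrary: p rule: less_induct)
  case less
  show ?case
  proof (cases "Polynomial.degree p = 0")
    case True
    then obtain c where "p = [:c:]" by (metis degree_eq_zeroE)
    thus ?thesis by (intro exI[of _ "[]"]) auto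
  next
    case False
    then obtain x where "poly p x = 0" using C_infinity_root[of p] by auto
    then obtain g where g: "p = [:-x, 1:] * g" using poly_eq_0_iff_dvd by (metis dvdE)
    have "g \<noteq> 0" using False g by auto
    hence "Polynomial.degree g < Polynomial.degree p"
      unfolding g by (subst degree_mult_eq) auto
    then obtain rs where rs: "g = Polynomial.smult (Polynomial.lead_coeff g) (\<Prod>r\<leftarrow>rs. [:-r, 1:])"
      using less by blast
    have lc: "Polynomial.lead_coeff p = Polynomial.lead_coeff g"
      unfolding g by (subst lead_coeff_mult) simp
    have "p = [:-x, 1:] * Polynomial.smult (Polynomial.lead_coeff g) (\<Prod>r\<leftarrow>rs. [:-r, 1:])"
      using g rs by metis
    also have "\<dots> = Polynomial.smult (Polynomial.lead_coeff p) (\<Prod>r\<leftarrow>x # rs. [:-r, 1:])"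
      by (simp only: lc mult_smult_right list.map prod_list.Cons)
    finally show ?thesis by blast
  qed
qed

text \<open>
  The points of a circle that are at the largest possible distance of finitely many given points. They
  exist since the residue field is infinite. One of them is obtained as a root of \<open>\<Prod>(X - s)
  - y\<^sub>0\<^sup>n\<close>, where \<open>s\<close> ranges over \<open>n\<close> points of the disc of
  radius \<open>|y\<^sub>0|\<close>, including \<open>0\<close>: no factor can exceed
  \<open>|y\<^sub>0|\<close>, so all are equal to it.
\<close>

lemma generic_point:
  fixes S :: "'c set"
  assumes S: "finite S" and y0: "y0 \<noteq> (0 :: 'c)"
  shows "\<exists>y. vabs y = vabs y0 \<and> (\<forall>s\<in>S. vabs (y - s) = max (vabs y0) (vabs s))"
proof -
  define S' where "S' = insert 0 {s\<in>S. vabs s \<le> vabs y0}"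
  have fin: "finite S'" using S by (simp add: S'_def)
  define n where "n = card S'"
  have n: "n > 0" using fin by (auto simp: n_def S'_def card_gt_0_iff)
  define p where "p = (\<Prod>s\<in>S'. [:-s, 1:]) - [:y0 ^ n:]"
  have "Polynomial.degree (\<Prod>s\<in>S'. [:-s, 1:]) = n"
    by (subst degree_prod_eq_sum_degree) (auto simp: n_def)
  hence "Polynomial.degree p = n"
    unfolding p_def using n by (simp add: degree_add_eq_left flip: add_uminus_conv_diff)
  then obtain y where y: "poly p y = 0" using C_infinity_root[of p] n by auto
  hence "(\<Prod>s\<in>S'. y - s) = y0 ^ n" by (simp add: p_def poly_prod)
  hence prod_eq: "(\<Prod>s\<in>S'. vabs (y - s)) = vabs y0 ^ n"
    by (metis vabs_prod vabs_power)
  have S'_le: "vabs s \<le> vabs y0" if "s \<in> S'" for s using that by (auto simp: S'_def)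
  have y_le: "vabs y \<le> vabs y0"
  proof (rule ccontr)
    assume "\<not> vabs y \<le> vabs y0"
    hence gt: "vabs y0 < vabs y" by simp
    hence "vabs (y - s) = vabs y" if "s \<in> S'" for s
      using vabs_diff_eq2[of s y] S'_le[OF that] by simp
    hence "(\<Prod>s\<in>S'. vabs (y - s)) = vabs y ^ n" by (simp add: n_def)
    moreover have "vabs y0 ^ n < vabs y ^ n" using gt n by (intro power_strict_mono) auto
    ultimately show False using prod_eq by simp
  qed
  have le: "vabs (y - s) \<le> vabs y0" if "s \<in> S'" for s
    using vabs_diff_leI y_le S'_le[OF that] by blast
  have eq: "vabs (y - s) = vabs y0" if s: "s \<in> S'" for s
  proof (rule ccontr)
    assume "vabs (y - s) \<noteq> vabs y0"
    hence lt: "vabs (y - s) < vabs y0" using le[OF s] by simp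
    have "(\<Prod>s\<in>S'. vabs (y - s)) = vabs (y - s) * (\<Prod>s\<in>S' - {s}. vabs (y - s))"
      using fin s by (simp add: prod.remove)
    also have "\<dots> \<le> vabs (y - s) * (\<Prod>s\<in>S' - {s}. vabs y0)"
      using le by (intro mult_left_mono prod_mono) auto
    also have "\<dots> = vabs (y - s) * vabs y0 ^ (n - 1)"
      using fin s by (simp add: n_def)
    also have "\<dots> < vabs y0 * vabs y0 ^ (n - 1)"
      using lt y0 by (intro mult_strict_right_mono) auto
    also have "\<dots> = vabs y0 ^ n" using power_minus_mult[OF n, of "vabs y0"] by (simp add: mult.commute)
    finally show False using prod_eq by simp
  qed
  have y_eq: "vabs y = vabs y0" using eq[of 0] by (simp add: S'_def)
  show ?thesis
  proof (intro exI[of _ y] conjI ballI y_eq)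
    fix s assume "s \<in> S"
    show "vabs (y - s) = max (vabs y0) (vabs s)"
    proof (cases "vabs s \<le> vabs y0")
      case True
      thus ?thesis using eq[of s] \<open>s \<in> S\<close> by (simp add: S'_def)
    next
      case False
      thus ?thesis using y_eq vabs_diff_eq[of y s] by simp
    qed
  qed
qed

text \<open>The absolute value of a square root of \<open>t\<close> is \<open>\<surd>q\<close>.\<close>

lemma ex_vabs_half_power: "\<exists>w :: 'c. vabs w = sqrt q * q ^ M"
proof -
  define x where "x = \<iota> (fls_X_inv :: 'a fls)"
  have vx: "vabs x = q"
    unfolding x_def by (simp add: vabs_iota fls_abs_q)
  have "Polynomial.degree [:- x, 0, 1:] > 0" by simp
  then obtain w where "poly [:- x, 0, 1:] w = 0" using C_infinity_root by blast
  hence "w * w = x" by (simp add: algebra_simps)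
  hence "vabs w * vabs w = q" using vx by (metis vabs_mult)
  hence "vabs w = sqrt q" by (metis abs_of_nonneg real_sqrt_mult_self real_sqrt_abs2 vabs_nonneg)
  thus ?thesis using vx by (intro exI[of _ "w * x ^ M"]) (simp add: vabs_mult vabs_power)
qed


section \<open>The imaginary part\<close>

lemma im_abs_le: "im_abs \<iota> z \<le> vabs (z - \<iota> x)"
  unfolding im_abs_def using infdist_le[of "\<iota> x" "range \<iota>" z] by (simp add: dist_conv_vabs)

lemma im_abs_nonneg [simp]: "0 \<le> im_abs \<iota> z"
  by (simp add: im_abs_def infdist_nonneg)

lemma im_abs_geI: "(\<And>x. B \<le> vabs (z - \<iota> x)) \<Longrightarrow> B \<le> im_abs \<iota> z"
  unfolding im_abs_def infdist_def by (auto intro!: cINF_greatest simp: dist_conv_vabs)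

lemma im_abs_lessE:
  assumes "im_abs \<iota> z < B"
  obtains x where "vabs (z - \<iota> x) < B"
  using im_abs_geI[of B z] assms by (meson not_less)

lemma im_abs_le_vabs: "im_abs \<iota> z \<le> vabs z"
  using im_abs_le[of z 0] by simp

lemma im_abs_add_iota [simp]: "im_abs \<iota> (z + \<iota> b) = im_abs \<iota> z"
proof -
  have *: "im_abs \<iota> z \<le> im_abs \<iota> (z + \<iota> b)" for z b
  proof (rule im_abs_geI)
    fix x
    show "im_abs \<iota> z \<le> vabs (z + \<iota> b - \<iota> x)"
      using im_abs_le[of z "x - b"] by (simp add: iota_diff algebra_simps)
  qed
  show ?thesis using *[of z b] *[of "z + \<iota> b" "- b"] by (simp add: iota_minus)
qed

lemma im_abs_diff_iota [simp]: "im_abs \<iota> (z - \<iota> b) = im_abs \<iota> z"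
  using im_abs_add_iota[of z "- b"] by (simp add: iota_minus)

lemma im_abs_iota_mult: "im_abs \<iota> (\<iota> a * z) = fls_abs a * im_abs \<iota> z"
proof (cases "a = 0")
  case True
  thus ?thesis using im_abs_le_vabs[of 0] im_abs_nonneg[of 0]
    by (simp add: fls_abs_def del: im_abs_nonneg)
next
  case False
  have *: "im_abs \<iota> (\<iota> a * z) \<ge> fls_abs a * im_abs \<iota> z" if "a \<noteq> 0" for a z
  proof (rule im_abs_geI)
    fix x
    have "\<iota> a * z - \<iota> x = \<iota> a * (z - \<iota> (x / a))"
      using that by (simp add: iota_divide algebra_simps)
    thus "fls_abs a * im_abs \<iota> z \<le> vabs (\<iota> a * z - \<iota> x)"
      using im_abs_le[of z "x / a"] that
      by (simp add: vabs_mult vabs_iota mult_left_mono less_imp_le)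
  qed
  have "fls_abs (inverse a) * im_abs \<iota> (\<iota> a * z) \<le> im_abs \<iota> z"
    using *[of "inverse a" "\<iota> a * z"] False by (simp add: iota_inverse flip: mult.assoc)
  moreover have "fls_abs (inverse a) = inverse (fls_abs a)"
    unfolding vabs_iota[symmetric] iota_inverse by (rule vabs_inverse)
  moreover have "fls_abs a > 0" using False by simp
  ultimately have "im_abs \<iota> (\<iota> a * z) \<le> fls_abs a * im_abs \<iota> z"
    by (simp only: inverse_eq_divide pos_divide_le_eq times_divide_eq_left mult_1_left mult.commute)
  thus ?thesis using *[OF False, of z] by simp
qed

text \<open>
  \<open>K\<^sub>\<infinity>\<close> is complete, hence closed: if \<open>z\<close> is approximated by
  elements of \<open>K\<^sub>\<infinity>\<close>, their coefficients stabilise, and the limit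
  coefficients are those of \<open>z\<close>.
\<close>

lemma im_abs_pos:
  assumes "z \<in> Omega \<iota>"
  shows "im_abs \<iota> z > 0"
proof (rule ccontr)
  assume "\<not> im_abs \<iota> z > 0"
  hence "im_abs \<iota> z < q powi (- int k)" for k
    using zero_less_power_int[OF q_pos, of "- int k"] by linarith
  hence "\<exists>x. vabs (z - \<iota> x) < q powi (- int k)" for k
    by (rule im_abs_lessE) blast
  then obtain x where x: "\<And>k. vabs (z - \<iota> (x k)) < q powi (- int k)" by metis
  have stable: "fls_nth (x k) n = fls_nth (x l) n" if "n < int k" "k \<le> l" for k l n
  proof -
    have "q powi (- int l) \<le> q powi (- int k)"
      using that q_gt_1 by (intro power_int_increasing) auto
    hence "vabs ((z - \<iota> (x l)) - (z - \<iota> (x k))) \<le> q powi (- int k)"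
      using x[of l] x[of k] by (intro vabs_diff_leI[of "z - \<iota> (x l)" _ "z - \<iota> (x k)"]) linarith+
    hence "vabs (\<iota> (x k - x l)) \<le> q powi (- int k)"
      by (simp add: iota_diff)
    hence "fls_abs (x k - x l) \<le> q powi (- int k)"
      by (simp only: vabs_iota)
    thus ?thesis using that(1) by (subst (asm) fls_abs_le_powi_iff') auto
  qed
  define y where "y = Abs_fls (\<lambda>n. fls_nth (x (nat (n + 1))) n)"
  obtain N where N: "\<And>n. n > N \<Longrightarrow> fls_nth (x 0) (- int n) = 0"
    using fls_nth_vanishes_below_natE[of "x 0"] by metis
  have "\<forall>\<^sub>\<infinity>n. fls_nth (x (nat (- int n + 1))) (- int n) = 0"
    unfolding MOST_nat
  proof (intro exI[of _ "Suc N"] allI impI)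
    fix n assume "n > Suc N"
    moreover from this have "nat (- int n + 1) = 0" by simp
    ultimately show "fls_nth (x (nat (- int n + 1))) (- int n) = 0" using N by simp
  qed
  hence y_nth: "fls_nth y n = fls_nth (x (nat (n + 1))) n" for n
    by (simp add: y_def)
  have "vabs (z - \<iota> y) \<le> q powi (- int k)" for k
  proof -
    have "fls_nth (y - x k) n = 0" if "n < int k" for n
    proof (cases "n < 0")
      case True
      thus ?thesis using stable[of n 0 k] by (simp add: y_nth)
    next
      case False
      thus ?thesis using stable[of n "nat (n + 1)" k] that by (simp add: y_nth)
    qed
    hence "fls_abs (y - x k) \<le> q powi (- int k)"
      by (subst fls_abs_le_powi_iff') auto
    hence "vabs (\<iota> y - \<iota> (x k)) \<le> q powi (- int k)"
      by (simp only: vabs_iota iota_diff[symmetric])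
    thus ?thesis using vabs_diff_leI[of "z - \<iota> (x k)" "q powi (- int k)" "\<iota> y - \<iota> (x k)"] x[of k]
      by simp
  qed
  moreover have "(\<lambda>k. q powi (- int k)) \<longlonglongrightarrow> 0"
  proof -
    have "(\<lambda>k. (1 / q) ^ k) \<longlonglongrightarrow> 0"
      using q_gt_1 by (intro LIMSEQ_realpow_zero) auto
    thus ?thesis by (simp only: power_int_minus power_int_of_nat power_one_over inverse_eq_divide)
  qed
  ultimately have "vabs (z - \<iota> y) \<le> 0"
    by (intro tendsto_lowerbound[where F = sequentially]) auto
  hence "vabs (z - \<iota> y) = 0" by (intro antisym) auto
  hence "z = \<iota> y" by simp
  thus False using assms by (simp add: Omega_def)
qed

lemma Omega_iff_im_abs: "z \<in> Omega \<iota> \<longleftrightarrow> im_abs \<iota> z > 0"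
proof
  assume "im_abs \<iota> z > 0"
  hence "z \<noteq> \<iota> x" for x using im_abs_le[of z x] by auto
  thus "z \<in> Omega \<iota>" unfolding Omega_def by auto
qed (rule im_abs_pos)

text \<open>
  Nonzero elements of \<open>K\<^sub>\<infinity>\<close> have integral powers of \<open>q\<close> as
  absolute values. So circles whose radius is a half-integral power avoid
  \<open>K\<^sub>\<infinity>\<close> and serve as boundaries of the domains considered below.
\<close>

lemma im_abs_half_power:
  assumes w: "vabs w = sqrt q * q powi j"
  shows "im_abs \<iota> w = vabs w"
proof (rule antisym[OF im_abs_le_vabs im_abs_geI])
  fix x :: "'a fls"
  have ne: "vabs w \<noteq> fls_abs x"
  proof
    assume eq: "vabs w = fls_abs x"
    have "0 < sqrt q * q powi j" using q_pos by simp
    hence "fls_abs x \<noteq> 0" using eq w by linarith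
    hence "x \<noteq> 0" by (auto simp: fls_abs_q)
    define n where "n = - fls_subdegree x"
    have "sqrt q * q powi j = q powi n" using eq w \<open>x \<noteq> 0\<close> by (simp add: fls_abs_q n_def)
    hence "sqrt q = q powi (n - j)"
      using q_pos by (simp add: power_int_diff field_simps)
    hence "sqrt q * sqrt q = q powi (n - j) * q powi (n - j)" by (simp only:)
    also have "\<dots> = q powi (2 * (n - j))"
      using q_pos unfolding mult_2 by (subst power_int_add) auto
    finally have eq1: "q powi 1 = q powi (2 * (n - j))"
      using q_pos by simp
    have "\<not> 1 < 2 * (n - j)"
      using power_int_strict_increasing[OF _ q_gt_1, of 1 "2 * (n - j)"] eq1 by linarith
    moreover have "\<not> 2 * (n - j) < 1"
      using power_int_strict_increasing[OF _ q_gt_1, of "2 * (n - j)" 1] eq1 by linarith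
    ultimately have "1 = 2 * (n - j)" by linarith
    thus False by presburger
  qed
  show "vabs w \<le> vabs (w - \<iota> x)"
  proof (cases "vabs w < fls_abs x")
    case True
    thus ?thesis using vabs_diff_eq[of w "\<iota> x"] by (simp add: vabs_iota)
  next
    case False
    thus ?thesis using ne vabs_diff_eq2[of "\<iota> x" w] by (simp add: vabs_iota)
  qed
qed

lemma ex_im_abs_ge: "\<exists>z. C \<le> im_abs \<iota> z \<and> z \<noteq> 0"
proof -
  obtain M where M: "C < q ^ M" using real_arch_pow[OF q_gt_1] by blast
  obtain w :: 'c where w: "vabs w = sqrt q * q ^ M" using ex_vabs_half_power by blast
  hence "im_abs \<iota> w = sqrt q * q ^ M" using im_abs_half_power[of w "int M"] by simp
  moreover have "q ^ M \<le> sqrt q * q ^ M" using q_gt_1 q_pos by simp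
  moreover have "w \<noteq> 0" using w q_pos by auto
  ultimately show ?thesis using M by (intro exI[of _ w]) linarith
qed

end

section \<open>Exponential functions of lattices\<close>

definition add_subgroup :: "'b::ab_group_add set \<Rightarrow> bool" where
  "add_subgroup A \<longleftrightarrow> 0 \<in> A \<and> (\<forall>x\<in>A. \<forall>y\<in>A. x - y \<in> A)"

lemma add_subgroup_0: "add_subgroup A \<Longrightarrow> 0 \<in> A"
  and add_subgroup_diff: "add_subgroup A \<Longrightarrow> x \<in> A \<Longrightarrow> y \<in> A \<Longrightarrow> x - y \<in> A"
  by (auto simp: add_subgroup_def)

lemma add_subgroup_minus: "add_subgroup A \<Longrightarrow> x \<in> A \<Longrightarrow> - x \<in> A"
  using add_subgroup_diff[of A 0 x] add_subgroup_0 by auto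

lemma add_subgroup_add: "add_subgroup A \<Longrightarrow> x \<in> A \<Longrightarrow> y \<in> A \<Longrightarrow> x + y \<in> A"
  using add_subgroup_diff[of A x "- y"] add_subgroup_minus by auto

lemma add_subgroup_translate:
  assumes "add_subgroup A" "b \<in> A"
  shows "bij_betw (\<lambda>a. a + b) A A"
  by (rule bij_betwI[where g = "\<lambda>a. a - b"])
     (auto intro: add_subgroup_add[OF assms(1)] add_subgroup_diff[OF assms(1)] assms(2))

lemma add_subgroup_uminus_bij:
  assumes "add_subgroup A"
  shows "bij_betw uminus A A"
  by (rule bij_betwI[where g = uminus]) (auto intro: add_subgroup_minus[OF assms])

definition discrete_lattice :: "'a::{finite,field} fls set \<Rightarrow> bool" where
  "discrete_lattice \<Lambda> \<longleftrightarrow> add_subgroup \<Lambda> \<and> (\<forall>r. finite {\<mu>\<in>\<Lambda>. fls_abs \<mu> \<le> r})"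

definition lattice_ball :: "'a::{finite,field} fls set \<Rightarrow> nat \<Rightarrow> 'a fls set" where
  "lattice_ball \<Lambda> N = {\<mu>\<in>\<Lambda>. fls_abs \<mu> \<le> real N}"

text \<open>
  Representatives of the cosets of \<open>\<Lambda>'\<close> in \<open>\<Lambda>\<close>, with
  \<open>0\<close> representing \<open>\<Lambda>'\<close> itself.
\<close>

definition coset_system :: "'b::ab_group_add set \<Rightarrow> 'b set \<Rightarrow> 'b set \<Rightarrow> bool" where
  "coset_system \<Lambda> \<Lambda>' R \<longleftrightarrow> finite R \<and> R \<subseteq> \<Lambda> \<and> 0 \<in> R \<and> (\<forall>\<mu>\<in>\<Lambda>. \<exists>!b. b \<in> R \<and> \<mu> - b \<in> \<Lambda>')"

lemma ex_coset_system:
  fixes \<kappa> :: "'b::ab_group_add \<Rightarrow> 'd"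
  assumes L: "add_subgroup \<Lambda>" "add_subgroup \<Lambda>'" and fin: "finite (\<kappa> ` \<Lambda>)"
    and \<kappa>: "\<And>x y. x \<in> \<Lambda> \<Longrightarrow> y \<in> \<Lambda> \<Longrightarrow> \<kappa> x = \<kappa> y \<Longrightarrow> x - y \<in> \<Lambda>'"
  shows "\<exists>R. coset_system \<Lambda> \<Lambda>' R"
proof -
  define r where "r x = (if x \<in> \<Lambda>' then 0 else (SOME y. y \<in> \<Lambda> \<and> x - y \<in> \<Lambda>'))" for x
  have r: "r x \<in> \<Lambda> \<and> x - r x \<in> \<Lambda>'" if "x \<in> \<Lambda>" for x
  proof (cases "x \<in> \<Lambda>'")
    case False
    have "x \<in> \<Lambda> \<and> x - x \<in> \<Lambda>'" using that add_subgroup_0[OF L(2)] by simp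
    hence "(SOME y. y \<in> \<Lambda> \<and> x - y \<in> \<Lambda>') \<in> \<Lambda> \<and> x - (SOME y. y \<in> \<Lambda> \<and> x - y \<in> \<Lambda>') \<in> \<Lambda>'"
      by (rule someI)
    thus ?thesis using False by (simp add: r_def)
  qed (use L in \<open>auto simp: r_def add_subgroup_0\<close>)
  have r_eq: "r x = r y" if "x - y \<in> \<Lambda>'" for x y
  proof -
    have "x - z \<in> \<Lambda>' \<longleftrightarrow> y - z \<in> \<Lambda>'" for z
    proof
      assume "x - z \<in> \<Lambda>'"
      thus "y - z \<in> \<Lambda>'" using add_subgroup_diff[OF L(2), of "x - z" "x - y"] that by simp
    next
      assume "y - z \<in> \<Lambda>'"
      thus "x - z \<in> \<Lambda>'" using add_subgroup_add[OF L(2), of "y - z" "x - y"] that by simp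
    qed
    from this this[of 0] show ?thesis by (simp add: r_def)
  qed
  have "inj_on (\<lambda>b. \<kappa> b) (r ` \<Lambda>)"
  proof (rule inj_onI)
    fix b c assume "b \<in> r ` \<Lambda>" "c \<in> r ` \<Lambda>" and eq: "\<kappa> b = \<kappa> c"
    then obtain x y where xy: "x \<in> \<Lambda>" "b = r x" "y \<in> \<Lambda>" "c = r y" by blast
    have "b - c \<in> \<Lambda>'" using \<kappa> eq r xy by auto
    moreover have "x - b \<in> \<Lambda>'" "y - c \<in> \<Lambda>'" using r xy by auto
    ultimately have "(x - b) - (y - c) \<in> \<Lambda>'" "b - c \<in> \<Lambda>'"
      by (auto intro: add_subgroup_diff[OF L(2), of "x - b" "y - c"])
    hence "(x - b) - (y - c) + (b - c) \<in> \<Lambda>'" by (rule add_subgroup_add[OF L(2)])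
    hence "x - y \<in> \<Lambda>'" by (simp add: algebra_simps)
    thus "b = c" using r_eq xy by simp
  qed
  moreover have "finite (\<kappa> ` r ` \<Lambda>)"
    using r by (intro finite_subset[OF _ fin]) auto
  ultimately have "finite (r ` \<Lambda>)" by (metis finite_imageD)
  moreover have "r ` \<Lambda> \<subseteq> \<Lambda>" using r by auto
  moreover have "0 \<in> r ` \<Lambda>"
    using add_subgroup_0[OF L(1)] add_subgroup_0[OF L(2)] by (intro image_eqI[of _ _ 0]) (auto simp: r_def)
  moreover have "\<exists>!b. b \<in> r ` \<Lambda> \<and> \<mu> - b \<in> \<Lambda>'" if \<mu>: "\<mu> \<in> \<Lambda>" for \<mu>
  proof (rule ex1I[of _ "r \<mu>"])
    show "r \<mu> \<in> r ` \<Lambda> \<and> \<mu> - r \<mu> \<in> \<Lambda>'" using r \<mu> by auto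
    fix b assume b: "b \<in> r ` \<Lambda> \<and> \<mu> - b \<in> \<Lambda>'"
    then obtain x where x: "x \<in> \<Lambda>" "b = r x" by blast
    have "(\<mu> - b) - (x - b) \<in> \<Lambda>'"
      using b r x by (intro add_subgroup_diff[OF L(2), of "\<mu> - b" "x - b"]) auto
    hence "\<mu> - x \<in> \<Lambda>'" by simp
    thus "b = r \<mu>" using r_eq x by simp
  qed
  ultimately show ?thesis unfolding coset_system_def
    by (intro exI[of _ "r ` \<Lambda>"] conjI ballI)
qed

lemma coset_system_diff:
  assumes "coset_system \<Lambda> \<Lambda>' R" "add_subgroup \<Lambda>'" "b \<in> R" "c \<in> R" "b - c \<in> \<Lambda>'"
  shows "b = c"
proof -
  have "b \<in> \<Lambda>" using assms by (auto simp: coset_system_def)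
  moreover have "b - b \<in> \<Lambda>'" using assms(2) by (simp add: add_subgroup_0)
  ultimately show ?thesis using assms unfolding coset_system_def by blast
qed

lemma tendsto_prod_ultrametric:
  fixes f :: "'b \<Rightarrow> 'd \<Rightarrow> 'c::complete_ultrametric_field"
  assumes "\<And>i. i \<in> I \<Longrightarrow> ((\<lambda>x. f i x) \<longlongrightarrow> l i) F"
  shows "((\<lambda>x. \<Prod>i\<in>I. f i x) \<longlongrightarrow> (\<Prod>i\<in>I. l i)) F"
  using assms
  by (induction I rule: infinite_finite_induct) (auto intro!: tendsto_mult)

context drinfeld_setting
begin

definition fin_exp :: "'a fls set \<Rightarrow> 'c \<Rightarrow> 'c" where
  "fin_exp A z = z * (\<Prod>a\<in>A - {0}. 1 - z / \<iota> a)"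

lemma prod_diff_conv_fin_exp:
  assumes "finite A" "0 \<in> A"
  shows "(\<Prod>a\<in>A. z - \<iota> a) = (\<Prod>a\<in>A - {0}. - \<iota> a) * fin_exp A z"
proof -
  have "(\<Prod>a\<in>A. z - \<iota> a) = z * (\<Prod>a\<in>A - {0}. z - \<iota> a)"
    using assms by (simp add: prod.remove)
  also have "(\<Prod>a\<in>A - {0}. z - \<iota> a) = (\<Prod>a\<in>A - {0}. - \<iota> a * (1 - z / \<iota> a))"
    by (intro prod.cong) (auto simp: field_simps)
  also have "\<dots> = (\<Prod>a\<in>A - {0}. - \<iota> a) * (\<Prod>a\<in>A - {0}. 1 - z / \<iota> a)"
    by (rule prod.distrib)
  finally show ?thesis by (simp add: fin_exp_def)
qed

lemma prod_minus_iota_nonzero: "finite A \<Longrightarrow> (\<Prod>a\<in>A - {0}. - \<iota> a) \<noteq> 0"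
  by (auto simp: prod_zero_iff)

text \<open>
  The polynomial \<open>F = \<Prod>(X - a)\<close> over a finite additive group is additive: for fixed
  \<open>w\<close> both \<open>F(X + w)\<close> and \<open>F(X) + F(w)\<close> are monic of degree
  \<open>|A|\<close> and agree on \<open>A\<close>.
\<close>

lemma fin_exp_add:
  assumes A: "add_subgroup A" "finite A"
  shows "fin_exp A (z + w) = fin_exp A z + fin_exp A w"
proof -
  define p where "p = (\<Prod>a\<in>A. [:- \<iota> a, 1:])"
  define n where "n = card A"
  have n: "n > 0" using A add_subgroup_0 by (auto simp: n_def card_gt_0_iff)
  have p_eval: "poly p x = (\<Prod>a\<in>A. x - \<iota> a)" for x
    by (simp add: p_def poly_prod)
  have deg: "Polynomial.degree p = n"
    unfolding p_def by (subst degree_prod_eq_sum_degree) (auto simp: n_def)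
  have lc: "Polynomial.lead_coeff p = 1"
    unfolding p_def by (simp add: lead_coeff_prod)
  have periodic: "poly p (\<iota> b + w) = poly p w" if "b \<in> A" for b
  proof -
    have "poly p (\<iota> b + w) = (\<Prod>a\<in>A. \<iota> b + w - \<iota> (a + b))"
      unfolding p_eval by (rule prod.reindex_bij_betw[symmetric, OF add_subgroup_translate[OF A(1) that]])
    thus ?thesis by (simp add: p_eval iota_add algebra_simps)
  qed
  have zero: "poly p (\<iota> b) = 0" if "b \<in> A" for b
    using that A by (auto simp: p_eval)
  have "p \<circ>\<^sub>p [:w, 1:] = p + [:poly p w:]"
  proof (rule poly_eqI_degree_lead_coeff)
    show "Polynomial.coeff (p \<circ>\<^sub>p [:w, 1:]) n = Polynomial.coeff (p + [:poly p w:]) n"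
    proof -
      have "Polynomial.degree (p \<circ>\<^sub>p [:w, 1:]) = n" by (simp add: deg degree_pcompose)
      moreover have "Polynomial.lead_coeff (p \<circ>\<^sub>p [:w, 1:]) = 1"
        using lead_coeff_comp[of "[:w, 1:]" p] lc by simp
      moreover have "Polynomial.coeff [:poly p w:] n = 0" using n by (simp add: coeff_eq_0)
      ultimately show ?thesis using lc by (simp add: deg)
    qed
    show "n \<le> card (\<iota> ` A)"
      by (subst card_image) (auto simp: inj_on_def n_def)
    show "Polynomial.degree (p \<circ>\<^sub>p [:w, 1:]) \<le> n" by (simp add: deg degree_pcompose)
    show "Polynomial.degree (p + [:poly p w:]) \<le> n"
      by (intro degree_add_le) (simp_all add: deg)
    fix x assume "x \<in> \<iota> ` A"
    thus "poly (p \<circ>\<^sub>p [:w, 1:]) x = poly (p + [:poly p w:]) x"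
      using periodic zero by (auto simp: poly_pcompose add.commute)
  qed
  hence "poly (p \<circ>\<^sub>p [:w, 1:]) z = poly (p + [:poly p w:]) z" by simp
  hence "poly p (z + w) = poly p z + poly p w" by (simp add: poly_pcompose add.commute)
  hence "(\<Prod>a\<in>A - {0}. - \<iota> a) * fin_exp A (z + w) =
      (\<Prod>a\<in>A - {0}. - \<iota> a) * (fin_exp A z + fin_exp A w)"
    using A by (simp add: p_eval prod_diff_conv_fin_exp add_subgroup_0 distrib_left)
  thus ?thesis using prod_minus_iota_nonzero[OF A(2)] by simp
qed

lemma fin_exp_0 [simp]: "fin_exp A 0 = 0"
  by (simp add: fin_exp_def)

lemma fin_exp_diff:
  assumes "add_subgroup A" "finite A"
  shows "fin_exp A (z - w) = fin_exp A z - fin_exp A w"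
  using fin_exp_add[OF assms, of "z - w" w] by simp

lemma fin_exp_eq_0_iff:
  assumes "0 \<in> A" "finite A"
  shows "fin_exp A z = 0 \<longleftrightarrow> z \<in> \<iota> ` A"
  using assms by (auto simp: fin_exp_def prod_zero_iff)

text \<open>
  The absolute value of \<open>fin_exp A\<close> at distance \<open>\<delta>\<close> from the group
  \<open>A\<close>. After translation by the closest element of \<open>A\<close> the ultrametric
  inequality determines every factor of the product.
\<close>

definition exp_size :: "'a fls set \<Rightarrow> real \<Rightarrow> real" where
  "exp_size A \<delta> = \<delta> * (\<Prod>a\<in>A - {0}. max 1 (\<delta> / fls_abs a))"

lemma exp_size_prod_ge_1: "1 \<le> (\<Prod>a\<in>A - {0}. max 1 (\<delta> / fls_abs a))"
  by (intro prod_ge_1) auto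

lemma exp_size_ge: "0 \<le> \<delta> \<Longrightarrow> \<delta> \<le> exp_size A \<delta>"
  using exp_size_prod_ge_1[of \<delta> A] by (simp add: exp_size_def mult_le_cancel_left1)

lemma fls_abs_nonneg [simp]: "0 \<le> fls_abs (x :: 'a fls)"
  unfolding vabs_iota[symmetric] by simp

lemma exp_size_mono:
  assumes "0 \<le> \<delta>" "\<delta> \<le> \<delta>'" "A \<subseteq> A'" "finite A'"
  shows "exp_size A \<delta> \<le> exp_size A' \<delta>'"
proof -
  have "(\<Prod>a\<in>A - {0}. max 1 (\<delta> / fls_abs a)) \<le> (\<Prod>a\<in>A - {0}. max 1 (\<delta>' / fls_abs a))"
    using assms by (intro prod_mono conjI max.mono divide_right_mono) auto
  also have "\<dots> \<le> (\<Prod>a\<in>A' - {0}. max 1 (\<delta>' / fls_abs a))"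
    using assms by (intro prod_mono2) auto
  finally show ?thesis unfolding exp_size_def
    using assms exp_size_prod_ge_1[of \<delta> A] by (intro mult_mono) auto
qed

lemma exp_size_strict_mono:
  assumes "0 \<le> \<delta>" "\<delta> < \<delta>'" "finite A"
  shows "exp_size A \<delta> < exp_size A \<delta>'"
proof -
  have "(\<Prod>a\<in>A - {0}. max 1 (\<delta> / fls_abs a)) \<le> (\<Prod>a\<in>A - {0}. max 1 (\<delta>' / fls_abs a))"
    using assms by (intro prod_mono conjI max.mono divide_right_mono) auto
  hence "\<delta> * (\<Prod>a\<in>A - {0}. max 1 (\<delta> / fls_abs a)) \<le> \<delta> * (\<Prod>a\<in>A - {0}. max 1 (\<delta>' / fls_abs a))"
    using assms by (intro mult_left_mono)
  also have "\<dots> < \<delta>' * (\<Prod>a\<in>A - {0}. max 1 (\<delta>' / fls_abs a))"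
    using assms exp_size_prod_ge_1[of \<delta>' A] by (intro mult_strict_right_mono) linarith+
  finally show ?thesis unfolding exp_size_def .
qed

lemma vabs_fin_exp_minimal:
  assumes "\<And>a. a \<in> A \<Longrightarrow> vabs w \<le> vabs (w - \<iota> a)"
  shows "vabs (fin_exp A w) = exp_size A (vabs w)"
proof -
  have "vabs (1 - w / \<iota> a) = max 1 (vabs w / fls_abs a)" if a: "a \<in> A - {0}" for a
  proof -
    have a0: "fls_abs a > 0" using a by simp
    have "vabs (w - \<iota> a) = max (fls_abs a) (vabs w)"
    proof (cases "vabs w < fls_abs a")
      case True
      thus ?thesis using vabs_diff_eq[of w "\<iota> a"] by (simp add: vabs_iota)
    next
      case False
      hence "vabs (w - \<iota> a) \<le> vabs w"
        using vabs_diff_le[of w "\<iota> a"] by (simp add: vabs_iota)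
      thus ?thesis using assms[of a] a False by simp
    qed
    moreover have "1 - w / \<iota> a = - ((w - \<iota> a) / \<iota> a)" using a by (simp add: field_simps)
    ultimately have "vabs (1 - w / \<iota> a) = max (fls_abs a) (vabs w) / fls_abs a"
      by (simp only: vabs_minus vabs_divide vabs_iota)
    also have "\<dots> = max 1 (vabs w / fls_abs a)" using a0 by (simp add: max_def divide_simps)
    finally show ?thesis .
  qed
  hence "(\<Prod>a\<in>A - {0}. vabs (1 - w / \<iota> a)) = (\<Prod>a\<in>A - {0}. max 1 (vabs w / fls_abs a))"
    by (intro prod.cong) auto
  thus ?thesis by (simp add: fin_exp_def exp_size_def vabs_mult vabs_prod)
qed

lemma vabs_fin_exp:
  assumes A: "add_subgroup A" "finite A" and a0: "a0 \<in> A"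
    and min: "\<And>a. a \<in> A \<Longrightarrow> vabs (z - \<iota> a0) \<le> vabs (z - \<iota> a)"
  shows "vabs (fin_exp A z) = exp_size A (vabs (z - \<iota> a0))"
proof -
  have "fin_exp A (\<iota> a0) = 0"
    using fin_exp_eq_0_iff[OF add_subgroup_0[OF A(1)] A(2)] a0 by blast
  hence "fin_exp A z = fin_exp A (z - \<iota> a0)"
    by (simp add: fin_exp_diff[OF A])
  moreover have "vabs (z - \<iota> a0) \<le> vabs (z - \<iota> a0 - \<iota> a)" if "a \<in> A" for a
    using min[OF add_subgroup_add[OF A(1) a0 that]] by (simp add: iota_add algebra_simps)
  ultimately show ?thesis using vabs_fin_exp_minimal[of A "z - \<iota> a0"] by simp
qed

lemma ex_closest:
  assumes "finite A" "A \<noteq> {}"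
  obtains a0 where "a0 \<in> A" "\<And>a. a \<in> A \<Longrightarrow> vabs (z - \<iota> a0) \<le> vabs (z - \<iota> a)"
proof -
  define a0 where "a0 = arg_min_on (\<lambda>a. vabs (z - \<iota> a)) A"
  have "a0 \<in> A" unfolding a0_def using assms by (rule arg_min_if_finite(1))
  moreover have "vabs (z - \<iota> a0) \<le> vabs (z - \<iota> a)" if "a \<in> A" for a
    unfolding a0_def using assms that by (rule arg_min_least)
  ultimately show ?thesis using that by blast
qed

lemma lattice_ball_subgroup:
  assumes "discrete_lattice (\<Lambda> :: 'a fls set)"
  shows "add_subgroup (lattice_ball \<Lambda> N)" "finite (lattice_ball \<Lambda> N)"
  using assms fls_abs_diff_leI[of _ "real N"] unfolding discrete_lattice_def lattice_ball_def add_subgroup_def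
  by (auto simp: fls_abs_q[of 0])

lemma lattice_ball_0 [intro]: "discrete_lattice (\<Lambda> :: 'a fls set) \<Longrightarrow> 0 \<in> lattice_ball \<Lambda> N"
  using lattice_ball_subgroup(1) add_subgroup_0 by blast

lemma lattice_ball_mono: "N \<le> N' \<Longrightarrow> lattice_ball \<Lambda> N \<subseteq> lattice_ball \<Lambda> N'"
  by (auto simp: lattice_ball_def)

lemma vabs_prod_minus_1_le:
  fixes f :: "'b \<Rightarrow> 'c"
  assumes "\<And>i. i \<in> I \<Longrightarrow> vabs (f i - 1) \<le> e" "e \<le> 1" "0 \<le> e"
  shows "vabs ((\<Prod>i\<in>I. f i) - 1) \<le> e"
  using assms
proof (induction I rule: infinite_finite_induct)
  case (insert i I)
  have "vabs (f i) \<le> 1"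
    using vabs_add_le[of "f i - 1" 1] insert.prems(1)[of i] insert.prems(2) by simp
  moreover have "vabs ((\<Prod>i\<in>I. f i) - 1) \<le> e" using insert by auto
  ultimately have "vabs (f i * ((\<Prod>i\<in>I. f i) - 1)) \<le> 1 * e"
    unfolding vabs_mult by (intro mult_mono) auto
  hence "vabs (f i * ((\<Prod>i\<in>I. f i) - 1) + (f i - 1)) \<le> e"
    using insert.prems by (intro vabs_add_leI) auto
  thus ?case using insert by (simp add: algebra_simps)
qed auto

lemma fin_exp_ball_split:
  assumes L: "discrete_lattice \<Lambda>" and "N \<le> N'"
  shows "fin_exp (lattice_ball \<Lambda> N') z =
    fin_exp (lattice_ball \<Lambda> N) z * (\<Prod>\<mu>\<in>lattice_ball \<Lambda> N' - lattice_ball \<Lambda> N. 1 - z / \<iota> \<mu>)"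
proof -
  have "lattice_ball \<Lambda> N' - {0} =
      (lattice_ball \<Lambda> N - {0}) \<union> (lattice_ball \<Lambda> N' - lattice_ball \<Lambda> N)"
    using lattice_ball_mono[OF assms(2), of \<Lambda>] lattice_ball_0[OF L, of N] by auto
  moreover have "(lattice_ball \<Lambda> N - {0}) \<inter> (lattice_ball \<Lambda> N' - lattice_ball \<Lambda> N) = {}" by blast
  ultimately have "(\<Prod>\<mu>\<in>lattice_ball \<Lambda> N' - {0}. 1 - z / \<iota> \<mu>) = (\<Prod>\<mu>\<in>lattice_ball \<Lambda> N - {0}. 1 - z / \<iota> \<mu>)
      * (\<Prod>\<mu>\<in>lattice_ball \<Lambda> N' - lattice_ball \<Lambda> N. 1 - z / \<iota> \<mu>)"
    using lattice_ball_subgroup(2)[OF L] by (simp only: prod.union_disjoint finite_Diff)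
  thus ?thesis by (simp add: fin_exp_def mult.assoc)
qed

lemma vabs_fin_exp_ball_eq:
  assumes L: "discrete_lattice \<Lambda>" and "N \<le> N'" "vabs z \<le> real N"
  shows "vabs (fin_exp (lattice_ball \<Lambda> N') z) = vabs (fin_exp (lattice_ball \<Lambda> N) z)"
proof -
  have "vabs (1 - z / \<iota> \<mu>) = 1" if "\<mu> \<in> lattice_ball \<Lambda> N' - lattice_ball \<Lambda> N" for \<mu>
  proof -
    have "vabs z < fls_abs \<mu>" using that assms(3) by (auto simp: lattice_ball_def)
    moreover from this have "fls_abs \<mu> > 0" using vabs_nonneg[of z] by linarith
    ultimately have "vabs (z / \<iota> \<mu>) < vabs 1" by (simp add: vabs_divide vabs_iota)
    thus ?thesis using vabs_diff_eq2 by fastforce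
  qed
  hence "(\<Prod>\<mu>\<in>lattice_ball \<Lambda> N' - lattice_ball \<Lambda> N. vabs (1 - z / \<iota> \<mu>)) = 1"
    by (intro prod.neutral) auto
  thus ?thesis by (simp add: fin_exp_ball_split[OF assms(1,2)] vabs_mult vabs_prod)
qed

text \<open>
  The factors with \<open>|\<mu>| > |z|\<close> have absolute value \<open>1\<close> and tend to
  \<open>1\<close>, so the partial products have constant absolute value from some point on and form a
  Cauchy sequence.
\<close>

lemma lattice_exp_tendsto:
  assumes L: "discrete_lattice \<Lambda>"
  shows "(\<lambda>N. fin_exp (lattice_ball \<Lambda> N) z) \<longlonglongrightarrow> lattice_exp \<iota> \<Lambda> z"
proof -
  define F where "F N = fin_exp (lattice_ball \<Lambda> N) z" for N
  obtain N0 :: nat where N0: "vabs z \<le> real N0" using real_arch_simple by blast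
  define B where "B = vabs (F N0)"
  have "(\<lambda>N. F (Suc (N + Suc N0)) - F (N + Suc N0)) \<longlonglongrightarrow> 0"
  proof (rule tendsto_vabs_squeeze)
    show "(\<lambda>N. B * real (Suc N0) * inverse (real (Suc N))) \<longlonglongrightarrow> 0"
      by (intro tendsto_mult_right_zero LIMSEQ_inverse_real_of_nat)
    fix N
    define M where "M = N + Suc N0"
    have M: "N0 \<le> M" "real (Suc N0) > 0" by (auto simp: M_def)
    define Q where "Q = (\<Prod>\<mu>\<in>lattice_ball \<Lambda> (Suc M) - lattice_ball \<Lambda> M. 1 - z / \<iota> \<mu>)"
    have "vabs (Q - 1) \<le> real (Suc N0) / real M"
      unfolding Q_def
    proof (rule vabs_prod_minus_1_le)
      fix \<mu> assume "\<mu> \<in> lattice_ball \<Lambda> (Suc M) - lattice_ball \<Lambda> M"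
      hence "real M < fls_abs \<mu>" by (auto simp: lattice_ball_def)
      hence "vabs z / fls_abs \<mu> \<le> real (Suc N0) / real M"
        using N0 M by (intro frac_le) (auto simp: M_def)
      thus "vabs (1 - z / \<iota> \<mu> - 1) \<le> real (Suc N0) / real M"
        by (simp add: vabs_divide vabs_iota)
    qed (auto simp: M_def divide_simps)
    moreover have "F (Suc M) - F M = F M * (Q - 1)"
      unfolding F_def Q_def by (subst fin_exp_ball_split[OF L, of M]) (auto simp: algebra_simps)
    moreover have "vabs (F M) = B"
      unfolding F_def B_def by (rule vabs_fin_exp_ball_eq[OF L M(1) N0])
    ultimately have "vabs (F (Suc M) - F M) = B * vabs (Q - 1)" "vabs (Q - 1) \<le> real (Suc N0) / real M"
      by (simp_all only: vabs_mult)
    hence "vabs (F (Suc M) - F M) \<le> B * (real (Suc N0) / real M)"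
      using mult_left_mono[of "vabs (Q - 1)" _ B] by (simp only: B_def vabs_nonneg)
    also have "\<dots> \<le> B * (real (Suc N0) / real (Suc N))"
      unfolding B_def by (intro mult_left_mono frac_le) (auto simp: M_def)
    finally show "vabs (F (Suc (N + Suc N0)) - F (N + Suc N0) - 0) \<le>
        B * real (Suc N0) * inverse (real (Suc N))"
      by (simp add: M_def divide_inverse mult.assoc)
  qed
  hence "Cauchy (\<lambda>N. F (N + Suc N0))" by (intro ultrametric_Cauchy) simp
  then obtain l where "(\<lambda>N. F (N + Suc N0)) \<longlonglongrightarrow> l"
    by (auto simp: Cauchy_convergent_iff convergent_def)
  hence "F \<longlonglongrightarrow> l" by (rule LIMSEQ_offset)
  hence conv: "F \<longlonglongrightarrow> lim F" using limI by blast
  have "{\<mu> \<in> \<Lambda>. \<mu> \<noteq> 0 \<and> fls_abs \<mu> \<le> real N} = lattice_ball \<Lambda> N - {0}" for N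
    by (auto simp: lattice_ball_def)
  hence "lattice_exp \<iota> \<Lambda> z = lim F"
    unfolding lattice_exp_def F_def fin_exp_def by simp
  thus ?thesis using conv by (simp add: F_def[abs_def])
qed

lemma vabs_lattice_exp:
  assumes L: "discrete_lattice \<Lambda>" and "vabs z \<le> real N"
  shows "vabs (lattice_exp \<iota> \<Lambda> z) = vabs (fin_exp (lattice_ball \<Lambda> N) z)"
proof -
  have "(\<lambda>N. vabs (fin_exp (lattice_ball \<Lambda> N) z)) \<longlonglongrightarrow> vabs (lattice_exp \<iota> \<Lambda> z)"
    by (rule tendsto_vabs[OF lattice_exp_tendsto[OF L]])
  moreover have "(\<lambda>N. vabs (fin_exp (lattice_ball \<Lambda> N) z)) \<longlonglongrightarrow> vabs (fin_exp (lattice_ball \<Lambda> N) z)"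
    by (intro tendsto_eventually eventually_sequentiallyI[of N] vabs_fin_exp_ball_eq[OF L _ assms(2)])
  ultimately show ?thesis using LIMSEQ_unique by blast
qed

lemma lattice_exp_add:
  assumes L: "discrete_lattice \<Lambda>"
  shows "lattice_exp \<iota> \<Lambda> (z + w) = lattice_exp \<iota> \<Lambda> z + lattice_exp \<iota> \<Lambda> w"
proof -
  have "(\<lambda>N. fin_exp (lattice_ball \<Lambda> N) z + fin_exp (lattice_ball \<Lambda> N) w)
      \<longlonglongrightarrow> lattice_exp \<iota> \<Lambda> z + lattice_exp \<iota> \<Lambda> w"
    by (rule tendsto_add[OF lattice_exp_tendsto[OF L] lattice_exp_tendsto[OF L]])
  moreover have "fin_exp (lattice_ball \<Lambda> N) (z + w) =
      fin_exp (lattice_ball \<Lambda> N) z + fin_exp (lattice_ball \<Lambda> N) w" for N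
    by (rule fin_exp_add[OF lattice_ball_subgroup[OF L]])
  ultimately show ?thesis
    using LIMSEQ_unique[OF lattice_exp_tendsto[OF L, of "z + w"]] by simp
qed

lemma lattice_exp_eq_0_iff:
  assumes L: "discrete_lattice \<Lambda>"
  shows "lattice_exp \<iota> \<Lambda> z = 0 \<longleftrightarrow> z \<in> \<iota> ` \<Lambda>"
proof -
  obtain N :: nat where N: "vabs z \<le> real N" using real_arch_simple by blast
  have "lattice_exp \<iota> \<Lambda> z = 0 \<longleftrightarrow> fin_exp (lattice_ball \<Lambda> N) z = 0"
    using vabs_lattice_exp[OF L N] by (metis vabs_eq_0_iff)
  also have "\<dots> \<longleftrightarrow> z \<in> \<iota> ` lattice_ball \<Lambda> N"
    by (rule fin_exp_eq_0_iff[OF lattice_ball_0[OF L] lattice_ball_subgroup(2)[OF L]])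
  also have "\<dots> \<longleftrightarrow> z \<in> \<iota> ` \<Lambda>"
    using N by (auto simp: lattice_ball_def vabs_iota)
  finally show ?thesis .
qed

lemma lattice_exp_diff:
  assumes L: "discrete_lattice \<Lambda>"
  shows "lattice_exp \<iota> \<Lambda> (z - w) = lattice_exp \<iota> \<Lambda> z - lattice_exp \<iota> \<Lambda> w"
  using lattice_exp_add[OF assms, of "z - w" w] by simp

lemma lattice_exp_periodic:
  assumes L: "discrete_lattice \<Lambda>" "b \<in> \<Lambda>"
  shows "lattice_exp \<iota> \<Lambda> (z + \<iota> b) = lattice_exp \<iota> \<Lambda> z"
proof -
  have "lattice_exp \<iota> \<Lambda> (\<iota> b) = 0" using assms by (subst lattice_exp_eq_0_iff) auto
  thus ?thesis by (simp add: lattice_exp_add[OF L(1)])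
qed

lemma vabs_lattice_exp_ge:
  assumes L: "discrete_lattice \<Lambda>"
  shows "vabs (lattice_exp \<iota> \<Lambda> z) \<ge> exp_size (lattice_ball \<Lambda> M) (im_abs \<iota> z)"
proof -
  obtain N0 :: nat where N0: "vabs z \<le> real N0" using real_arch_simple by blast
  define N where "N = max M N0"
  have N: "vabs z \<le> real N" "M \<le> N" using N0 by (auto simp: N_def)
  obtain a0 where a0: "a0 \<in> lattice_ball \<Lambda> N"
    "\<And>a. a \<in> lattice_ball \<Lambda> N \<Longrightarrow> vabs (z - \<iota> a0) \<le> vabs (z - \<iota> a)"
    using ex_closest[of "lattice_ball \<Lambda> N" z] lattice_ball_subgroup(2)[OF L] lattice_ball_0[OF L]
    by blast
  have "vabs (lattice_exp \<iota> \<Lambda> z) = exp_size (lattice_ball \<Lambda> N) (vabs (z - \<iota> a0))"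
    unfolding vabs_lattice_exp[OF L N(1)]
    by (rule vabs_fin_exp[OF lattice_ball_subgroup[OF L] a0])
  also have "\<dots> \<ge> exp_size (lattice_ball \<Lambda> M) (im_abs \<iota> z)"
    by (intro exp_size_mono im_abs_le lattice_ball_mono N lattice_ball_subgroup[OF L]) auto
  finally show ?thesis .
qed

lemma vabs_lattice_exp_ge_im:
  assumes L: "discrete_lattice \<Lambda>"
  shows "vabs (lattice_exp \<iota> \<Lambda> z) \<ge> im_abs \<iota> z"
  using vabs_lattice_exp_ge[OF L, of 0 z] exp_size_ge[of "im_abs \<iota> z" "lattice_ball \<Lambda> 0"] by simp

text \<open>
  Grouping the zeros in \<open>\<Lambda>\<close> by cosets of \<open>\<Lambda>'\<close> gives, on each
  ball, the product of the \<open>E(z - b) = E(z) - E(b)\<close>, with \<open>E\<close> the finite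
  exponential function of the ball of \<open>\<Lambda>'\<close>.
\<close>

lemma lattice_exp_sublattice:
  assumes L: "discrete_lattice \<Lambda>" "discrete_lattice \<Lambda>'" "\<Lambda>' \<subseteq> \<Lambda>" and R: "coset_system \<Lambda> \<Lambda>' R"
  shows "lattice_exp \<iota> \<Lambda> z =
    lattice_exp \<iota> \<Lambda>' z * (\<Prod>b\<in>R - {0}. 1 - lattice_exp \<iota> \<Lambda>' z / lattice_exp \<iota> \<Lambda>' (\<iota> b))"
proof -
  have finR: "finite R" and R\<Lambda>: "R \<subseteq> \<Lambda>" and R0: "0 \<in> R"
    using R by (auto simp: coset_system_def)
  have grp: "add_subgroup \<Lambda>" "add_subgroup \<Lambda>'" using L by (auto simp: discrete_lattice_def)
  define E where "E N = fin_exp (lattice_ball \<Lambda>' N)" for N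
  define e where "e = lattice_exp \<iota> \<Lambda>'"
  have E_lim: "(\<lambda>N. E N w) \<longlonglongrightarrow> e w" for w
    unfolding E_def e_def by (rule lattice_exp_tendsto[OF L(2)])
  have not_L': "b \<notin> \<Lambda>'" if "b \<in> R - {0}" for b
    using coset_system_diff[OF R grp(2), of b 0] that R0 by auto
  hence e_b: "e (\<iota> b) \<noteq> 0" if "b \<in> R - {0}" for b
    using that unfolding e_def lattice_exp_eq_0_iff[OF L(2)] by auto
  obtain N0 :: nat where N0: "\<And>b. b \<in> R \<Longrightarrow> fls_abs b \<le> real N0"
  proof -
    obtain N0 :: nat where "Max (fls_abs ` R) \<le> real N0" using real_arch_simple by blast
    thus ?thesis using that[of N0] finR by (auto intro: order.trans[OF Max_ge])
  qed
  have level: "fin_exp (lattice_ball \<Lambda> N) z = E N z * (\<Prod>b\<in>R - {0}. 1 - E N z / E N (\<iota> b))"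
    if N: "N \<ge> N0" for N
  proof -
    define B where "B = lattice_ball \<Lambda>' N"
    have B: "add_subgroup B" "finite B" "0 \<in> B"
      unfolding B_def using lattice_ball_subgroup[OF L(2)] lattice_ball_0[OF L(2)] by auto
    have bij: "bij_betw (\<lambda>(b, l). b + l) (R \<times> B) (lattice_ball \<Lambda> N)"
    proof (rule bij_betwI')
      fix x y assume "x \<in> R \<times> B" "y \<in> R \<times> B"
      then obtain b l b' l' where *: "x = (b, l)" "y = (b', l')" "b \<in> R" "b' \<in> R" "l \<in> \<Lambda>'" "l' \<in> \<Lambda>'"
        by (auto simp: B_def lattice_ball_def)
      have "b = b'" if "b + l = b' + l'"
      proof (rule coset_system_diff[OF R grp(2) *(3,4)])
        have "b - b' = l' - l" using that by (simp add: algebra_simps)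
        thus "b - b' \<in> \<Lambda>'" using add_subgroup_diff[OF grp(2) *(6,5)] by simp
      qed
      thus "((case x of (b, l) \<Rightarrow> b + l) = (case y of (b, l) \<Rightarrow> b + l)) = (x = y)"
        using * by auto
    next
      fix x assume "x \<in> R \<times> B"
      then obtain b l where *: "x = (b, l)" "b \<in> R" "l \<in> B" by auto
      have "b \<in> lattice_ball \<Lambda> N" "l \<in> lattice_ball \<Lambda> N"
        using * N0[of b] N R\<Lambda> L(3) by (auto simp: B_def lattice_ball_def)
      thus "(case x of (b, l) \<Rightarrow> b + l) \<in> lattice_ball \<Lambda> N"
        using * add_subgroup_add[OF lattice_ball_subgroup(1)[OF L(1)]] by auto
    next
      fix \<mu> assume \<mu>: "\<mu> \<in> lattice_ball \<Lambda> N"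
      hence "\<mu> \<in> \<Lambda>" by (auto simp: lattice_ball_def)
      then obtain b where b: "b \<in> R" "\<mu> - b \<in> \<Lambda>'" using R unfolding coset_system_def by blast
      have "fls_abs (\<mu> - b) \<le> real N"
        using N0[OF b(1)] N \<mu> by (intro fls_abs_diff_leI) (auto simp: lattice_ball_def)
      hence "(b, \<mu> - b) \<in> R \<times> B" using b by (auto simp: B_def lattice_ball_def)
      thus "\<exists>x\<in>R \<times> B. \<mu> = (case x of (b, l) \<Rightarrow> b + l)" by force
    qed
    define c where "c = (\<Prod>a\<in>B - {0}. - \<iota> a)"
    have prod_B: "(\<Prod>l\<in>B. w - \<iota> l) = c * E N w" for w
      using prod_diff_conv_fin_exp[OF B(2,3), of w] by (simp add: E_def B_def c_def)
    have cosets: "(\<Prod>\<mu>\<in>lattice_ball \<Lambda> N. w - \<iota> \<mu>) =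
        (\<Prod>b\<in>R. c * E N (w - \<iota> b))" for w
    proof -
      have "(\<Prod>\<mu>\<in>lattice_ball \<Lambda> N. w - \<iota> \<mu>) = (\<Prod>x\<in>R \<times> B. w - \<iota> (case x of (b, l) \<Rightarrow> b + l))"
        by (rule prod.reindex_bij_betw[OF bij, symmetric])
      also have "\<dots> = (\<Prod>b\<in>R. \<Prod>l\<in>B. (w - \<iota> b) - \<iota> l)"
        unfolding prod.cartesian_product by (intro prod.cong) (auto simp: iota_add)
      finally show ?thesis
        by (simp only: prod_B)
    qed
    have c0: "c \<noteq> 0" unfolding c_def by (rule prod_minus_iota_nonzero[OF B(2)])
    define r where "r = card R"
    define C where "C = (\<Prod>a\<in>lattice_ball \<Lambda> N - {0}. - \<iota> a)"
    have C0: "C \<noteq> 0"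
      unfolding C_def by (rule prod_minus_iota_nonzero[OF lattice_ball_subgroup(2)[OF L(1)]])
    have main: "C * fin_exp (lattice_ball \<Lambda> N) w = c ^ r * (\<Prod>b\<in>R. E N (w - \<iota> b))" for w
      unfolding C_def prod_diff_conv_fin_exp[OF lattice_ball_subgroup(2)[OF L(1)] lattice_ball_0[OF L(1)], symmetric]
        cosets r_def by (simp only: prod.distrib prod_constant)
    have E_diff: "E N (w - v) = E N w - E N v" for w v
      unfolding E_def using B unfolding B_def by (intro fin_exp_diff)
    have E_b: "E N (\<iota> b) \<noteq> 0" if "b \<in> R - {0}" for b
      using not_L'[OF that] fin_exp_eq_0_iff[OF B(3,2), of "\<iota> b"] unfolding E_def B_def
      by (auto simp: lattice_ball_def)
    \<comment> \<open>the normalising constant is found by comparing the coefficients of \<open>z\<close>, that is, from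
      the product over the nonzero elements of the ball\<close>
    have C_eq: "C = c ^ r * (\<Prod>b\<in>R - {0}. - E N (\<iota> b))"
    proof -
      have "C = (\<Prod>\<mu>\<in>lattice_ball \<Lambda> N - {0}. 0 - \<iota> \<mu>)" by (simp add: C_def)
      also have "\<dots> = (\<Prod>x\<in>R \<times> B - {(0, 0)}. 0 - \<iota> (case x of (b, l) \<Rightarrow> b + l))"
      proof (rule prod.reindex_bij_betw[symmetric])
        have "bij_betw (\<lambda>(b, l). b + l) (R \<times> B - {(0, 0)}) (lattice_ball \<Lambda> N - {(\<lambda>(b, l). b + l) (0, 0)})"
          using R0 B(3) lattice_ball_0[OF L(1), of N]
          by (intro bij_betw_DiffI[OF bij]) (auto simp: bij_betw_def)
        thus "bij_betw (\<lambda>(b, l). b + l) (R \<times> B - {(0, 0)}) (lattice_ball \<Lambda> N - {0})" by simp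
      qed
      also have "R \<times> B - {(0, 0)} = (R - {0}) \<times> B \<union> {0} \<times> (B - {0})"
        using R0 by auto
      also have "(\<Prod>x\<in>(R - {0}) \<times> B \<union> {0} \<times> (B - {0}). 0 - \<iota> (case x of (b, l) \<Rightarrow> b + l)) =
          (\<Prod>x\<in>(R - {0}) \<times> B. 0 - \<iota> (case x of (b, l) \<Rightarrow> b + l)) *
          (\<Prod>x\<in>{0} \<times> (B - {0}). 0 - \<iota> (case x of (b, l) \<Rightarrow> b + l))"
        using finR B(2) by (intro prod.union_disjoint) auto
      also have "(\<Prod>x\<in>{0} \<times> (B - {0}). 0 - \<iota> (case x of (b, l) \<Rightarrow> b + l)) = (\<Prod>b\<in>{0 :: 'a fls}. \<Prod>l\<in>B - {0}. - \<iota> (b + l))"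
        unfolding prod.cartesian_product by (intro prod.cong) auto
      also have "\<dots> = c" by (simp add: c_def)
      also have "(\<Prod>x\<in>(R - {0}) \<times> B. 0 - \<iota> (case x of (b, l) \<Rightarrow> b + l)) =
          (\<Prod>b\<in>R - {0}. \<Prod>l\<in>B. (- \<iota> b) - \<iota> l)"
        unfolding prod.cartesian_product by (intro prod.cong) (auto simp: iota_add)
      also have "\<dots> = (\<Prod>b\<in>R - {0}. c * - E N (\<iota> b))"
      proof (intro prod.cong refl)
        fix b
        have "E N (- \<iota> b) = - E N (\<iota> b)" using E_diff[of 0 "\<iota> b"] by (simp add: E_def)
        thus "(\<Prod>l\<in>B. (- \<iota> b) - \<iota> l) = c * - E N (\<iota> b)"
          by (simp only: prod_B)
      qed
      also have "\<dots> = c ^ (r - 1) * (\<Prod>b\<in>R - {0}. - E N (\<iota> b))"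
        using finR R0 by (simp only: prod.distrib prod_constant r_def card_Diff_singleton)
      finally have "C = c ^ (r - 1) * c * (\<Prod>b\<in>R - {0}. - E N (\<iota> b))" by (simp only: mult_ac)
      moreover have "r > 0" using finR R0 by (auto simp: r_def card_gt_0_iff)
      ultimately show ?thesis by (simp only: power_minus_mult)
    qed
    have "(\<Prod>b\<in>R - {0}. - E N (\<iota> b)) * fin_exp (lattice_ball \<Lambda> N) z = (\<Prod>b\<in>R. E N (z - \<iota> b))"
      using main[of z] c0 unfolding C_eq by simp
    also have "\<dots> = E N z * (\<Prod>b\<in>R - {0}. - E N (\<iota> b) * (1 - E N z / E N (\<iota> b)))"
    proof -
      have "(\<Prod>b\<in>R. E N (z - \<iota> b)) = E N z * (\<Prod>b\<in>R - {0}. E N (z - \<iota> b))"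
        using finR R0 by (simp add: prod.remove)
      also have "(\<Prod>b\<in>R - {0}. E N (z - \<iota> b)) = (\<Prod>b\<in>R - {0}. - E N (\<iota> b) * (1 - E N z / E N (\<iota> b)))"
        using E_b by (intro prod.cong) (auto simp: E_diff field_simps)
      finally show ?thesis .
    qed
    also have "\<dots> = (\<Prod>b\<in>R - {0}. - E N (\<iota> b)) * (E N z * (\<Prod>b\<in>R - {0}. 1 - E N z / E N (\<iota> b)))"
      by (simp only: prod.distrib mult_ac)
    finally have "(\<Prod>b\<in>R - {0}. - E N (\<iota> b)) * fin_exp (lattice_ball \<Lambda> N) z =
        (\<Prod>b\<in>R - {0}. - E N (\<iota> b)) * (E N z * (\<Prod>b\<in>R - {0}. 1 - E N z / E N (\<iota> b)))" .
    moreover have "(\<Prod>b\<in>R - {0}. - E N (\<iota> b)) \<noteq> 0"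
      using E_b finR by (auto simp: prod_zero_iff)
    ultimately show ?thesis by (simp only: mult_cancel_left) blast
  qed
  have "(\<lambda>N. E N z * (\<Prod>b\<in>R - {0}. 1 - E N z * inverse (E N (\<iota> b)))) \<longlonglongrightarrow>
      e z * (\<Prod>b\<in>R - {0}. 1 - e z * inverse (e (\<iota> b)))"
    by (intro tendsto_mult tendsto_prod_ultrametric tendsto_diff tendsto_const tendsto_inverse_vabs E_lim e_b)
  moreover have "(\<lambda>N. E N z * (\<Prod>b\<in>R - {0}. 1 - E N z * inverse (E N (\<iota> b)))) \<longlonglongrightarrow> lattice_exp \<iota> \<Lambda> z"
    by (rule Lim_transform_eventually[OF lattice_exp_tendsto[OF L(1)]],
        rule eventually_sequentiallyI[of N0]) (simp add: level divide_inverse)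
  ultimately show ?thesis using LIMSEQ_unique by (auto simp: e_def divide_inverse)
qed

end

section \<open>Power series over an ultrametric field\<close>

definition fps_value :: "'c::complete_ultrametric_field fps \<Rightarrow> 'c \<Rightarrow> 'c \<Rightarrow> bool" where
  "fps_value A x y \<longleftrightarrow> (\<lambda>n. fps_nth A n * x ^ n) sums y"

text \<open>
  \<open>M\<close> bounds the Gauss norm of radius \<open>\<rho>\<close>, which controls products,
  inverses and compositions as well as the values on the disc.
\<close>

definition gauss_le :: "'c::complete_ultrametric_field fps \<Rightarrow> real \<Rightarrow> real \<Rightarrow> bool" where
  "gauss_le A \<rho> M \<longleftrightarrow> (\<forall>n. vabs (fps_nth A n) * \<rho> ^ n \<le> M)"

lemma gauss_leD: "gauss_le A \<rho> M \<Longrightarrow> vabs (fps_nth A n) * \<rho> ^ n \<le> M"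
  by (simp add: gauss_le_def)

lemma gauss_le_nonneg: "gauss_le A \<rho> M \<Longrightarrow> 0 \<le> M"
  using order.trans[OF vabs_nonneg[of "fps_nth A 0"]] gauss_leD[of A \<rho> M 0] by simp

lemma gauss_le_mono_radius:
  assumes "gauss_le A \<sigma> M" "0 \<le> \<rho>" "\<rho> \<le> \<sigma>"
  shows "gauss_le A \<rho> M"
  unfolding gauss_le_def
proof
  fix n
  have "vabs (fps_nth A n) * \<rho> ^ n \<le> vabs (fps_nth A n) * \<sigma> ^ n"
    using assms by (intro mult_left_mono power_mono) auto
  also have "\<dots> \<le> M" by (rule gauss_leD[OF assms(1)])
  finally show "vabs (fps_nth A n) * \<rho> ^ n \<le> M" .
qed

lemma fps_value_unique: "fps_value A x y \<Longrightarrow> fps_value A x z \<Longrightarrow> y = z"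
  unfolding fps_value_def by (rule sums_unique2)

lemma gauss_le_term:
  assumes "gauss_le A \<rho> M" "0 < \<rho>"
  shows "vabs (fps_nth A n * x ^ n) \<le> M * (vabs x / \<rho>) ^ n"
proof -
  have "vabs (fps_nth A n * x ^ n) = (vabs (fps_nth A n) * \<rho> ^ n) * (vabs x / \<rho>) ^ n"
    using assms(2) by (simp add: vabs_mult vabs_power power_divide)
  also have "\<dots> \<le> M * (vabs x / \<rho>) ^ n"
    using assms by (intro mult_right_mono gauss_leD) auto
  finally show ?thesis .
qed

lemma fps_value_exists:
  assumes "gauss_le A \<rho> M" "vabs x < \<rho>"
  shows "\<exists>y. fps_value A x y"
proof -
  have \<rho>: "0 < \<rho>" using assms(2) vabs_nonneg[of x] by linarith
  have "(\<lambda>n. fps_nth A n * x ^ n) \<longlonglongrightarrow> 0"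
  proof (rule tendsto_vabs_squeeze)
    show "(\<lambda>n. M * (vabs x / \<rho>) ^ n) \<longlonglongrightarrow> 0"
      using assms \<rho> by (intro tendsto_mult_right_zero LIMSEQ_realpow_zero) auto
    show "vabs (fps_nth A n * x ^ n - 0) \<le> M * (vabs x / \<rho>) ^ n" for n
      using gauss_le_term[OF assms(1) \<rho>, of n x] by simp
  qed
  hence "summable (\<lambda>n. fps_nth A n * x ^ n)" by (rule ultrametric_summable)
  thus ?thesis unfolding fps_value_def summable_def by blast
qed

lemma fps_value_bound:
  assumes "gauss_le A \<rho> M" "vabs x \<le> \<rho>" "0 < \<rho>" "fps_value A x y"
  shows "vabs y \<le> M"
  using assms(4) unfolding fps_value_def
proof (rule vabs_sums_le)
  fix n
  have "M * (vabs x / \<rho>) ^ n \<le> M * 1"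
    using assms gauss_le_nonneg[OF assms(1)] by (intro mult_left_mono power_le_one) auto
  thus "vabs (fps_nth A n * x ^ n) \<le> M"
    using gauss_le_term[OF assms(1,3), of n x] by simp
qed

text \<open>
  Both the partial sums of the column sums and those of the row sums are compared with the sum over a
  square. All terms outside of it are at most \<open>B \<kappa>\<^sup>J\<close>, and in the ultrametric
  setting so is their sum.
\<close>

lemma sums_interchange:
  fixes t :: "nat \<Rightarrow> nat \<Rightarrow> 'c::complete_ultrametric_field"
  assumes bound: "\<And>i j. vabs (t i j) \<le> B * \<kappa> ^ j" and \<kappa>: "0 \<le> \<kappa>" "\<kappa> < 1"
    and tri: "\<And>i j. j < i \<Longrightarrow> t i j = 0"
    and r: "\<And>i. t i sums r i" and s: "r sums s"
  shows "(\<lambda>j. \<Sum>i\<le>j. t i j) sums s"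
proof -
  have B: "0 \<le> B" using order.trans[OF vabs_nonneg bound[of 0 0]] by simp
  have tail: "vabs ((\<Sum>j<J. t i j) - r i) \<le> B * \<kappa> ^ J" for i J
  proof -
    have "(\<lambda>N. (\<Sum>j<J. t i j) - (\<Sum>j<N. t i j)) \<longlonglongrightarrow> (\<Sum>j<J. t i j) - r i"
      using r[of i] unfolding sums_def by (intro tendsto_diff tendsto_const)
    thus ?thesis
    proof (rule vabs_le_of_tendsto)
      show "\<forall>\<^sub>F N in sequentially. vabs ((\<Sum>j<J. t i j) - (\<Sum>j<N. t i j)) \<le> B * \<kappa> ^ J"
      proof (rule eventually_sequentiallyI[of J])
        fix N assume N: "J \<le> N"
        hence "(\<Sum>j<N. t i j) = (\<Sum>j<J. t i j) + (\<Sum>j\<in>{J..<N}. t i j)"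
          by (simp add: sum.atLeastLessThan_concat flip: atLeast0LessThan)
        moreover have "vabs (\<Sum>j\<in>{J..<N}. t i j) \<le> B * \<kappa> ^ J"
        proof (rule vabs_sum_le)
          fix j assume "j \<in> {J..<N}"
          hence "B * \<kappa> ^ j \<le> B * \<kappa> ^ J"
            using \<kappa> B by (intro mult_left_mono power_decreasing) auto
          thus "vabs (t i j) \<le> B * \<kappa> ^ J" using bound[of i j] by linarith
        qed (use B \<kappa> in auto)
        ultimately show "vabs ((\<Sum>j<J. t i j) - (\<Sum>j<N. t i j)) \<le> B * \<kappa> ^ J" by simp
      qed
    qed simp
  qed
  have partial: "(\<Sum>j<J. \<Sum>i\<le>j. t i j) = (\<Sum>i<J. \<Sum>j<J. t i j)" for J
  proof -
    have "(\<Sum>j<J. \<Sum>i\<le>j. t i j) = (\<Sum>j<J. \<Sum>i<J. t i j)"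
    proof (rule sum.cong[OF refl])
      fix j assume "j \<in> {..<J}"
      thus "(\<Sum>i\<le>j. t i j) = (\<Sum>i<J. t i j)"
        using tri by (intro sum.mono_neutral_left) auto
    qed
    also have "\<dots> = (\<Sum>i<J. \<Sum>j<J. t i j)" by (rule sum.swap)
    finally show ?thesis .
  qed
  have "(\<lambda>J. (\<Sum>j<J. \<Sum>i\<le>j. t i j) - (\<Sum>i<J. r i)) \<longlonglongrightarrow> 0"
  proof (rule tendsto_vabs_squeeze)
    show "(\<lambda>J. B * \<kappa> ^ J) \<longlonglongrightarrow> 0"
      using \<kappa> by (intro tendsto_mult_right_zero LIMSEQ_realpow_zero) auto
    fix J
    have "vabs (\<Sum>i<J. (\<Sum>j<J. t i j) - r i) \<le> B * \<kappa> ^ J"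
      using tail B \<kappa> by (intro vabs_sum_le) auto
    thus "vabs ((\<Sum>j<J. \<Sum>i\<le>j. t i j) - (\<Sum>i<J. r i) - 0) \<le> B * \<kappa> ^ J"
      unfolding partial by (simp add: sum_subtractf)
  qed
  from tendsto_add[OF this s[unfolded sums_def]] show ?thesis
    unfolding sums_def by simp
qed

lemma sums_shift_zeros:
  fixes f :: "nat \<Rightarrow> 'c::complete_ultrametric_field"
  assumes "f sums s"
  shows "(\<lambda>j. if j < i then 0 else f (j - i)) sums s"
  unfolding sums_def
proof (rule LIMSEQ_offset[of _ i])
  have "(\<Sum>j<N + i. if j < i then 0 else f (j - i)) = (\<Sum>j<N. f j)" for N
    by (induction N) auto
  thus "(\<lambda>N. \<Sum>j<N + i. if j < i then 0 else f (j - i)) \<longlonglongrightarrow> s"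
    using assms by (simp add: sums_def)
qed

lemma gauss_le_mult:
  assumes "gauss_le A \<rho> M" "gauss_le B \<rho> N" "0 \<le> \<rho>"
  shows "gauss_le (A * B) \<rho> (M * N)"
  unfolding gauss_le_def
proof
  fix n
  have MN: "0 \<le> M" "0 \<le> N" using assms gauss_le_nonneg by auto

  have "vabs (fps_nth A i * fps_nth B (n - i)) * \<rho> ^ n \<le> M * N" if "i \<le> n" for i
  proof -
    have "vabs (fps_nth A i * fps_nth B (n - i)) * \<rho> ^ n =
        (vabs (fps_nth A i) * \<rho> ^ i) * (vabs (fps_nth B (n - i)) * \<rho> ^ (n - i))"
      using that by (simp add: vabs_mult flip: power_add)
    also have "\<dots> \<le> M * N"
      using assms MN by (intro mult_mono gauss_leD) auto
    finally show ?thesis .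
  qed
  note summand = this
  show "vabs (fps_nth (A * B) n) * \<rho> ^ n \<le> M * N"
  proof (cases "\<rho> ^ n = 0")
    case False
    hence "\<rho> ^ n > 0" using assms(3) by (metis order_le_less zero_le_power)
    hence "vabs (fps_nth (A * B) n) \<le> M * N / \<rho> ^ n"
      unfolding fps_mult_nth using summand MN
      by (intro vabs_sum_le) (auto simp: pos_le_divide_eq)
    thus ?thesis using \<open>\<rho> ^ n > 0\<close> by (simp add: pos_le_divide_eq)
  next
    case True
    thus ?thesis using MN by (simp only: mult_zero_right mult_nonneg_nonneg)
  qed
qed

lemma fps_value_mult:
  assumes A: "gauss_le A \<rho> M" and B: "gauss_le B \<rho> N" and x: "vabs x < \<rho>"
    and a: "fps_value A x a" and b: "fps_value B x b"
  shows "fps_value (A * B) x (a * b)"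
proof -
  have \<rho>: "0 < \<rho>" using x vabs_nonneg[of x] by linarith
  define t where "t i j = (if j < i then 0 else fps_nth A i * x ^ i * (fps_nth B (j - i) * x ^ (j - i)))" for i j
  have "(\<lambda>j. \<Sum>i\<le>j. t i j) sums (a * b)"
  proof (rule sums_interchange)
    fix i j :: nat
    show "vabs (t i j) \<le> M * N * (vabs x / \<rho>) ^ j"
    proof (cases "j < i")
      case True
      thus ?thesis using gauss_le_nonneg[OF A] gauss_le_nonneg[OF B] \<rho> by (simp add: t_def)
    next
      case False
      have "vabs (t i j) = vabs (fps_nth A i * x ^ i) * vabs (fps_nth B (j - i) * x ^ (j - i))"
        using False by (simp add: t_def vabs_mult)
      also have "\<dots> \<le> (M * (vabs x / \<rho>) ^ i) * (N * (vabs x / \<rho>) ^ (j - i))"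
        using gauss_le_nonneg[OF A] \<rho> by (intro mult_mono gauss_le_term[OF A] gauss_le_term[OF B]) auto
      also have "\<dots> = M * N * ((vabs x / \<rho>) ^ i * (vabs x / \<rho>) ^ (j - i))" by (simp add: mult_ac)
      also have "(vabs x / \<rho>) ^ i * (vabs x / \<rho>) ^ (j - i) = (vabs x / \<rho>) ^ j"
        using False by (simp flip: power_add)
      finally show ?thesis .
    qed
  next
    show "t i sums (fps_nth A i * x ^ i * b)" for i
      using sums_shift_zeros[OF ultrametric_sums_mult_left[OF b[unfolded fps_value_def]], of i "fps_nth A i * x ^ i"]
      by (simp add: t_def[abs_def])
    show "(\<lambda>i. fps_nth A i * x ^ i * b) sums (a * b)"
      using ultrametric_sums_mult_left[OF a[unfolded fps_value_def], of b] by (simp add: mult_ac)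
  qed (use x \<rho> in \<open>auto simp: t_def\<close>)
  moreover have "(\<Sum>i\<le>j. t i j) = fps_nth (A * B) j * x ^ j" for j
  proof -
    have "(\<Sum>i\<le>j. t i j) = (\<Sum>i\<le>j. fps_nth A i * fps_nth B (j - i) * x ^ j)"
      by (intro sum.cong) (auto simp: t_def mult_ac simp flip: power_add)
    thus ?thesis by (simp add: fps_mult_nth sum_distrib_right atLeast0AtMost)
  qed
  ultimately show ?thesis by (simp add: fps_value_def)
qed

lemma fps_value_finite:
  assumes "\<And>n. n > N \<Longrightarrow> fps_nth A n = 0"
  shows "fps_value A x (\<Sum>n\<le>N. fps_nth A n * x ^ n)"
  unfolding fps_value_def using assms by (intro sums_finite) auto

lemma fps_value_poly: "fps_value (fps_of_poly p) x (poly p x)"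
proof -
  have "fps_value (fps_of_poly p) x (\<Sum>n\<le>Polynomial.degree p. fps_nth (fps_of_poly p) n * x ^ n)"
    by (rule fps_value_finite) (simp add: coeff_eq_0)
  thus ?thesis by (simp add: poly_altdef)
qed

lemma fps_value_1: "fps_value 1 x 1"
  using fps_value_poly[of 1 x] by simp

lemma gauss_le_1: "gauss_le 1 \<rho> 1"
  by (auto simp: gauss_le_def)

lemma gauss_le_power:
  assumes "gauss_le A \<rho> M" "0 \<le> \<rho>"
  shows "gauss_le (A ^ n) \<rho> (M ^ n)"
  by (induction n) (auto intro!: gauss_le_mult gauss_le_1 assms)

lemma fps_value_power:
  assumes "gauss_le A \<rho> M" "vabs x < \<rho>" "fps_value A x a"
  shows "fps_value (A ^ n) x (a ^ n)"
proof (induction n)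
  case (Suc n)
  have "0 \<le> \<rho>" using assms(2) vabs_nonneg[of x] by linarith
  thus ?case
    using fps_value_mult[OF assms(1) gauss_le_power[OF assms(1)] assms(2,3) Suc] by simp
qed (simp add: fps_value_1)

text \<open>
  The double series with terms \<open>a\<^sub>i s\<^sub>i\<^sub>j x\<^sup>j\<close>, where
  \<open>s\<^sub>i\<^sub>j\<close> are the coefficients of \<open>S\<^sup>i\<close>, is triangular
  because \<open>S\<close> has no constant term.
\<close>

lemma fps_value_compose:
  assumes S: "gauss_le S \<rho> \<sigma>" "fps_nth S 0 = 0" and A: "gauss_le A \<sigma> M" and x: "vabs x < \<rho>"
    and y: "fps_value S x y" and t: "fps_value A y v"
  shows "fps_value (A oo S) x v"
proof -
  have \<rho>: "0 < \<rho>" using x vabs_nonneg[of x] by linarith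
  have \<sigma>: "0 \<le> \<sigma>" by (rule gauss_le_nonneg[OF S(1)])
  define t where "t i j = fps_nth A i * (fps_nth (S ^ i) j * x ^ j)" for i j
  have "(\<lambda>j. \<Sum>i\<le>j. t i j) sums v"
  proof (rule sums_interchange)
    fix i j :: nat
    have "vabs (t i j) = vabs (fps_nth A i) * vabs (fps_nth (S ^ i) j * x ^ j)"
      by (simp add: t_def vabs_mult)
    also have "\<dots> \<le> vabs (fps_nth A i) * (\<sigma> ^ i * (vabs x / \<rho>) ^ j)"
      using \<rho> by (intro mult_left_mono gauss_le_term gauss_le_power S) auto
    also have "\<dots> = (vabs (fps_nth A i) * \<sigma> ^ i) * (vabs x / \<rho>) ^ j" by (simp add: mult_ac)
    also have "\<dots> \<le> M * (vabs x / \<rho>) ^ j"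
      using \<rho> by (intro mult_right_mono gauss_leD[OF A]) auto
    finally show "vabs (t i j) \<le> M * (vabs x / \<rho>) ^ j" .
  next
    show "t i j = 0" if "j < i" for i j
      using startsby_zero_power_prefix[OF S(2), of i] that by (simp add: t_def)
    show "t i sums (fps_nth A i * y ^ i)" for i
      using ultrametric_sums_mult_left[OF fps_value_power[OF S(1) x y, of i, unfolded fps_value_def]]
      by (simp add: t_def[abs_def])
    show "(\<lambda>i. fps_nth A i * y ^ i) sums v" using t by (simp add: fps_value_def)
  qed (use x \<rho> in auto)
  moreover have "(\<Sum>i\<le>j. t i j) = fps_nth (A oo S) j * x ^ j" for j
    by (simp add: fps_compose_nth t_def sum_distrib_right atLeast0AtMost mult.assoc)
  ultimately show ?thesis by (simp add: fps_value_def)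
qed

text \<open>
  When the constant term dominates the Gauss norm, the recursion for the coefficients of the inverse
  preserves the bound.
\<close>

lemma gauss_le_inverse:
  assumes "gauss_le Q \<rho> (vabs (fps_nth Q 0))" "fps_nth Q 0 \<noteq> 0" "0 < \<rho>"
  shows "gauss_le (inverse Q) \<rho> (1 / vabs (fps_nth Q 0))"
  unfolding gauss_le_def
proof
  fix n
  define q0 where "q0 = vabs (fps_nth Q 0)"
  have q0: "q0 > 0" using assms(2) by (simp add: q0_def)
  show "vabs (fps_nth (inverse Q) n) * \<rho> ^ n \<le> 1 / vabs (fps_nth Q 0)"
  proof (induction n rule: less_induct)
    case (less n)
    show ?case
    proof (cases "n = 0")
      case True
      thus ?thesis by (simp add: vabs_inverse divide_inverse)
    next
      case False
      hence \<rho>n: "\<rho> ^ n > 0" using assms(3) by auto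
      have "0 = fps_nth (Q * inverse Q) n"
        using inverse_mult_eq_1[OF assms(2)] False by (simp add: mult.commute)
      also have "\<dots> = fps_nth Q 0 * fps_nth (inverse Q) n
          + (\<Sum>i\<in>{1..n}. fps_nth Q i * fps_nth (inverse Q) (n - i))"
        unfolding fps_mult_nth by (simp add: sum.atLeast_Suc_atMost)
      finally have "vabs (fps_nth Q 0 * fps_nth (inverse Q) n) =
          vabs (\<Sum>i\<in>{1..n}. fps_nth Q i * fps_nth (inverse Q) (n - i))"
        by (metis add_eq_0_iff vabs_minus)
      also have "\<dots> \<le> 1 / \<rho> ^ n"
      proof (rule vabs_sum_le)
        fix i assume i: "i \<in> {1..n}"
        have "vabs (fps_nth Q i * fps_nth (inverse Q) (n - i)) * \<rho> ^ n =
            (vabs (fps_nth Q i) * \<rho> ^ i) * (vabs (fps_nth (inverse Q) (n - i)) * \<rho> ^ (n - i))"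
          using i by (simp add: vabs_mult flip: power_add)
        also have "\<dots> \<le> q0 * (1 / q0)"
          unfolding q0_def using less[of "n - i"] i assms gauss_leD[OF assms(1)]
          by (intro mult_mono) auto
        also have "\<dots> = 1" using q0 by simp
        finally show "vabs (fps_nth Q i * fps_nth (inverse Q) (n - i)) \<le> 1 / \<rho> ^ n"
          using \<rho>n by (simp add: pos_le_divide_eq)
      qed (use \<rho>n in auto)
      finally show ?thesis
        using q0 \<rho>n by (simp add: vabs_mult q0_def[symmetric] field_simps)
    qed
  qed
qed

lemma fps_value_inverse:
  assumes "gauss_le Q \<rho> (vabs (fps_nth Q 0))" "fps_nth Q 0 \<noteq> 0" "vabs x < \<rho>" "fps_value Q x y"
  shows "y \<noteq> 0 \<and> fps_value (inverse Q) x (1 / y)"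
proof -
  have \<rho>: "0 < \<rho>" using assms(3) vabs_nonneg[of x] by linarith
  note inv = gauss_le_inverse[OF assms(1,2) \<rho>]
  obtain w where w: "fps_value (inverse Q) x w" using fps_value_exists[OF inv assms(3)] by blast
  have "fps_value (Q * inverse Q) x (y * w)"
    by (rule fps_value_mult[OF assms(1) inv assms(3,4) w])
  hence "y * w = 1"
    using fps_value_unique[OF _ fps_value_1] inverse_mult_eq_1[OF assms(2)] by (simp add: mult.commute)
  moreover from this have "y \<noteq> 0" by auto
  ultimately have "w = 1 / y" by (simp add: eq_divide_eq mult.commute)
  thus ?thesis using w \<open>y \<noteq> 0\<close> by simp
qed

lemma ex_small_radius:
  fixes Q :: "'c::complete_ultrametric_field poly"
  assumes Q0: "poly Q 0 \<noteq> 0" and e: "0 < e" and n: "0 < n"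
  obtains \<rho> where "0 < \<rho>" "\<rho> \<le> e" "\<rho> ^ n / vabs (poly Q 0) \<le> e"
    "gauss_le (fps_of_poly Q) \<rho> (vabs (poly Q 0))"
proof -
  have *: "\<forall>\<^sub>F \<rho> in at_right 0. c * \<rho> ^ i < b" if "i > 0" "b > 0" for b c :: real and i
  proof -
    have "((\<lambda>\<rho>. c * \<rho> ^ i) \<longlongrightarrow> c * 0 ^ i) (at_right (0::real))"
      by (intro tendsto_intros)
    hence "((\<lambda>\<rho>. c * \<rho> ^ i) \<longlongrightarrow> 0) (at_right (0::real))" using that by (simp add: power_0_left)
    from order_tendstoD(2)[OF this that(2)] show ?thesis .
  qed
  have "\<forall>\<^sub>F \<rho> in at_right 0. \<forall>i\<in>{1..Polynomial.degree Q}. vabs (Polynomial.coeff Q i) * \<rho> ^ i < vabs (poly Q 0)"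
    using Q0 by (intro eventually_ball_finite) (auto intro!: *)
  moreover have "\<forall>\<^sub>F \<rho> in at_right 0. 1 * \<rho> ^ 1 < e" using e by (intro *) auto
  moreover have "\<forall>\<^sub>F \<rho> in at_right 0. (1 / vabs (poly Q 0)) * \<rho> ^ n < e" using e n by (intro *) auto
  moreover have "\<forall>\<^sub>F \<rho> in at_right 0. (0::real) < \<rho>" by (simp add: eventually_at_right_less)
  ultimately have "\<forall>\<^sub>F \<rho> in at_right 0. (\<forall>i\<in>{1..Polynomial.degree Q}. vabs (Polynomial.coeff Q i) * \<rho> ^ i < vabs (poly Q 0))
      \<and> \<rho> < e \<and> \<rho> ^ n / vabs (poly Q 0) < e \<and> 0 < \<rho>"
    by eventually_elim auto
  then obtain \<rho> where \<rho>: "\<forall>i\<in>{1..Polynomial.degree Q}. vabs (Polynomial.coeff Q i) * \<rho> ^ i < vabs (poly Q 0)"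
      "\<rho> < e" "\<rho> ^ n / vabs (poly Q 0) < e" "0 < \<rho>"
    using eventually_happens[of _ "at_right (0::real)"] by auto
  have "vabs (Polynomial.coeff Q i) * \<rho> ^ i \<le> vabs (poly Q 0)" for i
  proof (cases "i = 0 \<or> i > Polynomial.degree Q")
    case True
    thus ?thesis by (auto simp: poly_0_coeff_0 coeff_eq_0)
  next
    case False
    thus ?thesis using \<rho>(1) by (intro less_imp_le) auto
  qed
  thus ?thesis using that[of \<rho>] \<rho> by (auto simp: gauss_le_def)
qed

text \<open>
  Division with remainder by \<open>X\<^sup>n - u Q\<close>. If \<open>v\<^sup>n = u Q(v)\<close>, then
  \<open>F(v) = p(v) + u G(v)\<close>, where \<open>p\<close> consists of the terms of \<open>F\<close>
  of degree less than \<open>n\<close> and \<open>G\<close> is the following series.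
\<close>

definition division_step :: "nat \<Rightarrow> 'c::complete_ultrametric_field poly \<Rightarrow> 'c fps \<Rightarrow> 'c fps" where
  "division_step n Q F = fps_of_poly Q * fps_shift n F"

lemma gauss_le_shift:
  assumes "gauss_le F \<rho> M" "0 < \<rho>"
  shows "gauss_le (fps_shift n F) \<rho> (M / \<rho> ^ n)"
  unfolding gauss_le_def
proof
  fix i
  have "vabs (fps_nth F (i + n)) * \<rho> ^ (i + n) \<le> M" by (rule gauss_leD[OF assms(1)])
  thus "vabs (fps_nth (fps_shift n F) i) * \<rho> ^ i \<le> M / \<rho> ^ n"
    using assms(2) by (simp add: power_add pos_le_divide_eq mult.assoc)
qed

lemma gauss_le_division_step:
  assumes "gauss_le F \<rho> M" "gauss_le (fps_of_poly Q) \<rho> N" "0 < \<rho>"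
  shows "gauss_le (division_step n Q F) \<rho> (N * (M / \<rho> ^ n))"
  unfolding division_step_def
proof (rule gauss_le_mult)
  show "gauss_le (fps_shift n F) \<rho> (M / \<rho> ^ n)"
    by (rule gauss_le_shift[OF assms(1,3)])
qed (use assms in auto)

lemma division_step_value:
  assumes F: "gauss_le F \<rho> M" and Q: "gauss_le (fps_of_poly Q) \<rho> N" and v: "vabs v < \<rho>"
    and eq: "v ^ n = u * poly Q v" and y: "fps_value F v y"
  obtains w where "fps_value (division_step n Q F) v w"
    "y = (\<Sum>i<n. fps_nth F i * v ^ i) + u * w"
proof -
  have \<rho>: "0 < \<rho>" using v vabs_nonneg[of v] by linarith
  have S: "gauss_le (fps_shift n F) \<rho> (M / \<rho> ^ n)"
    by (rule gauss_le_shift[OF F \<rho>])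
  obtain s where s: "fps_value (fps_shift n F) v s" using fps_value_exists[OF S v] by blast
  have "(\<lambda>j. if j < n then 0 else v ^ n * (fps_nth (fps_shift n F) (j - n) * v ^ (j - n))) sums (v ^ n * s)"
    by (rule sums_shift_zeros[OF ultrametric_sums_mult_left[OF s[unfolded fps_value_def]]])
  moreover have "(\<lambda>j. if j \<in> {..<n} then fps_nth F j * v ^ j else 0) sums (\<Sum>j<n. fps_nth F j * v ^ j)"
    by (rule sums_If_finite_set) simp
  ultimately have "(\<lambda>j. (if j \<in> {..<n} then fps_nth F j * v ^ j else 0) +
      (if j < n then 0 else v ^ n * (fps_nth (fps_shift n F) (j - n) * v ^ (j - n))))
      sums ((\<Sum>j<n. fps_nth F j * v ^ j) + v ^ n * s)"
    using sums_add by blast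
  also have "(\<lambda>j. (if j \<in> {..<n} then fps_nth F j * v ^ j else 0) +
      (if j < n then 0 else v ^ n * (fps_nth (fps_shift n F) (j - n) * v ^ (j - n)))) =
      (\<lambda>j. fps_nth F j * v ^ j)"
    by (rule ext) (auto simp: mult_ac simp flip: power_add)
  finally have "y = (\<Sum>j<n. fps_nth F j * v ^ j) + v ^ n * s"
    using y unfolding fps_value_def using sums_unique2 by blast
  moreover have "fps_value (division_step n Q F) v (poly Q v * s)"
    unfolding division_step_def by (rule fps_value_mult[OF Q S v fps_value_poly s])
  ultimately show ?thesis using that[of "poly Q v * s"] eq by (simp add: mult.assoc)
qed

text \<open>
  Iterating the division gives \<open>F(v) = \<Sum>\<^sub>i g\<^sub>i(u) v\<^sup>i\<close> with
  \<open>n\<close> power series \<open>g\<^sub>i\<close>. If this has the same value \<open>y\<close>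
  for \<open>n\<close> different \<open>v\<close> that belong to the same \<open>u\<close>, then the
  polynomial \<open>\<Sum>\<^sub>i g\<^sub>i(u) X\<^sup>i - y\<close> of degree less than
  \<open>n\<close> has \<open>n\<close> roots; hence it vanishes and \<open>y = g\<^sub>0(u)\<close>.
\<close>

lemma descent_of_parameter:
  fixes F :: "'c::complete_ultrametric_field fps"
  assumes F: "gauss_le F \<rho> M" and Q: "gauss_le (fps_of_poly Q) \<rho> (vabs (poly Q 0))"
    and Q0: "poly Q 0 \<noteq> 0" and n: "0 < n"
    and V: "finite V" "card V = n" "\<And>v. v \<in> V \<Longrightarrow> vabs v < \<rho>" "\<And>v. v \<in> V \<Longrightarrow> v ^ n = u * poly Q v"
      "\<And>v. v \<in> V \<Longrightarrow> fps_value F v y"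
  shows "(\<lambda>m. fps_nth ((division_step n Q ^^ m) F) 0 * u ^ m) sums y"
proof -
  define G where "G m = (division_step n Q ^^ m) F" for m
  obtain v0 where v0: "v0 \<in> V" using V n by (metis card_gt_0_iff ex_in_conv)
  have \<rho>: "0 < \<rho>" using V(3)[OF v0] vabs_nonneg[of v0] by linarith
  define \<tau> where "\<tau> = vabs (poly Q 0) / \<rho> ^ n"
  have \<tau>: "0 < \<tau>" using Q0 \<rho> by (simp add: \<tau>_def)
  have G_Suc: "G (Suc m) = division_step n Q (G m)" for m by (simp add: G_def)
  have G_le: "gauss_le (G m) \<rho> (M * \<tau> ^ m)" for m
  proof (induction m)
    case (Suc m)
    from gauss_le_division_step[OF this Q \<rho>, of n] show ?case
      by (simp add: G_Suc \<tau>_def mult_ac)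
  qed (use F in \<open>simp add: G_def\<close>)
  have u_small: "vabs u * \<tau> < 1"
  proof -
    have "vabs (poly Q v0) = vabs (poly Q 0)"
    proof -
      have "gauss_le (fps_of_poly Q) \<rho> (vabs (fps_nth (fps_of_poly Q) 0))"
        using Q by (simp add: poly_0_coeff_0)
      hence inv: "poly Q v0 \<noteq> 0 \<and> fps_value (inverse (fps_of_poly Q)) v0 (1 / poly Q v0)"
        using Q0 fps_value_poly V(3)[OF v0] by (intro fps_value_inverse) (auto simp: poly_0_coeff_0)
      have "gauss_le (inverse (fps_of_poly Q)) \<rho> (1 / vabs (fps_nth (fps_of_poly Q) 0))"
        using Q Q0 \<rho> by (intro gauss_le_inverse) (auto simp: poly_0_coeff_0)
      hence "vabs (1 / poly Q v0) \<le> 1 / vabs (poly Q 0)"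
        using inv V(3)[OF v0] \<rho> fps_value_bound[of "inverse (fps_of_poly Q)" \<rho> _ v0]
        by (simp add: poly_0_coeff_0)
      hence "vabs (poly Q 0) \<le> vabs (poly Q v0)"
        using inv Q0 by (simp add: vabs_divide field_simps)
      moreover have "vabs (poly Q v0) \<le> vabs (poly Q 0)"
        using fps_value_bound[OF Q _ \<rho> fps_value_poly] V(3)[OF v0] by auto
      ultimately show ?thesis by simp
    qed
    moreover have "vabs v0 ^ n = vabs u * vabs (poly Q v0)"
      using V(4)[OF v0] by (metis vabs_mult vabs_power)
    ultimately have "vabs u * \<tau> = (vabs v0 / \<rho>) ^ n"
      by (simp add: \<tau>_def power_divide)
    also have "\<dots> < 1" using power_strict_mono[of "vabs v0 / \<rho>" 1 n] V(3)[OF v0] \<rho> n by simp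
    finally show ?thesis .
  qed
  have g_ex: "\<exists>g. (\<lambda>m. fps_nth (G m) i * u ^ m) sums g" for i
  proof -
    have "(\<lambda>m. fps_nth (G m) i * u ^ m) \<longlonglongrightarrow> 0"
    proof (rule tendsto_vabs_squeeze)
      show "(\<lambda>m. M / \<rho> ^ i * (vabs u * \<tau>) ^ m) \<longlonglongrightarrow> 0"
        using u_small \<tau> by (intro tendsto_mult_right_zero LIMSEQ_realpow_zero) auto
      fix m
      have "vabs (fps_nth (G m) i) \<le> M * \<tau> ^ m / \<rho> ^ i"
        using gauss_leD[OF G_le, of m i] \<rho> by (simp add: pos_le_divide_eq)
      hence "vabs (fps_nth (G m) i) * vabs u ^ m \<le> M * \<tau> ^ m / \<rho> ^ i * vabs u ^ m"
        by (intro mult_right_mono) auto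
      thus "vabs (fps_nth (G m) i * u ^ m - 0) \<le> M / \<rho> ^ i * (vabs u * \<tau>) ^ m"
        by (simp add: vabs_mult vabs_power power_mult_distrib mult_ac)
    qed
    thus ?thesis using ultrametric_summable unfolding summable_def by blast
  qed
  then obtain g where g: "\<And>i. (\<lambda>m. fps_nth (G m) i * u ^ m) sums g i" by metis
  have y_eq: "y = (\<Sum>i<n. g i * v ^ i)" if v: "v \<in> V" for v
  proof -
    have "\<exists>w. fps_value (G K) v w \<and> y = (\<Sum>m<K. u ^ m * (\<Sum>i<n. fps_nth (G m) i * v ^ i)) + u ^ K * w" for K
    proof (induction K)
      case 0
      show ?case using V(5)[OF v] by (auto simp: G_def)
    next
      case (Suc K)
      then obtain w where w: "fps_value (G K) v w"
        "y = (\<Sum>m<K. u ^ m * (\<Sum>i<n. fps_nth (G m) i * v ^ i)) + u ^ K * w" by blast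
      obtain w' where w': "fps_value (G (Suc K)) v w'" "w = (\<Sum>i<n. fps_nth (G K) i * v ^ i) + u * w'"
        unfolding G_Suc by (rule division_step_value[OF G_le Q V(3)[OF v] V(4)[OF v] w(1)])
      have "y = (\<Sum>m<Suc K. u ^ m * (\<Sum>i<n. fps_nth (G m) i * v ^ i)) + u ^ Suc K * w'"
        unfolding w(2) w'(2) by (simp add: algebra_simps)
      thus ?case using w'(1) by blast
    qed
    hence "\<forall>K. \<exists>w. fps_value (G K) v w \<and> y = (\<Sum>m<K. u ^ m * (\<Sum>i<n. fps_nth (G m) i * v ^ i)) + u ^ K * w"
      by (rule allI)
    from choice[OF this] obtain w where w: "fps_value (G K) v (w K)"
      "y = (\<Sum>m<K. u ^ m * (\<Sum>i<n. fps_nth (G m) i * v ^ i)) + u ^ K * w K" for K by blast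
    have "(\<lambda>K. u ^ K * w K) \<longlonglongrightarrow> 0"
    proof (rule tendsto_vabs_squeeze)
      show "(\<lambda>K. M * (vabs u * \<tau>) ^ K) \<longlonglongrightarrow> 0"
        using u_small \<tau> by (intro tendsto_mult_right_zero LIMSEQ_realpow_zero) auto
      fix K
      have "vabs (w K) \<le> M * \<tau> ^ K"
        using fps_value_bound[OF G_le _ \<rho> w(1)] V(3)[OF v] by auto
      hence "vabs u ^ K * vabs (w K) \<le> vabs u ^ K * (M * \<tau> ^ K)"
        by (intro mult_left_mono) auto
      thus "vabs (u ^ K * w K - 0) \<le> M * (vabs u * \<tau>) ^ K"
        by (simp add: vabs_mult vabs_power power_mult_distrib mult_ac)
    qed
    hence "(\<lambda>K. y - u ^ K * w K) \<longlonglongrightarrow> y - 0" by (intro tendsto_diff tendsto_const)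
    moreover have eq: "y - u ^ K * w K = (\<Sum>i<n. (\<Sum>m<K. fps_nth (G m) i * u ^ m) * v ^ i)" for K
    proof -
      have "y - u ^ K * w K = (\<Sum>m<K. u ^ m * (\<Sum>i<n. fps_nth (G m) i * v ^ i))"
        using w(2)[of K] by (simp add: algebra_simps)
      also have "\<dots> = (\<Sum>m<K. \<Sum>i<n. fps_nth (G m) i * u ^ m * v ^ i)"
        by (simp add: sum_distrib_left mult_ac)
      also have "\<dots> = (\<Sum>i<n. \<Sum>m<K. fps_nth (G m) i * u ^ m * v ^ i)" by (rule sum.swap)
      finally show ?thesis by (simp add: sum_distrib_right)
    qed
    moreover have "(\<lambda>K. \<Sum>i<n. (\<Sum>m<K. fps_nth (G m) i * u ^ m) * v ^ i) \<longlonglongrightarrow> (\<Sum>i<n. g i * v ^ i)"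
      using g unfolding sums_def by (intro tendsto_sum tendsto_mult tendsto_const)
    ultimately show ?thesis unfolding eq diff_zero using LIMSEQ_unique by blast
  qed
  define p where "p = (\<Sum>i<n. Polynomial.monom (g i) i) - [:y:]"
  have deg: "Polynomial.degree p < n"
    unfolding p_def using n
    by (intro degree_diff_less degree_sum_less) (auto intro: le_less_trans[OF degree_monom_le])
  have "p = 0"
  proof (rule ccontr)
    assume "p \<noteq> 0"
    have "poly p v = 0" if "v \<in> V" for v
      using y_eq[OF that] by (simp add: p_def poly_sum poly_monom)
    hence "V \<subseteq> {x. poly p x = 0}" by auto
    hence "card V \<le> card {x. poly p x = 0}" using poly_roots_finite[OF \<open>p \<noteq> 0\<close>] by (rule card_mono[rotated])
    also have "\<dots> \<le> Polynomial.degree p" by (rule card_poly_roots_bound[OF \<open>p \<noteq> 0\<close>])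
    finally show False using deg V(2) by simp
  qed
  hence "0 = Polynomial.coeff p 0" by simp
  also have "\<dots> = g 0 - y" using n by (simp add: p_def coeff_sum sum.delta)
  finally have "y = g 0" by simp
  thus ?thesis using g[of 0] by (simp add: G_def)
qed


section \<open>Expansions at infinity with respect to different lattices\<close>

context drinfeld_setting
begin

lemma has_u_expansion_add:
  assumes "has_u_expansion \<iota> \<Lambda> f a" "has_u_expansion \<iota> \<Lambda> g b"
  shows "has_u_expansion \<iota> \<Lambda> (\<lambda>z. f z + g z) (\<lambda>n. a n + b n)"
proof -
  obtain C D where C: "C > 0" "\<And>z. im_abs \<iota> z \<ge> C \<Longrightarrow> (\<lambda>n. a n * (1 / lattice_exp \<iota> \<Lambda> z) ^ n) sums f z"
    and D: "D > 0" "\<And>z. im_abs \<iota> z \<ge> D \<Longrightarrow> (\<lambda>n. b n * (1 / lattice_exp \<iota> \<Lambda> z) ^ n) sums g z"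
    using assms unfolding has_u_expansion_def by metis
  have "(\<lambda>n. (a n + b n) * (1 / lattice_exp \<iota> \<Lambda> z) ^ n) sums (f z + g z)"
    if "im_abs \<iota> z \<ge> max C D" for z
    using sums_add[OF C(2)[of z] D(2)[of z]] that by (simp add: distrib_right)
  thus ?thesis unfolding has_u_expansion_def using C(1) by (intro exI[of _ "max C D"]) auto
qed

lemma has_u_expansion_scale:
  assumes "has_u_expansion \<iota> \<Lambda> f a"
  shows "has_u_expansion \<iota> \<Lambda> (\<lambda>z. c * f z) (\<lambda>n. c * a n)"
proof -
  obtain C where C: "C > 0" "\<And>z. im_abs \<iota> z \<ge> C \<Longrightarrow> (\<lambda>n. a n * (1 / lattice_exp \<iota> \<Lambda> z) ^ n) sums f z"
    using assms unfolding has_u_expansion_def by metis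
  have "(\<lambda>n. c * a n * (1 / lattice_exp \<iota> \<Lambda> z) ^ n) sums (c * f z)" if "im_abs \<iota> z \<ge> C" for z
    using ultrametric_sums_mult_left[OF C(2)[OF that], of c] by (simp add: mult.assoc)
  thus ?thesis unfolding has_u_expansion_def using C(1) by blast
qed

lemma has_u_expansion_zero: "has_u_expansion \<iota> \<Lambda> (\<lambda>z. 0) (\<lambda>n. 0)"
  unfolding has_u_expansion_def by (intro exI[of _ 1]) auto

text \<open>
  The zeros of \<open>e\<^sub>\<Lambda>\<close> lie in \<open>K\<^sub>\<infinity>\<close>, and
  \<open>|e\<^sub>\<Lambda>(z)|\<close> is at least \<open>|z|\<^sub>i\<close>; hence the parameter
  \<open>1/e\<^sub>\<Lambda>\<close> is small near the cusp.
\<close>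

lemma lattice_exp_nonzero:
  assumes "discrete_lattice \<Lambda>" "im_abs \<iota> z > 0"
  shows "lattice_exp \<iota> \<Lambda> z \<noteq> 0"
  using vabs_lattice_exp_ge_im[OF assms(1), of z] assms(2) by auto

lemma vabs_parameter_le:
  assumes "discrete_lattice \<Lambda>" "im_abs \<iota> z \<ge> C" "C > 0"
  shows "vabs (1 / lattice_exp \<iota> \<Lambda> z) \<le> 1 / C"
  using vabs_lattice_exp_ge_im[OF assms(1), of z] assms(2,3)
  by (simp add: vabs_divide frac_le)

text \<open>
  The terms of a convergent series are bounded, so convergence at a single point yields a bound for the
  Gauss norm.
\<close>

lemma has_u_expansion_gauss:
  assumes L: "discrete_lattice \<Lambda>" and f: "has_u_expansion \<iota> \<Lambda> f a"
  obtains C \<rho> M where "C > 0" "\<rho> > 0" "gauss_le (Abs_fps a) \<rho> M"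
    "\<And>z. im_abs \<iota> z \<ge> C \<Longrightarrow> fps_value (Abs_fps a) (1 / lattice_exp \<iota> \<Lambda> z) (f z)"
proof -
  obtain C where C: "C > 0" "\<And>z. im_abs \<iota> z \<ge> C \<Longrightarrow> (\<lambda>n. a n * (1 / lattice_exp \<iota> \<Lambda> z) ^ n) sums f z"
    using f unfolding has_u_expansion_def by metis
  obtain z1 where z1: "C \<le> im_abs \<iota> z1" using ex_im_abs_ge by blast
  define \<rho> where "\<rho> = vabs (1 / lattice_exp \<iota> \<Lambda> z1)"
  have "\<rho> > 0" unfolding \<rho>_def using lattice_exp_nonzero[OF L, of z1] z1 C(1) by simp
  obtain M where "\<And>n. vabs (a n * (1 / lattice_exp \<iota> \<Lambda> z1) ^ n) \<le> M"
    using ultrametric_sums_bounded[OF C(2)[OF z1]] by blast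
  hence "gauss_le (Abs_fps a) \<rho> M"
    by (simp add: gauss_le_def \<rho>_def vabs_mult vabs_power)
  thus ?thesis using that[of C \<rho> M] C \<open>\<rho> > 0\<close> by (simp add: fps_value_def)
qed

text \<open>
  With \<open>u = 1/e\<^sub>\<Lambda>\<close>, \<open>v = 1/e\<^sub>\<Lambda>'\<close> and \<open>n =
  [\<Lambda> : \<Lambda>']\<close>, the product formula for \<open>e\<^sub>\<Lambda>\<close> reads
  \<open>v\<^sup>n = u Q(v)\<close> for the following polynomial, whose constant term does not vanish.
\<close>

definition index_poly :: "'a fls set \<Rightarrow> 'a fls set \<Rightarrow> 'c poly" where
  "index_poly \<Lambda>' R = (\<Prod>b\<in>R - {0}. [:- (1 / lattice_exp \<iota> \<Lambda>' (\<iota> b)), 1:])"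

lemma lattice_exp_rep_nonzero:
  assumes "discrete_lattice \<Lambda>'" "coset_system \<Lambda> \<Lambda>' R" "b \<in> R - {0}"
  shows "lattice_exp \<iota> \<Lambda>' (\<iota> b) \<noteq> 0"
proof -
  have "b \<notin> \<Lambda>'"
    using coset_system_diff[OF assms(2), of b 0] assms by (auto simp: coset_system_def discrete_lattice_def)
  thus ?thesis unfolding lattice_exp_eq_0_iff[OF assms(1)] by auto
qed

lemma index_poly_0:
  assumes "discrete_lattice \<Lambda>'" "coset_system \<Lambda> \<Lambda>' R"
  shows "poly (index_poly \<Lambda>' R) 0 \<noteq> 0"
  using lattice_exp_rep_nonzero[OF assms] assms(2)
  by (auto simp: index_poly_def poly_prod prod_zero_iff coset_system_def)

lemma parameter_relation:
  assumes L: "discrete_lattice \<Lambda>" "discrete_lattice \<Lambda>'" "\<Lambda>' \<subseteq> \<Lambda>" and R: "coset_system \<Lambda> \<Lambda>' R"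
    and z: "im_abs \<iota> z > 0"
  shows "(1 / lattice_exp \<iota> \<Lambda>' z) ^ card R =
    1 / lattice_exp \<iota> \<Lambda> z * poly (index_poly \<Lambda>' R) (1 / lattice_exp \<iota> \<Lambda>' z)"
proof -
  define e where "e = lattice_exp \<iota> \<Lambda>' z"
  have e0: "e \<noteq> 0" unfolding e_def by (rule lattice_exp_nonzero[OF L(2) z])
  have finR: "finite R" "0 \<in> R" using R by (auto simp: coset_system_def)
  hence card: "card R = Suc (card (R - {0}))" by (metis card.remove)
  have "lattice_exp \<iota> \<Lambda> z = e * (\<Prod>b\<in>R - {0}. 1 - e / lattice_exp \<iota> \<Lambda>' (\<iota> b))"
    unfolding e_def by (rule lattice_exp_sublattice[OF L R])
  also have "(\<Prod>b\<in>R - {0}. 1 - e / lattice_exp \<iota> \<Lambda>' (\<iota> b)) =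
      (\<Prod>b\<in>R - {0}. e * (1 / e - 1 / lattice_exp \<iota> \<Lambda>' (\<iota> b)))"
    using e0 by (intro prod.cong) (auto simp: right_diff_distrib)
  also have "\<dots> = e ^ card (R - {0}) * poly (index_poly \<Lambda>' R) (1 / e)"
    by (simp add: prod.distrib index_poly_def poly_prod)
  finally have "lattice_exp \<iota> \<Lambda> z = e ^ card R * poly (index_poly \<Lambda>' R) (1 / e)"
    by (simp add: card mult.assoc)
  moreover have "lattice_exp \<iota> \<Lambda> z \<noteq> 0" by (rule lattice_exp_nonzero[OF L(1) z])
  ultimately show ?thesis unfolding e_def[symmetric] using e0
    by (simp add: power_one_over)
qed

text \<open>
  As \<open>Q(0) \<noteq> 0\<close>, the relation \<open>u = v\<^sup>n/Q(v)\<close> presents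
  \<open>u\<close> as a power series in \<open>v\<close> without constant term, which is substituted
  into the expansion.
\<close>

lemma has_u_expansion_sublattice:
  assumes L: "discrete_lattice \<Lambda>" "discrete_lattice \<Lambda>'" "\<Lambda>' \<subseteq> \<Lambda>" and R: "coset_system \<Lambda> \<Lambda>' R"
    and f: "has_u_expansion \<iota> \<Lambda> f a"
  shows "\<exists>b. has_u_expansion \<iota> \<Lambda>' f b \<and> b 0 = a 0"
proof -
  obtain C \<sigma> M where C: "C > 0" and \<sigma>: "\<sigma> > 0" and A: "gauss_le (Abs_fps a) \<sigma> M"
    and val: "\<And>z. im_abs \<iota> z \<ge> C \<Longrightarrow> fps_value (Abs_fps a) (1 / lattice_exp \<iota> \<Lambda> z) (f z)"
    using has_u_expansion_gauss[OF L(1) f] by metis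
  define Q where "Q = index_poly \<Lambda>' R"
  define n where "n = card R"
  have n: "n > 0" using R by (auto simp: n_def coset_system_def card_gt_0_iff)
  have Q0: "poly Q 0 \<noteq> 0" unfolding Q_def by (rule index_poly_0[OF L(2) R])
  obtain \<rho> where \<rho>: "0 < \<rho>" "\<rho> \<le> \<sigma>" "\<rho> ^ n / vabs (poly Q 0) \<le> \<sigma>"
    "gauss_le (fps_of_poly Q) \<rho> (vabs (poly Q 0))"
    using ex_small_radius[OF Q0 \<sigma> n] by blast
  have Qg: "gauss_le (fps_of_poly Q) \<rho> (vabs (fps_nth (fps_of_poly Q) 0))" "fps_nth (fps_of_poly Q) 0 \<noteq> 0"
    using \<rho>(4) Q0 by (simp_all add: poly_0_coeff_0)
  define S where "S = fps_X ^ n * inverse (fps_of_poly Q)"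
  have X: "gauss_le (fps_X ^ n :: 'c fps) \<rho> (\<rho> ^ n)"
    using \<rho>(1) by (auto simp: gauss_le_def)
  have S: "gauss_le S \<rho> (\<rho> ^ n / vabs (poly Q 0))"
    using gauss_le_mult[OF X gauss_le_inverse[OF Qg \<rho>(1)]] \<rho>(1) by (simp add: S_def poly_0_coeff_0)
  have S0: "fps_nth S 0 = 0" using n by (simp add: S_def)
  have A': "gauss_le (Abs_fps a) (\<rho> ^ n / vabs (poly Q 0)) M"
    by (rule gauss_le_mono_radius[OF A _ \<rho>(3)]) (use \<rho>(1) in simp)
  define b where "b = fps_nth (Abs_fps a oo S)"
  define D where "D = max C (2 / \<rho>)"
  have D: "D > 0" "D \<ge> C" "1 / D < \<rho>"
  proof -
    show "D > 0" "D \<ge> C" using C by (auto simp: D_def)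
    have "1 / D \<le> 1 / (2 / \<rho>)" using \<rho>(1) by (intro divide_left_mono) (auto simp: D_def C less_max_iff_disj)
    thus "1 / D < \<rho>" using \<rho>(1) by simp
  qed
  have "(\<lambda>m. b m * (1 / lattice_exp \<iota> \<Lambda>' z) ^ m) sums f z" if z: "im_abs \<iota> z \<ge> D" for z
  proof -
    define v where "v = 1 / lattice_exp \<iota> \<Lambda>' z"
    define u where "u = 1 / lattice_exp \<iota> \<Lambda> z"
    have v: "vabs v < \<rho>" using vabs_parameter_le[OF L(2) z D(1)] D(3) by (simp add: v_def)
    have rel: "v ^ n = u * poly Q v"
      using parameter_relation[OF L R, of z] z D(1) by (simp add: v_def u_def Q_def n_def)
    have inv: "poly Q v \<noteq> 0 \<and> fps_value (inverse (fps_of_poly Q)) v (1 / poly Q v)"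
      by (rule fps_value_inverse[OF Qg v fps_value_poly])
    have "fps_value (fps_X ^ n) v (v ^ n)"
      using fps_value_poly[of "Polynomial.monom 1 n" v] by (simp add: fps_of_poly_monom poly_monom)
    hence "fps_value S v (v ^ n * (1 / poly Q v))"
      unfolding S_def using inv
      by (intro fps_value_mult[OF X gauss_le_inverse[OF Qg \<rho>(1)] v]) auto
    hence "fps_value S v u" using rel inv by simp
    moreover have "fps_value (Abs_fps a) u (f z)" using val[of z] z D(2) by (simp add: u_def)
    ultimately have "fps_value (Abs_fps a oo S) v (f z)"
      by (rule fps_value_compose[OF S S0 A' v])
    thus ?thesis by (simp add: fps_value_def b_def v_def)
  qed
  hence "has_u_expansion \<iota> \<Lambda>' f b" unfolding has_u_expansion_def using D(1) by blast
  moreover have "b 0 = a 0" by (simp add: b_def fps_compose_nth)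
  ultimately show ?thesis by blast
qed

text \<open>
  If \<open>b\<close> runs through representatives of \<open>\<Lambda>/\<Lambda>'\<close>, the
  \<open>n\<close> values \<open>v(z + b)\<close> are distinct and belong to the same \<open>u\<close>,
  and by assumption \<open>f\<close> has the same value at all these points.
\<close>

lemma has_u_expansion_superlattice:
  assumes L: "discrete_lattice \<Lambda>" "discrete_lattice \<Lambda>'" "\<Lambda>' \<subseteq> \<Lambda>" and R: "coset_system \<Lambda> \<Lambda>' R"
    and f: "has_u_expansion \<iota> \<Lambda>' f a"
    and inv: "\<And>z b. z \<in> Omega \<iota> \<Longrightarrow> b \<in> \<Lambda> \<Longrightarrow> f (z + \<iota> b) = f z"
  shows "\<exists>b. has_u_expansion \<iota> \<Lambda> f b \<and> b 0 = a 0"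
proof -
  obtain C \<sigma> M where C: "C > 0" and \<sigma>: "\<sigma> > 0" and A: "gauss_le (Abs_fps a) \<sigma> M"
    and val: "\<And>z. im_abs \<iota> z \<ge> C \<Longrightarrow> fps_value (Abs_fps a) (1 / lattice_exp \<iota> \<Lambda>' z) (f z)"
    using has_u_expansion_gauss[OF L(2) f] by metis
  define Q where "Q = index_poly \<Lambda>' R"
  define n where "n = card R"
  have n: "n > 0" using R by (auto simp: n_def coset_system_def card_gt_0_iff)
  have Q0: "poly Q 0 \<noteq> 0" unfolding Q_def by (rule index_poly_0[OF L(2) R])
  obtain \<rho> where \<rho>: "0 < \<rho>" "\<rho> \<le> \<sigma>" "\<rho> ^ n / vabs (poly Q 0) \<le> \<sigma>"
    "gauss_le (fps_of_poly Q) \<rho> (vabs (poly Q 0))"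
    using ex_small_radius[OF Q0 \<sigma> n] by blast
  have A': "gauss_le (Abs_fps a) \<rho> M"
    by (rule gauss_le_mono_radius[OF A _ \<rho>(2)]) (use \<rho>(1) in simp)
  define b where "b m = fps_nth ((division_step n Q ^^ m) (Abs_fps a)) 0" for m
  define D where "D = max C (2 / \<rho>)"
  have D: "D > 0" "D \<ge> C" "1 / D < \<rho>"
  proof -
    show "D > 0" "D \<ge> C" using C by (auto simp: D_def)
    have "1 / D \<le> 1 / (2 / \<rho>)" using \<rho>(1) by (intro divide_left_mono) (auto simp: D_def C less_max_iff_disj)
    thus "1 / D < \<rho>" using \<rho>(1) by simp
  qed
  have "(\<lambda>m. b m * (1 / lattice_exp \<iota> \<Lambda> z) ^ m) sums f z" if z: "im_abs \<iota> z \<ge> D" for z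
    unfolding b_def
  proof (rule descent_of_parameter[OF A' \<rho>(4) Q0 n])
    define v where "v c = 1 / lattice_exp \<iota> \<Lambda>' (z + \<iota> c)" for c
    have R\<Lambda>: "c \<in> \<Lambda>" if "c \<in> R" for c using R that by (auto simp: coset_system_def)
    have im: "im_abs \<iota> (z + \<iota> c) \<ge> D" for c using z by simp
    have inj: "inj_on v R"
    proof (rule inj_onI)
      fix c d assume cd: "c \<in> R" "d \<in> R" "v c = v d"
      hence "lattice_exp \<iota> \<Lambda>' (z + \<iota> c) = lattice_exp \<iota> \<Lambda>' (z + \<iota> d)"
        by (simp add: v_def)
      hence "lattice_exp \<iota> \<Lambda>' (\<iota> (c - d)) = 0"
        by (simp add: lattice_exp_add[OF L(2)] lattice_exp_diff[OF L(2)] iota_diff)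
      hence "c - d \<in> \<Lambda>'" unfolding lattice_exp_eq_0_iff[OF L(2)] by auto
      thus "c = d" using coset_system_diff[OF R _ cd(1,2)] L(2) by (auto simp: discrete_lattice_def)
    qed
    show "finite (v ` R)" using R by (auto simp: coset_system_def)
    show "card (v ` R) = n" using card_image[OF inj] by (simp add: n_def)
    fix w assume "w \<in> v ` R"
    then obtain c where c: "c \<in> R" "w = v c" by blast
    show "vabs w < \<rho>"
      using vabs_parameter_le[OF L(2) im D(1), of c] D(3) by (simp add: v_def c)
    show "w ^ n = 1 / lattice_exp \<iota> \<Lambda> z * poly Q w"
      using parameter_relation[OF L R, of "z + \<iota> c"] im[of c] D(1)
      by (simp add: v_def c Q_def n_def lattice_exp_periodic[OF L(1) R\<Lambda>[OF c(1)]])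
    have "z \<in> Omega \<iota>" using z D(1) by (simp add: Omega_iff_im_abs)
    thus "fps_value (Abs_fps a) w (f z)"
      using val[of "z + \<iota> c"] im[of c] D(2) inv[OF _ R\<Lambda>[OF c(1)]] by (simp add: v_def c)
  qed
  hence "has_u_expansion \<iota> \<Lambda> f b" unfolding has_u_expansion_def using D(1) by blast
  moreover have "b 0 = a 0" by (simp add: b_def)
  ultimately show ?thesis by blast
qed

end

section \<open>The slash operators\<close>

lemma mat2_nth [simp]:
  "mat2 a b c d $ 1 $ 1 = a" "mat2 a b c d $ 1 $ 2 = b"
  "mat2 a b c d $ 2 $ 1 = c" "mat2 a b c d $ 2 $ 2 = d"
  by (simp_all add: mat2_def)

lemma matrix_2_eqI:
  fixes A B :: "'b ^ 2 ^ 2"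
  assumes "A $ 1 $ 1 = B $ 1 $ 1" "A $ 1 $ 2 = B $ 1 $ 2" "A $ 2 $ 1 = B $ 2 $ 1" "A $ 2 $ 2 = B $ 2 $ 2"
  shows "A = B"
  using assms by (simp add: vec_eq_iff forall_2)

lemma matrix_mult_2_nth:
  fixes A B :: "'b::semiring_1 ^ 2 ^ 2"
  shows "(A ** B) $ i $ l = A $ i $ 1 * B $ 1 $ l + A $ i $ 2 * B $ 2 $ l"
  by (simp add: matrix_matrix_mult_def sum_2)

lemma mat_1_2_nth [simp]:
  "(mat 1 :: 'b::semiring_1 ^ 2 ^ 2) $ 1 $ 1 = 1" "(mat 1 :: 'b::semiring_1 ^ 2 ^ 2) $ 1 $ 2 = 0"
  "(mat 1 :: 'b::semiring_1 ^ 2 ^ 2) $ 2 $ 1 = 0" "(mat 1 :: 'b::semiring_1 ^ 2 ^ 2) $ 2 $ 2 = 1"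
  by (simp_all add: mat_def)

context drinfeld_setting
begin

definition automorphy :: "'a fls ^ 2 ^ 2 \<Rightarrow> 'c \<Rightarrow> 'c" where
  "automorphy \<gamma> z = \<iota> (\<gamma> $ 2 $ 1) * z + \<iota> (\<gamma> $ 2 $ 2)"

lemma vabs_affine_ge: "vabs (\<iota> a * z + \<iota> b) \<ge> fls_abs a * im_abs \<iota> z"
proof -
  have "im_abs \<iota> (\<iota> a * z) \<le> vabs (\<iota> a * z - \<iota> (- b))" by (rule im_abs_le)
  thus ?thesis by (simp add: im_abs_iota_mult iota_minus)
qed

lemma automorphy_nonzero:
  assumes "det \<gamma> \<noteq> 0" "z \<in> Omega \<iota>"
  shows "automorphy \<gamma> z \<noteq> 0"
proof (cases "\<gamma> $ 2 $ 1 = 0")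
  case True
  hence "\<gamma> $ 2 $ 2 \<noteq> 0" using assms(1) by (auto simp: det_2)
  thus ?thesis using True by (simp add: automorphy_def)
next
  case False
  hence "fls_abs (\<gamma> $ 2 $ 1) * im_abs \<iota> z > 0"
    using im_abs_pos[OF assms(2)] by simp
  hence "vabs (automorphy \<gamma> z) > 0"
    using vabs_affine_ge[of "\<gamma> $ 2 $ 1" z "\<gamma> $ 2 $ 2"] unfolding automorphy_def by linarith
  thus ?thesis by simp
qed

text \<open>
  For \<open>x\<close> in \<open>K\<^sub>\<infinity>\<close> put \<open>\<alpha> = a - cx\<close> and
  \<open>\<beta> = b - dx\<close>, so that \<open>\<gamma>z - x = (\<alpha>z + \<beta>)/(cz + d)\<close>
  and \<open>det \<gamma> = \<alpha>(cz + d) - c(\<alpha>z + \<beta>)\<close>; one of the two terms is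
  at least as large as the determinant.
\<close>

lemma im_abs_moebius_ge:
  assumes det: "det \<gamma> \<noteq> 0" and z: "z \<in> Omega \<iota>"
  shows "im_abs \<iota> (moebius \<iota> \<gamma> z) \<ge> fls_abs (det \<gamma>) * im_abs \<iota> z / vabs (automorphy \<gamma> z) ^ 2"
proof (rule im_abs_geI)
  fix x
  define J where "J = automorphy \<gamma> z"
  have J: "vabs J > 0" unfolding J_def using automorphy_nonzero[OF det z] by simp
  have im: "im_abs \<iota> z > 0" by (rule im_abs_pos[OF z])
  define a b c d where abcd: "a = \<gamma> $ 1 $ 1" "b = \<gamma> $ 1 $ 2" "c = \<gamma> $ 2 $ 1" "d = \<gamma> $ 2 $ 2"
  define \<alpha> \<beta> where \<alpha>\<beta>: "\<alpha> = a - c * x" "\<beta> = b - d * x"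
  define w where "w = \<iota> \<alpha> * z + \<iota> \<beta>"
  have J_eq: "J = \<iota> c * z + \<iota> d" by (simp add: J_def automorphy_def abcd)
  have "moebius \<iota> \<gamma> z - \<iota> x = w / J"
    using J unfolding moebius_def J_eq w_def \<alpha>\<beta> abcd[symmetric]
    by (simp add: field_simps iota_diff iota_mult)
  hence lhs: "vabs (moebius \<iota> \<gamma> z - \<iota> x) = vabs w / vabs J" by (simp add: vabs_divide)
  have det_eq: "\<iota> (det \<gamma>) = \<iota> \<alpha> * J - \<iota> c * w"
    unfolding det_2 abcd[symmetric] J_eq w_def \<alpha>\<beta> iota_diff iota_mult by (simp add: algebra_simps)
  have c: "fls_abs c * im_abs \<iota> z \<le> vabs J"
    unfolding J_eq by (rule vabs_affine_ge)
  have \<alpha>: "fls_abs \<alpha> * im_abs \<iota> z \<le> vabs w"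
    unfolding w_def by (rule vabs_affine_ge)
  have "fls_abs (det \<gamma>) \<le> max (fls_abs \<alpha> * vabs J) (fls_abs c * vabs w)"
    using vabs_diff_le[of "\<iota> \<alpha> * J" "\<iota> c * w"] unfolding det_eq[symmetric] by (simp add: vabs_mult vabs_iota)
  hence "fls_abs (det \<gamma>) * im_abs \<iota> z \<le> max (fls_abs \<alpha> * vabs J) (fls_abs c * vabs w) * im_abs \<iota> z"
    by (rule mult_right_mono) simp
  also have "\<dots> = max (fls_abs \<alpha> * im_abs \<iota> z * vabs J) (fls_abs c * im_abs \<iota> z * vabs w)"
    using im unfolding max_def by (auto simp: mult_ac)
  also have "\<dots> \<le> vabs w * vabs J"
    using mult_right_mono[OF \<alpha>, of "vabs J"] mult_right_mono[OF c, of "vabs w"] J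
    by (simp add: mult.commute)
  finally show "fls_abs (det \<gamma>) * im_abs \<iota> z / vabs (automorphy \<gamma> z) ^ 2 \<le> vabs (moebius \<iota> \<gamma> z - \<iota> x)"
    unfolding lhs J_def[symmetric] using J by (simp add: power2_eq_square field_simps)
qed

lemma moebius_Omega:
  assumes "det \<gamma> \<noteq> 0" "z \<in> Omega \<iota>"
  shows "moebius \<iota> \<gamma> z \<in> Omega \<iota>"
proof -
  have "fls_abs (det \<gamma>) * im_abs \<iota> z / vabs (automorphy \<gamma> z) ^ 2 > 0"
    using assms automorphy_nonzero[OF assms] im_abs_pos[OF assms(2)] by simp
  thus ?thesis using im_abs_moebius_ge[OF assms] by (simp add: Omega_iff_im_abs)
qed

lemma automorphy_mult:
  assumes "det \<gamma>2 \<noteq> 0" "z \<in> Omega \<iota>"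
  shows "automorphy (\<gamma>1 ** \<gamma>2) z = automorphy \<gamma>1 (moebius \<iota> \<gamma>2 z) * automorphy \<gamma>2 z"
  using automorphy_nonzero[OF assms]
  by (simp add: automorphy_def moebius_def matrix_mult_2_nth iota_add iota_mult field_simps)

lemma moebius_mult:
  assumes "det \<gamma>1 \<noteq> 0" "det \<gamma>2 \<noteq> 0" "z \<in> Omega \<iota>"
  shows "moebius \<iota> (\<gamma>1 ** \<gamma>2) z = moebius \<iota> \<gamma>1 (moebius \<iota> \<gamma>2 z)"
proof -
  define J where "J = automorphy \<gamma>2 z"
  define N where "N = \<iota> (\<gamma>2 $ 1 $ 1) * z + \<iota> (\<gamma>2 $ 1 $ 2)"
  define w where "w = moebius \<iota> \<gamma>2 z"
  have J: "J \<noteq> 0" unfolding J_def by (rule automorphy_nonzero[OF assms(2,3)])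
  have w: "w * J = N" using J by (simp add: w_def moebius_def N_def J_def automorphy_def)
  have A1: "automorphy \<gamma>1 w \<noteq> 0"
    unfolding w_def by (rule automorphy_nonzero[OF assms(1) moebius_Omega[OF assms(2,3)]])
  have num: "\<iota> ((\<gamma>1 ** \<gamma>2) $ 1 $ 1) * z + \<iota> ((\<gamma>1 ** \<gamma>2) $ 1 $ 2) =
      (\<iota> (\<gamma>1 $ 1 $ 1) * w + \<iota> (\<gamma>1 $ 1 $ 2)) * J"
  proof -
    have "(\<iota> (\<gamma>1 $ 1 $ 1) * w + \<iota> (\<gamma>1 $ 1 $ 2)) * J = \<iota> (\<gamma>1 $ 1 $ 1) * N + \<iota> (\<gamma>1 $ 1 $ 2) * J"
      by (simp add: distrib_right mult.assoc w)
    thus ?thesis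
      by (simp add: N_def J_def automorphy_def matrix_mult_2_nth iota_add iota_mult algebra_simps)
  qed
  have den: "\<iota> ((\<gamma>1 ** \<gamma>2) $ 2 $ 1) * z + \<iota> ((\<gamma>1 ** \<gamma>2) $ 2 $ 2) = automorphy \<gamma>1 w * J"
    using automorphy_mult[OF assms(2,3), of \<gamma>1] by (simp add: automorphy_def J_def w_def)
  show ?thesis
    unfolding moebius_def[of \<iota> "\<gamma>1 ** \<gamma>2"] num den using J A1
    by (simp add: moebius_def[of \<iota> \<gamma>1] automorphy_def flip: w_def)
qed

lemma slash_Omega:
  "z \<in> Omega \<iota> \<Longrightarrow> slash \<iota> k m \<gamma> \<phi> z =
     \<phi> (moebius \<iota> \<gamma> z) * \<iota> (det \<gamma>) powi m * automorphy \<gamma> z powi (- k)"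
  by (simp add: slash_def automorphy_def)

lemma slash_outside [simp]: "z \<notin> Omega \<iota> \<Longrightarrow> slash \<iota> k m \<gamma> \<phi> z = 0"
  by (simp add: slash_def)

lemma slash_mult:
  assumes "det \<gamma>1 \<noteq> 0" "det \<gamma>2 \<noteq> 0"
  shows "slash \<iota> k m (\<gamma>1 ** \<gamma>2) \<phi> = slash \<iota> k m \<gamma>2 (slash \<iota> k m \<gamma>1 \<phi>)"
proof
  fix z
  show "slash \<iota> k m (\<gamma>1 ** \<gamma>2) \<phi> z = slash \<iota> k m \<gamma>2 (slash \<iota> k m \<gamma>1 \<phi>) z"
  proof (cases "z \<in> Omega \<iota>")
    case True
    thus ?thesis using moebius_Omega[OF assms(2) True]
      by (simp add: slash_Omega moebius_mult[OF assms True] automorphy_mult[OF assms(2) True]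
          det_mul iota_mult power_int_mult_distrib mult_ac)
  qed simp
qed

lemma slash_one: "(\<And>z. z \<notin> Omega \<iota> \<Longrightarrow> \<phi> z = 0) \<Longrightarrow> slash \<iota> k m (mat 1) \<phi> = \<phi>"
  by (rule ext) (auto simp: slash_def moebius_def)

lemma slash_add: "slash \<iota> k m \<gamma> (\<lambda>z. f z + g z) = (\<lambda>z. slash \<iota> k m \<gamma> f z + slash \<iota> k m \<gamma> g z)"
  by (rule ext) (simp add: slash_def distrib_right)

lemma slash_scale: "slash \<iota> k m \<gamma> (\<lambda>z. c * f z) = (\<lambda>z. c * slash \<iota> k m \<gamma> f z)"
  by (rule ext) (simp add: slash_def mult.assoc)

lemma slash_zero [simp]: "slash \<iota> k m \<gamma> (\<lambda>z. 0) = (\<lambda>z. 0)"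
  by (rule ext) (simp add: slash_def)

lemma slash_sum: "slash \<iota> k m \<gamma> (\<lambda>z. \<Sum>i\<in>I. f i z) = (\<lambda>z. \<Sum>i\<in>I. slash \<iota> k m \<gamma> (f i) z)"
  by (rule ext) (simp add: slash_def sum_distrib_right)

lemma slash_scalar:
  assumes s: "s \<noteq> 0"
  shows "slash \<iota> k m (mat2 s 0 0 s) \<phi> z = (if z \<in> Omega \<iota> then \<iota> s powi (2 * m - k) * \<phi> z else 0)"
proof -
  have "moebius \<iota> (mat2 s 0 0 s) z = z" using s by (simp add: moebius_def)
  moreover have eq: "\<iota> (s * s) powi m * \<iota> s powi (- k) = \<iota> s powi (2 * m - k)"
  proof -
    have "\<iota> (s * s) powi m = \<iota> s powi (m + m)"
      unfolding iota_mult power_int_mult_distrib by (rule power_int_add[symmetric]) (simp add: s)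
    moreover have "\<iota> s powi (m + m + - k) = \<iota> s powi (m + m) * \<iota> s powi (- k)"
      by (rule power_int_add) (simp add: s)
    moreover have "m + m + - k = 2 * m - k" by simp
    ultimately show ?thesis by (simp only:)
  qed
  ultimately show ?thesis
    by (auto simp add: slash_def det_2 mult.assoc mult.commute[of "\<phi> z"] eq simp del: power_int_mult_distrib)
qed


section \<open>Rigid analytic functions\<close>

lemma rigid_analytic_iff:
  "rigid_analytic \<iota> \<phi> \<longleftrightarrow> (\<forall>n e. e > 0 \<longrightarrow> (\<exists>f g. \<forall>z\<in>Omega_aff \<iota> n.
     poly g z \<noteq> 0 \<and> vabs (poly f z / poly g z - \<phi> z) < e))"
proof (intro iffI allI impI)
  fix n and e :: real assume "rigid_analytic \<iota> \<phi>" "e > 0"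
  then obtain f g :: "nat \<Rightarrow> 'c poly" where fg: "\<forall>i. \<forall>z\<in>Omega_aff \<iota> n. poly (g i) z \<noteq> 0"
    "uniform_limit (Omega_aff \<iota> n) (\<lambda>i z. poly (f i) z / poly (g i) z) \<phi> sequentially"
    unfolding rigid_analytic_def by meson
  obtain i where "\<forall>z\<in>Omega_aff \<iota> n. dist (poly (f i) z / poly (g i) z) (\<phi> z) < e"
    using uniform_limitD[OF fg(2) \<open>e > 0\<close>] by (auto simp: eventually_sequentially)
  thus "\<exists>f g. \<forall>z\<in>Omega_aff \<iota> n. poly g z \<noteq> 0 \<and> vabs (poly f z / poly g z - \<phi> z) < e"
    using fg(1) by (intro exI[of _ "f i"] exI[of _ "g i"]) (auto simp: dist_conv_vabs)
next
  assume *: "\<forall>n e. e > 0 \<longrightarrow> (\<exists>f g. \<forall>z\<in>Omega_aff \<iota> n.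
     poly g z \<noteq> 0 \<and> vabs (poly f z / poly g z - \<phi> z) < e)"
  show "rigid_analytic \<iota> \<phi>"
    unfolding rigid_analytic_def
  proof
    fix n
    have "\<exists>f g. \<forall>z\<in>Omega_aff \<iota> n. poly g z \<noteq> 0 \<and> vabs (poly f z / poly g z - \<phi> z) < inverse (real (Suc i))" for i
      using * by simp
    then obtain f g where fg: "\<And>i z. z \<in> Omega_aff \<iota> n \<Longrightarrow>
        poly (g i) z \<noteq> 0 \<and> vabs (poly (f i) z / poly (g i) z - \<phi> z) < inverse (real (Suc i))" by metis
    have "uniform_limit (Omega_aff \<iota> n) (\<lambda>i z. poly (f i) z / poly (g i) z) \<phi> sequentially"
    proof (rule uniform_limitI)
      fix e :: real assume "e > 0"
      then obtain N where N: "inverse (real (Suc N)) < e" using reals_Archimedean by blast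
      show "\<forall>\<^sub>F i in sequentially. \<forall>z\<in>Omega_aff \<iota> n. dist (poly (f i) z / poly (g i) z) (\<phi> z) < e"
      proof (rule eventually_sequentiallyI[of N], rule ballI)
        fix i z assume "N \<le> i" and z: "z \<in> Omega_aff \<iota> n"
        hence "inverse (real (Suc i)) \<le> inverse (real (Suc N))" by (intro le_imp_inverse_le) auto
        thus "dist (poly (f i) z / poly (g i) z) (\<phi> z) < e"
          using conjunct2[OF fg[OF z, of i]] N unfolding dist_conv_vabs by linarith
      qed
    qed
    thus "\<exists>f g :: nat \<Rightarrow> 'c poly. (\<forall>i. \<forall>z\<in>Omega_aff \<iota> n. poly (g i) z \<noteq> 0) \<and>
        uniform_limit (Omega_aff \<iota> n) (\<lambda>i z. poly (f i) z / poly (g i) z) \<phi> sequentially"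
      using fg by blast
  qed
qed

lemma Omega_aff_mem: "z \<in> Omega_aff \<iota> n \<longleftrightarrow> vabs z \<le> q ^ n \<and> im_abs \<iota> z \<ge> 1 / q ^ n"
  by (simp add: Omega_aff_def q_def)

lemma Omega_aff_subset: "z \<in> Omega_aff \<iota> n \<Longrightarrow> z \<in> Omega \<iota>"
  using q_pos by (auto simp: Omega_aff_mem Omega_iff_im_abs intro: less_le_trans[rotated])

lemma rigid_analytic_add:
  assumes "rigid_analytic \<iota> \<phi>" "rigid_analytic \<iota> \<psi>"
  shows "rigid_analytic \<iota> (\<lambda>z. \<phi> z + \<psi> z)"
  unfolding rigid_analytic_iff
proof (intro allI impI)
  fix n and e :: real assume e: "e > 0"
  obtain f1 g1 where 1: "\<forall>z\<in>Omega_aff \<iota> n. poly g1 z \<noteq> 0 \<and> vabs (poly f1 z / poly g1 z - \<phi> z) < e"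
    using assms(1) e unfolding rigid_analytic_iff by blast
  obtain f2 g2 where 2: "\<forall>z\<in>Omega_aff \<iota> n. poly g2 z \<noteq> 0 \<and> vabs (poly f2 z / poly g2 z - \<psi> z) < e"
    using assms(2) e unfolding rigid_analytic_iff by blast
  have "poly (g1 * g2) z \<noteq> 0 \<and>
      vabs (poly (f1 * g2 + f2 * g1) z / poly (g1 * g2) z - (\<phi> z + \<psi> z)) < e" if z: "z \<in> Omega_aff \<iota> n" for z
  proof -
    have ne: "poly g1 z \<noteq> 0" "poly g2 z \<noteq> 0" using 1 2 z by auto
    have eq: "poly (f1 * g2 + f2 * g1) z / poly (g1 * g2) z - (\<phi> z + \<psi> z) =
        (poly f1 z / poly g1 z - \<phi> z) + (poly f2 z / poly g2 z - \<psi> z)"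
      using ne by (simp add: field_simps)
    have "vabs ((poly f1 z / poly g1 z - \<phi> z) + (poly f2 z / poly g2 z - \<psi> z)) < e"
      using vabs_add_le[of "poly f1 z / poly g1 z - \<phi> z" "poly f2 z / poly g2 z - \<psi> z"] 1 2 z
      by (meson le_less_trans max_less_iff_conj)
    hence "vabs (poly (f1 * g2 + f2 * g1) z / poly (g1 * g2) z - (\<phi> z + \<psi> z)) < e"
      by (simp only: eq)
    thus ?thesis using ne by simp
  qed
  thus "\<exists>f g. \<forall>z\<in>Omega_aff \<iota> n. poly g z \<noteq> 0 \<and> vabs (poly f z / poly g z - (\<phi> z + \<psi> z)) < e"
    by blast
qed

lemma rigid_analytic_scale:
  assumes "rigid_analytic \<iota> \<phi>"
  shows "rigid_analytic \<iota> (\<lambda>z. c * \<phi> z)"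
  unfolding rigid_analytic_iff
proof (intro allI impI)
  fix n and e :: real assume e: "e > 0"
  define d where "d = e / (vabs c + 1)"
  have c: "vabs c + 1 > 0" using vabs_nonneg[of c] by linarith
  have d: "d > 0" using e c by (simp add: d_def)
  obtain f g where fg: "\<forall>z\<in>Omega_aff \<iota> n. poly g z \<noteq> 0 \<and> vabs (poly f z / poly g z - \<phi> z) < d"
    using assms d unfolding rigid_analytic_iff by blast
  have "poly g z \<noteq> 0 \<and> vabs (poly (Polynomial.smult c f) z / poly g z - c * \<phi> z) < e"
    if z: "z \<in> Omega_aff \<iota> n" for z
  proof -
    have "vabs (c * (poly f z / poly g z - \<phi> z)) \<le> vabs c * d"
      unfolding vabs_mult using fg z by (intro mult_left_mono) (auto intro: less_imp_le)
    also have "\<dots> < (vabs c + 1) * d" using d by (intro mult_strict_right_mono) auto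
    also have "\<dots> = e" using c by (simp add: d_def)
    finally have "vabs (c * (poly f z / poly g z - \<phi> z)) < e" .
    moreover have eq: "poly (Polynomial.smult c f) z / poly g z - c * \<phi> z = c * (poly f z / poly g z - \<phi> z)"
      by (simp add: right_diff_distrib)
    ultimately show ?thesis unfolding eq using fg z by blast
  qed
  thus "\<exists>f g. \<forall>z\<in>Omega_aff \<iota> n. poly g z \<noteq> 0 \<and> vabs (poly f z / poly g z - c * \<phi> z) < e"
    by blast
qed

lemma rigid_analytic_zero: "rigid_analytic \<iota> (\<lambda>z. 0)"
  unfolding rigid_analytic_iff by (intro allI impI exI[of _ 0] exI[of _ 1]) auto

lemma rigid_analytic_sum:
  "(\<And>i. i \<in> I \<Longrightarrow> rigid_analytic \<iota> (f i)) \<Longrightarrow> rigid_analytic \<iota> (\<lambda>z. \<Sum>i\<in>I. f i z)"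
  by (induction I rule: infinite_finite_induct) (auto intro!: rigid_analytic_add rigid_analytic_zero)

text \<open>
  Clearing denominators makes a rational function composed with a Moebius transformation a quotient of
  two polynomials.
\<close>

lemma homogenization:
  fixes f :: "'c poly"
  assumes "Polynomial.degree f \<le> D"
  shows "\<exists>F. \<forall>z. c * z + d \<noteq> 0 \<longrightarrow> poly F z = poly f ((a * z + b) / (c * z + d)) * (c * z + d) ^ D"
proof (intro exI allI impI)
  fix z assume J: "c * z + d \<noteq> 0"
  have "poly f ((a * z + b) / (c * z + d)) * (c * z + d) ^ D =
      (\<Sum>i\<le>D. Polynomial.coeff f i * ((a * z + b) / (c * z + d)) ^ i) * (c * z + d) ^ D"
    unfolding poly_altdef using assms
    by (intro arg_cong[of _ _ "\<lambda>x. x * _"] sum.mono_neutral_left) (auto simp: coeff_eq_0)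
  also have "\<dots> = (\<Sum>i\<le>D. Polynomial.coeff f i * ((a * z + b) ^ i * (c * z + d) ^ (D - i)))"
    unfolding sum_distrib_right
  proof (rule sum.cong[OF refl])
    fix i assume "i \<in> {..D}"
    hence "(c * z + d) ^ D = (c * z + d) ^ i * (c * z + d) ^ (D - i)"
      by (simp flip: power_add)
    thus "Polynomial.coeff f i * ((a * z + b) / (c * z + d)) ^ i * (c * z + d) ^ D =
        Polynomial.coeff f i * ((a * z + b) ^ i * (c * z + d) ^ (D - i))"
      using J by (simp add: power_divide)
  qed
  also have "\<dots> = poly (\<Sum>i\<le>D. Polynomial.smult (Polynomial.coeff f i) ([:b, a:] ^ i * [:d, c:] ^ (D - i))) z"
    by (simp add: poly_sum algebra_simps)
  finally show "poly (\<Sum>i\<le>D. Polynomial.smult (Polynomial.coeff f i) ([:b, a:] ^ i * [:d, c:] ^ (D - i))) z =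
      poly f ((a * z + b) / (c * z + d)) * (c * z + d) ^ D" ..
qed

lemma automorphy_bounds:
  assumes det: "det \<gamma> \<noteq> 0"
  obtains B b where "0 < b" "0 < B" "\<And>z. z \<in> Omega_aff \<iota> n \<Longrightarrow> b \<le> vabs (automorphy \<gamma> z)"
    "\<And>z. z \<in> Omega_aff \<iota> n \<Longrightarrow> vabs (automorphy \<gamma> z) \<le> B"
proof -
  define c d where "c = \<gamma> $ 2 $ 1" and "d = \<gamma> $ 2 $ 2"
  define b where "b = (if c = 0 then fls_abs d else fls_abs c / q ^ n)"
  define B where "B = fls_abs c * q ^ n + fls_abs d"
  have cd: "c \<noteq> 0 \<or> d \<noteq> 0" using det by (auto simp: det_2 c_def d_def)
  have b: "b > 0" using cd q_pos by (auto simp: b_def)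
  have B: "B > 0" using cd q_pos fls_abs_nonneg[of c] fls_abs_nonneg[of d]
    by (auto simp: B_def intro: add_pos_nonneg add_nonneg_pos)
  have low: "b \<le> vabs (automorphy \<gamma> z)" if z: "z \<in> Omega_aff \<iota> n" for z
  proof (cases "c = 0")
    case True
    thus ?thesis by (simp add: automorphy_def b_def vabs_iota flip: c_def d_def)
  next
    case False
    have "fls_abs c * (1 / q ^ n) \<le> fls_abs c * im_abs \<iota> z"
      using z by (intro mult_left_mono) (auto simp: Omega_aff_mem)
    also have "\<dots> \<le> vabs (automorphy \<gamma> z)"
      unfolding automorphy_def c_def by (rule vabs_affine_ge)
    finally show ?thesis using False by (simp add: b_def)
  qed
  have up: "vabs (automorphy \<gamma> z) \<le> B" if z: "z \<in> Omega_aff \<iota> n" for z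
  proof -
    have "vabs (automorphy \<gamma> z) \<le> max (fls_abs c * vabs z) (fls_abs d)"
      using vabs_add_le[of "\<iota> c * z" "\<iota> d"] by (simp add: automorphy_def c_def d_def vabs_mult vabs_iota)
    moreover have "fls_abs c * vabs z \<le> fls_abs c * q ^ n"
      using z by (intro mult_left_mono) (auto simp: Omega_aff_mem)
    moreover have "0 \<le> fls_abs c * q ^ n" using q_pos by simp
    ultimately show ?thesis
      using fls_abs_nonneg[of d] unfolding B_def by linarith
  qed
  show ?thesis by (rule that[OF b B low up])
qed

lemma moebius_Omega_aff:
  assumes det: "det \<gamma> \<noteq> 0"
  obtains n' where "\<And>z. z \<in> Omega_aff \<iota> n \<Longrightarrow> moebius \<iota> \<gamma> z \<in> Omega_aff \<iota> n'"
proof -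
  obtain B b where Bb: "0 < b" "0 < B" "\<And>z. z \<in> Omega_aff \<iota> n \<Longrightarrow> b \<le> vabs (automorphy \<gamma> z)"
    "\<And>z. z \<in> Omega_aff \<iota> n \<Longrightarrow> vabs (automorphy \<gamma> z) \<le> B"
    using automorphy_bounds[OF det, of n] by metis
  define N where "N = fls_abs (\<gamma> $ 1 $ 1) * q ^ n + fls_abs (\<gamma> $ 1 $ 2)"
  have N0: "N \<ge> 0" unfolding N_def using q_pos by simp
  define D where "D = fls_abs (det \<gamma>)"
  have D: "D > 0" using det by (simp add: D_def)
  obtain n' where n': "max (N / b) (B\<^sup>2 * q ^ n / D) < q ^ n'" using real_arch_pow[OF q_gt_1] by blast
  have "moebius \<iota> \<gamma> z \<in> Omega_aff \<iota> n'" if z: "z \<in> Omega_aff \<iota> n" for z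
  proof -
    have "vabs (\<iota> (\<gamma> $ 1 $ 1) * z + \<iota> (\<gamma> $ 1 $ 2)) \<le> max (fls_abs (\<gamma> $ 1 $ 1) * vabs z) (fls_abs (\<gamma> $ 1 $ 2))"
      using vabs_add_le[of "\<iota> (\<gamma> $ 1 $ 1) * z" "\<iota> (\<gamma> $ 1 $ 2)"] by (simp add: vabs_mult vabs_iota)
    moreover have "fls_abs (\<gamma> $ 1 $ 1) * vabs z \<le> fls_abs (\<gamma> $ 1 $ 1) * q ^ n"
      using z by (intro mult_left_mono) (auto simp: Omega_aff_mem)
    moreover have "0 \<le> fls_abs (\<gamma> $ 1 $ 1) * q ^ n" using q_pos by simp
    ultimately have num: "vabs (\<iota> (\<gamma> $ 1 $ 1) * z + \<iota> (\<gamma> $ 1 $ 2)) \<le> N"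
      using fls_abs_nonneg[of "\<gamma> $ 1 $ 2"] unfolding N_def by linarith
    have "vabs (moebius \<iota> \<gamma> z) = vabs (\<iota> (\<gamma> $ 1 $ 1) * z + \<iota> (\<gamma> $ 1 $ 2)) / vabs (automorphy \<gamma> z)"
      by (simp add: moebius_def automorphy_def vabs_divide)
    also have "\<dots> \<le> N / b" using num Bb(1) Bb(3)[OF z] N0 by (intro frac_le) auto
    finally have 1: "vabs (moebius \<iota> \<gamma> z) \<le> q ^ n'" using n' by simp
    have J0: "vabs (automorphy \<gamma> z) > 0" using Bb(1) Bb(3)[OF z] by linarith
    have "1 / q ^ n' \<le> 1 / (B\<^sup>2 * q ^ n / D)"
      using n' Bb(2) D q_pos by (intro divide_left_mono) auto
    also have "\<dots> = D * (1 / q ^ n) / B\<^sup>2" by simp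
    also have "\<dots> \<le> D * im_abs \<iota> z / vabs (automorphy \<gamma> z) ^ 2"
      using z D Bb(4)[OF z] J0 by (intro frac_le mult_left_mono power_mono) (auto simp: Omega_aff_mem)
    also have "\<dots> \<le> im_abs \<iota> (moebius \<iota> \<gamma> z)"
      unfolding D_def by (rule im_abs_moebius_ge[OF det Omega_aff_subset[OF z]])
    finally show ?thesis using 1 by (simp add: Omega_aff_mem)
  qed
  thus ?thesis by (rule that)
qed

text \<open>
  A Moebius transformation maps each affinoid of the covering into another one, and \<open>|cz +
  d|\<close> is bounded away from zero on it. So rational approximations of \<open>\<phi>\<close> on the
  larger affinoid transform into rational approximations of \<open>\<phi>|\<gamma>\<close>.
\<close>

lemma rigid_analytic_slash:
  assumes rig: "rigid_analytic \<iota> \<phi>" and det: "det \<gamma> \<noteq> 0" and k: "k \<ge> 0"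
  shows "rigid_analytic \<iota> (slash \<iota> k m \<gamma> \<phi>)"
  unfolding rigid_analytic_iff
proof (intro allI impI)
  fix n and e :: real assume e: "e > 0"
  obtain n' where n': "\<And>z. z \<in> Omega_aff \<iota> n \<Longrightarrow> moebius \<iota> \<gamma> z \<in> Omega_aff \<iota> n'"
    using moebius_Omega_aff[OF det, of n] by blast
  obtain B b where Bb: "0 < b" "0 < B" "\<And>z. z \<in> Omega_aff \<iota> n \<Longrightarrow> b \<le> vabs (automorphy \<gamma> z)"
    "\<And>z. z \<in> Omega_aff \<iota> n \<Longrightarrow> vabs (automorphy \<gamma> z) \<le> B"
    using automorphy_bounds[OF det, of n] by metis
  define K where "K = nat k"
  define s where "s = \<iota> (det \<gamma>) powi m"
  have s: "vabs s > 0" using det by (simp add: s_def)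
  define e' where "e' = e * b ^ K / vabs s"
  have e': "e' > 0" using e Bb(1) s by (simp add: e'_def)
  obtain f g where fg: "\<forall>z\<in>Omega_aff \<iota> n'. poly g z \<noteq> 0 \<and> vabs (poly f z / poly g z - \<phi> z) < e'"
    using rig e' unfolding rigid_analytic_iff by blast
  define D where "D = max (Polynomial.degree f) (Polynomial.degree g)"
  obtain F where F: "\<And>z. automorphy \<gamma> z \<noteq> 0 \<Longrightarrow> poly F z = poly f (moebius \<iota> \<gamma> z) * automorphy \<gamma> z ^ D"
    using homogenization[of f D "\<iota> (\<gamma> $ 2 $ 1)" "\<iota> (\<gamma> $ 2 $ 2)" "\<iota> (\<gamma> $ 1 $ 1)" "\<iota> (\<gamma> $ 1 $ 2)"]
    by (auto simp: D_def automorphy_def moebius_def)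
  obtain G where G: "\<And>z. automorphy \<gamma> z \<noteq> 0 \<Longrightarrow> poly G z = poly g (moebius \<iota> \<gamma> z) * automorphy \<gamma> z ^ D"
    using homogenization[of g D "\<iota> (\<gamma> $ 2 $ 1)" "\<iota> (\<gamma> $ 2 $ 2)" "\<iota> (\<gamma> $ 1 $ 1)" "\<iota> (\<gamma> $ 1 $ 2)"]
    by (auto simp: D_def automorphy_def moebius_def)
  define F' where "F' = Polynomial.smult s F"
  define G' where "G' = G * [:\<iota> (\<gamma> $ 2 $ 2), \<iota> (\<gamma> $ 2 $ 1):] ^ K"
  have "poly G' z \<noteq> 0 \<and> vabs (poly F' z / poly G' z - slash \<iota> k m \<gamma> \<phi> z) < e" if z: "z \<in> Omega_aff \<iota> n" for z
  proof -
    define J where "J = automorphy \<gamma> z"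
    define w where "w = moebius \<iota> \<gamma> z"
    have zO: "z \<in> Omega \<iota>" by (rule Omega_aff_subset[OF z])
    have J: "J \<noteq> 0" unfolding J_def by (rule automorphy_nonzero[OF det zO])
    have w: "poly g w \<noteq> 0" "vabs (poly f w / poly g w - \<phi> w) < e'" using fg n'[OF z] by (auto simp: w_def)
    have G'z: "poly G' z = poly g w * J ^ D * J ^ K"
      using G[of z] J by (simp add: G'_def J_def w_def automorphy_def algebra_simps)
    have F'z: "poly F' z = s * (poly f w * J ^ D)"
      using F[of z] J by (simp add: F'_def J_def w_def)
    have sl: "slash \<iota> k m \<gamma> \<phi> z = \<phi> w * s / J ^ K"
      using zO k by (simp add: slash_Omega s_def w_def J_def K_def power_int_minus divide_inverse power_int_nonneg_exp)
    have eq: "poly F' z / poly G' z - slash \<iota> k m \<gamma> \<phi> z = s / J ^ K * (poly f w / poly g w - \<phi> w)"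
      unfolding F'z G'z sl using J w(1) by (simp add: field_simps)
    have "vabs (s / J ^ K * (poly f w / poly g w - \<phi> w)) = vabs s / vabs J ^ K * vabs (poly f w / poly g w - \<phi> w)"
      by (simp only: vabs_mult vabs_divide vabs_power)
    also have "\<dots> < vabs s / vabs J ^ K * e'"
      using s J w(2) by (intro mult_strict_left_mono) auto
    also have "\<dots> \<le> vabs s / b ^ K * e'"
    proof (intro mult_right_mono divide_left_mono power_mono)
      have "vabs J > 0" using J by simp
      thus "0 < vabs J ^ K * b ^ K" using Bb(1) by simp
    qed (use e' Bb(1) Bb(3)[OF z] in \<open>auto simp: J_def\<close>)
    also have "\<dots> = e" using s Bb(1) by (simp add: e'_def)
    finally have "vabs (poly F' z / poly G' z - slash \<iota> k m \<gamma> \<phi> z) < e" by (simp only: eq)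
    moreover have "poly G' z \<noteq> 0" unfolding G'z using J w(1) by simp
    ultimately show ?thesis by blast
  qed
  thus "\<exists>f g. \<forall>z\<in>Omega_aff \<iota> n. poly g z \<noteq> 0 \<and> vabs (poly f z / poly g z - slash \<iota> k m \<gamma> \<phi> z) < e"
    by blast
qed

text \<open>
  For \<open>b\<close> a zero of a denominator without zeros in the affinoid, this bounds the factor
  \<open>z - b\<close> from below.
\<close>

lemma Omega_aff_dist:
  assumes z: "z \<in> Omega_aff \<iota> n" and b: "b \<notin> Omega_aff \<iota> n"
  shows "vabs (z - b) \<ge> 1 / q ^ n"
proof (rule ccontr)
  assume "\<not> ?thesis"
  hence lt: "vabs (z - b) < 1 / q ^ n" by simp
  have qn: "1 / q ^ n \<le> q ^ n"
  proof -
    have "1 \<le> q ^ n" using q_gt_1 by (intro one_le_power) auto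
    thus ?thesis by (simp add: divide_le_eq) (use mult_mono[of 1 "q ^ n" 1 "q ^ n"] in auto)
  qed
  have "vabs b \<le> q ^ n"
    using vabs_diff_leI[of z "q ^ n" "z - b"] z lt qn by (simp add: Omega_aff_mem)
  hence "im_abs \<iota> b < 1 / q ^ n" using b by (simp add: Omega_aff_mem)
  then obtain x where x: "vabs (b - \<iota> x) < 1 / q ^ n" by (rule im_abs_lessE)
  have "vabs (z - \<iota> x) < 1 / q ^ n"
    using vabs_add_le[of "z - b" "b - \<iota> x"] lt x by simp
  moreover have "1 / q ^ n \<le> im_abs \<iota> z" using z by (simp add: Omega_aff_mem)
  ultimately show False using im_abs_le[of z x] by linarith
qed

lemma rigid_analytic_bounded:
  assumes "rigid_analytic \<iota> \<phi>"
  shows "\<exists>B>0. \<forall>z\<in>Omega_aff \<iota> n. vabs (\<phi> z) \<le> B"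
proof -
  obtain f g where fg: "\<forall>z\<in>Omega_aff \<iota> n. poly g z \<noteq> 0 \<and> vabs (poly f z / poly g z - \<phi> z) < 1"
    using assms unfolding rigid_analytic_iff by (meson zero_less_one)
  show ?thesis
  proof (cases "Omega_aff \<iota> n = {}")
    case False
    hence "g \<noteq> 0" using fg by auto
    obtain rs where rs: "g = Polynomial.smult (Polynomial.lead_coeff g) (\<Prod>r\<leftarrow>rs. [:-r, 1:])"
      using C_infinity_splits by blast
    define l where "l = Polynomial.lead_coeff g"
    have l: "vabs l > 0" using \<open>g \<noteq> 0\<close> by (simp add: l_def)
    have g_eq: "poly g z = l * (\<Prod>r\<leftarrow>rs. z - r)" for z
      by (subst rs) (simp add: poly_prod_linear l_def)
    define b where "b = vabs l * (1 / q ^ n) ^ length rs"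
    have b: "b > 0" using l q_pos by (simp add: b_def)
    have low: "b \<le> vabs (poly g z)" if z: "z \<in> Omega_aff \<iota> n" for z
    proof -
      have "r \<notin> Omega_aff \<iota> n" if "r \<in> set rs" for r
        using fg that g_eq[of r] by (auto simp: prod_list_zero_iff)
      hence "(1 / q ^ n) ^ length rs \<le> prod_list (map (\<lambda>r. vabs (z - r)) rs)"
        using Omega_aff_dist[OF z] q_pos by (intro prod_list_ge_power) auto
      thus ?thesis unfolding g_eq b_def vabs_mult vabs_prod_list
        by (intro mult_left_mono) (auto simp: o_def)
    qed
    define e where "e = (\<Sum>i\<le>Polynomial.degree f. vabs (Polynomial.coeff f i))"
    have e: "0 \<le> e" unfolding e_def by (intro sum_nonneg) auto
    have up: "vabs (poly f z) \<le> e * (q ^ n) ^ Polynomial.degree f" if z: "z \<in> Omega_aff \<iota> n" for z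
    proof (rule vabs_poly_le)
      show "vabs (Polynomial.coeff f i) \<le> e" if "i \<le> Polynomial.degree f" for i
        unfolding e_def using that by (intro member_le_sum) auto
      show "1 \<le> q ^ n" using q_gt_1 by (intro one_le_power) auto
    qed (use z e in \<open>auto simp: Omega_aff_mem\<close>)
    define B where "B = max 1 (e * (q ^ n) ^ Polynomial.degree f / b)"
    have "vabs (\<phi> z) \<le> B" if z: "z \<in> Omega_aff \<iota> n" for z
    proof -
      have "vabs (poly f z / poly g z) \<le> e * (q ^ n) ^ Polynomial.degree f / b"
        unfolding vabs_divide using up[OF z] low[OF z] b e q_pos by (intro frac_le) auto
      hence "vabs (poly f z / poly g z) \<le> B" by (simp add: B_def)
      moreover have "vabs (poly f z / poly g z - \<phi> z) \<le> B" using fg z by (force simp: B_def)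
      ultimately show ?thesis
        using vabs_diff_leI[of "poly f z / poly g z" B "poly f z / poly g z - \<phi> z"] by simp
    qed
    moreover have "B > 0" by (simp add: B_def)
    ultimately show ?thesis by blast
  qed (auto intro: exI[of _ 1])
qed

end


section \<open>Matrices over the polynomial ring\<close>

lemma invertible_2_iff:
  fixes A :: "'b::comm_ring_1 ^ 2 ^ 2"
  shows "invertible A \<longleftrightarrow> det A dvd 1"
proof
  assume "invertible A"
  then obtain B where "A ** B = mat 1" unfolding invertible_def by blast
  hence "det A * det B = 1" by (metis det_mul det_I)
  thus "det A dvd 1" by (metis dvd_triv_left)
next
  assume "det A dvd 1"
  then obtain u where u: "det A * u = 1" by (metis dvdE)
  define B where "B = mat2 (u * A $ 2 $ 2) (- (u * A $ 1 $ 2)) (- (u * A $ 2 $ 1)) (u * A $ 1 $ 1)"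
  have u': "A $ 1 $ 1 * A $ 2 $ 2 * u - A $ 1 $ 2 * A $ 2 $ 1 * u = 1"
    using u by (simp add: det_2 left_diff_distrib)
  have "A ** B = mat 1" "B ** A = mat 1"
    using u' by (auto intro!: matrix_2_eqI simp: matrix_mult_2_nth B_def algebra_simps)
  thus "invertible A" unfolding invertible_def by blast
qed

definition poly_matrix :: "'a::{finite,field} poly ^ 2 ^ 2 \<Rightarrow> 'a fls ^ 2 ^ 2" where
  "poly_matrix = map_matrix of_O"

lemma poly_matrix_nth [simp]: "poly_matrix A $ i $ l = of_O (A $ i $ l)"
  by (simp add: poly_matrix_def)

lemma poly_matrix_mult: "poly_matrix (A ** B) = poly_matrix A ** poly_matrix B"
  by (rule matrix_2_eqI) (simp_all add: matrix_mult_2_nth of_O_add of_O_mult)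

lemma det_poly_matrix: "det (poly_matrix A) = of_O (det A)"
  by (simp add: det_2 of_O_diff of_O_mult)

lemma poly_matrix_mat2: "poly_matrix (mat2 a b c d) = mat2 (of_O a) (of_O b) (of_O c) (of_O d)"
  by (rule matrix_2_eqI) simp_all

lemma poly_matrix_mat_1: "poly_matrix (mat 1) = mat 1"
  by (rule matrix_2_eqI) simp_all

lemma poly_matrix_eq_iff: "poly_matrix A = poly_matrix B \<longleftrightarrow> A = B"
proof
  assume *: "poly_matrix A = poly_matrix B"
  have "of_O (A $ i $ l) = of_O (B $ i $ l)" for i l
    using arg_cong[OF *, of "\<lambda>M. M $ i $ l"] by simp
  thus "A = B" by (simp add: vec_eq_iff)
qed simp

lemma det_poly_matrix_nonzero: "invertible A \<Longrightarrow> det (poly_matrix A) \<noteq> 0"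
  unfolding invertible_2_iff det_poly_matrix by auto

lemma GL2_O_poly_matrix: "GL2_O = poly_matrix ` {A. invertible A}"
  by (simp add: GL2_O_def poly_matrix_def)

lemma Gamma0_poly_matrix: "Gamma0 P = poly_matrix ` {A. invertible A \<and> P dvd A $ 2 $ 1}"
  by (simp add: Gamma0_def poly_matrix_def)

lemma Gamma0_subset: "Gamma0 P \<subseteq> GL2_O"
  by (auto simp: Gamma0_poly_matrix GL2_O_poly_matrix)

lemma det_GL2_K: "\<gamma> \<in> GL2_K \<Longrightarrow> det \<gamma> \<noteq> 0"
  by (auto simp: GL2_K_def invertible_2_iff)

lemma field_K_add: "x \<in> field_K \<Longrightarrow> y \<in> field_K \<Longrightarrow> x + y \<in> field_K"
proof -
  assume "x \<in> field_K" "y \<in> field_K"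
  then obtain a b c d where *: "x = of_O a / of_O b" "b \<noteq> 0" "y = of_O c / of_O d" "d \<noteq> 0"
    unfolding field_K_def by blast
  have "x + y = of_O (a * d + c * b) / of_O (b * d)"
    using * by (simp add: of_O_add of_O_mult add_frac_eq)
  thus ?thesis unfolding field_K_def using *(2,4) by (intro CollectI exI[of _ "a * d + c * b"] exI[of _ "b * d"]) auto
qed

lemma field_K_mult: "x \<in> field_K \<Longrightarrow> y \<in> field_K \<Longrightarrow> x * y \<in> field_K"
proof -
  assume "x \<in> field_K" "y \<in> field_K"
  then obtain a b c d where *: "x = of_O a / of_O b" "b \<noteq> 0" "y = of_O c / of_O d" "d \<noteq> 0"
    unfolding field_K_def by blast
  have "x * y = of_O (a * c) / of_O (b * d)" using * by (simp add: of_O_mult)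
  thus ?thesis unfolding field_K_def using *(2,4) by (intro CollectI exI[of _ "a * c"] exI[of _ "b * d"]) auto
qed

lemma field_K_of_O: "of_O a \<in> field_K"
  unfolding field_K_def by (intro CollectI exI[of _ a] exI[of _ 1]) auto

lemma GL2_K_mult_poly:
  assumes "\<gamma> \<in> GL2_K" "det A \<noteq> 0"
  shows "poly_matrix A ** \<gamma> \<in> GL2_K"
  using assms det_GL2_K[OF assms(1)] unfolding GL2_K_def
  by (auto simp: invertible_2_iff det_mul det_poly_matrix matrix_mult_2_nth dvd_field_iff
      intro!: field_K_add field_K_mult field_K_of_O)

lemma mat_1_GL2_K: "mat 1 \<in> GL2_K"
  unfolding GL2_K_def poly_matrix_mat_1[symmetric] by (auto simp: invertible_2_iff det_poly_matrix intro: field_K_of_O)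


section \<open>The lattices of the cusps\<close>

lemma adjugate_identities:
  fixes a b c d D :: "'b::field"
  assumes D: "D = a * d - b * c" "D \<noteq> 0"
  shows "d / D * a + (- b) / D * c = 1" "d / D * b + (- b) / D * d = 0" "(- c) / D * a + a / D * c = 0"
    "(- c) / D * b + a / D * d = 1" "a * (d / D) + b * ((- c) / D) = 1" "a * (- b / D) + b * (a / D) = 0"
    "c * (d / D) + d * (- c / D) = 0" "c * (- b / D) + d * (a / D) = 1"
proof -
  have 1: "a * d / D = 1 + b * c / D" using D by (simp add: field_simps)
  show "d / D * a + (- b) / D * c = 1" "d / D * b + (- b) / D * d = 0" "(- c) / D * a + a / D * c = 0"
    "(- c) / D * b + a / D * d = 1" "a * (d / D) + b * ((- c) / D) = 1" "a * (- b / D) + b * (a / D) = 0"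
    "c * (d / D) + d * (- c / D) = 0" "c * (- b / D) + d * (a / D) = 1"
    using 1 by (simp_all add: mult.commute)
qed
lemma conjugate_identities:
  fixes a b c d D x :: "'b::field"
  assumes D: "D = a * d - b * c" "D \<noteq> 0"
  shows "a * (d / D) + (a * x + b) * (- c / D) = 1 - x * (a * c / D)"
   "a * (- b / D) + (a * x + b) * (a / D) = x * (a * a / D)"
   "c * (d / D) + (c * x + d) * (- c / D) = - (x * (c * c / D))"
   "c * (- b / D) + (c * x + d) * (a / D) = 1 + x * (a * c / D)"
   "(1 - x * (a * c / D)) * a + x * (a * a / D) * c = a"
   "(1 - x * (a * c / D)) * b + x * (a * a / D) * d = a * x + b"
   "- (x * (c * c / D)) * a + (1 + x * (a * c / D)) * c = c"
   "- (x * (c * c / D)) * b + (1 + x * (a * c / D)) * d = c * x + d"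
proof -
  have 1: "a * d / D = 1 + b * c / D" using D by (simp add: field_simps)
  have 2: "a * (a * d / D) * x = a * (1 + b * c / D) * x" "c * (a * d / D) * x = c * (1 + b * c / D) * x"
     unfolding 1 by simp_all
  show "a * (d / D) + (a * x + b) * (- c / D) = 1 - x * (a * c / D)"
   "a * (- b / D) + (a * x + b) * (a / D) = x * (a * a / D)"
   "c * (d / D) + (c * x + d) * (- c / D) = - (x * (c * c / D))"
   "c * (- b / D) + (c * x + d) * (a / D) = 1 + x * (a * c / D)"
    using 1 by (simp_all add: distrib_right distrib_left mult_ac add_divide_distrib)
  show  "(1 - x * (a * c / D)) * a + x * (a * a / D) * c = a"
   "(1 - x * (a * c / D)) * b + x * (a * a / D) * d = a * x + b"
   "- (x * (c * c / D)) * a + (1 + x * (a * c / D)) * c = c"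
   "- (x * (c * c / D)) * b + (1 + x * (a * c / D)) * d = c * x + d"
  proof -
    have 3: "a * d / D - b * c / D = 1" using 1 by simp
    have "(1 - x * (a * c / D)) * b + x * (a * a / D) * d = a * x * (a * d / D - b * c / D) + b"
      by (simp add: algebra_simps)
    thus "(1 - x * (a * c / D)) * b + x * (a * a / D) * d = a * x + b" by (simp only: 3 mult_1_right)
    have "- (x * (c * c / D)) * b + (1 + x * (a * c / D)) * d = c * x * (a * d / D - b * c / D) + d"
      by (simp add: algebra_simps)
    thus "- (x * (c * c / D)) * b + (1 + x * (a * c / D)) * d = c * x + d" by (simp only: 3 mult_1_right)
  qed (simp_all add: algebra_simps)
qed

lemma matrix_inv_2:
  fixes \<gamma> :: "'b::field ^ 2 ^ 2"
  assumes D: "det \<gamma> \<noteq> 0"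
  shows "matrix_inv \<gamma> = mat2 (\<gamma> $ 2 $ 2 / det \<gamma>) (- \<gamma> $ 1 $ 2 / det \<gamma>) (- \<gamma> $ 2 $ 1 / det \<gamma>) (\<gamma> $ 1 $ 1 / det \<gamma>)"
    (is "_ = ?B")
proof -
  have B: "?B ** \<gamma> = mat 1" "\<gamma> ** ?B = mat 1"
    by (intro matrix_2_eqI; simp only: matrix_mult_2_nth mat2_nth mat_1_2_nth;
        rule adjugate_identities[OF det_2 D])+
  hence "invertible \<gamma>" unfolding invertible_def by blast
  hence inv: "\<gamma> ** matrix_inv \<gamma> = mat 1 \<and> matrix_inv \<gamma> ** \<gamma> = mat 1"
    unfolding invertible_def matrix_inv_def by (rule someI_ex)
  have "matrix_inv \<gamma> = (?B ** \<gamma>) ** matrix_inv \<gamma>" by (simp only: B(1) matrix_mul_lid)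
  also have "\<dots> = ?B ** (\<gamma> ** matrix_inv \<gamma>)" by (rule matrix_mul_assoc[symmetric])
  also have "\<dots> = ?B" by (simp only: inv matrix_mul_rid)
  finally show ?thesis .
qed

definition col_prod :: "'b::field ^ 2 ^ 2 \<Rightarrow> 2 \<Rightarrow> 2 \<Rightarrow> 'b" where
  "col_prod \<gamma> i l = \<gamma> $ i $ 1 * \<gamma> $ l $ 1 / det \<gamma>"

text \<open>
  The conjugate by \<open>\<gamma>\<close> of the matrix of \<open>z \<mapsto> z + b\<close>. It
  involves only the first column of \<open>\<gamma>\<close>, which represents the cusp.
\<close>

definition cusp_conj :: "'b::field ^ 2 ^ 2 \<Rightarrow> 'b \<Rightarrow> 'b ^ 2 ^ 2" where
  "cusp_conj \<gamma> b = mat2 (1 - b * col_prod \<gamma> 1 2) (b * col_prod \<gamma> 1 1)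
     (- (b * col_prod \<gamma> 2 2)) (1 + b * col_prod \<gamma> 1 2)"

lemma cusp_conj:
  assumes D: "det \<gamma> \<noteq> 0"
  shows "\<gamma> ** mat2 1 b 0 1 ** matrix_inv \<gamma> = cusp_conj \<gamma> b"
proof -
  show ?thesis
    unfolding matrix_inv_2[OF D] cusp_conj_def col_prod_def
    by (intro matrix_2_eqI; simp only: matrix_mult_2_nth mat2_nth mult_1_right mult_zero_right add_0_right;
        rule conjugate_identities[OF det_2 D])
qed

lemma cusp_conj_mult:
  assumes D: "det \<gamma> \<noteq> 0"
  shows "cusp_conj \<gamma> b ** \<gamma> = \<gamma> ** mat2 1 b 0 1"
proof -
  show ?thesis
    unfolding cusp_conj_def col_prod_def
    by (intro matrix_2_eqI; simp only: matrix_mult_2_nth mat2_nth mult_1_right mult_zero_right add_0_right;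
        rule conjugate_identities[OF det_2 D])
qed

lemma det_cusp_conj: "det (cusp_conj \<gamma> b) = 1"
  by (subst det_2) (simp add: cusp_conj_def col_prod_def algebra_simps)

text \<open>
  With \<open>I = J = \<O>\<close> this is the lattice of \<open>GL\<^sub>2(\<O>)\<close>, with \<open>I
  = \<O>\<close> and \<open>J = (P)\<close> that of \<open>\<Gamma>\<^sub>0(P)\<close>, and with
  \<open>I = J = (P)\<close> that of the principal congruence subgroup, at the cusp
  \<open>\<gamma>\<infinity>\<close>.
\<close>

definition cusp_coords :: "'b::field ^ 2 ^ 2 \<Rightarrow> 'b set \<Rightarrow> 'b set \<Rightarrow> 'b set" where
  "cusp_coords \<gamma> I J = {b. b * col_prod \<gamma> 1 2 \<in> I \<and>
     b * col_prod \<gamma> 1 1 \<in> I \<and> b * col_prod \<gamma> 2 2 \<in> J}"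

definition O_ring :: "'a::{finite,field} fls set" where "O_ring = range of_O"

definition O_ideal :: "'a::{finite,field} poly \<Rightarrow> 'a fls set" where "O_ideal P = of_O ` {x. P dvd x}"

lemma O_ring_of_O: "of_O x \<in> O_ring"
  by (simp add: O_ring_def)

lemma O_ring_1: "1 \<in> O_ring" and O_ring_0: "0 \<in> O_ring"
  using O_ring_of_O[of 1] O_ring_of_O[of 0] by simp_all

lemma O_ringE: "x \<in> O_ring \<Longrightarrow> (\<And>p. x = of_O p \<Longrightarrow> thesis) \<Longrightarrow> thesis"
  by (auto simp: O_ring_def)

lemma O_ring_add: "x \<in> O_ring \<Longrightarrow> y \<in> O_ring \<Longrightarrow> x + y \<in> O_ring"
  by (elim O_ringE) (simp add: O_ring_of_O flip: of_O_add)

lemma O_ring_diff: "x \<in> O_ring \<Longrightarrow> y \<in> O_ring \<Longrightarrow> x - y \<in> O_ring"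
  by (elim O_ringE) (simp add: O_ring_of_O flip: of_O_diff)

lemma O_ideal_of_O: "P dvd x \<Longrightarrow> of_O x \<in> O_ideal P"
  by (auto simp: O_ideal_def)

lemma O_idealE: "x \<in> O_ideal P \<Longrightarrow> (\<And>p. P dvd p \<Longrightarrow> x = of_O p \<Longrightarrow> thesis) \<Longrightarrow> thesis"
  by (auto simp: O_ideal_def)

lemma O_ideal_diff: "x \<in> O_ideal P \<Longrightarrow> y \<in> O_ideal P \<Longrightarrow> x - y \<in> O_ideal P"
  by (elim O_idealE) (simp add: O_ideal_of_O flip: of_O_diff)

lemma O_ideal_mult: "x \<in> O_ring \<Longrightarrow> y \<in> O_ideal P \<Longrightarrow> x * y \<in> O_ideal P"
  by (elim O_idealE O_ringE) (simp add: O_ideal_of_O flip: of_O_mult)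

lemma O_ideal_0: "0 \<in> O_ideal P"
  unfolding O_ideal_def by (intro image_eqI[of _ _ 0]) auto

lemma O_ideal_subset: "O_ideal P \<subseteq> O_ring"
  by (auto simp: O_ideal_def O_ring_def)

lemma add_subgroup_O_ring: "add_subgroup O_ring"
  by (auto simp: add_subgroup_def O_ring_0 O_ring_diff)

lemma add_subgroup_O_ideal: "add_subgroup (O_ideal P)"
  by (auto simp: add_subgroup_def O_ideal_0 O_ideal_diff)

lemma cusp_lattice_GL2_O:
  assumes D: "det \<gamma> \<noteq> 0"
  shows "cusp_lattice GL2_O \<gamma> = cusp_coords \<gamma> O_ring O_ring"
proof (rule Set.set_eqI)
  fix b
  have "cusp_conj \<gamma> b \<in> GL2_O \<longleftrightarrow> (\<forall>i l. cusp_conj \<gamma> b $ i $ l \<in> O_ring)"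
  proof
    assume "\<forall>i l. cusp_conj \<gamma> b $ i $ l \<in> O_ring"
    hence "\<forall>i. \<forall>l. \<exists>p. cusp_conj \<gamma> b $ i $ l = of_O p" by (blast elim: O_ringE)
    then obtain A where A: "\<And>i l. cusp_conj \<gamma> b $ i $ l = of_O (A i l)" by metis
    have eq: "cusp_conj \<gamma> b = poly_matrix (\<chi> i l. A i l)"
      using A by (intro matrix_2_eqI) simp_all
    have "of_O (det (\<chi> i l. A i l)) = of_O 1"
      using det_cusp_conj[of \<gamma> b] unfolding eq det_poly_matrix by simp
    hence "det (\<chi> i l. A i l) = 1" by (simp only: of_O_eq_iff)
    hence "invertible (\<chi> i l. A i l)" unfolding invertible_2_iff by simp
    thus "cusp_conj \<gamma> b \<in> GL2_O" unfolding eq GL2_O_poly_matrix by blast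
  qed (auto simp: GL2_O_poly_matrix O_ring_def)
  also have "\<dots> \<longleftrightarrow> b \<in> cusp_coords \<gamma> O_ring O_ring"
  proof -
    have "1 - x \<in> O_ring \<longleftrightarrow> x \<in> O_ring" for x :: "'a fls"
      using O_ring_diff[OF O_ring_1, of x] O_ring_diff[OF O_ring_1, of "1 - x"] by auto
    moreover have "1 + x \<in> O_ring \<longleftrightarrow> x \<in> O_ring" for x :: "'a fls"
      using O_ring_add[OF O_ring_1, of x] O_ring_diff[OF _ O_ring_1, of "1 + x"] by auto
    moreover have "- x \<in> O_ring \<longleftrightarrow> x \<in> O_ring" for x :: "'a fls"
      using O_ring_diff[OF O_ring_0, of x] O_ring_diff[OF O_ring_0, of "- x"] by auto
    ultimately show ?thesis by (auto simp: forall_2 cusp_conj_def cusp_coords_def)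
  qed
  finally show "b \<in> cusp_lattice GL2_O \<gamma> \<longleftrightarrow> b \<in> cusp_coords \<gamma> O_ring O_ring"
    by (simp add: cusp_lattice_def cusp_conj[OF D])
qed

lemma cusp_lattice_Gamma0:
  assumes D: "det \<gamma> \<noteq> 0"
  shows "cusp_lattice (Gamma0 P) \<gamma> = cusp_coords \<gamma> O_ring (O_ideal P)"
proof (rule Set.set_eqI)
  fix b
  have "M \<in> Gamma0 P \<longleftrightarrow> M \<in> GL2_O \<and> M $ 2 $ 1 \<in> O_ideal P" for M
    unfolding Gamma0_poly_matrix GL2_O_poly_matrix O_ideal_def by auto
  hence "b \<in> cusp_lattice (Gamma0 P) \<gamma> \<longleftrightarrow> b \<in> cusp_lattice GL2_O \<gamma> \<and> cusp_conj \<gamma> b $ 2 $ 1 \<in> O_ideal P"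
    by (simp add: cusp_lattice_def cusp_conj[OF D])
  also have "cusp_conj \<gamma> b $ 2 $ 1 \<in> O_ideal P \<longleftrightarrow> b * col_prod \<gamma> 2 2 \<in> O_ideal P"
  proof -
    have "- x \<in> O_ideal P \<longleftrightarrow> x \<in> O_ideal P" for x
      using O_ideal_diff[OF O_ideal_0, of x P] O_ideal_diff[OF O_ideal_0, of "- x" P] by auto
    thus ?thesis by (simp add: cusp_conj_def)
  qed
  finally show "b \<in> cusp_lattice (Gamma0 P) \<gamma> \<longleftrightarrow> b \<in> cusp_coords \<gamma> O_ring (O_ideal P)"
    using O_ideal_subset[of P] by (auto simp: cusp_lattice_GL2_O[OF D] cusp_coords_def)
qed

lemma add_subgroup_cusp_coords:
  assumes "add_subgroup I" "add_subgroup J"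
  shows "add_subgroup (cusp_coords \<gamma> I J)"
  using assms by (auto simp: add_subgroup_def cusp_coords_def left_diff_distrib)

lemma cusp_coords_mono: "I \<subseteq> I' \<Longrightarrow> J \<subseteq> J' \<Longrightarrow> cusp_coords \<gamma> I J \<subseteq> cusp_coords \<gamma> I' J'"
  by (auto simp: cusp_coords_def)

text \<open>
  For the principal congruence subgroup the conditions are invariant under
  \<open>GL\<^sub>2(\<O>)\<close>.
\<close>

lemma cusp_coords_mult:
  assumes A: "invertible A" and D: "det \<gamma> \<noteq> 0"
    and I: "add_subgroup I" "\<And>x y. x \<in> O_ring \<Longrightarrow> y \<in> I \<Longrightarrow> x * y \<in> I"
  shows "cusp_coords \<gamma> I I \<subseteq> cusp_coords (poly_matrix A ** \<gamma>) I I"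
proof
  fix b assume b: "b \<in> cusp_coords \<gamma> I I"
  obtain u where u: "det A * u = 1" using A unfolding invertible_2_iff by (metis dvdE)
  hence "of_O (det A) * of_O u = 1" by (metis of_O_1 of_O_mult)
  moreover from this have "of_O (det A) \<noteq> 0" by auto
  ultimately have detA: "1 / of_O (det A) = of_O u" by (simp add: divide_eq_eq mult.commute)
  define x y where "x = \<gamma> $ 1 $ 1" and "y = \<gamma> $ 2 $ 1"
  define m1 m2 m3 where "m1 = b * (x * y / det \<gamma>)" and "m2 = b * (x * x / det \<gamma>)"
    and "m3 = b * (y * y / det \<gamma>)"
  have m: "m1 \<in> I" "m2 \<in> I" "m3 \<in> I"
    using b by (auto simp: cusp_coords_def col_prod_def m1_def m2_def m3_def x_def y_def)
  have form: "b * ((of_O p * x + of_O r * y) * (of_O s * x + of_O t * y) / (of_O (det A) * det \<gamma>)) =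
      of_O (u * p * s) * m2 + of_O (u * (p * t + r * s)) * m1 + of_O (u * r * t) * m3" for p r s t
  proof -
    have "b * ((of_O p * x + of_O r * y) * (of_O s * x + of_O t * y) / (of_O (det A) * det \<gamma>)) =
        1 / of_O (det A) * (b * ((of_O p * x + of_O r * y) * (of_O s * x + of_O t * y) / det \<gamma>))"
      by simp
    also have "\<dots> = of_O u * (of_O (p * s) * m2 + of_O (p * t + r * s) * m1 + of_O (r * t) * m3)"
      unfolding detA m1_def m2_def m3_def of_O_add of_O_mult using D by (simp add: field_simps)
    finally show ?thesis by (simp add: of_O_add of_O_mult algebra_simps)
  qed
  have mem: "b * ((of_O p * x + of_O r * y) * (of_O s * x + of_O t * y) / (of_O (det A) * det \<gamma>)) \<in> I" for p r s t
    unfolding form by (intro add_subgroup_add[OF I(1)] I(2) O_ring_of_O m)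
  show "b \<in> cusp_coords (poly_matrix A ** \<gamma>) I I"
    unfolding cusp_coords_def col_prod_def mem_Collect_eq matrix_mult_2_nth poly_matrix_nth
      det_mul det_poly_matrix x_def[symmetric] y_def[symmetric]
    by (intro conjI mem)
qed

context drinfeld_setting
begin

lemma finite_O_ring_ball: "finite {x \<in> (O_ring :: 'a fls set). fls_abs x \<le> r}"
proof -
  obtain n where n: "r < q ^ n" using real_arch_pow[OF q_gt_1] by blast
  have "{x \<in> (O_ring :: 'a fls set). fls_abs x \<le> r} \<subseteq> of_O ` {p. Polynomial.degree p < Suc n}"
  proof
    fix x :: "'a fls" assume "x \<in> {x \<in> O_ring. fls_abs x \<le> r}"
    then obtain p where p: "x = of_O p" "fls_abs (of_O p) \<le> r" by (auto simp: O_ring_def)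
    have "Polynomial.degree p \<le> n"
    proof (rule ccontr)
      assume "\<not> ?thesis"
      moreover from this have "p \<noteq> 0" by auto
      moreover have "q ^ n \<le> q ^ Polynomial.degree p"
        using calculation q_gt_1 by (intro power_increasing) auto
      ultimately have "q ^ n \<le> fls_abs (of_O p)" by (simp add: fls_abs_of_O')
      thus False using p(2) n by linarith
    qed
    thus "x \<in> of_O ` {p. Polynomial.degree p < Suc n}" using p(1) by auto
  qed
  thus ?thesis by (rule finite_subset) (intro finite_imageI finite_degree_less)
qed

lemma discrete_lattice_cusp_coords:
  fixes \<gamma> :: "'a fls ^ 2 ^ 2"
  assumes D: "det \<gamma> \<noteq> 0" and I: "add_subgroup I" "add_subgroup J" "I \<subseteq> O_ring" "J \<subseteq> O_ring"
  shows "discrete_lattice (cusp_coords \<gamma> I J)"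
  unfolding discrete_lattice_def
proof (intro conjI allI)
  show "add_subgroup (cusp_coords \<gamma> I J)" by (rule add_subgroup_cusp_coords[OF I(1,2)])
  fix r
  have "\<exists>y. y \<noteq> 0 \<and> (\<forall>b\<in>cusp_coords \<gamma> I J. b * y \<in> O_ring)"
  proof (cases "\<gamma> $ 1 $ 1 = 0")
    case True
    hence "\<gamma> $ 2 $ 1 \<noteq> 0" using D by (auto simp: det_2)
    thus ?thesis using D I by (intro exI[of _ "col_prod \<gamma> 2 2"]) (auto simp: cusp_coords_def col_prod_def)
  next
    case False
    thus ?thesis using D I by (intro exI[of _ "col_prod \<gamma> 1 1"]) (auto simp: cusp_coords_def col_prod_def)
  qed
  then obtain y where y: "y \<noteq> 0" "\<And>b. b \<in> cusp_coords \<gamma> I J \<Longrightarrow> b * y \<in> O_ring" by blast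
  have "(\<lambda>b. b * y) ` {\<mu> \<in> cusp_coords \<gamma> I J. fls_abs \<mu> \<le> r} \<subseteq> {x \<in> O_ring. fls_abs x \<le> r * fls_abs y}"
    using y by (auto intro!: mult_right_mono simp: fls_abs_mult)
  hence "finite ((\<lambda>b. b * y) ` {\<mu> \<in> cusp_coords \<gamma> I J. fls_abs \<mu> \<le> r})"
    using finite_O_ring_ball by (rule finite_subset)
  moreover have "inj_on (\<lambda>b. b * y) {\<mu> \<in> cusp_coords \<gamma> I J. fls_abs \<mu> \<le> r}"
    using y(1) by (auto intro: inj_onI)
  ultimately show "finite {\<mu> \<in> cusp_coords \<gamma> I J. fls_abs \<mu> \<le> r}" by (rule finite_imageD)
qed

end

text \<open>
  The index is finite, as an element is determined modulo the sublattice by its coordinates modulo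
  \<open>P\<close>.
\<close>

lemma ex_coset_system_cusp_coords:
  fixes P :: "'a::{finite,field} poly"
  assumes P: "P \<noteq> 0" and L: "add_subgroup \<Lambda>" "add_subgroup \<Lambda>'"
    and sub: "\<Lambda> \<subseteq> cusp_coords \<gamma> O_ring O_ring" "cusp_coords \<gamma> (O_ideal P) (O_ideal P) \<subseteq> \<Lambda>'"
  shows "\<exists>R. coset_system \<Lambda> \<Lambda>' R"
proof -
  define c where "c x = (SOME p. x = of_O p) mod P" for x
  define \<kappa> where "\<kappa> b = (c (b * col_prod \<gamma> 1 2), c (b * col_prod \<gamma> 1 1),
     c (b * col_prod \<gamma> 2 2))" for b
  define F where "F = insert 0 {p :: 'a poly. Polynomial.degree p < Polynomial.degree P}"
  have c_F: "c x \<in> F" for x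
    using degree_mod_less[OF P, of "SOME p. x = of_O p"] by (auto simp: c_def F_def)
  have finF: "finite F" by (simp add: F_def finite_degree_less)
  have c_eq: "x - y \<in> O_ideal P" if eq: "c x = c y" and x: "x \<in> O_ring" and y: "y \<in> O_ring" for x y
  proof -
    obtain p where p: "x = of_O p" using x by (rule O_ringE)
    obtain r where r: "y = of_O r" using y by (rule O_ringE)
    note pr = p r
    hence "p mod P = r mod P" using eq by (simp add: c_def)
    hence "P dvd p - r" by (simp add: mod_eq_dvd_iff)
    thus ?thesis using pr by (auto simp: O_ideal_def simp flip: of_O_diff)
  qed
  show ?thesis
  proof (rule ex_coset_system[OF L, of \<kappa>])
    have "\<kappa> ` \<Lambda> \<subseteq> F \<times> F \<times> F" using c_F by (auto simp: \<kappa>_def)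
    thus "finite (\<kappa> ` \<Lambda>)" by (rule finite_subset) (intro finite_cartesian_product finF)
    fix x y assume "x \<in> \<Lambda>" "y \<in> \<Lambda>" "\<kappa> x = \<kappa> y"
    hence "x - y \<in> cusp_coords \<gamma> (O_ideal P) (O_ideal P)"
      using sub(1) c_eq by (auto simp: cusp_coords_def \<kappa>_def left_diff_distrib)
    thus "x - y \<in> \<Lambda>'" using sub(2) by blast
  qed
qed


section \<open>Representatives of the cosets\<close>

text \<open>
  Whether two matrices in \<open>GL\<^sub>2(\<O>)\<close> belong to the same coset of
  \<open>\<Gamma>\<^sub>0(P)\<close> is decided by the determinant of their second rows.
\<close>

definition row_det :: "'b::comm_ring_1 ^ 2 ^ 2 \<Rightarrow> 'b ^ 2 ^ 2 \<Rightarrow> 'b" where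
  "row_det A B = A $ 2 $ 1 * B $ 2 $ 2 - A $ 2 $ 2 * B $ 2 $ 1"

lemma row_det_mult: "row_det (A ** G) (B ** G) = row_det A B * det G"
  by (simp add: row_det_def matrix_mult_2_nth det_2 algebra_simps)

lemma invertible_row_not_dvd:
  fixes A :: "'b::comm_ring_1 ^ 2 ^ 2"
  assumes "invertible A" "\<not> P dvd 1"
  shows "\<not> (P dvd A $ 2 $ 1 \<and> P dvd A $ 2 $ 2)"
proof
  assume "P dvd A $ 2 $ 1 \<and> P dvd A $ 2 $ 2"
  hence "P dvd det A" by (auto simp: det_2 intro: dvd_diff dvd_mult)
  thus False using assms unfolding invertible_2_iff by (metis dvd_trans)
qed

text \<open>
  Modulo the prime \<open>P\<close> the vanishing of \<open>row_det\<close> means that the second rows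
  are proportional, and second rows of invertible matrices do not vanish modulo \<open>P\<close>.
\<close>

lemma row_det_trans:
  assumes P: "prime_elem P" and C: "invertible C" and d: "P dvd row_det A C" "P dvd row_det B C"
  shows "P dvd row_det A B"
proof (rule ccontr)
  assume n: "\<not> P dvd row_det A B"
  have "row_det A B * C $ 2 $ i = row_det A C * B $ 2 $ i - row_det B C * A $ 2 $ i" if "i = 1 \<or> i = 2" for i
    using that by (auto simp: row_det_def algebra_simps)
  hence "P dvd row_det A B * C $ 2 $ i" if "i = 1 \<or> i = 2" for i
    using that d by (metis dvd_diff dvd_mult2)
  hence "P dvd C $ 2 $ 1" "P dvd C $ 2 $ 2" using n prime_elem_dvd_multD[OF P] by blast+
  thus False using invertible_row_not_dvd[OF C, of P] P by (auto simp: prime_elem_def)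
qed

text \<open>The lower left entry of \<open>A B\<^sup>-\<^sup>1\<close> is \<open>row_det A B\<close> up to a unit.\<close>

lemma row_det_same_coset:
  assumes A: "invertible A" and B: "invertible B" and d: "P dvd row_det A B"
  obtains G where "invertible G" "P dvd G $ 2 $ 1" "A = G ** B"
proof -
  obtain u where u: "det B * u = 1" using B unfolding invertible_2_iff by (metis dvdE)
  define B' where "B' = mat2 (u * B $ 2 $ 2) (- (u * B $ 1 $ 2)) (- (u * B $ 2 $ 1)) (u * B $ 1 $ 1)"
  have u': "B $ 1 $ 1 * B $ 2 $ 2 * u - B $ 1 $ 2 * B $ 2 $ 1 * u = 1"
    using u by (simp add: det_2 left_diff_distrib)
  have BB: "B' ** B = mat 1" "B ** B' = mat 1"
    using u' by (auto intro!: matrix_2_eqI simp: matrix_mult_2_nth B'_def algebra_simps)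
  have "invertible B'" using BB unfolding invertible_def by blast
  show ?thesis
  proof (rule that[of "A ** B'"])
    show "invertible (A ** B')" by (rule invertible_mult[OF A \<open>invertible B'\<close>])
    have "(A ** B') $ 2 $ 1 = u * row_det A B"
      by (simp add: matrix_mult_2_nth B'_def row_det_def algebra_simps)
    thus "P dvd (A ** B') $ 2 $ 1" using d by simp
    show "A = A ** B' ** B" by (simp add: BB flip: matrix_mul_assoc)
  qed
qed

definition poly_reps :: "'a::{finite,field} poly \<Rightarrow> ('a poly ^ 2 ^ 2) set" where
  "poly_reps P = insert (mat 1) {mat2 0 (- 1) 1 Q | Q. Polynomial.degree Q < Polynomial.degree P}"

lemma coset_reps_conv:
  fixes P :: "'a::{finite,field} poly"
  shows "coset_reps P = poly_matrix ` poly_reps P"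
proof -
  have "poly_matrix ` {mat2 0 (- 1) 1 Q | Q :: 'a poly. Polynomial.degree Q < Polynomial.degree P} =
      {mat2 0 (- 1) 1 (of_O Q) | Q. Polynomial.degree Q < Polynomial.degree P}"
    by (force simp: poly_matrix_mat2 of_O_minus)
  thus ?thesis unfolding coset_reps_def poly_reps_def image_insert poly_matrix_mat_1 by simp
qed

lemma finite_poly_reps:
  fixes P :: "'a::{finite,field} poly"
  shows "finite (poly_reps P)"
proof -
  have "{mat2 0 (- 1) 1 Q | Q :: 'a poly. Polynomial.degree Q < Polynomial.degree P} =
      (\<lambda>Q. mat2 0 (- 1) 1 Q) ` {Q. Polynomial.degree Q < Polynomial.degree P}" by auto
  thus ?thesis by (simp add: poly_reps_def finite_degree_less)
qed

lemma invertible_poly_reps: "r \<in> poly_reps P \<Longrightarrow> invertible r"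
  by (auto simp: poly_reps_def invertible_2_iff det_2)

text \<open>
  With \<open>(c, d)\<close> the second row of \<open>A\<close>, the representative is the identity if
  \<open>P\<close> divides \<open>c\<close>. Otherwise it is given by the solution \<open>Q\<close> of
  \<open>c Q \<equiv> d\<close> modulo \<open>P\<close>.
\<close>

lemma ex1_poly_rep:
  fixes P :: "'a::{finite,field} poly"
  assumes P: "prime_elem P" and A: "invertible A"
  shows "\<exists>!r. r \<in> poly_reps P \<and> P dvd row_det A r"
proof (cases "P dvd A $ 2 $ 1")
  case True
  hence "\<not> P dvd A $ 2 $ 2" using invertible_row_not_dvd[OF A] P by (auto simp: prime_elem_def)
  hence "\<not> P dvd row_det A (mat2 0 (- 1) 1 Q)" for Q
    using True by (simp add: row_det_def dvd_diff_right_iff)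
  moreover have "P dvd row_det A (mat 1)" using True by (simp add: row_det_def)
  ultimately show ?thesis by (intro ex1I[of _ "mat 1"]) (auto simp: poly_reps_def)
next
  case False
  have P0: "P \<noteq> 0" using P by auto
  have degP: "Polynomial.degree P > 0"
    using P P0 unfolding prime_elem_def by (metis is_unit_iff_degree gr0I)
  define S where "S = {Q :: 'a poly. Polynomial.degree Q < Polynomial.degree P}"
  have mod_S: "x mod P \<in> S" for x
    using degree_mod_less[OF P0, of x] degP by (auto simp: S_def)
  have uniq: "Q = Q'" if "Q \<in> S" "Q' \<in> S" "P dvd A $ 2 $ 1 * Q - A $ 2 $ 1 * Q'" for Q Q'
  proof (rule ccontr)
    assume "Q \<noteq> Q'"
    have "P dvd A $ 2 $ 1 * (Q - Q')" using that(3) by (simp add: right_diff_distrib)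
    hence "P dvd Q - Q'" using False prime_elem_dvd_multD[OF P] by blast
    hence "Polynomial.degree P \<le> Polynomial.degree (Q - Q')"
      using \<open>Q \<noteq> Q'\<close> by (intro dvd_imp_degree_le) auto
    moreover have "Polynomial.degree (Q - Q') < Polynomial.degree P"
      using that(1,2) by (auto simp: S_def intro: degree_diff_less)
    ultimately show False by simp
  qed
  have "inj_on (\<lambda>Q. (A $ 2 $ 1 * Q) mod P) S"
    using uniq by (intro inj_onI) (auto simp: mod_eq_dvd_iff)
  moreover have "(\<lambda>Q. (A $ 2 $ 1 * Q) mod P) ` S \<subseteq> S" using mod_S by auto
  moreover have "finite S" by (simp add: S_def finite_degree_less)
  ultimately have "(\<lambda>Q. (A $ 2 $ 1 * Q) mod P) ` S = S" by (simp add: endo_inj_surj)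
  then obtain Q where Q: "Q \<in> S" "(A $ 2 $ 1 * Q) mod P = A $ 2 $ 2 mod P"
  proof -
    have "A $ 2 $ 2 mod P \<in> (\<lambda>Q. (A $ 2 $ 1 * Q) mod P) ` S"
      using mod_S[of "A $ 2 $ 2"] \<open>_ = S\<close> by simp
    thus ?thesis using that by (elim imageE) simp
  qed
  hence dQ: "P dvd A $ 2 $ 1 * Q - A $ 2 $ 2" by (simp add: mod_eq_dvd_iff)
  show ?thesis
  proof (rule ex1I[of _ "mat2 0 (- 1) 1 Q"])
    show "mat2 0 (- 1) 1 Q \<in> poly_reps P \<and> P dvd row_det A (mat2 0 (- 1) 1 Q)"
      using Q dQ by (auto simp: poly_reps_def S_def row_det_def)
    fix r assume r: "r \<in> poly_reps P \<and> P dvd row_det A r"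
    hence "r \<noteq> mat 1" using False by (auto simp: row_det_def)
    then obtain Q' where Q': "r = mat2 0 (- 1) 1 Q'" "Q' \<in> S" using r by (auto simp: poly_reps_def S_def)
    have "P dvd A $ 2 $ 1 * Q' - A $ 2 $ 2" using r by (simp add: Q' row_det_def)
    hence "P dvd (A $ 2 $ 1 * Q' - A $ 2 $ 2) - (A $ 2 $ 1 * Q - A $ 2 $ 2)" using dQ by (rule dvd_diff)
    hence "Q' = Q" using uniq[OF Q'(2) Q(1)] by simp
    thus "r = mat2 0 (- 1) 1 Q" by (simp add: Q')
  qed
qed

section \<open>Spaces of cusp forms and the operators between them\<close>

context drinfeld_setting
begin

lemma cusp_formsD:
  assumes "\<phi> \<in> cusp_forms \<iota> k m \<Gamma>"
  shows "z \<notin> Omega \<iota> \<Longrightarrow> \<phi> z = 0" "rigid_analytic \<iota> \<phi>" "\<gamma> \<in> \<Gamma> \<Longrightarrow> slash \<iota> k m \<gamma> \<phi> = \<phi>"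
    "\<gamma> \<in> GL2_K \<Longrightarrow> \<exists>a. has_u_expansion \<iota> (cusp_lattice \<Gamma> \<gamma>) (slash \<iota> k m \<gamma> \<phi>) a \<and> a 0 = 0"
  using assms unfolding cusp_forms_def by blast+

lemma cusp_formsI:
  assumes "\<And>z. z \<notin> Omega \<iota> \<Longrightarrow> \<phi> z = 0" "rigid_analytic \<iota> \<phi>" "\<And>\<gamma>. \<gamma> \<in> \<Gamma> \<Longrightarrow> slash \<iota> k m \<gamma> \<phi> = \<phi>"
    "\<And>\<gamma>. \<gamma> \<in> GL2_K \<Longrightarrow> \<exists>a. has_u_expansion \<iota> (cusp_lattice \<Gamma> \<gamma>) (slash \<iota> k m \<gamma> \<phi>) a \<and> a 0 = 0"
  shows "\<phi> \<in> cusp_forms \<iota> k m \<Gamma>"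
  using assms unfolding cusp_forms_def by blast

lemma cusp_forms_add:
  assumes f: "f \<in> cusp_forms \<iota> k m \<Gamma>" and g: "g \<in> cusp_forms \<iota> k m \<Gamma>"
  shows "(\<lambda>z. f z + g z) \<in> cusp_forms \<iota> k m \<Gamma>"
proof (rule cusp_formsI)
  fix \<gamma> assume \<gamma>: "\<gamma> \<in> (GL2_K :: ('a fls ^ 2 ^ 2) set)"
  obtain a where a: "has_u_expansion \<iota> (cusp_lattice \<Gamma> \<gamma>) (slash \<iota> k m \<gamma> f) a" "a 0 = 0"
    using cusp_formsD(4)[OF f \<gamma>] by blast
  obtain b where b: "has_u_expansion \<iota> (cusp_lattice \<Gamma> \<gamma>) (slash \<iota> k m \<gamma> g) b" "b 0 = 0"
    using cusp_formsD(4)[OF g \<gamma>] by blast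
  show "\<exists>a. has_u_expansion \<iota> (cusp_lattice \<Gamma> \<gamma>) (slash \<iota> k m \<gamma> (\<lambda>z. f z + g z)) a \<and> a 0 = 0"
    unfolding slash_add using has_u_expansion_add[OF a(1) b(1)] a(2) b(2)
    by (intro exI[of _ "\<lambda>n. a n + b n"]) simp
qed (use cusp_formsD[OF f] cusp_formsD[OF g] in \<open>simp_all add: slash_add rigid_analytic_add\<close>)

lemma cusp_forms_scale:
  assumes f: "f \<in> cusp_forms \<iota> k m \<Gamma>"
  shows "(\<lambda>z. c * f z) \<in> cusp_forms \<iota> k m \<Gamma>"
proof (rule cusp_formsI)
  fix \<gamma> assume \<gamma>: "\<gamma> \<in> (GL2_K :: ('a fls ^ 2 ^ 2) set)"
  obtain a where a: "has_u_expansion \<iota> (cusp_lattice \<Gamma> \<gamma>) (slash \<iota> k m \<gamma> f) a" "a 0 = 0"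
    using cusp_formsD(4)[OF f \<gamma>] by blast
  show "\<exists>a. has_u_expansion \<iota> (cusp_lattice \<Gamma> \<gamma>) (slash \<iota> k m \<gamma> (\<lambda>z. c * f z)) a \<and> a 0 = 0"
    unfolding slash_scale using has_u_expansion_scale[OF a(1)] a(2)
    by (intro exI[of _ "\<lambda>n. c * a n"]) simp
qed (use cusp_formsD[OF f] in \<open>simp_all add: slash_scale rigid_analytic_scale\<close>)

lemma cusp_forms_zero: "(\<lambda>z. 0) \<in> cusp_forms \<iota> k m \<Gamma>"
  by (rule cusp_formsI)
     (auto simp: rigid_analytic_zero intro!: exI[of _ "\<lambda>n. 0"] has_u_expansion_zero)

lemma cusp_forms_diff:
  assumes "f \<in> cusp_forms \<iota> k m \<Gamma>" "g \<in> cusp_forms \<iota> k m \<Gamma>"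
  shows "(\<lambda>z. f z - g z) \<in> cusp_forms \<iota> k m \<Gamma>"
  using cusp_forms_add[OF assms(1) cusp_forms_scale[OF assms(2), of "-1"]] by simp

lemma cusp_forms_sum:
  assumes "\<And>i. i \<in> I \<Longrightarrow> f i \<in> cusp_forms \<iota> k m \<Gamma>"
  shows "(\<lambda>z. \<Sum>i\<in>I. f i z) \<in> cusp_forms \<iota> k m \<Gamma>"
  using assms by (induction I rule: infinite_finite_induct) (auto intro: cusp_forms_zero cusp_forms_add)

lemma slash_translation: "z \<in> Omega \<iota> \<Longrightarrow> slash \<iota> k m (mat2 1 b 0 1) \<phi> z = \<phi> (z + \<iota> b)"
  by (simp add: slash_Omega automorphy_def moebius_def det_2)

lemma slash_periodic:
  assumes D: "det \<gamma> \<noteq> 0" and b: "b \<in> cusp_lattice \<Gamma> \<gamma>" and z: "z \<in> Omega \<iota>"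
    and inv: "\<And>\<delta>. \<delta> \<in> \<Gamma> \<Longrightarrow> slash \<iota> k m \<delta> \<phi> = \<phi>"
  shows "slash \<iota> k m \<gamma> \<phi> (z + \<iota> b) = slash \<iota> k m \<gamma> \<phi> z"
proof -
  have \<delta>: "cusp_conj \<gamma> b \<in> \<Gamma>" using b by (simp add: cusp_lattice_def cusp_conj[OF D])
  have "slash \<iota> k m \<gamma> \<phi> (z + \<iota> b) = slash \<iota> k m (mat2 1 b 0 1) (slash \<iota> k m \<gamma> \<phi>) z"
    by (rule slash_translation[OF z, symmetric])
  also have "\<dots> = slash \<iota> k m (\<gamma> ** mat2 1 b 0 1) \<phi> z"
    using D by (subst slash_mult) (simp_all add: det_2[of "mat2 1 b 0 1"])
  also have "\<gamma> ** mat2 1 b 0 1 = cusp_conj \<gamma> b ** \<gamma>" by (rule cusp_conj_mult[OF D, symmetric])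
  also have "slash \<iota> k m (cusp_conj \<gamma> b ** \<gamma>) \<phi> = slash \<iota> k m \<gamma> (slash \<iota> k m (cusp_conj \<gamma> b) \<phi>)"
    using D by (intro slash_mult) (simp_all add: det_cusp_conj)
  finally show ?thesis by (simp add: inv[OF \<delta>])
qed

context
  fixes P :: "'a poly" and k m :: int
  assumes irreducible: "Factorial_Ring.irreducible P" and weight: "k \<ge> 0"
begin

lemma prime: "prime_elem P"
  by (rule field_poly_irreducible_imp_prime[OF irreducible])

lemma P_nonzero: "P \<noteq> 0" and not_unit: "\<not> P dvd 1"
  using prime by (auto simp: prime_elem_def)

lemma degree_P: "Polynomial.degree P > 0"
  using P_nonzero not_unit is_unit_iff_degree[of P] by auto

lemma cusp_coords_lattices:
  fixes \<gamma> :: "'a fls ^ 2 ^ 2"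
  assumes D: "det \<gamma> \<noteq> 0"
  shows "discrete_lattice (cusp_coords \<gamma> O_ring O_ring)" "discrete_lattice (cusp_coords \<gamma> O_ring (O_ideal P))"
    "discrete_lattice (cusp_coords \<gamma> (O_ideal P) (O_ideal P))"
  by (rule discrete_lattice_cusp_coords[OF D]; simp add: add_subgroup_O_ring add_subgroup_O_ideal O_ideal_subset)+

text \<open>Invariance under the smaller group is clear; the expansions are rewritten for the smaller lattices.\<close>

lemma cusp_forms_GL2_O_subset: "cusp_forms \<iota> k m GL2_O \<subseteq> cusp_forms \<iota> k m (Gamma0 P)"
proof
  fix \<phi> assume \<phi>: "\<phi> \<in> cusp_forms \<iota> k m GL2_O"
  show "\<phi> \<in> cusp_forms \<iota> k m (Gamma0 P)"
  proof (rule cusp_formsI)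
    fix \<gamma> assume \<gamma>: "\<gamma> \<in> (GL2_K :: ('a fls ^ 2 ^ 2) set)"
    have D: "det \<gamma> \<noteq> 0" by (rule det_GL2_K[OF \<gamma>])
    obtain R where R: "coset_system (cusp_coords \<gamma> O_ring O_ring) (cusp_coords \<gamma> O_ring (O_ideal P)) R"
      using ex_coset_system_cusp_coords[OF P_nonzero, of "cusp_coords \<gamma> O_ring O_ring" "cusp_coords \<gamma> O_ring (O_ideal P)" \<gamma>]
        cusp_coords_lattices[OF D] cusp_coords_mono[of "O_ideal P" O_ring "O_ideal P" "O_ideal P" \<gamma>] O_ideal_subset[of P]
      unfolding discrete_lattice_def by blast
    obtain a where a: "has_u_expansion \<iota> (cusp_lattice GL2_O \<gamma>) (slash \<iota> k m \<gamma> \<phi>) a" "a 0 = 0"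
      using cusp_formsD(4)[OF \<phi> \<gamma>] by blast
    have sub: "cusp_coords \<gamma> O_ring (O_ideal P) \<subseteq> cusp_coords \<gamma> O_ring O_ring"
      by (rule cusp_coords_mono) (simp_all add: O_ideal_subset)
    show "\<exists>a. has_u_expansion \<iota> (cusp_lattice (Gamma0 P) \<gamma>) (slash \<iota> k m \<gamma> \<phi>) a \<and> a 0 = 0"
      using has_u_expansion_sublattice[OF cusp_coords_lattices(1,2)[OF D] sub R a(1)[unfolded cusp_lattice_GL2_O[OF D]]] a(2)
      unfolding cusp_lattice_Gamma0[OF D] by auto
  qed (use cusp_formsD[OF \<phi>] Gamma0_subset[of P] in auto)
qed

text \<open>
  The matrix of the Fricke involution normalises \<open>\<Gamma>\<^sub>0(P)\<close>, hence permutes the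
  cusps without changing their lattices.
\<close>

definition fricke_matrix :: "'a poly ^ 2 ^ 2" where
  "fricke_matrix = mat2 0 (- 1) P 0"

lemma fricke_conv: "fricke \<iota> k m P = slash \<iota> k m (poly_matrix fricke_matrix)"
  by (simp add: fricke_def fricke_matrix_def poly_matrix_mat2 of_O_minus)

lemma det_fricke_matrix: "det fricke_matrix = P" "det (poly_matrix fricke_matrix) \<noteq> 0"
  using P_nonzero by (simp_all add: det_poly_matrix fricke_matrix_def det_2)

lemma O_ideal_iff: "y \<in> O_ideal P \<longleftrightarrow> y / of_O P \<in> O_ring"
proof
  assume "y \<in> O_ideal P"
  then obtain p where "y = of_O (P * p)" by (auto elim!: O_idealE dvdE)
  thus "y / of_O P \<in> O_ring" using P_nonzero by (simp add: of_O_mult O_ring_of_O)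
next
  assume "y / of_O P \<in> O_ring"
  then obtain p where "y / of_O P = of_O p" by (rule O_ringE)
  hence "y = of_O (P * p)" using P_nonzero by (simp add: of_O_mult divide_eq_eq mult.commute)
  thus "y \<in> O_ideal P" by (simp add: O_ideal_of_O)
qed

lemma cusp_lattice_fricke:
  fixes \<gamma> :: "'a fls ^ 2 ^ 2"
  assumes D: "det \<gamma> \<noteq> 0"
  shows "cusp_lattice (Gamma0 P) (poly_matrix fricke_matrix ** \<gamma>) = cusp_lattice (Gamma0 P) \<gamma>"
proof -
  have D': "det (poly_matrix fricke_matrix ** \<gamma>) = of_O P * det \<gamma>"
    by (simp add: det_mul det_poly_matrix det_fricke_matrix)
  have D0: "det (poly_matrix fricke_matrix ** \<gamma>) \<noteq> 0" using D P_nonzero by (simp add: D')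
  define \<gamma>' where "\<gamma>' = poly_matrix fricke_matrix ** \<gamma>"
  have ent: "\<gamma>' $ 1 $ 1 = - \<gamma> $ 2 $ 1" "\<gamma>' $ 2 $ 1 = of_O P * \<gamma> $ 1 $ 1" "det \<gamma>' = of_O P * det \<gamma>"
    unfolding \<gamma>'_def D' by (simp_all add: matrix_mult_2_nth fricke_matrix_def of_O_minus)
  have P0: "of_O P \<noteq> 0" using P_nonzero by simp
  have cp: "col_prod \<gamma>' 1 2 = - col_prod \<gamma> 1 2" "col_prod \<gamma>' 1 1 = col_prod \<gamma> 2 2 / of_O P"
    "col_prod \<gamma>' 2 2 = of_O P * col_prod \<gamma> 1 1"
    unfolding col_prod_def ent using P0 D by (simp_all add: field_simps)
  have neg: "- x \<in> O_ring \<longleftrightarrow> x \<in> O_ring" for x :: "'a fls"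
    using O_ring_diff[OF O_ring_0, of x] O_ring_diff[OF O_ring_0, of "- x"] by auto
  have "b \<in> cusp_coords \<gamma>' O_ring (O_ideal P) \<longleftrightarrow> b \<in> cusp_coords \<gamma> O_ring (O_ideal P)" for b
  proof -
    have "b * col_prod \<gamma>' 1 2 \<in> O_ring \<longleftrightarrow> b * col_prod \<gamma> 1 2 \<in> O_ring"
      unfolding cp using neg[of "b * col_prod \<gamma> 1 2"] by simp
    moreover have "b * col_prod \<gamma>' 1 1 \<in> O_ring \<longleftrightarrow> b * col_prod \<gamma> 2 2 \<in> O_ideal P"
      unfolding cp O_ideal_iff by simp
    moreover have "b * col_prod \<gamma>' 2 2 \<in> O_ideal P \<longleftrightarrow> b * col_prod \<gamma> 1 1 \<in> O_ring"
    proof -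
      have "b * col_prod \<gamma>' 2 2 / of_O P = b * col_prod \<gamma> 1 1" unfolding cp using P0 by simp
      thus ?thesis unfolding O_ideal_iff by simp
    qed
    ultimately show ?thesis by (auto simp: cusp_coords_def)
  qed
  hence "cusp_coords \<gamma>' O_ring (O_ideal P) = cusp_coords \<gamma> O_ring (O_ideal P)"
    by (intro Set.set_eqI)
  thus ?thesis
    by (simp only: cusp_lattice_Gamma0[OF D0] cusp_lattice_Gamma0[OF D] \<gamma>'_def)
qed

lemma fricke_cusp_form:
  assumes \<phi>: "\<phi> \<in> cusp_forms \<iota> k m (Gamma0 P)"
  shows "fricke \<iota> k m P \<phi> \<in> cusp_forms \<iota> k m (Gamma0 P)"
proof (rule cusp_formsI)
  show "rigid_analytic \<iota> (fricke \<iota> k m P \<phi>)"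
    unfolding fricke_conv by (rule rigid_analytic_slash[OF cusp_formsD(2)[OF \<phi>] det_fricke_matrix(2) weight])
  show "fricke \<iota> k m P \<phi> z = 0" if "z \<notin> Omega \<iota>" for z
    using that by (simp add: fricke_conv)
next
  fix \<gamma> assume "\<gamma> \<in> Gamma0 P"
  then obtain A where A: "\<gamma> = poly_matrix A" "invertible A" "P dvd A $ 2 $ 1"
    by (auto simp: Gamma0_poly_matrix)
  then obtain c where c: "A $ 2 $ 1 = P * c" by (auto elim: dvdE)
  define A' where "A' = mat2 (A $ 2 $ 2) (- c) (- (P * A $ 1 $ 2)) (A $ 1 $ 1)"
  have comm: "fricke_matrix ** A = A' ** fricke_matrix"
    by (intro matrix_2_eqI) (simp_all add: matrix_mult_2_nth fricke_matrix_def A'_def c)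
  have "det A' = det A" by (simp add: det_2 A'_def c)
  hence A': "invertible A'" using A(2) by (simp add: invertible_2_iff)
  have "poly_matrix A' \<in> Gamma0 P"
    unfolding Gamma0_poly_matrix using A' by (auto simp: A'_def)
  hence inv: "slash \<iota> k m (poly_matrix A') \<phi> = \<phi>" by (rule cusp_formsD(3)[OF \<phi>])
  have "slash \<iota> k m \<gamma> (fricke \<iota> k m P \<phi>) = slash \<iota> k m (poly_matrix (fricke_matrix ** A)) \<phi>"
    unfolding fricke_conv A(1) poly_matrix_mult
    by (rule slash_mult[OF det_fricke_matrix(2) det_poly_matrix_nonzero[OF A(2)], symmetric])
  also have "\<dots> = slash \<iota> k m (poly_matrix fricke_matrix) (slash \<iota> k m (poly_matrix A') \<phi>)"
    unfolding comm poly_matrix_mult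
    by (rule slash_mult[OF det_poly_matrix_nonzero[OF A'] det_fricke_matrix(2)])
  finally show "slash \<iota> k m \<gamma> (fricke \<iota> k m P \<phi>) = fricke \<iota> k m P \<phi>"
    by (simp add: inv fricke_conv)
next
  fix \<gamma> assume \<gamma>: "\<gamma> \<in> (GL2_K :: ('a fls ^ 2 ^ 2) set)"
  have D: "det \<gamma> \<noteq> 0" by (rule det_GL2_K[OF \<gamma>])
  have "poly_matrix fricke_matrix ** \<gamma> \<in> GL2_K"
    by (rule GL2_K_mult_poly[OF \<gamma>]) (simp add: det_fricke_matrix P_nonzero)
  from cusp_formsD(4)[OF \<phi> this] show
    "\<exists>a. has_u_expansion \<iota> (cusp_lattice (Gamma0 P) \<gamma>) (slash \<iota> k m \<gamma> (fricke \<iota> k m P \<phi>)) a \<and> a 0 = 0"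
    unfolding cusp_lattice_fricke[OF D] fricke_conv slash_mult[OF det_fricke_matrix(2) D] .
qed

text \<open>
  The summand \<open>\<phi>|r\<close> of the trace depends only on the coset of \<open>r\<close>, and
  right multiplication permutes the cosets.
\<close>

lemma trace_conv: "trace_map \<iota> k m P \<phi> = (\<lambda>z. \<Sum>r\<in>poly_reps P. slash \<iota> k m (poly_matrix r) \<phi> z)"
proof
  fix z
  have "inj_on poly_matrix (poly_reps P)" by (rule inj_onI) (simp add: poly_matrix_eq_iff)
  thus "trace_map \<iota> k m P \<phi> z = (\<Sum>r\<in>poly_reps P. slash \<iota> k m (poly_matrix r) \<phi> z)"
    unfolding trace_map_def coset_reps_conv by (simp add: sum.reindex)
qed

lemma slash_same_coset:
  assumes \<phi>: "\<phi> \<in> cusp_forms \<iota> k m (Gamma0 P)" and A: "invertible A" and B: "invertible B"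
    and d: "P dvd row_det A B"
  shows "slash \<iota> k m (poly_matrix A) \<phi> = slash \<iota> k m (poly_matrix B) \<phi>"
proof -
  obtain G where G: "invertible G" "P dvd G $ 2 $ 1" "A = G ** B"
    using row_det_same_coset[OF A B d] by blast
  have "poly_matrix G \<in> Gamma0 P" using G by (auto simp: Gamma0_poly_matrix)
  hence inv: "slash \<iota> k m (poly_matrix G) \<phi> = \<phi>" by (rule cusp_formsD(3)[OF \<phi>])
  have "slash \<iota> k m (poly_matrix A) \<phi> = slash \<iota> k m (poly_matrix B) (slash \<iota> k m (poly_matrix G) \<phi>)"
    unfolding G(3) poly_matrix_mult
    by (rule slash_mult[OF det_poly_matrix_nonzero[OF G(1)] det_poly_matrix_nonzero[OF B]])
  thus ?thesis by (simp add: inv)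
qed

lemma slash_trace:
  assumes "det \<gamma> \<noteq> 0"
  shows "slash \<iota> k m \<gamma> (trace_map \<iota> k m P \<phi>) =
    (\<lambda>z. \<Sum>r\<in>poly_reps P. slash \<iota> k m (poly_matrix r ** \<gamma>) \<phi> z)"
  unfolding trace_conv slash_sum
  by (rule ext, rule sum.cong[OF refl])
     (simp add: slash_mult[OF det_poly_matrix_nonzero[OF invertible_poly_reps] assms])

lemma trace_invariant:
  assumes \<phi>: "\<phi> \<in> cusp_forms \<iota> k m (Gamma0 P)" and \<gamma>: "\<gamma> \<in> GL2_O"
  shows "slash \<iota> k m \<gamma> (trace_map \<iota> k m P \<phi>) = trace_map \<iota> k m P \<phi>"
proof -
  obtain A where A: "\<gamma> = poly_matrix A" "invertible A" using \<gamma> by (auto simp: GL2_O_poly_matrix)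
  define \<pi> where "\<pi> r = (THE s. s \<in> poly_reps P \<and> P dvd row_det (r ** A) s)" for r
  have inv: "invertible (r ** A)" if "r \<in> poly_reps P" for r
    using that by (intro invertible_mult invertible_poly_reps A(2))
  have \<pi>: "\<pi> r \<in> poly_reps P \<and> P dvd row_det (r ** A) (\<pi> r)" if "r \<in> poly_reps P" for r
    unfolding \<pi>_def by (rule theI'[OF ex1_poly_rep[OF prime inv[OF that]]])
  have "inj_on \<pi> (poly_reps P)"
  proof (rule inj_onI)
    fix r s assume rs: "r \<in> poly_reps P" "s \<in> poly_reps P" "\<pi> r = \<pi> s"
    have "P dvd row_det (r ** A) (s ** A)"
    proof (rule row_det_trans[OF prime])
      show "invertible (\<pi> r)" using \<pi>[OF rs(1)] invertible_poly_reps by blast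
      show "P dvd row_det (r ** A) (\<pi> r)" using \<pi>[OF rs(1)] by blast
      show "P dvd row_det (s ** A) (\<pi> r)" unfolding rs(3) using \<pi>[OF rs(2)] by blast
    qed
    hence "P dvd row_det r s * det A" by (simp add: row_det_mult)
    moreover have "det A dvd 1" using A(2) by (simp add: invertible_2_iff)
    ultimately have "P dvd row_det r s"
      using prime_elem_dvd_multD[OF prime, of "row_det r s" "det A"] not_unit dvd_trans[of P "det A" 1] by blast
    moreover have "P dvd row_det r r" by (simp add: row_det_def mult.commute)
    ultimately show "r = s"
      using ex1_poly_rep[OF prime invertible_poly_reps[OF rs(1)]] rs(1,2) by blast
  qed
  moreover have "\<pi> ` poly_reps P \<subseteq> poly_reps P" using \<pi> by blast
  ultimately have bij: "bij_betw \<pi> (poly_reps P) (poly_reps P)"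
    using endo_inj_surj[OF finite_poly_reps] by (simp add: bij_betw_def)
  show ?thesis
  proof
    fix z
    have "slash \<iota> k m \<gamma> (trace_map \<iota> k m P \<phi>) z = (\<Sum>r\<in>poly_reps P. slash \<iota> k m (poly_matrix (r ** A)) \<phi> z)"
      unfolding A(1) by (subst slash_trace[OF det_poly_matrix_nonzero[OF A(2)]]) (simp add: poly_matrix_mult)
    also have "\<dots> = (\<Sum>r\<in>poly_reps P. slash \<iota> k m (poly_matrix (\<pi> r)) \<phi> z)"
    proof (rule sum.cong[OF refl])
      fix r assume r: "r \<in> poly_reps P"
      have "slash \<iota> k m (poly_matrix (r ** A)) \<phi> = slash \<iota> k m (poly_matrix (\<pi> r)) \<phi>"
        by (rule slash_same_coset[OF \<phi> inv[OF r] invertible_poly_reps[OF conjunct1[OF \<pi>[OF r]]]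
            conjunct2[OF \<pi>[OF r]]])
      thus "slash \<iota> k m (poly_matrix (r ** A)) \<phi> z = slash \<iota> k m (poly_matrix (\<pi> r)) \<phi> z" by simp
    qed
    also have "\<dots> = (\<Sum>r\<in>poly_reps P. slash \<iota> k m (poly_matrix r) \<phi> z)"
      by (rule sum.reindex_bij_betw[OF bij])
    finally show "slash \<iota> k m \<gamma> (trace_map \<iota> k m P \<phi>) z = trace_map \<iota> k m P \<phi> z"
      by (simp add: trace_conv)
  qed
qed

text \<open>
  The lattices of the summands \<open>\<phi>|r\<gamma>\<close> depend on \<open>r\<close>, but all
  contain that of the principal congruence subgroup, in whose parameter the sum is expanded. The sum is
  invariant under the lattice of \<open>GL\<^sub>2(\<O>)\<close>, so its expansion descends to that
  lattice.
\<close>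

lemma trace_cusp_form:
  assumes \<phi>: "\<phi> \<in> cusp_forms \<iota> k m (Gamma0 P)"
  shows "trace_map \<iota> k m P \<phi> \<in> cusp_forms \<iota> k m GL2_O"
proof (rule cusp_formsI)
  show "trace_map \<iota> k m P \<phi> z = 0" if "z \<notin> Omega \<iota>" for z
    using that by (simp add: trace_conv)
  show "rigid_analytic \<iota> (trace_map \<iota> k m P \<phi>)"
    unfolding trace_conv
    by (intro rigid_analytic_sum rigid_analytic_slash[OF cusp_formsD(2)[OF \<phi>] _ weight]
        det_poly_matrix_nonzero invertible_poly_reps)
  show "slash \<iota> k m \<gamma> (trace_map \<iota> k m P \<phi>) = trace_map \<iota> k m P \<phi>" if "\<gamma> \<in> GL2_O" for \<gamma>
    by (rule trace_invariant[OF \<phi> that])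
next
  fix \<gamma> assume \<gamma>: "\<gamma> \<in> (GL2_K :: ('a fls ^ 2 ^ 2) set)"
  have D: "det \<gamma> \<noteq> 0" by (rule det_GL2_K[OF \<gamma>])
  define \<Lambda> where "\<Lambda> = cusp_coords \<gamma> (O_ideal P) (O_ideal P)"
  have summand: "\<exists>a. has_u_expansion \<iota> \<Lambda> (slash \<iota> k m (poly_matrix r ** \<gamma>) \<phi>) a \<and> a 0 = 0" if r: "r \<in> poly_reps P" for r
  proof -
    define \<gamma>' where "\<gamma>' = poly_matrix r ** \<gamma>"
    have inv: "invertible r" by (rule invertible_poly_reps[OF r])
    have D': "det \<gamma>' \<noteq> 0" using det_poly_matrix_nonzero[OF inv] D by (simp add: \<gamma>'_def det_mul)
    have \<gamma>': "\<gamma>' \<in> GL2_K"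
      unfolding \<gamma>'_def using inv by (intro GL2_K_mult_poly[OF \<gamma>]) (auto simp: invertible_2_iff)
    have "\<Lambda> \<subseteq> cusp_coords \<gamma>' (O_ideal P) (O_ideal P)"
      unfolding \<Lambda>_def \<gamma>'_def
      by (rule cusp_coords_mult[OF inv D add_subgroup_O_ideal O_ideal_mult])
    moreover have "cusp_coords \<gamma>' (O_ideal P) (O_ideal P) \<subseteq> \<Lambda>"
    proof -
      obtain s where s: "r ** s = mat 1" "s ** r = mat 1" using inv unfolding invertible_def by blast
      hence "invertible s" unfolding invertible_def by blast
      from cusp_coords_mult[OF this D' add_subgroup_O_ideal O_ideal_mult]
      have "cusp_coords \<gamma>' (O_ideal P) (O_ideal P) \<subseteq> cusp_coords (poly_matrix s ** \<gamma>') (O_ideal P) (O_ideal P)" .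
      moreover have "poly_matrix s ** \<gamma>' = \<gamma>"
        unfolding \<gamma>'_def by (simp add: matrix_mul_assoc s poly_matrix_mat_1 flip: poly_matrix_mult)
      ultimately show ?thesis by (simp add: \<Lambda>_def)
    qed
    ultimately have \<Lambda>_eq: "\<Lambda> = cusp_coords \<gamma>' (O_ideal P) (O_ideal P)" by blast
    have sub: "cusp_coords \<gamma>' (O_ideal P) (O_ideal P) \<subseteq> cusp_coords \<gamma>' O_ring (O_ideal P)"
      "cusp_coords \<gamma>' O_ring (O_ideal P) \<subseteq> cusp_coords \<gamma>' O_ring O_ring"
      by (rule cusp_coords_mono; simp add: O_ideal_subset)+
    have grp: "add_subgroup (cusp_coords \<gamma>' O_ring (O_ideal P))" "add_subgroup (cusp_coords \<gamma>' (O_ideal P) (O_ideal P))"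
      by (rule add_subgroup_cusp_coords; simp add: add_subgroup_O_ring add_subgroup_O_ideal)+
    obtain R where R: "coset_system (cusp_coords \<gamma>' O_ring (O_ideal P)) (cusp_coords \<gamma>' (O_ideal P) (O_ideal P)) R"
      using ex_coset_system_cusp_coords[OF P_nonzero grp sub(2) order_refl] by blast
    obtain a where a: "has_u_expansion \<iota> (cusp_lattice (Gamma0 P) \<gamma>') (slash \<iota> k m \<gamma>' \<phi>) a" "a 0 = 0"
      using cusp_formsD(4)[OF \<phi> \<gamma>'] by blast
    show ?thesis
      using has_u_expansion_sublattice[OF cusp_coords_lattices(2,3)[OF D'] sub(1) R a(1)[unfolded cusp_lattice_Gamma0[OF D']]] a(2)
      unfolding \<Lambda>_eq \<gamma>'_def by auto
  qed
  then obtain a where a: "\<And>r. r \<in> poly_reps P \<Longrightarrow>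
      has_u_expansion \<iota> \<Lambda> (slash \<iota> k m (poly_matrix r ** \<gamma>) \<phi>) (a r) \<and> a r 0 = 0" by metis
  have sum: "has_u_expansion \<iota> \<Lambda> (\<lambda>z. \<Sum>r\<in>I. slash \<iota> k m (poly_matrix r ** \<gamma>) \<phi> z) (\<lambda>n. \<Sum>r\<in>I. a r n)"
    if "finite I" "I \<subseteq> poly_reps P" for I
    using that
  proof (induction I rule: finite_induct)
    case (insert r I)
    thus ?case using has_u_expansion_add[of \<Lambda> _ "a r"] a[of r] by simp
  qed (simp add: has_u_expansion_zero)
  have exp: "has_u_expansion \<iota> \<Lambda> (slash \<iota> k m \<gamma> (trace_map \<iota> k m P \<phi>)) (\<lambda>n. \<Sum>r\<in>poly_reps P. a r n)"
    unfolding slash_trace[OF D] by (rule sum[OF finite_poly_reps order_refl])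
  have sub: "\<Lambda> \<subseteq> cusp_coords \<gamma> O_ring O_ring"
    unfolding \<Lambda>_def by (rule cusp_coords_mono; rule O_ideal_subset)
  have grp: "add_subgroup (cusp_coords \<gamma> O_ring O_ring)" "add_subgroup \<Lambda>"
    unfolding \<Lambda>_def by (rule add_subgroup_cusp_coords; simp add: add_subgroup_O_ring add_subgroup_O_ideal)+
  obtain R where R: "coset_system (cusp_coords \<gamma> O_ring O_ring) \<Lambda> R"
    using ex_coset_system_cusp_coords[OF P_nonzero grp order_refl] by (auto simp: \<Lambda>_def)
  have "\<exists>b. has_u_expansion \<iota> (cusp_coords \<gamma> O_ring O_ring) (slash \<iota> k m \<gamma> (trace_map \<iota> k m P \<phi>)) b
      \<and> b 0 = (\<Sum>r\<in>poly_reps P. a r 0)"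
  proof (rule has_u_expansion_superlattice[OF cusp_coords_lattices(1)[OF D] _ sub R exp])
    show "discrete_lattice \<Lambda>" unfolding \<Lambda>_def by (rule cusp_coords_lattices(3)[OF D])
    fix z b assume "z \<in> Omega \<iota>" "b \<in> cusp_coords \<gamma> O_ring O_ring"
    thus "slash \<iota> k m \<gamma> (trace_map \<iota> k m P \<phi>) (z + \<iota> b) = slash \<iota> k m \<gamma> (trace_map \<iota> k m P \<phi>) z"
      by (intro slash_periodic[OF D, of _ GL2_O] trace_invariant[OF \<phi>]) (simp_all add: cusp_lattice_GL2_O[OF D])
  qed
  thus "\<exists>a. has_u_expansion \<iota> (cusp_lattice GL2_O \<gamma>) (slash \<iota> k m \<gamma> (trace_map \<iota> k m P \<phi>)) a \<and> a 0 = 0"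
    unfolding cusp_lattice_GL2_O[OF D] using a by auto
qed

text \<open>
  On forms of level one the trace is multiplication by \<open>1 + q\<^sup>d = 1\<close>: the translation
  \<open>Q \<mapsto> Q + 1\<close> shows that the number of polynomials of degree less than
  \<open>d\<close> is zero in characteristic \<open>p\<close>.
\<close>

lemma of_nat_card_degree_less: "of_nat (card {Q :: 'a poly. Polynomial.degree Q < Polynomial.degree P}) = (0 :: 'c)"
proof -
  define S where "S = {Q :: 'a poly. Polynomial.degree Q < Polynomial.degree P}"
  have fin: "finite S" by (simp add: S_def finite_degree_less)
  have "bij_betw (\<lambda>Q. Q + 1) S S"
    using degree_P by (intro bij_betwI[where g = "\<lambda>Q. Q - 1"])
      (auto simp: S_def intro: degree_add_less degree_diff_less)
  hence "(\<Sum>Q\<in>S. \<iota> (of_O (Q + 1))) = (\<Sum>Q\<in>S. \<iota> (of_O Q))" by (rule sum.reindex_bij_betw)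
  hence "(\<Sum>Q\<in>S. \<iota> (of_O Q)) + of_nat (card S) = (\<Sum>Q\<in>S. \<iota> (of_O Q))"
    by (simp add: of_O_add iota_add sum.distrib)
  thus ?thesis by (simp add: S_def)
qed

lemma trace_level_one:
  assumes \<phi>: "\<phi> \<in> cusp_forms \<iota> k m GL2_O"
  shows "trace_map \<iota> k m P \<phi> = \<phi>"
proof
  fix z
  define S where "S = {Q :: 'a poly. Polynomial.degree Q < Polynomial.degree P}"
  have reps: "poly_reps P = insert (mat 1) ((\<lambda>Q. mat2 0 (- 1) 1 Q) ` S)"
    by (auto simp: poly_reps_def S_def)
  have "inj_on (\<lambda>Q. mat2 0 (- 1) 1 Q) S"
    by (rule inj_onI) (metis mat2_nth(4))
  hence "card ((\<lambda>Q. mat2 0 (- 1) 1 Q) ` S) = card S" by (rule card_image)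
  moreover have "mat 1 \<notin> (\<lambda>Q. mat2 0 (- 1) 1 Q) ` S"
  proof
    assume "mat 1 \<in> (\<lambda>Q. mat2 0 (- 1) 1 Q) ` S"
    then obtain Q where "(mat 1 :: 'a poly ^ 2 ^ 2) = mat2 0 (- 1) 1 Q" by blast
    hence "(mat 1 :: 'a poly ^ 2 ^ 2) $ 2 $ 1 = mat2 0 (- 1) 1 Q $ 2 $ 1" by simp
    thus False by simp
  qed
  moreover have "finite S" by (simp add: S_def finite_degree_less)
  ultimately have "card (poly_reps P) = Suc (card S)" by (simp add: reps)
  hence card: "of_nat (card (poly_reps P)) = (1 :: 'c)"
    using of_nat_card_degree_less by (simp add: S_def)
  have "slash \<iota> k m (poly_matrix r) \<phi> = \<phi>" if "r \<in> poly_reps P" for r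
    using invertible_poly_reps[OF that] by (intro cusp_formsD(3)[OF \<phi>]) (auto simp: GL2_O_poly_matrix)
  thus "trace_map \<iota> k m P \<phi> z = \<phi> z" by (simp add: trace_conv card)
qed

text \<open>
  The matrix of the Fricke operator is the product of one in \<open>GL\<^sub>2(\<O>)\<close> and the
  matrix of \<open>\<delta>\<^sub>P\<close>.
\<close>

lemma delta_P_level_one:
  assumes \<phi>: "\<phi> \<in> cusp_forms \<iota> k m GL2_O"
  shows "delta_P \<iota> k m P \<phi> = fricke \<iota> k m P \<phi>"
proof -
  define S D where "S = (mat2 0 (- 1) 1 0 :: 'a poly ^ 2 ^ 2)" and "D = mat2 P 0 0 1"
  have S: "invertible S" by (simp add: S_def invertible_2_iff det_2)
  have D0: "det (poly_matrix D) \<noteq> 0" using P_nonzero by (simp add: det_poly_matrix D_def det_2)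
  have "poly_matrix S \<in> GL2_O" using S by (auto simp: GL2_O_poly_matrix)
  hence inv: "slash \<iota> k m (poly_matrix S) \<phi> = \<phi>" by (rule cusp_formsD(3)[OF \<phi>])
  have "fricke_matrix = S ** D"
    by (intro matrix_2_eqI) (simp_all add: matrix_mult_2_nth fricke_matrix_def S_def D_def)
  hence "fricke \<iota> k m P \<phi> = slash \<iota> k m (poly_matrix D) (slash \<iota> k m (poly_matrix S) \<phi>)"
    unfolding fricke_conv poly_matrix_mult
    using slash_mult[OF det_poly_matrix_nonzero[OF S] D0] by (simp add: poly_matrix_mult)
  thus ?thesis by (simp add: inv delta_P_def D_def poly_matrix_mat2)
qed

text \<open>
  The square of the matrix is the scalar \<open>-P\<close>. It acts as the scalar \<open>P\<close> does,
  since \<open>-1\<close> belongs to \<open>\<Gamma>\<^sub>0(P)\<close>.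
\<close>

lemma fricke_fricke:
  assumes \<phi>: "\<phi> \<in> cusp_forms \<iota> k m (Gamma0 P)"
  shows "fricke \<iota> k m P (fricke \<iota> k m P \<phi>) = (\<lambda>z. \<iota> (of_O P) powi (2 * m - k) * \<phi> z)"
proof -
  define N where "N = (mat2 (- 1) 0 0 (- 1) :: 'a poly ^ 2 ^ 2)"
  define D where "D = mat2 P 0 0 P"
  have N: "invertible N" by (simp add: N_def invertible_2_iff det_2)
  have D0: "det (poly_matrix D) \<noteq> 0" using P_nonzero by (simp add: det_poly_matrix D_def det_2)
  have "poly_matrix N \<in> Gamma0 P" using N by (auto simp: Gamma0_poly_matrix N_def)
  hence inv: "slash \<iota> k m (poly_matrix N) \<phi> = \<phi>" by (rule cusp_formsD(3)[OF \<phi>])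
  have mat: "fricke_matrix ** fricke_matrix = N ** D"
    by (intro matrix_2_eqI) (simp_all add: matrix_mult_2_nth fricke_matrix_def N_def D_def)
  have "fricke \<iota> k m P (fricke \<iota> k m P \<phi>) = slash \<iota> k m (poly_matrix (fricke_matrix ** fricke_matrix)) \<phi>"
    unfolding fricke_conv poly_matrix_mult
    by (rule slash_mult[OF det_fricke_matrix(2) det_fricke_matrix(2), symmetric])
  also have "\<dots> = slash \<iota> k m (poly_matrix D) (slash \<iota> k m (poly_matrix N) \<phi>)"
    unfolding mat poly_matrix_mult by (rule slash_mult[OF det_poly_matrix_nonzero[OF N] D0])
  also have "\<dots> = (\<lambda>z. \<iota> (of_O P) powi (2 * m - k) * \<phi> z)"
    unfolding inv D_def poly_matrix_mat2 of_O_0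
    using P_nonzero cusp_formsD(1)[OF \<phi>] by (intro ext) (simp add: slash_scalar)
  finally show ?thesis .
qed

lemma fricke_linear:
  "fricke \<iota> k m P (\<lambda>z. f z + g z) = (\<lambda>z. fricke \<iota> k m P f z + fricke \<iota> k m P g z)"
  "fricke \<iota> k m P (\<lambda>z. c * f z) = (\<lambda>z. c * fricke \<iota> k m P f z)"
  by (simp_all add: fricke_conv slash_add slash_scale)

lemma trace_linear:
  "trace_map \<iota> k m P (\<lambda>z. f z + g z) = (\<lambda>z. trace_map \<iota> k m P f z + trace_map \<iota> k m P g z)"
  "trace_map \<iota> k m P (\<lambda>z. c * f z) = (\<lambda>z. c * trace_map \<iota> k m P f z)"
  by (simp_all add: trace_conv slash_add slash_scale sum.distrib sum_distrib_left)

lemma twisted_trace_linear: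
  "twisted_trace \<iota> k m P (\<lambda>z. f z + g z) = (\<lambda>z. twisted_trace \<iota> k m P f z + twisted_trace \<iota> k m P g z)"
  "twisted_trace \<iota> k m P (\<lambda>z. c * f z) = (\<lambda>z. c * twisted_trace \<iota> k m P f z)"
  by (simp_all add: twisted_trace_def fricke_linear trace_linear)

lemma twisted_trace_cusp_form:
  "\<phi> \<in> cusp_forms \<iota> k m (Gamma0 P) \<Longrightarrow> twisted_trace \<iota> k m P \<phi> \<in> cusp_forms \<iota> k m GL2_O"
  unfolding twisted_trace_def by (intro trace_cusp_form fricke_cusp_form)

end

end

section \<open>A three circles theorem for periodic functions\<close>

lemma prod_list_ge_of_ratio:
  fixes f g :: "'b \<Rightarrow> real"
  assumes "0 \<le> l" "\<And>x. x \<in> set xs \<Longrightarrow> p x \<Longrightarrow> l * f x \<le> g x"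
    "\<And>x. x \<in> set xs \<Longrightarrow> \<not> p x \<Longrightarrow> f x \<le> g x" "\<And>x. 0 \<le> f x"
  shows "l ^ length (filter p xs) * prod_list (map f xs) \<le> prod_list (map g xs)"
  using assms(2,3)
proof (induction xs)
  case (Cons x xs)
  have IH: "l ^ length (filter p xs) * prod_list (map f xs) \<le> prod_list (map g xs)"
    using Cons by simp
  have nn: "0 \<le> prod_list (map f xs)" using assms(4) by (induction xs) auto
  show ?case
  proof (cases "p x")
    case True
    have "(l * f x) * (l ^ length (filter p xs) * prod_list (map f xs)) \<le> g x * prod_list (map g xs)"
      using Cons.prems(1)[of x] True IH assms(1,4) nn
      by (intro mult_mono) (auto intro: order.trans[OF mult_nonneg_nonneg])
    thus ?thesis using True by (simp add: mult_ac)
  next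
    case False
    have "f x * (l ^ length (filter p xs) * prod_list (map f xs)) \<le> g x * prod_list (map g xs)"
      using Cons.prems(2)[of x] False IH assms(1,4) nn
      by (intro mult_mono) (auto intro: order.trans[OF assms(4)])
    thus ?thesis using False by (simp add: mult_ac)
  qed
qed simp

lemma prod_list_eq_of_ratio:
  fixes f g :: "'b \<Rightarrow> real"
  assumes "\<And>x. x \<in> set xs \<Longrightarrow> p x \<Longrightarrow> g x = l * f x" "\<And>x. x \<in> set xs \<Longrightarrow> \<not> p x \<Longrightarrow> g x = f x"
  shows "prod_list (map g xs) = l ^ length (filter p xs) * prod_list (map f xs)"
  using assms by (induction xs) auto

lemma prod_list_map_pos:
  fixes f :: "'b \<Rightarrow> real"
  shows "(\<And>x. x \<in> set xs \<Longrightarrow> 0 < f x) \<Longrightarrow> 0 < prod_list (map f xs)"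
  by (induction xs) auto

context drinfeld_setting
begin

text \<open>
  For a rational function of \<open>t\<close> without poles in an annulus, the generic absolute value on
  the circle of radius \<open>s\<close> is proportional to \<open>s\<^sup>-\<^sup>n\<close> times the
  product of \<open>max s |\<alpha>|\<close> over the zeros, where \<open>n\<close> is the number of
  poles inside. Hence it grows towards the outer boundary if at least \<open>n\<close> zeros have
  absolute value at most \<open>s\<close>, and towards the inner boundary otherwise.
\<close>

lemma annulus_maximum:
  fixes t0 y1 y2 :: 'c and as bs :: "'c list"
  assumes t0: "s1 \<le> vabs t0" "vabs t0 \<le> s2" and s1: "0 < s1"
    and bs: "\<And>b. b \<in> set bs \<Longrightarrow> vabs b < s1 \<or> vabs b > s2"
    and y: "vabs y1 = s1" "vabs y2 = s2"
  obtains t where "vabs t = s1 \<or> vabs t = s2"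
    "(\<Prod>a\<leftarrow>as. vabs (t0 - a)) / (\<Prod>b\<leftarrow>bs. vabs (t0 - b)) \<le> (\<Prod>a\<leftarrow>as. vabs (t - a)) / (\<Prod>b\<leftarrow>bs. vabs (t - b))"
proof -
  note result = that
  define s where "s = vabs t0"
  have s: "0 < s" "s1 \<le> s" "s \<le> s2" using t0 s1 by (auto simp: s_def)
  define N where "N = length (filter (\<lambda>a. vabs a \<le> s) as)"
  define n where "n = length (filter (\<lambda>b. vabs b < s1) bs)"
  have G0: "(\<Prod>b\<leftarrow>bs. vabs (t0 - b)) > 0"
  proof (rule prod_list_map_pos)
    fix b assume "b \<in> set bs"
    hence "t0 \<noteq> b" using bs[of b] t0 by auto
    thus "0 < vabs (t0 - b)" by simp
  qed
  have step: thesis if S: "S = s1 \<or> S = s2" and y: "vabs y = S"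
    and pow: "(S / s) ^ n \<le> (S / s) ^ N" for S and y :: 'c
  proof -
    have S0: "0 < S" "s1 \<le> S" "S \<le> s2" using S s s1 by auto
    define l where "l = S / s"
    have l: "0 < l" using S0 s by (simp add: l_def)
    have "y \<noteq> 0" using y S0 by auto
    then obtain t where t: "vabs t = S" "\<And>a. a \<in> set as \<Longrightarrow> vabs (t - a) = max S (vabs a)"
      using generic_point[of "set as" y] y by auto
    have F: "l ^ N * (\<Prod>a\<leftarrow>as. vabs (t0 - a)) \<le> (\<Prod>a\<leftarrow>as. vabs (t - a))"
      unfolding N_def
    proof (rule prod_list_ge_of_ratio)
      fix a assume a: "a \<in> set as"
      have le: "vabs (t0 - a) \<le> max s (vabs a)" using vabs_diff_le[of t0 a] by (simp add: s_def)
      show "l * vabs (t0 - a) \<le> vabs (t - a)" if "vabs a \<le> s"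
      proof -
        have "l * vabs (t0 - a) \<le> l * s" using le that l by (intro mult_left_mono) auto
        also have "\<dots> = S" using s by (simp add: l_def)
        finally show ?thesis using t(2)[OF a] by simp
      qed
      show "vabs (t0 - a) \<le> vabs (t - a)" if "\<not> vabs a \<le> s"
        using le that t(2)[OF a] by auto
    qed (use l in auto)
    have G: "(\<Prod>b\<leftarrow>bs. vabs (t - b)) = l ^ n * (\<Prod>b\<leftarrow>bs. vabs (t0 - b))"
      unfolding n_def
    proof (rule prod_list_eq_of_ratio)
      fix b assume b: "b \<in> set bs"
      show "vabs (t - b) = l * vabs (t0 - b)" if "vabs b < s1"
        using that S0 s t(1) vabs_diff_eq2[of b t] vabs_diff_eq2[of b t0] by (simp add: s_def l_def)
      show "vabs (t - b) = vabs (t0 - b)" if "\<not> vabs b < s1"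
        using that bs[OF b] S0 s t(1) vabs_diff_eq[of t b] vabs_diff_eq[of t0 b] by (simp add: s_def)
    qed
    have "l ^ n * (\<Prod>a\<leftarrow>as. vabs (t0 - a)) \<le> l ^ N * (\<Prod>a\<leftarrow>as. vabs (t0 - a))"
      using pow by (intro mult_right_mono prod_list_nonneg) (auto simp: l_def)
    hence "l ^ n * (\<Prod>a\<leftarrow>as. vabs (t0 - a)) \<le> (\<Prod>a\<leftarrow>as. vabs (t - a))" using F by linarith
    hence "l ^ n * (\<Prod>a\<leftarrow>as. vabs (t0 - a)) / (l ^ n * (\<Prod>b\<leftarrow>bs. vabs (t0 - b)))
        \<le> (\<Prod>a\<leftarrow>as. vabs (t - a)) / (\<Prod>b\<leftarrow>bs. vabs (t - b))"
      unfolding G using G0 l by (intro divide_right_mono) auto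
    hence "(\<Prod>a\<leftarrow>as. vabs (t0 - a)) / (\<Prod>b\<leftarrow>bs. vabs (t0 - b))
        \<le> (\<Prod>a\<leftarrow>as. vabs (t - a)) / (\<Prod>b\<leftarrow>bs. vabs (t - b))"
      using l by simp
    thus thesis using result[of t] t(1) S by auto
  qed
  show thesis
  proof (cases "n \<le> N")
    case True
    thus ?thesis using s by (intro step[of s2 y2] power_increasing y) auto
  next
    case False
    thus ?thesis using s s1 by (intro step[of s1 y1] power_decreasing y) auto
  qed
qed

lemma exp_size_pos: "0 < \<delta> \<Longrightarrow> 0 < exp_size A \<delta>"
  using exp_size_ge[of \<delta> A] by linarith

lemma exp_size_nonneg: "0 \<le> \<delta> \<Longrightarrow> 0 \<le> exp_size A \<delta>"
  using exp_size_ge[of \<delta> A] by linarith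

lemma sqrt_q_gt_1: "1 < sqrt q" and sqrt_q_pos: "0 < sqrt q"
  using q_gt_1 by simp_all

lemma inverse_q_less: "1 / q < 1 / sqrt q"
proof -
  have "sqrt q * 1 < sqrt q * sqrt q" using sqrt_q_gt_1 sqrt_q_pos by (intro mult_strict_left_mono)
  hence "sqrt q < q" using q_pos by simp
  thus ?thesis using sqrt_q_pos by (intro divide_strict_left_mono) auto
qed

definition O_ball :: "nat \<Rightarrow> 'a fls set" where
  "O_ball M = lattice_ball O_ring (CARD('a) ^ M)"

lemma O_ball_mem: "a \<in> O_ball M \<longleftrightarrow> a \<in> O_ring \<and> fls_abs a \<le> q ^ M"
  by (simp add: O_ball_def lattice_ball_def q_def)

lemma discrete_lattice_O_ring: "discrete_lattice (O_ring :: 'a fls set)"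
  unfolding discrete_lattice_def using add_subgroup_O_ring finite_O_ring_ball by blast

lemma O_ball_subgroup: "add_subgroup (O_ball M)" "finite (O_ball M)" "0 \<in> O_ball M"
  unfolding O_ball_def using lattice_ball_subgroup[OF discrete_lattice_O_ring]
    lattice_ball_0[OF discrete_lattice_O_ring] by blast+

lemma fls_abs_O_ring_ge_1:
  fixes a :: "'a fls"
  assumes "a \<in> O_ring" "a \<noteq> 0"
  shows "1 \<le> fls_abs a"
proof -
  obtain p where "a = of_O p" using assms(1) by (rule O_ringE)
  thus ?thesis using assms(2) q_gt_1 by (simp add: fls_abs_of_O')
qed

text \<open>
  The map \<open>fin_exp (O_ball M)\<close> sends this set to an annulus, and its complement to the
  complement of the annulus. Translations by \<open>O_ball M\<close> preserve it.
\<close>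

definition perforated_disc :: "nat \<Rightarrow> 'c set" where
  "perforated_disc M = {z. vabs z \<le> sqrt q * q ^ M \<and> (\<forall>a\<in>O_ball M. 1 / sqrt q \<le> vabs (z - \<iota> a))}"

lemma O_ball_small: "a \<in> O_ball M \<Longrightarrow> vabs (\<iota> a) < sqrt q * q ^ M"
  using O_ball_mem[of a M] sqrt_q_gt_1 q_pos
  by (auto simp: vabs_iota intro: le_less_trans)

lemma perforated_disc_translate:
  assumes "z \<in> perforated_disc M" "a \<in> O_ball M"
  shows "z + \<iota> a \<in> perforated_disc M"
proof -
  have "1 / sqrt q \<le> vabs (z + \<iota> a - \<iota> b)" if b: "b \<in> O_ball M" for b
  proof -
    have "b - a \<in> O_ball M" by (rule add_subgroup_diff[OF O_ball_subgroup(1) b assms(2)])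
    hence "1 / sqrt q \<le> vabs (z - \<iota> (b - a))" using assms(1) unfolding perforated_disc_def by blast
    thus ?thesis by (simp add: iota_diff algebra_simps)
  qed
  moreover have "vabs (z + \<iota> a) \<le> sqrt q * q ^ M"
    using assms O_ball_small[OF assms(2)] by (intro vabs_add_leI) (auto simp: perforated_disc_def)
  ultimately show ?thesis by (simp add: perforated_disc_def)
qed

text \<open>
  Values of \<open>K\<^sub>\<infinity>\<close> are integral powers of \<open>q\<close>, so every element
  of \<open>K\<^sub>\<infinity>\<close> is within \<open>1/q\<close> of a polynomial and the perforated
  disc stays away from \<open>K\<^sub>\<infinity>\<close>.
\<close>

lemma fls_abs_le_half_power:
  fixes x :: "'a fls"
  assumes "fls_abs x \<le> sqrt q * q ^ M"
  shows "fls_abs x \<le> q ^ M"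
proof (rule ccontr)
  assume n: "\<not> ?thesis"
  hence "x \<noteq> 0" using q_pos by (auto simp: fls_abs_q)
  define j where "j = - fls_subdegree x"
  have x: "fls_abs x = q powi j" using \<open>x \<noteq> 0\<close> by (simp add: fls_abs_q j_def)
  have "\<not> j \<le> int M" using n power_int_increasing[of j "int M" q] q_gt_1 unfolding x by auto
  hence "q powi (int M + 1) \<le> q powi j" using q_gt_1 by (intro power_int_increasing) auto
  moreover have "q powi (int M + 1) = q * q ^ M" using q_pos by (simp add: power_int_add)
  ultimately have "q * q ^ M \<le> sqrt q * q ^ M" using assms unfolding x by linarith
  hence "q \<le> sqrt q" using q_pos by (intro mult_right_le_imp_le[of q "q ^ M" "sqrt q"]) auto
  moreover have "sqrt q * 1 < sqrt q * sqrt q" using sqrt_q_gt_1 sqrt_q_pos by (intro mult_strict_left_mono)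
  ultimately show False using q_pos by simp
qed

lemma near_K_near_O:
  assumes "vabs (z - \<iota> x) < 1 / sqrt q"
  obtains a where "a \<in> O_ring" "vabs (z - \<iota> a) < 1 / sqrt q" "fls_abs a \<le> max (fls_abs x) (1 / q)"
proof -
  obtain p where p: "fls_abs (x - of_O p) \<le> 1 / q" using polynomial_part' by blast
  show ?thesis
  proof (rule that[OF O_ring_of_O])
    have "vabs (\<iota> x - \<iota> (of_O p)) < 1 / sqrt q"
      unfolding iota_diff[symmetric] vabs_iota using p inverse_q_less by linarith
    thus "vabs (z - \<iota> (of_O p)) < 1 / sqrt q"
      using assms vabs_add_le[of "z - \<iota> x" "\<iota> x - \<iota> (of_O p)"] by auto
    show "fls_abs (of_O p) \<le> max (fls_abs x) (1 / q)"
      using p fls_abs_diff_leI[of x "max (fls_abs x) (1 / q)" "x - of_O p"] by auto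
  qed
qed

lemma perforated_disc_im:
  assumes z: "z \<in> perforated_disc M"
  shows "1 / sqrt q \<le> im_abs \<iota> z"
proof (rule im_abs_geI, rule ccontr)
  fix x assume "\<not> 1 / sqrt q \<le> vabs (z - \<iota> x)"
  hence lt: "vabs (z - \<iota> x) < 1 / sqrt q" by simp
  have "1 / sqrt q \<le> 1" using sqrt_q_gt_1 by simp
  also have "1 \<le> sqrt q * q ^ M"
    using mult_mono[of 1 "sqrt q" 1 "q ^ M"] sqrt_q_gt_1 q_gt_1 one_le_power[of q M] by simp
  finally have "vabs (\<iota> x) \<le> sqrt q * q ^ M"
    using vabs_diff_leI[of z "sqrt q * q ^ M" "z - \<iota> x"] z lt by (simp add: perforated_disc_def)
  hence x: "fls_abs x \<le> q ^ M" using fls_abs_le_half_power[of x M] by (simp add: vabs_iota)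
  obtain a where a: "a \<in> O_ring" "vabs (z - \<iota> a) < 1 / sqrt q" "fls_abs a \<le> max (fls_abs x) (1 / q)"
    using near_K_near_O[OF lt] by blast
  have "1 / q \<le> q ^ M" using q_gt_1 one_le_power[of q M] by (simp add: divide_le_eq mult_mono[of 1 "q ^ M" 1 q, simplified])
  hence "a \<in> O_ball M" using a(1,3) x by (auto simp: O_ball_mem)
  thus False using a(2) z by (auto simp: perforated_disc_def)
qed

lemma perforated_disc_Omega_aff:
  assumes z: "z \<in> perforated_disc M"
  shows "z \<in> Omega_aff \<iota> (Suc M)"
proof -
  have "sqrt q * 1 \<le> sqrt q * sqrt q" using sqrt_q_gt_1 by (intro mult_left_mono) auto
  hence sq: "sqrt q \<le> q" using q_pos by simp
  have "vabs z \<le> sqrt q * q ^ M" using z by (simp add: perforated_disc_def)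
  also have "\<dots> \<le> q * q ^ M" using sq q_pos by (intro mult_right_mono) auto
  finally have "vabs z \<le> q ^ Suc M" by simp
  moreover have "1 / q ^ Suc M \<le> 1 / sqrt q"
  proof (rule divide_left_mono)
    have "sqrt q * 1 \<le> q * q ^ M" using sq q_gt_1 one_le_power[of q M] by (intro mult_mono) auto
    thus "sqrt q \<le> q ^ Suc M" by simp
  qed (use q_pos in auto)
  hence "1 / q ^ Suc M \<le> im_abs \<iota> z" using perforated_disc_im[OF z] by linarith
  ultimately show ?thesis by (simp add: Omega_aff_mem)
qed

text \<open>
  Of the polynomials of degree at most \<open>M\<close>, none is closer to a point of these two circles
  than \<open>0\<close>.
\<close>

lemma boundary_circle:
  assumes w: "vabs w = 1 / sqrt q \<or> vabs w = sqrt q * q ^ M"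
  shows "w \<in> perforated_disc M" "vabs (fin_exp (O_ball M) w) = exp_size (O_ball M) (vabs w)"
proof -
  have r1: "1 / sqrt q < 1" using sqrt_q_gt_1 by simp
  have R1: "1 \<le> sqrt q * q ^ M"
    using mult_mono[of 1 "sqrt q" 1 "q ^ M"] sqrt_q_gt_1 q_gt_1 one_le_power[of q M] by simp
  have min: "vabs w \<le> vabs (w - \<iota> a)" if a: "a \<in> O_ball M" for a
  proof (cases "a = 0")
    case False
    hence "1 \<le> vabs (\<iota> a)" using fls_abs_O_ring_ge_1 a by (simp add: O_ball_mem vabs_iota)
    thus ?thesis
      using w vabs_diff_eq[of w "\<iota> a"] vabs_diff_eq2[of "\<iota> a" w] O_ball_small[OF a] r1 by auto
  qed simp
  show "vabs (fin_exp (O_ball M) w) = exp_size (O_ball M) (vabs w)"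
    by (rule vabs_fin_exp_minimal[OF min])
  have "1 / sqrt q \<le> vabs w" "vabs w \<le> sqrt q * q ^ M" using w r1 R1 by linarith+
  thus "w \<in> perforated_disc M"
    using min by (auto simp: perforated_disc_def intro: order.trans)
qed

lemma exp_size_bounds:
  assumes z: "z \<in> perforated_disc M"
  shows "exp_size (O_ball M) (1 / sqrt q) \<le> vabs (fin_exp (O_ball M) z)"
    "vabs (fin_exp (O_ball M) z) \<le> exp_size (O_ball M) (sqrt q * q ^ M)"
proof -
  obtain a0 where a0: "a0 \<in> O_ball M" "\<And>a. a \<in> O_ball M \<Longrightarrow> vabs (z - \<iota> a0) \<le> vabs (z - \<iota> a)"
    using ex_closest[of "O_ball M" z] O_ball_subgroup by blast
  have eq: "vabs (fin_exp (O_ball M) z) = exp_size (O_ball M) (vabs (z - \<iota> a0))"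
    by (rule vabs_fin_exp[OF O_ball_subgroup(1,2) a0])
  show "exp_size (O_ball M) (1 / sqrt q) \<le> vabs (fin_exp (O_ball M) z)"
    unfolding eq using z a0(1) q_pos
    by (intro exp_size_mono O_ball_subgroup) (auto simp: perforated_disc_def)
  have "vabs (z - \<iota> a0) \<le> sqrt q * q ^ M"
    using z O_ball_small[OF a0(1)] by (intro vabs_diff_leI) (auto simp: perforated_disc_def)
  thus "vabs (fin_exp (O_ball M) z) \<le> exp_size (O_ball M) (sqrt q * q ^ M)"
    unfolding eq by (intro exp_size_mono O_ball_subgroup) auto
qed

lemma exp_size_outside:
  assumes b: "b \<notin> perforated_disc M"
  shows "vabs (fin_exp (O_ball M) b) < exp_size (O_ball M) (1 / sqrt q) \<or>
    vabs (fin_exp (O_ball M) b) > exp_size (O_ball M) (sqrt q * q ^ M)"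
proof -
  obtain a0 where a0: "a0 \<in> O_ball M" "\<And>a. a \<in> O_ball M \<Longrightarrow> vabs (b - \<iota> a0) \<le> vabs (b - \<iota> a)"
    using ex_closest[of "O_ball M" b] O_ball_subgroup by blast
  have eq: "vabs (fin_exp (O_ball M) b) = exp_size (O_ball M) (vabs (b - \<iota> a0))"
    by (rule vabs_fin_exp[OF O_ball_subgroup(1,2) a0])
  show ?thesis
  proof (cases "vabs b \<le> sqrt q * q ^ M")
    case True
    then obtain a where "a \<in> O_ball M" "vabs (b - \<iota> a) < 1 / sqrt q"
      using b by (auto simp: perforated_disc_def not_le)
    hence "vabs (b - \<iota> a0) < 1 / sqrt q" using a0(2) by fastforce
    thus ?thesis unfolding eq by (intro disjI1 exp_size_strict_mono O_ball_subgroup) auto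
  next
    case False
    hence "vabs (b - \<iota> a0) = vabs b" using O_ball_small[OF a0(1)] by (intro vabs_diff_eq2) auto
    hence "sqrt q * q ^ M < vabs (b - \<iota> a0)" using False by simp
    thus ?thesis unfolding eq using q_pos by (intro disjI2 exp_size_strict_mono O_ball_subgroup) auto
  qed
qed

definition fin_exp_poly :: "'a fls set \<Rightarrow> 'c poly" where
  "fin_exp_poly A = Polynomial.smult (inverse (\<Prod>a\<in>A - {0}. - \<iota> a)) (\<Prod>a\<in>A. [:- \<iota> a, 1:])"

lemma poly_fin_exp_poly:
  assumes "finite A" "0 \<in> A"
  shows "poly (fin_exp_poly A) z = fin_exp A z"
  using prod_minus_iota_nonzero[OF assms(1)] prod_diff_conv_fin_exp[OF assms, of z]
  by (simp add: fin_exp_poly_def poly_prod)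

text \<open>
  Some preimage exists by algebraic closedness. Its distance to the group is \<open>\<rho>\<close>, by
  strict monotonicity of \<open>exp_size\<close>, and a translation moves it to the circle.
\<close>

lemma ex_fin_exp_value:
  assumes \<rho>: "\<rho> = 1 / sqrt q \<or> \<rho> = sqrt q * q ^ M" and y: "vabs y = exp_size (O_ball M) \<rho>"
  obtains w where "vabs w = \<rho>" "fin_exp (O_ball M) w = y"
proof -
  define A where "A = O_ball M"
  have A: "add_subgroup A" "finite A" "0 \<in> A" using O_ball_subgroup by (auto simp: A_def)
  define c where "c = (\<Prod>a\<in>A - {0}. - \<iota> a)"
  have c: "c \<noteq> 0" unfolding c_def by (rule prod_minus_iota_nonzero[OF A(2)])
  define p where "p = (\<Prod>a\<in>A. [:- \<iota> a, 1:]) - [:c * y:]"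
  have n: "card A > 0" using A by (auto simp: card_gt_0_iff)
  have "Polynomial.degree (\<Prod>a\<in>A. [:- \<iota> a, 1:]) = card A"
    by (subst degree_prod_eq_sum_degree) auto
  hence "Polynomial.degree p = card A"
    unfolding p_def using n by (simp add: degree_add_eq_left flip: add_uminus_conv_diff)
  then obtain v where "poly p v = 0" using C_infinity_root[of p] n by auto
  hence "(\<Prod>a\<in>A. v - \<iota> a) = c * y" by (simp add: p_def poly_prod)
  hence v: "fin_exp A v = y" using prod_diff_conv_fin_exp[OF A(2,3), of v] c by (simp add: c_def)
  obtain a0 where a0: "a0 \<in> A" "\<And>a. a \<in> A \<Longrightarrow> vabs (v - \<iota> a0) \<le> vabs (v - \<iota> a)"
    using ex_closest[of A v] A by blast
  have "exp_size A (vabs (v - \<iota> a0)) = exp_size A \<rho>"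
    using vabs_fin_exp[OF A(1,2) a0] v y by (simp add: A_def)
  moreover have "0 \<le> \<rho>" using \<rho> q_pos by auto
  ultimately have "vabs (v - \<iota> a0) = \<rho>"
    using exp_size_strict_mono[OF _ _ A(2), of \<rho> "vabs (v - \<iota> a0)"]
      exp_size_strict_mono[OF _ _ A(2), of "vabs (v - \<iota> a0)" \<rho>] by (cases rule: linorder_cases) auto
  moreover have "fin_exp A (v - \<iota> a0) = y"
    using fin_exp_diff[OF A(1,2)] fin_exp_eq_0_iff[OF A(3,2), of "\<iota> a0"] a0(1) v by simp
  ultimately show ?thesis using that unfolding A_def by blast
qed

text \<open>
  The norm \<open>\<Prod>\<^sub>a h(z + a)\<close> of a rational function is a rational function of
  \<open>fin_exp\<close>, by additivity.
\<close>

lemma norm_of_poly: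
  assumes A: "add_subgroup A" "finite A" and f: "f = Polynomial.smult l (\<Prod>r\<leftarrow>rs. [:-r, 1:])"
  shows "(\<Prod>a\<in>A. vabs (poly f (z + \<iota> a))) =
    vabs l ^ card A * vabs (\<Prod>a\<in>A - {0}. - \<iota> a) ^ length rs * (\<Prod>e\<leftarrow>map (fin_exp A) rs. vabs (fin_exp A z - e))"
proof -
  have A0: "0 \<in> A" by (rule add_subgroup_0[OF A(1)])
  have lin: "(\<Prod>a\<in>A. z + \<iota> a - r) = (\<Prod>a\<in>A - {0}. - \<iota> a) * (fin_exp A z - fin_exp A r)" for r
  proof -
    have "(\<Prod>a\<in>A. z + \<iota> a - r) = (\<Prod>a\<in>A. z + \<iota> (- a) - r)"
      by (rule prod.reindex_bij_betw[symmetric, OF add_subgroup_uminus_bij[OF A(1)]])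
    also have "\<dots> = (\<Prod>a\<in>A. (z - r) - \<iota> a)" by (simp add: iota_minus algebra_simps)
    also have "\<dots> = (\<Prod>a\<in>A - {0}. - \<iota> a) * fin_exp A (z - r)" by (rule prod_diff_conv_fin_exp[OF A(2) A0])
    finally show ?thesis by (simp only: fin_exp_diff[OF A])
  qed
  have "(\<Prod>a\<in>A. vabs (poly (\<Prod>r\<leftarrow>rs. [:-r, 1:]) (z + \<iota> a))) =
      vabs (\<Prod>a\<in>A - {0}. - \<iota> a) ^ length rs * (\<Prod>e\<leftarrow>map (fin_exp A) rs. vabs (fin_exp A z - e))"
  proof (induction rs)
    case (Cons r rs)
    have "(\<Prod>a\<in>A. vabs (poly (\<Prod>r\<leftarrow>r # rs. [:-r, 1:]) (z + \<iota> a))) =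
        (\<Prod>a\<in>A. vabs (z + \<iota> a - r) * vabs (poly (\<Prod>r\<leftarrow>rs. [:-r, 1:]) (z + \<iota> a)))"
      by (simp add: poly_prod_linear vabs_mult del: mult_pCons_left)
    also have "\<dots> = vabs (\<Prod>a\<in>A. z + \<iota> a - r) * (\<Prod>a\<in>A. vabs (poly (\<Prod>r\<leftarrow>rs. [:-r, 1:]) (z + \<iota> a)))"
      by (simp add: prod.distrib vabs_prod)
    finally show ?case unfolding lin Cons.IH by (simp add: vabs_mult mult_ac)
  qed simp
  thus ?thesis unfolding f by (simp add: vabs_mult prod.distrib)
qed

text \<open>
  The norm is a rational function of \<open>fin_exp\<close> whose poles lie outside of the image
  annulus, because the poles of \<open>f/g\<close> lie outside of the perforated disc.
\<close>

lemma rational_maximum: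
  fixes f g :: "'c poly"
  assumes g: "\<And>z. z \<in> perforated_disc M \<Longrightarrow> poly g z \<noteq> 0" and z0: "z0 \<in> perforated_disc M"
  obtains w where "vabs w = 1 / sqrt q \<or> vabs w = sqrt q * q ^ M"
    "(\<Prod>a\<in>O_ball M. vabs (poly f (z0 + \<iota> a) / poly g (z0 + \<iota> a))) \<le>
     (\<Prod>a\<in>O_ball M. vabs (poly f (w + \<iota> a) / poly g (w + \<iota> a)))"
proof -
  define A where "A = O_ball M"
  have A: "add_subgroup A" "finite A" "0 \<in> A" using O_ball_subgroup by (auto simp: A_def)
  define s1 s2 where "s1 = exp_size A (1 / sqrt q)" and "s2 = exp_size A (sqrt q * q ^ M)"
  obtain rs where rs: "f = Polynomial.smult (Polynomial.lead_coeff f) (\<Prod>r\<leftarrow>rs. [:-r, 1:])"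
    using C_infinity_splits by blast
  obtain qs where qs: "g = Polynomial.smult (Polynomial.lead_coeff g) (\<Prod>r\<leftarrow>qs. [:-r, 1:])"
    using C_infinity_splits by blast
  define c where "c = (\<Prod>a\<in>A - {0}. - \<iota> a)"
  define K where "K = vabs (Polynomial.lead_coeff f) ^ card A * vabs c ^ length rs /
      (vabs (Polynomial.lead_coeff g) ^ card A * vabs c ^ length qs)"
  have K: "0 \<le> K" by (simp add: K_def)
  have norm: "(\<Prod>a\<in>A. vabs (poly f (z + \<iota> a) / poly g (z + \<iota> a))) =
      K * ((\<Prod>e\<leftarrow>map (fin_exp A) rs. vabs (fin_exp A z - e)) / (\<Prod>e\<leftarrow>map (fin_exp A) qs. vabs (fin_exp A z - e)))" for z
    unfolding vabs_divide prod_dividef norm_of_poly[OF A(1,2) rs] norm_of_poly[OF A(1,2) qs]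
    by (simp add: K_def c_def)
  have bs: "vabs e < s1 \<or> vabs e > s2" if "e \<in> set (map (fin_exp A) qs)" for e
  proof -
    from that obtain b where b: "b \<in> set qs" "e = fin_exp A b" by auto
    have "poly g b = 0" by (subst qs) (use b(1) in \<open>auto simp: poly_prod_linear prod_list_zero_iff\<close>)
    hence "b \<notin> perforated_disc M" using g by blast
    thus ?thesis using exp_size_outside unfolding b(2) s1_def s2_def A_def by blast
  qed
  obtain v2 :: 'c where v2: "vabs v2 = sqrt q * q ^ M" using ex_vabs_half_power by blast
  obtain v0 :: 'c where v0: "vabs v0 = sqrt q * q ^ 0" using ex_vabs_half_power by blast
  hence v1: "vabs (1 / v0) = 1 / sqrt q" by (simp add: vabs_divide)
  have e1: "vabs (fin_exp A (1 / v0)) = s1" "vabs (fin_exp A v2) = s2"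
    using boundary_circle(2)[of "1 / v0" M] boundary_circle(2)[of v2 M] v1 v2
    by (simp_all add: A_def s1_def s2_def)
  have s1: "0 < s1"
    unfolding s1_def by (rule exp_size_pos) (use sqrt_q_pos in simp)
  have b: "s1 \<le> vabs (fin_exp A z0)" "vabs (fin_exp A z0) \<le> s2"
    using exp_size_bounds[OF z0] by (simp_all add: A_def s1_def s2_def)
  obtain t where t: "vabs t = s1 \<or> vabs t = s2"
    "(\<Prod>e\<leftarrow>map (fin_exp A) rs. vabs (fin_exp A z0 - e)) / (\<Prod>e\<leftarrow>map (fin_exp A) qs. vabs (fin_exp A z0 - e)) \<le>
     (\<Prod>e\<leftarrow>map (fin_exp A) rs. vabs (t - e)) / (\<Prod>e\<leftarrow>map (fin_exp A) qs. vabs (t - e))"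
    using annulus_maximum[OF b s1 bs e1] by blast
  obtain w where w: "vabs w = 1 / sqrt q \<or> vabs w = sqrt q * q ^ M" "fin_exp A w = t"
    using t(1) ex_fin_exp_value[of "1 / sqrt q" M t] ex_fin_exp_value[of "sqrt q * q ^ M" M t]
    unfolding s1_def s2_def A_def by blast
  have "(\<Prod>a\<in>A. vabs (poly f (z0 + \<iota> a) / poly g (z0 + \<iota> a))) \<le> (\<Prod>a\<in>A. vabs (poly f (w + \<iota> a) / poly g (w + \<iota> a)))"
    unfolding norm w(2) by (rule mult_left_mono[OF t(2) K])
  thus ?thesis using that w(1) unfolding A_def by blast
qed

text \<open>
  The function \<open>\<phi> E\<^sup>N\<close>, with \<open>E\<close> the finite exponential, satisfies
  the maximum principle on the perforated disc. A rational approximation \<open>h\<close> of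
  \<open>\<phi>\<close> is in general not periodic, but \<open>|h(z\<^sub>0 + a)| =
  |\<phi>(z\<^sub>0)|\<close> for all \<open>a\<close> in the group once \<open>h\<close> is close
  enough to \<open>\<phi>\<close>, and the bounds on the boundary hold for all \<open>h(w + a)\<close>.
  So the norms compare the \<open>n\<close>-th powers of the two sides, with \<open>n\<close> the order
  of the group.
\<close>

lemma three_circles:
  assumes rig: "rigid_analytic \<iota> \<phi>"
    and per: "\<And>z a. z \<in> Omega \<iota> \<Longrightarrow> a \<in> O_ring \<Longrightarrow> \<phi> (z + \<iota> a) = \<phi> z"
    and B: "0 < B1" "0 < B2" "\<And>z. vabs z = 1 / sqrt q \<Longrightarrow> vabs (\<phi> z) \<le> B1"
      "\<And>z. vabs z = sqrt q * q ^ M \<Longrightarrow> vabs (\<phi> z) \<le> B2"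
    and z0: "z0 \<in> perforated_disc M"
  shows "vabs (\<phi> z0) * vabs (fin_exp (O_ball M) z0) ^ N \<le>
    max (B1 * exp_size (O_ball M) (1 / sqrt q) ^ N) (B2 * exp_size (O_ball M) (sqrt q * q ^ M) ^ N)"
    (is "?L \<le> ?R")
proof (cases "\<phi> z0 = 0")
  case True
  have "0 \<le> B1 * exp_size (O_ball M) (1 / sqrt q) ^ N"
    using B(1) q_pos by (intro mult_nonneg_nonneg zero_le_power exp_size_nonneg) auto
  thus ?thesis using True by simp
next
  case False
  define A where "A = O_ball M"
  have A: "add_subgroup A" "finite A" "0 \<in> A" using O_ball_subgroup by (auto simp: A_def)
  define n where "n = card A"
  have n: "n > 0" using A by (auto simp: n_def card_gt_0_iff)
  define e where "e = min (min B1 B2) (vabs (\<phi> z0))"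
  have e: "e > 0" using B False by (simp add: e_def)
  obtain f g where fg: "\<forall>z\<in>Omega_aff \<iota> (Suc M). poly g z \<noteq> 0 \<and> vabs (poly f z / poly g z - \<phi> z) < e"
    using rig e unfolding rigid_analytic_iff by blast
  have fg': "poly g z \<noteq> 0" "vabs (poly f z / poly g z - \<phi> z) < e" if "z \<in> perforated_disc M" for z
    using fg perforated_disc_Omega_aff[OF that] by auto
  have Om: "z \<in> Omega \<iota>" if "z \<in> perforated_disc M" for z
    using Omega_aff_subset[OF perforated_disc_Omega_aff[OF that]] .
  have per': "\<phi> (z + \<iota> a) = \<phi> z" if "z \<in> perforated_disc M" "a \<in> A" for z a
    using per[OF Om[OF that(1)]] that(2) by (simp add: A_def O_ball_mem)
  define F where "F = f * fin_exp_poly A ^ N"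
  have F: "poly F (z + \<iota> a) / poly g (z + \<iota> a) = poly f (z + \<iota> a) / poly g (z + \<iota> a) * fin_exp A z ^ N"
    if "a \<in> A" for z a
  proof -
    have "fin_exp A (z + \<iota> a) = fin_exp A z"
      using fin_exp_add[OF A(1,2)] fin_exp_eq_0_iff[OF A(3,2), of "\<iota> a"] that by simp
    thus ?thesis by (simp add: F_def poly_fin_exp_poly[OF A(2,3)])
  qed
  obtain w where w: "vabs w = 1 / sqrt q \<or> vabs w = sqrt q * q ^ M"
    "(\<Prod>a\<in>A. vabs (poly F (z0 + \<iota> a) / poly g (z0 + \<iota> a))) \<le> (\<Prod>a\<in>A. vabs (poly F (w + \<iota> a) / poly g (w + \<iota> a)))"
    using rational_maximum[OF fg'(1) z0, of F] unfolding A_def by blast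
  have wX: "w \<in> perforated_disc M" by (rule boundary_circle(1)[OF w(1)])
  have "vabs (poly F (z0 + \<iota> a) / poly g (z0 + \<iota> a)) = ?L" if a: "a \<in> A" for a
  proof -
    have "z0 + \<iota> a \<in> perforated_disc M"
      using perforated_disc_translate[OF z0] a by (simp add: A_def)
    hence "vabs (poly f (z0 + \<iota> a) / poly g (z0 + \<iota> a) - \<phi> z0) < vabs (\<phi> z0)"
      using fg'(2)[of "z0 + \<iota> a"] per'[OF z0 a] by (simp add: e_def)
    hence "vabs (poly f (z0 + \<iota> a) / poly g (z0 + \<iota> a)) = vabs (\<phi> z0)"
      using vabs_add_eq[of "poly f (z0 + \<iota> a) / poly g (z0 + \<iota> a) - \<phi> z0" "\<phi> z0"] by simp
    thus ?thesis unfolding F[OF a] vabs_mult vabs_power by (simp add: A_def)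
  qed
  hence left: "(\<Prod>a\<in>A. vabs (poly F (z0 + \<iota> a) / poly g (z0 + \<iota> a))) = ?L ^ n"
    by (simp add: n_def)
  have "vabs (poly F (w + \<iota> a) / poly g (w + \<iota> a)) \<le> ?R" if a: "a \<in> A" for a
  proof -
    have Ew: "vabs (fin_exp A w) = exp_size A (vabs w)"
      unfolding A_def by (rule boundary_circle(2)[OF w(1)])
    have "w + \<iota> a \<in> perforated_disc M"
      using perforated_disc_translate[OF wX] a by (simp add: A_def)
    hence *: "vabs (poly f (w + \<iota> a) / poly g (w + \<iota> a) - \<phi> w) < e"
      using fg'(2)[of "w + \<iota> a"] per'[OF wX a] by simp
    have bound: "vabs (poly F (w + \<iota> a) / poly g (w + \<iota> a)) \<le> C * exp_size A (vabs w) ^ N"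
      if "vabs (\<phi> w) \<le> C" "e \<le> C" for C
    proof -
      have "vabs (poly f (w + \<iota> a) / poly g (w + \<iota> a)) \<le> C"
        using vabs_add_leI[of "poly f (w + \<iota> a) / poly g (w + \<iota> a) - \<phi> w" C "\<phi> w"] * that by simp
      thus ?thesis unfolding F[OF a] vabs_mult vabs_power Ew
        by (intro mult_right_mono zero_le_power exp_size_nonneg) auto
    qed
    from w(1) show ?thesis
    proof
      assume w': "vabs w = 1 / sqrt q"
      have "vabs (poly F (w + \<iota> a) / poly g (w + \<iota> a)) \<le> B1 * exp_size A (1 / sqrt q) ^ N"
        using bound[OF B(3)[OF w']] unfolding w' by (simp add: e_def)
      thus ?thesis by (simp add: A_def)
    next
      assume w': "vabs w = sqrt q * q ^ M"
      have "vabs (poly F (w + \<iota> a) / poly g (w + \<iota> a)) \<le> B2 * exp_size A (sqrt q * q ^ M) ^ N"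
        using bound[OF B(4)[OF w']] unfolding w' by (simp add: e_def)
      thus ?thesis by (simp add: A_def)
    qed
  qed
  hence "(\<Prod>a\<in>A. vabs (poly F (w + \<iota> a) / poly g (w + \<iota> a))) \<le> (\<Prod>a\<in>A. ?R)"
    by (intro prod_mono) auto
  hence "?L ^ n \<le> ?R ^ n" using w(2) unfolding left by (simp add: n_def)
  moreover have "0 \<le> ?R"
    using B(1) q_pos by (intro max.coboundedI1 mult_nonneg_nonneg zero_le_power exp_size_nonneg) auto
  ultimately show ?thesis using power_mono_iff[of ?L ?R n] n by simp
qed

end

section \<open>Forms of level one are determined by finitely many coefficients\<close>

context drinfeld_setting
begin

lemma cusp_lattice_infinity: "cusp_lattice GL2_O (mat 1) = (O_ring :: 'a fls set)"
proof -
  have "cusp_lattice GL2_O (mat 1) = cusp_coords (mat 1 :: 'a fls ^ 2 ^ 2) O_ring O_ring"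
    by (rule cusp_lattice_GL2_O) simp
  thus ?thesis by (auto simp: cusp_coords_def col_prod_def O_ring_0)
qed

lemma level_one_expansion:
  assumes \<phi>: "\<phi> \<in> cusp_forms \<iota> k m GL2_O"
  shows "\<exists>a. has_u_expansion \<iota> O_ring \<phi> a \<and> a 0 = 0"
  using cusp_formsD(4)[OF \<phi> mat_1_GL2_K] cusp_formsD(1)[OF \<phi>]
  unfolding cusp_lattice_infinity by (simp add: slash_one)

lemma level_one_periodic:
  assumes \<phi>: "\<phi> \<in> cusp_forms \<iota> k m GL2_O" and z: "z \<in> Omega \<iota>" and a: "a \<in> O_ring"
  shows "\<phi> (z + \<iota> a) = \<phi> z"
proof -
  obtain p where p: "a = of_O p" using a by (rule O_ringE)
  have "poly_matrix (mat2 1 p 0 1) \<in> GL2_O"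
    unfolding GL2_O_poly_matrix by (intro imageI) (simp add: invertible_2_iff det_2)
  from cusp_formsD(3)[OF \<phi> this] show ?thesis
    using slash_translation[OF z, of k m a \<phi>] by (simp add: poly_matrix_mat2 p)
qed

lemma level_one_inversion:
  assumes \<phi>: "\<phi> \<in> cusp_forms \<iota> k m GL2_O" and z: "z \<in> Omega \<iota>"
  shows "\<phi> z = \<phi> (- 1 / z) * z powi (- k)"
proof -
  have "poly_matrix (mat2 0 (- 1) 1 0) \<in> GL2_O"
    unfolding GL2_O_poly_matrix by (intro imageI) (simp add: invertible_2_iff det_2)
  from cusp_formsD(3)[OF \<phi> this] have "slash \<iota> k m (poly_matrix (mat2 0 (- 1) 1 0)) \<phi> z = \<phi> z" by simp
  moreover have "slash \<iota> k m (poly_matrix (mat2 0 (- 1) 1 0)) \<phi> z = \<phi> (- 1 / z) * z powi (- k)"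
    using z by (simp add: slash_Omega moebius_def automorphy_def poly_matrix_mat2 of_O_minus iota_minus det_2)
  ultimately show ?thesis by simp
qed

lemma Omega_inversion:
  assumes z: "z \<in> Omega \<iota>"
  shows "- 1 / z \<in> Omega \<iota>" "im_abs \<iota> (- 1 / z) \<ge> im_abs \<iota> z / vabs z ^ 2"
proof -
  define S where "S = (mat2 0 (- 1) 1 0 :: 'a fls ^ 2 ^ 2)"
  have D: "det S = 1" by (simp add: S_def det_2)
  have m: "moebius \<iota> S z = - 1 / z" "automorphy S z = z"
    by (simp_all add: S_def moebius_def automorphy_def iota_minus)
  show "- 1 / z \<in> Omega \<iota>" using moebius_Omega[of S z] z D m by simp
  show "im_abs \<iota> (- 1 / z) \<ge> im_abs \<iota> z / vabs z ^ 2"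
    using im_abs_moebius_ge[of S z] z D m by (simp flip: vabs_iota)
qed

lemma expansion_decay:
  fixes \<phi> :: "'c \<Rightarrow> 'c"
  assumes \<phi>: "has_u_expansion \<iota> O_ring \<phi> a" and a: "\<And>n. n \<le> N \<Longrightarrow> a n = 0"
  obtains C K where "C > 0" "K > 0"
    "\<And>z. im_abs \<iota> z \<ge> C \<Longrightarrow> vabs (\<phi> z) \<le> K / vabs (lattice_exp \<iota> O_ring z) ^ Suc N"
proof -
  obtain C \<rho> M where C: "C > 0" and \<rho>: "\<rho> > 0" and A: "gauss_le (Abs_fps a) \<rho> M"
    and val: "\<And>z. im_abs \<iota> z \<ge> C \<Longrightarrow> fps_value (Abs_fps a) (1 / lattice_exp \<iota> O_ring z) (\<phi> z)"
    using has_u_expansion_gauss[OF discrete_lattice_O_ring \<phi>] by metis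
  have M: "0 \<le> M" by (rule gauss_le_nonneg[OF A])
  define C' where "C' = max C (1 / \<rho>)"
  define K where "K = (M + 1) / \<rho> ^ Suc N"
  have K: "K > 0" using M \<rho> by (simp add: K_def)
  have "vabs (\<phi> z) \<le> K / vabs (lattice_exp \<iota> O_ring z) ^ Suc N" if z: "im_abs \<iota> z \<ge> C'" for z
  proof -
    define u where "u = 1 / lattice_exp \<iota> O_ring z"
    have C'0: "C' > 0" using C by (simp add: C'_def less_max_iff_disj)
    have "1 / C' \<le> 1 / (1 / \<rho>)" using \<rho> C'0 by (intro divide_left_mono) (auto simp: C'_def)
    hence u: "vabs u \<le> \<rho>"
      using vabs_parameter_le[OF discrete_lattice_O_ring z C'0] by (simp add: u_def)
    have "fps_value (Abs_fps a) u (\<phi> z)" using val[of z] z by (simp add: C'_def u_def)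
    hence "vabs (\<phi> z) \<le> M * (vabs u / \<rho>) ^ Suc N"
      unfolding fps_value_def
    proof (rule vabs_sums_le)
      fix n
      show "vabs (fps_nth (Abs_fps a) n * u ^ n) \<le> M * (vabs u / \<rho>) ^ Suc N"
      proof (cases "n \<le> N")
        case True
        thus ?thesis using a[OF True] M \<rho> by simp
      next
        case False
        have "vabs (fps_nth (Abs_fps a) n * u ^ n) \<le> M * (vabs u / \<rho>) ^ n"
          by (rule gauss_le_term[OF A \<rho>])
        also have "\<dots> \<le> M * (vabs u / \<rho>) ^ Suc N"
          using M u \<rho> False by (intro mult_left_mono power_decreasing) auto
        finally show ?thesis .
      qed
    qed
    also have "\<dots> \<le> (M + 1) * (vabs u / \<rho>) ^ Suc N"
      using \<rho> by (intro mult_right_mono zero_le_power) auto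
    also have "\<dots> = K / vabs (lattice_exp \<iota> O_ring z) ^ Suc N"
      by (simp add: K_def u_def vabs_divide power_divide power_mult_distrib mult_ac)
    finally show ?thesis .
  qed
  moreover have "C' > 0" using C by (simp add: C'_def less_max_iff_disj)
  ultimately show ?thesis using that K by blast
qed

text \<open>
  Three circles on larger and larger discs, with \<open>|E(z\<^sub>0)| \<ge> \<delta>\<close> for the
  finite exponential \<open>E\<close>. Because the form vanishes to order more than \<open>N\<close>,
  the product \<open>\<phi> E\<^sup>N\<close> tends to zero on the outer circles, so only the inner
  circle counts.
\<close>

lemma inner_circle_bound:
  fixes \<phi> :: "'c \<Rightarrow> 'c"
  assumes rig: "rigid_analytic \<iota> \<phi>"
    and per: "\<And>z a. z \<in> Omega \<iota> \<Longrightarrow> a \<in> O_ring \<Longrightarrow> \<phi> (z + \<iota> a) = \<phi> z"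
    and \<phi>: "has_u_expansion \<iota> O_ring \<phi> a" and a: "\<And>n. n \<le> N \<Longrightarrow> a n = 0"
    and B: "0 < B" "\<And>z. vabs z = 1 / sqrt q \<Longrightarrow> vabs (\<phi> z) \<le> B"
    and \<delta>: "1 / sqrt q \<le> \<delta>" "\<And>a. a \<in> O_ring \<Longrightarrow> \<delta> \<le> vabs (z0 - \<iota> a)"
  shows "vabs (\<phi> z0) * \<delta> ^ N \<le> B * (1 / sqrt q) ^ N"
proof (rule ccontr)
  assume neg: "\<not> ?thesis"
  obtain C K where C: "C > 0" and K: "K > 0"
    and decay: "\<And>z. im_abs \<iota> z \<ge> C \<Longrightarrow> vabs (\<phi> z) \<le> K / vabs (lattice_exp \<iota> O_ring z) ^ Suc N"
    using expansion_decay[OF \<phi> a] by metis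
  have r: "0 < 1 / sqrt q" using sqrt_q_pos by simp
  have \<delta>0: "0 < \<delta>" using \<delta>(1) r by linarith
  have lhs: "0 < vabs (\<phi> z0) * \<delta> ^ N"
  proof -
    have "0 \<le> B * (1 / sqrt q) ^ N" using B(1) r by simp
    thus ?thesis using neg by linarith
  qed
  define L where "L = vabs (\<phi> z0) * \<delta> ^ N"
  obtain M where M: "max (max C (vabs z0)) (K / L) < q ^ M" using real_arch_pow[OF q_gt_1] by blast
  define R where "R = sqrt q * q ^ M"
  have R: "q ^ M \<le> R" "0 < R" using sqrt_q_gt_1 q_pos by (simp_all add: R_def)
  have z0: "z0 \<in> perforated_disc M"
    using \<delta> M R by (auto simp: perforated_disc_def R_def[symmetric] O_ball_mem intro: order.trans)
  define s1 s2 where "s1 = exp_size (O_ball M) (1 / sqrt q)" and "s2 = exp_size (O_ball M) R"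
  have s2: "R \<le> s2" "0 < s2" unfolding s2_def using exp_size_ge[of R] exp_size_pos[of R] R by auto
  have outer: "vabs (\<phi> w) \<le> K / s2 ^ Suc N" if w: "vabs w = sqrt q * q ^ M" for w
  proof -
    have im: "im_abs \<iota> w = R" using im_abs_half_power[of w "int M"] w by (simp add: R_def)
    have "s2 \<le> vabs (lattice_exp \<iota> O_ring w)"
      using vabs_lattice_exp_ge[OF discrete_lattice_O_ring, of "CARD('a) ^ M" w]
      unfolding im s2_def O_ball_def .
    hence "K / vabs (lattice_exp \<iota> O_ring w) ^ Suc N \<le> K / s2 ^ Suc N"
      using K s2 by (intro divide_left_mono power_mono mult_pos_pos zero_less_power) auto
    moreover have "vabs (\<phi> w) \<le> K / vabs (lattice_exp \<iota> O_ring w) ^ Suc N"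
      using M R by (intro decay) (simp add: im)
    ultimately show ?thesis by linarith
  qed
  have "vabs (\<phi> z0) * vabs (fin_exp (O_ball M) z0) ^ N \<le> max (B * s1 ^ N) (K / s2 ^ Suc N * s2 ^ N)"
    unfolding s1_def s2_def R_def
    using three_circles[OF rig per B(1) _ B(2) outer z0, of N] K s2(2) by (simp add: s2_def R_def)
  moreover have "s1 = 1 / sqrt q"
  proof -
    have "(\<Prod>a\<in>O_ball M - {0}. max 1 (1 / sqrt q / fls_abs a)) = (\<Prod>a\<in>O_ball M - {0}. 1)"
    proof (rule prod.cong[OF refl])
      fix a assume "a \<in> O_ball M - {0}"
      hence "1 \<le> fls_abs a" using fls_abs_O_ring_ge_1 by (auto simp: O_ball_mem)
      hence "1 / sqrt q / fls_abs a \<le> 1 / sqrt q / 1"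
        using r by (intro divide_left_mono) (auto simp only: mult_1_right intro: less_le_trans[OF zero_less_one])
      also have "\<dots> \<le> 1" using sqrt_q_gt_1 by simp
      finally show "max 1 (1 / sqrt q / fls_abs a) = 1" by simp
    qed
    thus ?thesis by (simp add: s1_def exp_size_def)
  qed
  moreover have "\<delta> \<le> vabs (fin_exp (O_ball M) z0)"
  proof -
    obtain a0 where a0: "a0 \<in> O_ball M" "\<And>a. a \<in> O_ball M \<Longrightarrow> vabs (z0 - \<iota> a0) \<le> vabs (z0 - \<iota> a)"
      using ex_closest[of "O_ball M" z0] O_ball_subgroup by blast
    have "\<delta> \<le> vabs (z0 - \<iota> a0)" using \<delta>(2) a0(1) by (simp add: O_ball_mem)
    also have "\<dots> \<le> exp_size (O_ball M) (vabs (z0 - \<iota> a0))" by (rule exp_size_ge) simp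
    also have "\<dots> = vabs (fin_exp (O_ball M) z0)"
      by (rule vabs_fin_exp[OF O_ball_subgroup(1,2) a0, symmetric])
    finally show ?thesis .
  qed
  hence "L \<le> vabs (\<phi> z0) * vabs (fin_exp (O_ball M) z0) ^ N"
    unfolding L_def using \<delta>0 by (intro mult_left_mono power_mono) auto
  moreover have "K / s2 ^ Suc N * s2 ^ N = K / s2" using s2 by simp
  ultimately have "L \<le> max (B * (1 / sqrt q) ^ N) (K / s2)" by (metis order.trans)
  hence "L \<le> K / s2" using neg by (auto simp: L_def)
  also have "\<dots> \<le> K / q ^ M" using s2 R K q_pos by (intro divide_left_mono) auto
  finally have "L * q ^ M \<le> K" using q_pos by (simp add: pos_le_divide_eq)
  moreover have "K < q ^ M * L" using M lhs by (simp add: L_def pos_divide_less_eq)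
  ultimately show False by (simp add: mult.commute)
qed

text \<open>
  The inversion \<open>z \<mapsto> -1/z\<close> exchanges the circles of radius
  \<open>1/\<surd>q\<close> and \<open>\<surd>q\<close> and costs a factor
  \<open>\<surd>q\<^sup>k\<close>, while the preceding bound for the order \<open>N = k + 1\<close>
  gains \<open>\<surd>q\<^sup>k\<^sup>+\<^sup>1\<close>. So every bound on the circle of radius
  \<open>\<surd>q\<close> improves by the factor \<open>1/\<surd>q\<close>, and the form vanishes there.
\<close>

lemma level_one_vanishing:
  assumes \<phi>: "\<phi> \<in> cusp_forms \<iota> k m GL2_O" and k: "k \<ge> 0"
    and e: "has_u_expansion \<iota> O_ring \<phi> a" and a: "\<And>n. n \<le> Suc (nat k) \<Longrightarrow> a n = 0"
  shows "\<phi> z = 0"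
proof -
  define K where "K = nat k"
  define N where "N = Suc K"
  define r where "r = 1 / sqrt q"
  have r: "0 < r" "r < 1" using sqrt_q_gt_1 by (auto simp: r_def)
  note rig = cusp_formsD(2)[OF \<phi>]
  note per = level_one_periodic[OF \<phi>]
  have a': "\<And>n. n \<le> N \<Longrightarrow> a n = 0" using a by (simp add: N_def K_def)
  have circle: "w \<in> Omega \<iota>" if "vabs w = sqrt q \<or> vabs w = 1 / sqrt q" for w
  proof -
    have "1 / sqrt q = sqrt q * q powi (- 1)"
      using q_pos by (simp add: power_int_minus field_simps)
    moreover have "sqrt q = sqrt q * q powi 0" by simp
    ultimately have "im_abs \<iota> w = vabs w" using that im_abs_half_power[of w] by metis
    thus ?thesis using that sqrt_q_pos by (auto simp: Omega_iff_im_abs)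
  qed
  have inv: "vabs (\<phi> w) = vabs (\<phi> (- 1 / w)) * (1 / vabs w) ^ K" if "w \<in> Omega \<iota>" for w
  proof -
    have "vabs (w powi (- k)) = (1 / vabs w) ^ K"
      unfolding K_def using k by (auto simp: power_int_def vabs_inverse divide_inverse vabs_power power_inverse)
    thus ?thesis using level_one_inversion[OF \<phi> that] by (metis vabs_mult)
  qed
  have improve: "vabs (\<phi> w) \<le> B * r" if B: "0 < B" "\<And>w. vabs w = sqrt q \<Longrightarrow> vabs (\<phi> w) \<le> B" and w: "vabs w = sqrt q" for B w
  proof -
    have "vabs (\<phi> v) \<le> B * sqrt q ^ K" if v: "vabs v = 1 / sqrt q" for v
    proof -
      have "vabs (- 1 / v) = sqrt q" using v by (simp add: vabs_divide)
      hence "vabs (\<phi> (- 1 / v)) \<le> B" by (rule B(2))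
      thus ?thesis using inv[OF circle, of v] v sqrt_q_pos by (simp add: mult_right_mono)
    qed
    moreover have "0 < B * sqrt q ^ K" using B(1) sqrt_q_pos by simp
    moreover have "1 / sqrt q \<le> sqrt q" using r sqrt_q_gt_1 unfolding r_def by linarith
    moreover have "sqrt q \<le> vabs (w - \<iota> b)" if "b \<in> O_ring" for b
    proof -
      have "sqrt q = sqrt q * q powi 0" by simp
      hence "im_abs \<iota> w = sqrt q" using im_abs_half_power[of w 0] w by simp
      thus ?thesis using im_abs_le[of w b] by simp
    qed
    ultimately have "vabs (\<phi> w) * sqrt q ^ N \<le> B * sqrt q ^ K * (1 / sqrt q) ^ N"
      by (intro inner_circle_bound[OF rig per e a'])
    also have "\<dots> = B * (sqrt q ^ K * (1 / sqrt q) ^ N)" by (rule mult.assoc)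
    also have "sqrt q ^ K * (1 / sqrt q) ^ N = r"
      using sqrt_q_pos by (simp add: N_def r_def power_one_over)
    finally have "vabs (\<phi> w) * sqrt q ^ N \<le> B * r" .
    moreover have "vabs (\<phi> w) * 1 \<le> vabs (\<phi> w) * sqrt q ^ N"
      using sqrt_q_gt_1 by (intro mult_left_mono one_le_power) auto
    ultimately show ?thesis by linarith
  qed
  obtain B where B: "B > 0" "\<forall>z\<in>Omega_aff \<iota> 1. vabs (\<phi> z) \<le> B"
    using rigid_analytic_bounded[OF rig, of 1] by blast
  have iterate: "vabs (\<phi> w) \<le> B * r ^ j" if "vabs w = sqrt q" for w j
    using that
  proof (induction j arbitrary: w)
    case 0
    have "w \<in> perforated_disc 0" using 0 by (intro boundary_circle) simp
    hence "w \<in> Omega_aff \<iota> 1" using perforated_disc_Omega_aff[of w 0] by simp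
    thus ?case using B(2) by simp
  next
    case (Suc j)
    thus ?case using improve[of "B * r ^ j" w] B(1) r by (simp add: mult_ac)
  qed
  have zero_circle: "\<phi> w = 0" if w: "vabs w = sqrt q" for w
  proof -
    have "(\<lambda>j. B * r ^ j) \<longlonglongrightarrow> 0"
      using r by (intro tendsto_mult_right_zero LIMSEQ_realpow_zero) auto
    hence "vabs (\<phi> w) \<le> 0"
      by (rule tendsto_lowerbound) (use iterate[OF w] in auto)
    hence "vabs (\<phi> w) = 0" by (intro antisym) auto
    thus ?thesis by simp
  qed
  have inner_zero: "\<phi> v = 0" if v: "vabs v = 1 / sqrt q" for v
  proof -
    have "vabs (- 1 / v) = sqrt q" using v by (simp add: vabs_divide)
    hence "vabs (\<phi> v) = 0" using inv[OF circle, of v] v zero_circle by simp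
    thus ?thesis by simp
  qed
  have far: "\<phi> w = 0" if w: "r \<le> im_abs \<iota> w" for w
  proof (rule ccontr)
    assume n: "\<phi> w \<noteq> 0"
    have "vabs (\<phi> w) * r ^ N \<le> vabs (\<phi> w) / 2 * (1 / sqrt q) ^ N"
    proof (rule inner_circle_bound[OF rig per e a'])
      show "r \<le> vabs (w - \<iota> b)" for b using im_abs_le[of w b] w by linarith
    qed (use n inner_zero in \<open>auto simp: r_def\<close>)
    hence "vabs (\<phi> w) * r ^ N \<le> vabs (\<phi> w) / 2 * r ^ N" by (simp only: r_def)
    moreover have "0 < vabs (\<phi> w) * r ^ N" using n r(1) by simp
    ultimately show False by simp
  qed
  \<comment> \<open>every orbit of \<open>GL\<^sub>2(\<O>)\<close> meets the region \<open>|z|\<^sub>i \<ge> 1/\<surd>q\<close>\<close>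
  have reduce: "\<phi> w = 0" if "w \<in> Omega \<iota>" "r \<le> q ^ j * im_abs \<iota> w" for w j
    using that
  proof (induction j arbitrary: w)
    case 0
    thus ?case by (intro far) simp
  next
    case (Suc j)
    show ?case
    proof (cases "r \<le> im_abs \<iota> w")
      case False
      hence "im_abs \<iota> w < 1 / sqrt q" by (simp add: r_def)
      then obtain x where "vabs (w - \<iota> x) < 1 / sqrt q" by (rule im_abs_lessE)
      then obtain b where b: "b \<in> O_ring" "vabs (w - \<iota> b) < 1 / sqrt q" using near_K_near_O by metis
      define v where "v = w - \<iota> b"
      have v: "v \<in> Omega \<iota>" using Suc.prems(1) by (simp add: v_def Omega_iff_im_abs)
      have v0: "vabs v > 0" using im_abs_pos[OF v] im_abs_le_vabs[of v] by linarith
      have "vabs v ^ 2 \<le> (1 / sqrt q) ^ 2"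
        using b(2) by (intro power_mono) (auto simp: v_def)
      also have "\<dots> = 1 / q" using q_pos by (simp add: power_divide)
      finally have "im_abs \<iota> v / (1 / q) \<le> im_abs \<iota> v / vabs v ^ 2"
        using v0 q_pos by (intro divide_left_mono) auto
      also have "\<dots> \<le> im_abs \<iota> (- 1 / v)" by (rule Omega_inversion(2)[OF v])
      finally have "q * im_abs \<iota> w \<le> im_abs \<iota> (- 1 / v)" by (simp add: v_def mult.commute)
      hence "q ^ j * (q * im_abs \<iota> w) \<le> q ^ j * im_abs \<iota> (- 1 / v)"
        using q_pos by (intro mult_left_mono) auto
      hence "r \<le> q ^ j * im_abs \<iota> (- 1 / v)" using Suc.prems(2) by (simp add: mult_ac)
      hence "\<phi> (- 1 / v) = 0" using Omega_inversion(1)[OF v] by (intro Suc.IH)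
      hence "\<phi> v = 0" using level_one_inversion[OF \<phi> v] by simp
      thus ?thesis using per[OF v b(1)] by (simp add: v_def)
    qed (rule far)
  qed
  show ?thesis
  proof (cases "z \<in> Omega \<iota>")
    case True
    have im: "im_abs \<iota> z > 0" by (rule im_abs_pos[OF True])
    obtain j where "r / im_abs \<iota> z < q ^ j" using real_arch_pow[OF q_gt_1] by blast
    hence "r \<le> q ^ j * im_abs \<iota> z" using im by (simp add: pos_divide_less_eq)
    thus ?thesis using reduce True by blast
  qed (rule cusp_formsD(1)[OF \<phi>])
qed

end

text \<open>Gaussian elimination of one unknown at a time.\<close>

lemma homogeneous_system:
  fixes A :: "'i \<Rightarrow> nat \<Rightarrow> 'b::field"
  assumes "finite I" "n < card I"
  shows "\<exists>c. (\<exists>i\<in>I. c i \<noteq> 0) \<and> (\<forall>j<n. (\<Sum>i\<in>I. c i * A i j) = 0)"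
  using assms
proof (induction n arbitrary: I A)
  case 0
  thus ?case by (intro exI[of _ "\<lambda>_. 1"]) (auto simp: card_gt_0_iff)
next
  case (Suc n)
  show ?case
  proof (cases "\<exists>p\<in>I. A p n \<noteq> 0")
    case False
    obtain c where c: "\<exists>i\<in>I. c i \<noteq> 0" "\<forall>j<n. (\<Sum>i\<in>I. c i * A i j) = 0"
      using Suc.IH[of I A] Suc.prems by auto
    have "(\<Sum>i\<in>I. c i * A i n) = 0" using False by (intro sum.neutral) auto
    thus ?thesis using c by (intro exI[of _ c]) (auto simp: less_Suc_eq)
  next
    case True
    then obtain p where p: "p \<in> I" "A p n \<noteq> 0" by blast
    define J where "J = I - {p}"
    define B where "B i j = A i j - A i n / A p n * A p j" for i j
    have J: "finite J" "n < card J" "p \<notin> J" "I = insert p J"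
      using Suc.prems p by (auto simp: J_def)
    obtain c where c: "\<exists>i\<in>J. c i \<noteq> 0" "\<forall>j<n. (\<Sum>i\<in>J. c i * B i j) = 0"
      using Suc.IH[OF J(1,2), of B] by blast
    define d where "d = c(p := - (\<Sum>i\<in>J. c i * A i n / A p n))"
    have d_sum: "(\<Sum>i\<in>I. d i * A i j) = (\<Sum>i\<in>J. c i * B i j)" for j
    proof -
      have "(\<Sum>i\<in>I. d i * A i j) = d p * A p j + (\<Sum>i\<in>J. d i * A i j)"
        using J by simp
      also have "(\<Sum>i\<in>J. d i * A i j) = (\<Sum>i\<in>J. c i * A i j)"
        using J(3) by (intro sum.cong) (auto simp: d_def)
      also have "d p * A p j + \<dots> = (\<Sum>i\<in>J. c i * A i j - c i * A i n / A p n * A p j)"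
        by (simp add: d_def sum_subtractf sum_distrib_right)
      finally show ?thesis by (simp add: B_def right_diff_distrib mult.assoc times_divide_eq_left)
    qed
    have "B i n = 0" for i using p(2) by (simp add: B_def)
    hence "\<forall>j<Suc n. (\<Sum>i\<in>I. d i * A i j) = 0" using c(2) by (auto simp: d_sum less_Suc_eq)
    moreover have "\<exists>i\<in>I. d i \<noteq> 0" using c(1) J by (auto simp: d_def)
    ultimately show ?thesis by blast
  qed
qed

context drinfeld_setting
begin

lemma has_u_expansion_sum:
  assumes "finite I" "\<And>i. i \<in> I \<Longrightarrow> has_u_expansion \<iota> \<Lambda> (f i) (a i)"
  shows "has_u_expansion \<iota> \<Lambda> (\<lambda>z. \<Sum>i\<in>I. c i * f i z) (\<lambda>n. \<Sum>i\<in>I. c i * a i n)"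
  using assms
proof (induction I rule: finite_induct)
  case (insert i I)
  thus ?case using has_u_expansion_add[OF has_u_expansion_scale[of \<Lambda> "f i" "a i" "c i"]] by simp
qed (simp add: has_u_expansion_zero)

text \<open>
  There are \<open>k + 3\<close> forms, and a combination vanishes as soon as its coefficients of index
  \<open>0\<close> to \<open>k + 1\<close> do.
\<close>

lemma level_one_dependent:
  assumes k: "k \<ge> 0" and f: "\<And>i. i \<le> Suc (Suc (nat k)) \<Longrightarrow> f i \<in> cusp_forms \<iota> k m GL2_O"
  shows "\<exists>c. (\<exists>i\<le>Suc (Suc (nat k)). c i \<noteq> 0) \<and> (\<forall>z. (\<Sum>i\<le>Suc (Suc (nat k)). c i * f i z) = 0)"
proof -
  define I where "I = {..Suc (Suc (nat k))}"
  have "\<exists>a. has_u_expansion \<iota> O_ring (f i) a \<and> a 0 = 0" if "i \<in> I" for i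
    using level_one_expansion[OF f] that by (simp add: I_def)
  then obtain a where a: "\<And>i. i \<in> I \<Longrightarrow> has_u_expansion \<iota> O_ring (f i) (a i) \<and> a i 0 = 0" by metis
  \<comment> \<open>the coefficients of index \<open>1\<close> to \<open>k + 1\<close> are to vanish, that of index \<open>0\<close> does for every cusp form\<close>
  obtain c where c: "\<exists>i\<in>I. c i \<noteq> 0" "\<forall>j<Suc (nat k). (\<Sum>i\<in>I. c i * a i (Suc j)) = 0"
    using homogeneous_system[of I "Suc (nat k)" "\<lambda>i j. a i (Suc j)"] by (auto simp: I_def)
  define g where "g = (\<lambda>z. \<Sum>i\<in>I. c i * f i z)"
  have "g \<in> cusp_forms \<iota> k m GL2_O"
    unfolding g_def I_def by (intro cusp_forms_sum cusp_forms_scale f) simp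
  moreover have "has_u_expansion \<iota> O_ring g (\<lambda>n. \<Sum>i\<in>I. c i * a i n)"
    unfolding g_def by (rule has_u_expansion_sum) (use a in \<open>auto simp: I_def\<close>)
  moreover have "(\<Sum>i\<in>I. c i * a i n) = 0" if "n \<le> Suc (nat k)" for n
  proof (cases n)
    case 0
    thus ?thesis using a by (intro sum.neutral) auto
  next
    case (Suc j)
    thus ?thesis using c(2) that by simp
  qed
  ultimately have "g z = 0" for z using level_one_vanishing[OF _ k] by blast
  thus ?thesis using c(1) unfolding g_def I_def by (intro exI[of _ c]) auto
qed

text \<open>
  By finite dimension there is a nontrivial relation between the iterates \<open>\<psi>\<close>,
  \<open>L \<psi>\<close>, \<open>L\<^sup>2 \<psi>\<close> and so on. As \<open>L\<close> is injective,
  the relation can be divided by \<open>L\<close> until the coefficient of \<open>\<psi>\<close> is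
  nonzero, and then \<open>\<psi>\<close> is in the image of \<open>L\<close>.
\<close>

lemma level_one_surjective:
  fixes L :: "('c \<Rightarrow> 'c) \<Rightarrow> 'c \<Rightarrow> 'c"
  assumes k: "k \<ge> 0"
    and L: "\<And>f. f \<in> cusp_forms \<iota> k m GL2_O \<Longrightarrow> L f \<in> cusp_forms \<iota> k m GL2_O"
    and add: "\<And>f g. L (\<lambda>z. f z + g z) = (\<lambda>z. L f z + L g z)"
    and scale: "\<And>c f. L (\<lambda>z. c * f z) = (\<lambda>z. c * L f z)"
    and inj: "\<And>f. f \<in> cusp_forms \<iota> k m GL2_O \<Longrightarrow> L f = (\<lambda>z. 0) \<Longrightarrow> f = (\<lambda>z. 0)"
    and \<psi>: "\<psi> \<in> cusp_forms \<iota> k m GL2_O"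
  shows "\<exists>\<phi>\<in>cusp_forms \<iota> k m GL2_O. L \<phi> = \<psi>"
proof -
  have L_zero: "L (\<lambda>z. 0) = (\<lambda>z. 0)" using scale[of 0 "\<lambda>z. 0"] by simp
  have it: "(L ^^ i) \<psi> \<in> cusp_forms \<iota> k m GL2_O" for i by (induction i) (auto intro: L \<psi>)
  have L_sum: "L (\<lambda>z. \<Sum>i\<le>n. c i * (L ^^ i) \<psi> z) = (\<lambda>z. \<Sum>i\<le>n. c i * (L ^^ Suc i) \<psi> z)" for n c
    by (induction n) (simp_all add: add scale)
  have comb: "(\<lambda>z. \<Sum>i\<le>n. c i * (L ^^ i) \<psi> z) \<in> cusp_forms \<iota> k m GL2_O" for n c
    by (intro cusp_forms_sum cusp_forms_scale it)
  have main: "\<exists>\<phi>\<in>cusp_forms \<iota> k m GL2_O. L \<phi> = \<psi>"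
    if "\<exists>i\<le>n. c i \<noteq> 0" "\<forall>z. (\<Sum>i\<le>n. c i * (L ^^ i) \<psi> z) = 0" for n c
    using that
  proof (induction n arbitrary: c)
    case 0
    hence "\<psi> = (\<lambda>z. 0)" by auto
    thus ?case using L_zero cusp_forms_zero by auto
  next
    case (Suc n)
    define g where "g = (\<lambda>z. \<Sum>i\<le>n. c (Suc i) * (L ^^ i) \<psi> z)"
    have g: "g \<in> cusp_forms \<iota> k m GL2_O" unfolding g_def by (rule comb)
    have Lg: "c 0 * \<psi> z + L g z = 0" for z
    proof -
      have "(\<Sum>i\<le>Suc n. c i * (L ^^ i) \<psi> z) = 0" using Suc.prems(2) by blast
      thus ?thesis unfolding g_def L_sum sum.atMost_Suc_shift by simp
    qed
    show ?case
    proof (cases "c 0 = 0")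
      case True
      hence "L g z = 0" for z using Lg[of z] by simp
      hence "L g = (\<lambda>z. 0)" by (rule ext)
      hence "g = (\<lambda>z. 0)" by (rule inj[OF g])
      moreover have "\<exists>i\<le>n. c (Suc i) \<noteq> 0"
      proof -
        obtain i where i: "i \<le> Suc n" "c i \<noteq> 0" using Suc.prems(1) by blast
        with True obtain l where "i = Suc l" by (cases i) auto
        with i show ?thesis by auto
      qed
      ultimately show ?thesis by (intro Suc.IH[of "\<lambda>i. c (Suc i)"]) (auto simp: g_def dest: fun_cong)
    next
      case False
      have "L (\<lambda>z. (- 1 / c 0) * g z) = \<psi>"
      proof
        fix z
        have "L g z = - (c 0 * \<psi> z)" using Lg[of z] by (simp add: add_eq_0_iff)
        moreover have "L (\<lambda>z. (- 1 / c 0) * g z) z = (- 1 / c 0) * L g z" by (subst scale) (rule refl)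
        ultimately show "L (\<lambda>z. (- 1 / c 0) * g z) z = \<psi> z" using False by simp
      qed
      thus ?thesis using cusp_forms_scale[OF g] by blast
    qed
  qed
  have "\<exists>c. (\<exists>i\<le>Suc (Suc (nat k)). c i \<noteq> 0) \<and> (\<forall>z. (\<Sum>i\<le>Suc (Suc (nat k)). c i * (L ^^ i) \<psi> z) = 0)"
    by (rule level_one_dependent[OF k, of "\<lambda>i. (L ^^ i) \<psi>"]) (rule it)
  then obtain c where "\<exists>i\<le>Suc (Suc (nat k)). c i \<noteq> 0"
      "\<forall>z. (\<Sum>i\<le>Suc (Suc (nat k)). c i * (L ^^ i) \<psi> z) = 0"
    by blast
  thus ?thesis by (rule main)
qed

end

section \<open>Independence of the two families of oldforms\<close>

context drinfeld_setting
begin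

text \<open>
  Each of \<open>n\<close> nonzero polynomials of degree at most \<open>n\<close> contributes a factor
  of at least \<open>|z|\<^sub>i/q\<^sup>n\<close> to the product. In particular the function grows
  faster than every power of \<open>|z|\<^sub>i\<close>.
\<close>

lemma vabs_lattice_exp_O_ring_ge:
  assumes "q ^ n \<le> im_abs \<iota> z"
  shows "im_abs \<iota> z * (im_abs \<iota> z / q ^ n) ^ n \<le> vabs (lattice_exp \<iota> O_ring z)"
proof -
  define \<delta> where "\<delta> = im_abs \<iota> z"
  have \<delta>: "0 \<le> \<delta>" "1 \<le> \<delta> / q ^ n" using assms q_pos by (auto simp: \<delta>_def pos_le_divide_eq)
  define A where "A = O_ball n - {0}"
  have fin: "finite A" using O_ball_subgroup(2)[of n] by (simp add: A_def)
  have "(\<lambda>i. of_O (Polynomial.monom 1 i) :: 'a fls) ` {..<n} \<subseteq> A"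
  proof (rule image_subsetI)
    fix i assume "i \<in> {..<n}"
    hence "q ^ i \<le> q ^ n" using q_gt_1 by (intro power_increasing) auto
    thus "(of_O (Polynomial.monom 1 i) :: 'a fls) \<in> A"
      by (simp add: A_def O_ball_mem O_ring_of_O fls_abs_of_O' monom_eq_0_iff Polynomial.degree_monom_eq)
  qed
  hence "card ((\<lambda>i. of_O (Polynomial.monom 1 i) :: 'a fls) ` {..<n}) \<le> card A"
    by (rule card_mono[OF fin])
  moreover have "inj (\<lambda>i. of_O (Polynomial.monom 1 i) :: 'a fls)"
    by (rule injI) (simp add: monom_eq_iff')
  ultimately have card: "n \<le> card A" by (simp add: card_image inj_on_subset[OF _ subset_UNIV])
  have "(\<delta> / q ^ n) ^ n \<le> (\<delta> / q ^ n) ^ card A" by (rule power_increasing[OF card \<delta>(2)])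
  also have "\<dots> = (\<Prod>a\<in>A. \<delta> / q ^ n)" by simp
  also have "\<dots> \<le> (\<Prod>a\<in>A. max 1 (\<delta> / fls_abs a))"
  proof (rule prod_mono)
    fix a assume "a \<in> A"
    hence a: "fls_abs a \<le> q ^ n" "a \<noteq> 0" by (auto simp: A_def O_ball_mem)
    have "0 < fls_abs a" using a(2) by simp
    hence "\<delta> / q ^ n \<le> \<delta> / fls_abs a" using a(1) \<delta>(1) q_pos by (intro divide_left_mono mult_pos_pos) auto
    thus "0 \<le> \<delta> / q ^ n \<and> \<delta> / q ^ n \<le> max 1 (\<delta> / fls_abs a)" using \<delta>(2) by linarith
  qed
  finally have "\<delta> * (\<delta> / q ^ n) ^ n \<le> exp_size (O_ball n) \<delta>"
    unfolding exp_size_def A_def using \<delta>(1) by (intro mult_left_mono) auto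
  also have "\<dots> \<le> vabs (lattice_exp \<iota> O_ring z)"
    unfolding \<delta>_def O_ball_def by (rule vabs_lattice_exp_ge[OF discrete_lattice_O_ring])
  finally show ?thesis by (simp add: \<delta>_def)
qed

context
  fixes P :: "'a poly" and k m :: int
  assumes irreducible: "Factorial_Ring.irreducible P" and weight: "k \<ge> 0"
begin

text \<open>
  If \<open>y\<close> and \<open>y(Pz)\<close> are both of level one, then the inversion \<open>z
  \<mapsto> -1/z\<close> relates the values at \<open>z\<close> and at \<open>P\<^sup>2z\<close> by a
  factor of fixed size. The point \<open>P\<^sup>2\<^sup>n z\<close> approaches the cusp
  \<open>\<infinity>\<close>, where \<open>y\<close> decays faster than such a functional equation
  permits.
\<close>

lemma fricke_level_one_imp_zero:
  assumes y: "y \<in> cusp_forms \<iota> k m GL2_O" and Fy: "fricke \<iota> k m P y \<in> cusp_forms \<iota> k m GL2_O"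
  shows "y = (\<lambda>z. 0)"
proof (rule ext, rule ccontr)
  fix w assume nz: "y w \<noteq> 0"
  have w: "w \<in> Omega \<iota>" using cusp_formsD(1)[OF y, of w] nz by blast
  define \<pi> where "\<pi> = \<iota> (of_O P)"
  define n where "n = nat k"
  define R where "R = vabs \<pi>"
  have P0: "P \<noteq> 0" by (rule P_nonzero[OF irreducible weight])
  have \<pi>0: "\<pi> \<noteq> 0" using P0 by (simp add: \<pi>_def)
  have "R = q ^ Polynomial.degree P" using P0 by (simp add: R_def \<pi>_def vabs_iota fls_abs_of_O')
  hence R: "R > 1" using degree_P[OF irreducible weight] q_gt_1 by simp
  have kn: "k = int n" using weight by (simp add: n_def)
  have im_mult: "im_abs \<iota> (\<pi> * z) = R * im_abs \<iota> z" for z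
    by (simp add: \<pi>_def R_def im_abs_iota_mult vabs_iota)
  have Om_mult: "\<pi> * z \<in> Omega \<iota>" if "z \<in> Omega \<iota>" for z
    using that R by (simp add: Omega_iff_im_abs im_mult)
  have g: "fricke \<iota> k m P y z = y (\<pi> * z) * \<pi> powi m" if "z \<in> Omega \<iota>" for z
    using that delta_P_level_one[OF irreducible weight y, symmetric]
    by (simp add: delta_P_def slash_Omega moebius_def automorphy_def det_2 \<pi>_def)
  have step: "vabs (y z) = R ^ n * vabs (y (\<pi> * (\<pi> * z)))" if z: "z \<in> Omega \<iota>" for z
  proof -
    define v where "v = \<pi> * z"
    have v: "v \<in> Omega \<iota>" using Om_mult[OF z] by (simp add: v_def)
    have z0: "z \<noteq> 0" using im_abs_pos[OF z] im_abs_le_vabs[of z] by auto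
    have "fricke \<iota> k m P y v = fricke \<iota> k m P y (- 1 / v) * v powi (- k)"
      by (rule level_one_inversion[OF Fy v])
    hence "y (\<pi> * v) * \<pi> powi m = y (\<pi> * (- 1 / v)) * v powi (- k) * \<pi> powi m"
      unfolding g[OF v] g[OF Omega_inversion(1)[OF v]] by (simp only: mult_ac)
    hence "y (\<pi> * v) = y (\<pi> * (- 1 / v)) * v powi (- k)" using \<pi>0 by simp
    also have "\<pi> * (- 1 / v) = - 1 / z" using \<pi>0 by (simp add: v_def)
    finally have a: "vabs (y (\<pi> * v)) * vabs v ^ n = vabs (y (- 1 / z))"
      using \<pi>0 z0 by (simp add: kn power_int_minus vabs_mult vabs_inverse vabs_power v_def)
    have "y z = y (- 1 / z) * z powi (- k)" by (rule level_one_inversion[OF y z])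
    hence "vabs (y z) * vabs z ^ n = vabs (y (- 1 / z))"
      using z0 by (simp add: kn power_int_minus vabs_mult vabs_inverse vabs_power)
    with a have "vabs (y z) * vabs z ^ n = (R ^ n * vabs (y (\<pi> * v))) * vabs z ^ n"
      by (simp add: v_def vabs_mult R_def power_mult_distrib mult_ac)
    thus ?thesis using z0 by (simp add: v_def)
  qed
  have iterate: "im_abs \<iota> ((\<pi> ^ 2) ^ j * w) = (R ^ j) ^ 2 * im_abs \<iota> w \<and>
      vabs (y w) = (R ^ j) ^ n * vabs (y ((\<pi> ^ 2) ^ j * w))" for j
  proof (induction j)
    case (Suc j)
    define v where "v = (\<pi> ^ 2) ^ j * w"
    have v: "(\<pi> ^ 2) ^ Suc j * w = \<pi> * (\<pi> * v)" by (simp add: v_def power2_eq_square mult_ac)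
    have "v \<in> Omega \<iota>" using Suc.IH w R by (simp add: Omega_iff_im_abs v_def)
    note step[OF this]
    moreover have "im_abs \<iota> v = (R ^ j) ^ 2 * im_abs \<iota> w" "vabs (y w) = (R ^ j) ^ n * vabs (y v)"
      using Suc.IH by (simp_all add: v_def)
    ultimately show ?case unfolding v
      by (simp add: im_mult power_mult_distrib power2_eq_square mult_ac)
  qed simp
  define \<delta> where "\<delta> = im_abs \<iota> w"
  have \<delta>: "\<delta> > 0" using im_abs_pos[OF w] by (simp add: \<delta>_def)
  obtain a where e: "has_u_expansion \<iota> O_ring y a" and a0: "a 0 = 0"
    using level_one_expansion[OF y] by blast
  obtain C K where C: "C > 0" "K > 0"
    and decay: "\<And>z. im_abs \<iota> z \<ge> C \<Longrightarrow> vabs (y z) \<le> K / vabs (lattice_exp \<iota> O_ring z) ^ Suc 0"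
    using expansion_decay[OF e, of 0] a0 by auto
  obtain j where j: "max (max (C / \<delta>) (q ^ n / \<delta>)) (K / (\<delta> * vabs (y w))) < R ^ j"
    using real_arch_pow[OF R] by blast
  define H where "H = R ^ j"
  have H1: "1 \<le> H" using R by (simp add: H_def)
  have H: "C \<le> H * \<delta>" "q ^ n \<le> H * \<delta>" "K < H * \<delta> * vabs (y w)"
    using j \<delta> nz by (auto simp: H_def pos_divide_less_eq mult_ac)
  define v where "v = (\<pi> ^ 2) ^ j * w"
  have im: "im_abs \<iota> v = H * (H * \<delta>)" and yw: "vabs (y w) = H ^ n * vabs (y v)"
    using iterate[of j] by (simp_all add: v_def H_def \<delta>_def power2_eq_square)
  have H2: "H * \<delta> \<le> H * (H * \<delta>)" using H1 \<delta> by simp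
  define E where "E = vabs (lattice_exp \<iota> O_ring v)"
  have "H ^ n \<le> (H * (H * \<delta> / q ^ n)) ^ n"
    using H H1 q_pos by (intro power_mono) (auto simp: pos_le_divide_eq)
  hence "(H * \<delta>) * H ^ n \<le> (H * (H * \<delta>)) * (H * (H * \<delta> / q ^ n)) ^ n"
    using H2 H1 \<delta> by (intro mult_mono) auto
  also have "\<dots> \<le> E"
    using vabs_lattice_exp_O_ring_ge[of n v] H H2 by (simp add: im E_def)
  finally have E: "(H * \<delta>) * H ^ n \<le> E" .
  moreover have "0 < (H * \<delta>) * H ^ n" using H1 \<delta> by simp
  ultimately have E0: "0 < E" by linarith
  have "vabs (y v) \<le> K / E" using decay[of v] H H2 by (simp add: im E_def)
  hence "vabs (y v) * E \<le> K" using E0 by (simp add: pos_le_divide_eq)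
  moreover have "vabs (y v) * ((H * \<delta>) * H ^ n) \<le> vabs (y v) * E"
    by (rule mult_left_mono[OF E]) simp
  ultimately have "H * \<delta> * vabs (y w) \<le> K" by (simp add: yw mult_ac)
  thus False using H(3) by linarith
qed

section \<open>The decomposition\<close>

text \<open>
  On oldforms the two traces are \<open>Tr (x + y\<^sup>F\<^sup>r) = x + Tr' y\<close> and \<open>Tr' (x
  + y\<^sup>F\<^sup>r) = Tr' x + b y\<close>, where \<open>b =
  P\<^sup>2\<^sup>m\<^sup>-\<^sup>k\<close>. Eliminating \<open>x\<close> leaves a multiple of
  \<open>\<D> y\<close>.
\<close>

lemma traces_oldform:
  assumes x: "x \<in> cusp_forms \<iota> k m GL2_O" and y: "y \<in> cusp_forms \<iota> k m GL2_O"
  shows "trace_map \<iota> k m P (\<lambda>z. x z + fricke \<iota> k m P y z) = (\<lambda>z. x z + twisted_trace \<iota> k m P y z)"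
    and "twisted_trace \<iota> k m P (\<lambda>z. x z + fricke \<iota> k m P y z) =
      (\<lambda>z. twisted_trace \<iota> k m P x z + \<iota> (of_O P) powi (2 * m - k) * y z)"
proof -
  note trace = trace_level_one[OF irreducible weight]
  have y': "y \<in> cusp_forms \<iota> k m (Gamma0 P)"
    using y cusp_forms_GL2_O_subset[OF irreducible weight] by blast
  have "twisted_trace \<iota> k m P (fricke \<iota> k m P y) = (\<lambda>z. \<iota> (of_O P) powi (2 * m - k) * y z)"
    by (simp add: twisted_trace_def fricke_fricke[OF irreducible weight y']
        trace_linear[OF irreducible weight] trace[OF y])
  thus "twisted_trace \<iota> k m P (\<lambda>z. x z + fricke \<iota> k m P y z) =
      (\<lambda>z. twisted_trace \<iota> k m P x z + \<iota> (of_O P) powi (2 * m - k) * y z)"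
    by (simp add: twisted_trace_linear[OF irreducible weight])
  show "trace_map \<iota> k m P (\<lambda>z. x z + fricke \<iota> k m P y z) = (\<lambda>z. x z + twisted_trace \<iota> k m P y z)"
    by (simp add: trace_linear[OF irreducible weight] trace[OF x] twisted_trace_def)
qed

text \<open>
  In the direct decomposition, the oldform part of \<open>\<phi>\<close> is the one with the same two
  traces as \<open>\<phi>\<close>; conversely, if \<open>\<D> h = 0\<close> then \<open>h\<close> gives
  rise to an oldform that is also a newform.
\<close>

lemma old_new_decomposition_iff:
  "is_direct_sum (cusp_forms \<iota> k m (Gamma0 P)) (oldforms \<iota> k m P) (newforms \<iota> k m P)
     \<longleftrightarrow> bij_betw (D_map \<iota> k m P) (cusp_forms \<iota> k m (Gamma0 P)) (cusp_forms \<iota> k m (Gamma0 P))"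
proof -
  define V V0 where "V = cusp_forms \<iota> k m (Gamma0 P)" and "V0 = cusp_forms \<iota> k m GL2_O"
  define T T' F D where "T = trace_map \<iota> k m P" and "T' = twisted_trace \<iota> k m P"
    and "F = fricke \<iota> k m P" and "D = D_map \<iota> k m P"
  define b c where "b = \<iota> (of_O P) powi (2 * m - k)" and "c = \<iota> (of_O P) powi (k - 2 * m)"
  have P0: "\<iota> (of_O P) \<noteq> 0" using P_nonzero[OF irreducible weight] by simp
  have "c * b = \<iota> (of_O P) powi ((k - 2 * m) + (2 * m - k))"
    unfolding b_def c_def using P0 by (subst power_int_add) auto
  hence cb: "c * b = 1" by simp
  have bc: "b * c = 1" using cb by (simp add: mult.commute)
  have D_eq: "D \<phi> = (\<lambda>z. \<phi> z - c * T' (T' \<phi>) z)" for \<phi>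
    by (simp add: D_def D_map_def T'_def c_def)
  have V0_V: "\<phi> \<in> V" if "\<phi> \<in> V0" for \<phi>
    using that cusp_forms_GL2_O_subset[OF irreducible weight] unfolding V_def V0_def by blast
  note V_add = cusp_forms_add[of _ k m "Gamma0 P", folded V_def]
  note V_diff = cusp_forms_diff[of _ k m "Gamma0 P", folded V_def]
  note V_scale = cusp_forms_scale[of _ k m "Gamma0 P", folded V_def]
  note V0_add = cusp_forms_add[of _ k m GL2_O, folded V0_def]
  note V0_diff = cusp_forms_diff[of _ k m GL2_O, folded V0_def]
  note V0_scale = cusp_forms_scale[of _ k m GL2_O, folded V0_def]
  have V0_zero: "(\<lambda>z. 0) \<in> V0" unfolding V0_def by (rule cusp_forms_zero)
  have T_V: "T \<phi> \<in> V0" if "\<phi> \<in> V" for \<phi>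
    using that trace_cusp_form[OF irreducible weight] by (simp add: T_def V_def V0_def)
  have T'_V: "T' \<phi> \<in> V0" if "\<phi> \<in> V" for \<phi>
    using that twisted_trace_cusp_form[OF irreducible weight] by (simp add: T'_def V_def V0_def)
  have F_V: "F \<phi> \<in> V" if "\<phi> \<in> V" for \<phi>
    using that fricke_cusp_form[OF irreducible weight] by (simp add: F_def V_def)
  have T'T'_V: "T' (T' \<phi>) \<in> V0" if "\<phi> \<in> V" for \<phi>
    by (intro T'_V V0_V that)
  have T_add: "T (\<lambda>z. f z + g z) = (\<lambda>z. T f z + T g z)"
    and T_scale: "T (\<lambda>z. s * f z) = (\<lambda>z. s * T f z)" for f g s
    unfolding T_def by (rule trace_linear[OF irreducible weight])+
  have T'_add: "T' (\<lambda>z. f z + g z) = (\<lambda>z. T' f z + T' g z)"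
    and T'_scale: "T' (\<lambda>z. s * f z) = (\<lambda>z. s * T' f z)" for f g s
    unfolding T'_def by (rule twisted_trace_linear[OF irreducible weight])+
  have T_diff: "T (\<lambda>z. f z - g z) = (\<lambda>z. T f z - T g z)" for f g
    using T_add[of f "\<lambda>z. - 1 * g z"] unfolding T_scale by simp
  have T'_diff: "T' (\<lambda>z. f z - g z) = (\<lambda>z. T' f z - T' g z)" for f g
    using T'_add[of f "\<lambda>z. - 1 * g z"] unfolding T'_scale by simp
  have T'_zero: "T' (\<lambda>z. 0) = (\<lambda>z. 0)" using T'_scale[of 0 "\<lambda>z. 0"] by simp
  have F_zero: "F (\<lambda>z. 0) = (\<lambda>z. 0)"
    using fricke_linear(2)[OF irreducible weight, of m 0 "\<lambda>z. 0"] by (simp add: F_def)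
  have D_add: "D (\<lambda>z. f z + g z) = (\<lambda>z. D f z + D g z)" for f g
    by (simp add: D_eq T'_add algebra_simps)
  have D_scale: "D (\<lambda>z. s * f z) = (\<lambda>z. s * D f z)" for f s
    by (simp add: D_eq T'_scale algebra_simps)
  have D_diff: "D (\<lambda>z. f z - g z) = (\<lambda>z. D f z - D g z)" for f g
    by (simp add: D_eq T'_diff algebra_simps)
  have D_V: "D \<phi> \<in> V" if "\<phi> \<in> V" for \<phi>
    unfolding D_eq by (intro V_diff V_scale V0_V T'T'_V that)
  have D_V0: "D \<phi> \<in> V0" if "\<phi> \<in> V0" for \<phi>
    unfolding D_eq by (intro V0_diff V0_scale T'T'_V V0_V that)
  \<comment> \<open>\<open>D\<close> is the identity modulo forms of level one\<close>
  have level_one_of_D: "\<phi> \<in> V0" if "\<phi> \<in> V" "D \<phi> \<in> V0" for \<phi>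
  proof -
    have "(\<lambda>z. D \<phi> z + c * T' (T' \<phi>) z) \<in> V0" by (intro V0_add V0_scale T'T'_V that)
    thus ?thesis by (simp add: D_eq)
  qed
  have old_iff: "f \<in> oldforms \<iota> k m P \<longleftrightarrow> (\<exists>x\<in>V0. \<exists>y\<in>V0. f = (\<lambda>z. x z + F y z))" for f
  proof -
    have "f \<in> oldforms \<iota> k m P \<longleftrightarrow> (\<exists>x\<in>V0. \<exists>y\<in>V0. f = (\<lambda>z. x z + delta_P \<iota> k m P y z))"
      unfolding oldforms_def delta_one_def V0_def by blast
    also have "\<dots> \<longleftrightarrow> (\<exists>x\<in>V0. \<exists>y\<in>V0. f = (\<lambda>z. x z + F y z))"
      unfolding V0_def F_def by (intro bex_cong refl) (simp add: delta_P_level_one[OF irreducible weight])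
    finally show ?thesis .
  qed
  have new_iff: "f \<in> newforms \<iota> k m P \<longleftrightarrow> f \<in> V \<and> T f = (\<lambda>z. 0) \<and> T' f = (\<lambda>z. 0)" for f
    by (simp add: newforms_def V_def T_def T'_def)
  have T_old: "T (\<lambda>z. x z + F y z) = (\<lambda>z. x z + T' y z)"
    and T'_old: "T' (\<lambda>z. x z + F y z) = (\<lambda>z. T' x z + b * y z)" if "x \<in> V0" "y \<in> V0" for x y
    using traces_oldform[of x y] that unfolding V0_def T_def T'_def F_def b_def by auto
  have old_V: "(\<lambda>z. x z + F y z) \<in> V" if "x \<in> V0" "y \<in> V0" for x y
    by (intro V_add F_V V0_V that)
  show ?thesis
    unfolding V_def[symmetric] D_def[symmetric]
  proof
    assume dir: "is_direct_sum V (oldforms \<iota> k m P) (newforms \<iota> k m P)"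
    have inj: "h = (\<lambda>z. 0)" if h: "h \<in> V" and Dh: "D h = (\<lambda>z. 0)" for h
    proof -
      have h0: "h \<in> V0" using level_one_of_D[OF h] V0_zero Dh by simp
      \<comment> \<open>chosen so that both traces of \<open>x + F h\<close> vanish\<close>
      define x where "x = (\<lambda>z. - 1 * T' h z)"
      have x: "x \<in> V0" unfolding x_def by (intro V0_scale T'_V h)
      define f where "f = (\<lambda>z. x z + F h z)"
      have eq: "h z = c * T' (T' h) z" for z using fun_cong[OF Dh, of z] by (simp add: D_eq)
      have "T' x = (\<lambda>z. - 1 * T' (T' h) z)" unfolding x_def by (rule T'_scale)
      moreover have "b * h z = T' (T' h) z" for z
        using eq[of z] bc by (metis mult.assoc mult_1_left)
      ultimately have "T' f = (\<lambda>z. 0)" unfolding f_def T'_old[OF x h0] by simp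
      moreover have "T f = (\<lambda>z. 0)" unfolding f_def T_old[OF x h0] by (simp add: x_def)
      ultimately have "f \<in> newforms \<iota> k m P" using old_V[OF x h0] by (simp add: new_iff f_def)
      moreover have "f \<in> oldforms \<iota> k m P" unfolding old_iff f_def using x h0 by blast
      ultimately have f0: "f = (\<lambda>z. 0)" using dir unfolding is_direct_sum_def by blast
      \<comment> \<open>hence \<open>F h\<close> has level one\<close>
      have "F h z = - 1 * x z" for z
        using fun_cong[OF f0, of z] unfolding f_def by (simp add: eq_neg_iff_add_eq_0 add.commute)
      hence Fh: "F h = (\<lambda>z. - 1 * x z)" by (rule ext)
      have "F h \<in> V0" unfolding Fh by (rule V0_scale[OF x])
      thus ?thesis using fricke_level_one_imp_zero[of h] h0 by (simp add: V0_def F_def)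
    qed
    have "inj_on D V"
    proof (rule inj_onI)
      fix f g assume "f \<in> V" "g \<in> V" "D f = D g"
      hence "(\<lambda>z. f z - g z) = (\<lambda>z. 0)" by (intro inj[OF V_diff]) (simp_all add: D_diff)
      from fun_cong[OF this] show "f = g" by (intro ext) simp
    qed
    moreover have "\<exists>\<phi>\<in>V. D \<phi> = \<psi>" if \<psi>: "\<psi> \<in> V" for \<psi>
    proof -
      have "(\<lambda>z. c * T' (T' \<psi>) z) \<in> V0" by (intro V0_scale T'T'_V \<psi>)
      moreover have "f = (\<lambda>z. 0)" if "f \<in> V0" "D f = (\<lambda>z. 0)" for f
        by (rule inj[OF V0_V[OF that(1)] that(2)])
      ultimately obtain \<omega> where \<omega>: "\<omega> \<in> V0" "D \<omega> = (\<lambda>z. c * T' (T' \<psi>) z)"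
        using level_one_surjective[of k m D, folded V0_def, OF weight D_V0 D_add D_scale] by blast
      have "D (\<lambda>z. \<psi> z + \<omega> z) = \<psi>" unfolding D_add \<omega>(2) by (simp add: D_eq)
      thus ?thesis using V_add[OF \<psi> V0_V[OF \<omega>(1)]] by blast
    qed
    ultimately show "bij_betw D V V" using D_V by (auto simp: bij_betw_def image_iff)
  next
    assume bij: "bij_betw D V V"
    have inj: "y = (\<lambda>z. 0)" if y: "y \<in> V0" "D y = (\<lambda>z. 0)" for y
    proof -
      have "D (\<lambda>z. 0) = (\<lambda>z. 0)" by (simp add: D_eq T'_zero)
      thus ?thesis using bij_betw_imp_inj_on[OF bij] y V0_V V0_zero by (metis inj_onD)
    qed
    have surj: "\<exists>y\<in>V0. D y = \<psi>" if \<psi>: "\<psi> \<in> V0" for \<psi>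
    proof -
      have "\<psi> \<in> D ` V" using V0_V[OF \<psi>] by (simp only: bij_betw_imp_surj_on[OF bij])
      then obtain y where "y \<in> V" "D y = \<psi>" by (rule imageE) simp
      thus ?thesis using level_one_of_D[of y] \<psi> by blast
    qed
    have "\<exists>f\<in>oldforms \<iota> k m P. \<exists>g\<in>newforms \<iota> k m P. \<phi> = (\<lambda>z. f z + g z)" if \<phi>: "\<phi> \<in> V" for \<phi>
    proof -
      \<comment> \<open>the oldform with the same two traces as \<open>\<phi>\<close>\<close>
      have "(\<lambda>z. c * (T' \<phi> z - T' (T \<phi>) z)) \<in> V0"
        by (intro V0_scale V0_diff T'_V T_V V0_V \<phi>)
      then obtain y where y: "y \<in> V0" and Dy: "D y = (\<lambda>z. c * (T' \<phi> z - T' (T \<phi>) z))"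
        using surj by blast
      define x where "x = (\<lambda>z. T \<phi> z - T' y z)"
      have x: "x \<in> V0" unfolding x_def by (intro V0_diff T_V T'_V V0_V \<phi> y)
      define f where "f = (\<lambda>z. x z + F y z)"
      have "T f = T \<phi>" unfolding f_def T_old[OF x y] by (simp add: x_def)
      moreover have "T' f = T' \<phi>"
      proof
        fix z
        have "b * y z - b * c * T' (T' y) z = b * c * (T' \<phi> z - T' (T \<phi>) z)"
          using arg_cong[OF fun_cong[OF Dy, of z], of "\<lambda>s. b * s"]
          by (simp add: D_eq right_diff_distrib mult.assoc)
        hence "T' (T \<phi>) z - T' (T' y) z + b * y z = T' \<phi> z" by (simp add: bc algebra_simps)
        thus "T' f z = T' \<phi> z" unfolding f_def T'_old[OF x y] by (simp add: x_def T'_diff)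
      qed
      ultimately have "(\<lambda>z. \<phi> z - f z) \<in> newforms \<iota> k m P"
        using V_diff[OF \<phi> old_V[OF x y]] by (simp add: new_iff T_diff T'_diff f_def)
      moreover have "f \<in> oldforms \<iota> k m P" unfolding old_iff f_def using x y by blast
      ultimately show ?thesis by (intro bexI[of _ f] bexI[of _ "\<lambda>z. \<phi> z - f z"]) auto
    qed
    moreover have "(\<lambda>z. f z + g z) \<in> V" if "f \<in> oldforms \<iota> k m P" "g \<in> newforms \<iota> k m P" for f g
    proof -
      have "f \<in> V" using that(1) old_V unfolding old_iff by blast
      moreover have "g \<in> V" using that(2) by (simp add: new_iff)
      ultimately show ?thesis by (rule V_add)
    qed
    moreover have "f = (\<lambda>z. 0)" if old: "f \<in> oldforms \<iota> k m P" and new: "f \<in> newforms \<iota> k m P" for f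
    proof -
      obtain x y where x: "x \<in> V0" and y: "y \<in> V0" and f: "f = (\<lambda>z. x z + F y z)"
        using old unfolding old_iff by blast
      have Tf: "T f = (\<lambda>z. 0)" "T' f = (\<lambda>z. 0)" using new by (auto simp: new_iff)
      have x_eq: "x = (\<lambda>z. - 1 * T' y z)"
        using fun_cong[OF Tf(1)] by (auto simp: f T_old[OF x y] eq_neg_iff_add_eq_0)
      have "b * y z = T' (T' y) z" for z
      proof -
        have "T' x z + b * y z = 0" using fun_cong[OF Tf(2), of z] unfolding f T'_old[OF x y] .
        moreover have "T' x z = - 1 * T' (T' y) z" unfolding x_eq T'_scale by (rule refl)
        ultimately show ?thesis by (simp add: eq_neg_iff_add_eq_0)
      qed
      hence "y z = c * T' (T' y) z" for z using cb by (metis mult.assoc mult_1_left)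
      hence "D y = (\<lambda>z. 0)" unfolding D_eq by (metis right_minus_eq)
      hence "y = (\<lambda>z. 0)" by (rule inj[OF y])
      thus ?thesis unfolding f x_eq by (simp add: T'_zero F_zero)
    qed
    moreover have "(\<lambda>z. 0) \<in> oldforms \<iota> k m P"
      unfolding old_iff using V0_zero F_zero by (intro bexI[of _ "\<lambda>z. 0"]) auto
    moreover have "(\<lambda>z. 0) \<in> newforms \<iota> k m P"
      using V0_V[OF V0_zero] T'_zero T_scale[of 0 "\<lambda>z. 0"] by (simp add: new_iff)
    ultimately show "is_direct_sum V (oldforms \<iota> k m P) (newforms \<iota> k m P)"
      unfolding is_direct_sum_def by blast
  qed
qed

end

end

theorem theorem2p12:
  fixes \<iota> :: "'a::{finite,field} fls \<Rightarrow> 'c::complete_ultrametric_field"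
    and P :: "'a poly"
    and k m :: int
  assumes "is_C_infinity \<iota>"
    and "Polynomial.lead_coeff P = 1"
    and "Factorial_Ring.irreducible P"
    and "k \<ge> 0"
  shows "is_direct_sum (cusp_forms \<iota> k m (Gamma0 P)) (oldforms \<iota> k m P) (newforms \<iota> k m P)
     \<longleftrightarrow> bij_betw (D_map \<iota> k m P) (cusp_forms \<iota> k m (Gamma0 P)) (cusp_forms \<iota> k m (Gamma0 P))"
proof -
  interpret drinfeld_setting \<iota> "real CARD('a)" by unfold_locales (rule assms(1))
  show ?thesis by (rule old_new_decomposition_iff[OF assms(3,4)])
qed

end
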